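(* Let $p$ be an odd prime, let $m,n\in\mathbb N$, and let $k$ be a field of characteristic not $p$ containing a primitive $p^n$-th root of unity $\zeta_{p^n}$; put $\mu_{p^n}=\langle\zeta_{p^n}\rangle$. Let $L/k=k(\sqrt[p^n]{a_1},\dots,\sqrt[p^n]{a_m})/k$ (with $a_i\in k^\times$) be a Galois extension with Galois group $(C_{p^n})^m$, and let $$1\longrightarrow\mu_{p^n}\longrightarrow G\longrightarrow (C_{p^n})^m\longrightarrow 1$$ be a non-split central group extension. Let $\sigma_1,\dots,\sigma_m$ be the generators of $(C_{p^n})^m$, with $\sigma_j(\sqrt[p^n]{a_i})=\zeta_{p^n}^{\delta_{ij}}\sqrt[p^n]{a_i}$ ($\delta_{ij}$ the Kronecker delta), and let $s_1,\dots,s_m\in G$ be their pre-images, such that $s_i^{p^n}=\zeta_{p^n}^{j_i}$ for $1\le i\le m$ and $s_js_i=\zeta_{p^n}^{d_{ij}}s_is_j$ for $i<j$, where $j_i,d_{ij}\in\{0,1,\dots,p^n-1\}$. Then the obstruction to the weak solvability of the embedding problem $(L/k,G,\mu_{p^n})$ is $$\prod_{i=1}^m(a_i,\zeta_{p^n}^{j_i};\zeta_{p^n})\cdot\prod_{i<j}(a_j,a_i;\zeta_{p^n})^{d_{ij}}\in\mathrm{Br}(k).$$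
   Context: $\mu_{p^n}\subset k^\times$ is identified with the central kernel of $G\to(C_{p^n})^m$, so $\zeta_{p^n}$ also denotes an element of $G$. For $a,b\in k^\times$, $(a,b;\zeta_{p^n})\in\mathrm{Br}(k)$ denotes the class of the cyclic $k$-algebra generated by $i_1,i_2$ with $i_1^{p^n}=b$, $i_2^{p^n}=a$, $i_1i_2=\zeta_{p^n}i_2i_1$. The Brauer group is written multiplicatively. Embedding problem: given a Galois extension $L/k$ with group $F$ and a group extension $1\to\mu_{p^n}\to G\to F\to1$, the problem $(L/k,G,\mu_{p^n})$ is weakly solvable if there is a $G$-Galois algebra over $k$ containing $L$ such that restriction to $L$ of the action of $G$ is given by the map $G\to F=\mathrm{Gal}(L/k)$. The obstruction is the image of the class $c\in H^2(F,\mu_{p^n})$ of the group extension under inflation $H^2(F,\mu_{p^n})\to H^2(\Omega_k,\mu_{p^n})\cong\mathrm{Br}_{p^n}(k)$ (where $\Omega_k$ is the absolute Galois group of $k$ and $\mathrm{Br}_{p^n}(k)$ the $p^n$-torsion of $\mathrm{Br}(k)$); equivalently it is the class of the crossed product algebra of $L/k$ with respect to the image of $c$ in $H^2(F,L^\times)$. The problem is weakly solvable if and only if the obstruction is trivial. *)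

theory Defs
  imports "HOL-Algebra.Algebra"
begin

section \<open>Algebras over a field\<close>

text \<open>
  The locale \<open>algebra\<close> of the library is for commutative algebras only. Here an
  algebra over \<open>k\<close> is associative and unital, but not necessarily commutative.
\<close>

definition k_algebra :: "('a, 'r) ring_scheme \<Rightarrow> ('a, 'b, 's) module_scheme \<Rightarrow> bool" where
  "k_algebra k A \<longleftrightarrow> module k A \<and> ring A \<and>
     (\<forall>r\<in>carrier k. \<forall>x\<in>carrier A. \<forall>y\<in>carrier A.
        (r \<odot>\<^bsub>A\<^esub> x) \<otimes>\<^bsub>A\<^esub> y = r \<odot>\<^bsub>A\<^esub> (x \<otimes>\<^bsub>A\<^esub> y) \<and>
        x \<otimes>\<^bsub>A\<^esub> (r \<odot>\<^bsub>A\<^esub> y) = r \<odot>\<^bsub>A\<^esub> (x \<otimes>\<^bsub>A\<^esub> y))"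

definition finite_dim_algebra ::
    "('a, 'r) ring_scheme \<Rightarrow> ('a, 'b, 's) module_scheme \<Rightarrow> bool" where
  "finite_dim_algebra k A \<longleftrightarrow> k_algebra k A \<and>
     (\<exists>S. finite S \<and> S \<subseteq> carrier A \<and>
        (\<forall>x\<in>carrier A. \<exists>c \<in> S \<rightarrow> carrier k. x = (\<Oplus>\<^bsub>A\<^esub>s\<in>S. c s \<odot>\<^bsub>A\<^esub> s)))"

definition central_simple_algebra ::
    "('a, 'r) ring_scheme \<Rightarrow> ('a, 'b, 's) module_scheme \<Rightarrow> bool" where
  "central_simple_algebra k A \<longleftrightarrow> finite_dim_algebra k A \<and>
     (\<forall>x\<in>carrier A. (\<forall>y\<in>carrier A. x \<otimes>\<^bsub>A\<^esub> y = y \<otimes>\<^bsub>A\<^esub> x) \<longrightarrow>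
        (\<exists>r\<in>carrier k. x = r \<odot>\<^bsub>A\<^esub> \<one>\<^bsub>A\<^esub>)) \<and>
     carrier A \<noteq> {\<zero>\<^bsub>A\<^esub>} \<and>
     (\<forall>I. ideal I A \<longrightarrow> I = {\<zero>\<^bsub>A\<^esub>} \<or> I = carrier A)"

definition algebra_iso ::
    "('a, 'r) ring_scheme \<Rightarrow> ('a, 'b, 's) module_scheme \<Rightarrow> ('a, 'c, 't) module_scheme \<Rightarrow>
     ('b \<Rightarrow> 'c) set" where
  "algebra_iso k A B =
     {h \<in> ring_iso A B. \<forall>r\<in>carrier k. \<forall>x\<in>carrier A. h (r \<odot>\<^bsub>A\<^esub> x) = r \<odot>\<^bsub>B\<^esub> h x}"

definition base_algebra :: "('a, 'r) ring_scheme \<Rightarrow> ('a, 'a) module" where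
  "base_algebra k =
     \<lparr>carrier = carrier k, monoid.mult = (\<otimes>\<^bsub>k\<^esub>), one = \<one>\<^bsub>k\<^esub>, ring.zero = \<zero>\<^bsub>k\<^esub>, add = (\<oplus>\<^bsub>k\<^esub>),
      smult = (\<otimes>\<^bsub>k\<^esub>)\<rparr>"

definition matrix_algebra ::
    "nat \<Rightarrow> ('a, 'b, 's) module_scheme \<Rightarrow> ('a, nat \<times> nat \<Rightarrow> 'b) module" where
  "matrix_algebra n A =
     \<lparr>carrier = {..<n} \<times> {..<n} \<rightarrow>\<^sub>E carrier A,
      monoid.mult = (\<lambda>x y. restrict (\<lambda>(i, j). \<Oplus>\<^bsub>A\<^esub>l\<in>{..<n}. x (i, l) \<otimes>\<^bsub>A\<^esub> y (l, j)) ({..<n} \<times> {..<n})),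
      one = restrict (\<lambda>(i, j). if i = j then \<one>\<^bsub>A\<^esub> else \<zero>\<^bsub>A\<^esub>) ({..<n} \<times> {..<n}),
      ring.zero = (\<lambda>ij\<in>{..<n} \<times> {..<n}. \<zero>\<^bsub>A\<^esub>),
      add = (\<lambda>x y. \<lambda>ij\<in>{..<n} \<times> {..<n}. x ij \<oplus>\<^bsub>A\<^esub> y ij),
      smult = (\<lambda>r x. \<lambda>ij\<in>{..<n} \<times> {..<n}. r \<odot>\<^bsub>A\<^esub> x ij)\<rparr>"

text \<open>\<open>I\<close> is a two-sided ideal of \<open>A\<close>; the ring structure is that of \<open>A Quot I\<close>.\<close>

definition quotient_algebra ::
    "('a, 'b, 's) module_scheme \<Rightarrow> 'b set \<Rightarrow> ('a, 'b set) module" where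
  "quotient_algebra A I =
     \<lparr>carrier = carrier (A Quot I), monoid.mult = (\<otimes>\<^bsub>A Quot I\<^esub>), one = \<one>\<^bsub>A Quot I\<^esub>,
      ring.zero = \<zero>\<^bsub>A Quot I\<^esub>, add = (\<oplus>\<^bsub>A Quot I\<^esub>),
      smult = (\<lambda>r C. \<Union>x\<in>C. I +>\<^bsub>A\<^esub> (r \<odot>\<^bsub>A\<^esub> x))\<rparr>"

subsection \<open>Monoid algebras, generators and relations\<close>

text \<open>
  The monoid algebra \<open>k[M]\<close>: finitely supported functions \<open>f\<close> on \<open>M\<close>, standing for
  the formal sums of the \<open>f x\<close> times \<open>x\<close>. Functions are zero (not \<open>undefined\<close>)
  outside \<open>carrier M\<close>.
\<close>

definition support :: "('a, 'r) ring_scheme \<Rightarrow> ('x \<Rightarrow> 'a) \<Rightarrow> 'x set" where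
  "support k f = {x. f x \<noteq> \<zero>\<^bsub>k\<^esub>}"

definition single :: "('a, 'r) ring_scheme \<Rightarrow> 'x \<Rightarrow> 'x \<Rightarrow> 'a" where
  "single k x = (\<lambda>y. if y = x then \<one>\<^bsub>k\<^esub> else \<zero>\<^bsub>k\<^esub>)"

definition monoid_algebra ::
    "('a, 'r) ring_scheme \<Rightarrow> ('x, 's) monoid_scheme \<Rightarrow> ('a, 'x \<Rightarrow> 'a) module" where
  "monoid_algebra k M =
     \<lparr>carrier = {f. range f \<subseteq> carrier k \<and> finite (support k f) \<and> support k f \<subseteq> carrier M},
      monoid.mult = (\<lambda>f g z. \<Oplus>\<^bsub>k\<^esub>w\<in>{w \<in> support k f \<times> support k g. fst w \<otimes>\<^bsub>M\<^esub> snd w = z}.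
                f (fst w) \<otimes>\<^bsub>k\<^esub> g (snd w)),
      one = single k \<one>\<^bsub>M\<^esub>,
      ring.zero = (\<lambda>z. \<zero>\<^bsub>k\<^esub>),
      add = (\<lambda>f g z. f z \<oplus>\<^bsub>k\<^esub> g z),
      smult = (\<lambda>r f z. r \<otimes>\<^bsub>k\<^esub> f z)\<rparr>"

definition free_monoid :: "'x set \<Rightarrow> 'x list monoid" where
  "free_monoid S = \<lparr>carrier = lists S, monoid.mult = (@), one = []\<rparr>"

text \<open>
  The cyclic algebra \<open>(a,b;\<zeta>)\<close> of degree \<open>q\<close>: the \<open>k\<close>-algebra presented by generators
  \<open>i\<^sub>1\<close>, \<open>i\<^sub>2\<close> (the letters \<open>1\<close>, \<open>2\<close>) and relations \<open>i\<^sub>1\<^sup>q = b\<close>, \<open>i\<^sub>2\<^sup>q = a\<close>,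
  \<open>i\<^sub>1 i\<^sub>2 = \<zeta> i\<^sub>2 i\<^sub>1\<close>. Note that \<open>i\<^sub>1\<close> belongs to \<open>b\<close> and \<open>i\<^sub>2\<close> to \<open>a\<close>.
\<close>

definition cyclic_algebra ::
    "('a, 'r) ring_scheme \<Rightarrow> nat \<Rightarrow> 'a \<Rightarrow> 'a \<Rightarrow> 'a \<Rightarrow> ('a, (nat list \<Rightarrow> 'a) set) module" where
  "cyclic_algebra k q \<zeta> a b =
     (let P = monoid_algebra k (free_monoid {1, 2});
          i1 = single k [1]; i2 = single k [2]
      in quotient_algebra P (Idl\<^bsub>P\<^esub>
           {i1 [^]\<^bsub>P\<^esub> q \<ominus>\<^bsub>P\<^esub> b \<odot>\<^bsub>P\<^esub> \<one>\<^bsub>P\<^esub>,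
            i2 [^]\<^bsub>P\<^esub> q \<ominus>\<^bsub>P\<^esub> a \<odot>\<^bsub>P\<^esub> \<one>\<^bsub>P\<^esub>,
            i1 \<otimes>\<^bsub>P\<^esub> i2 \<ominus>\<^bsub>P\<^esub> \<zeta> \<odot>\<^bsub>P\<^esub> (i2 \<otimes>\<^bsub>P\<^esub> i1)}))"

text \<open>
  The tensor product of \<open>k\<close>-algebras, as the free \<open>k\<close>-module on \<open>A \<times> B\<close> modulo the
  relations of bilinearity. The free module carries the multiplication
  \<open>(x,y)(x',y') = (xx',yy')\<close>, i.e. it is the monoid algebra of \<open>A \<times>\<times> B\<close>; the submodule
  spanned by the relations is already closed under multiplication by the pairs \<open>(x,y)\<close>,
  so it is the ideal generated by them.
\<close>

definition tensor_algebra ::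
    "('a, 'r) ring_scheme \<Rightarrow> ('a, 'b, 's) module_scheme \<Rightarrow> ('a, 'c, 't) module_scheme \<Rightarrow>
     ('a, ('b \<times> 'c \<Rightarrow> 'a) set) module" where
  "tensor_algebra k A B =
     (let P = monoid_algebra k (A \<times>\<times> B);
          t = (\<lambda>x y. single k (x, y))
      in quotient_algebra P (Idl\<^bsub>P\<^esub>
           ({t (x \<oplus>\<^bsub>A\<^esub> x') y \<ominus>\<^bsub>P\<^esub> (t x y \<oplus>\<^bsub>P\<^esub> t x' y) | x x' y.
               x \<in> carrier A \<and> x' \<in> carrier A \<and> y \<in> carrier B} \<union>
            {t x (y \<oplus>\<^bsub>B\<^esub> y') \<ominus>\<^bsub>P\<^esub> (t x y \<oplus>\<^bsub>P\<^esub> t x y') | x y y'.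
               x \<in> carrier A \<and> y \<in> carrier B \<and> y' \<in> carrier B} \<union>
            {t (r \<odot>\<^bsub>A\<^esub> x) y \<ominus>\<^bsub>P\<^esub> r \<odot>\<^bsub>P\<^esub> t x y | r x y.
               r \<in> carrier k \<and> x \<in> carrier A \<and> y \<in> carrier B} \<union>
            {t x (r \<odot>\<^bsub>B\<^esub> y) \<ominus>\<^bsub>P\<^esub> r \<odot>\<^bsub>P\<^esub> t x y | r x y.
               r \<in> carrier k \<and> x \<in> carrier A \<and> y \<in> carrier B})))"

section \<open>The Brauer group\<close>

definition brauer_equivalent ::
    "('a, 'r) ring_scheme \<Rightarrow> ('a, 'b, 's) module_scheme \<Rightarrow> ('a, 'c, 't) module_scheme \<Rightarrow> bool" where
  "brauer_equivalent k A B \<longleftrightarrow>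
     (\<exists>r>0. \<exists>s>0. algebra_iso k (matrix_algebra r A) (matrix_algebra s B) \<noteq> {})"

text \<open>
  The members of a Brauer class are taken among the algebras whose elements have type
  \<open>nat \<Rightarrow> 'a\<close>. This is no restriction: an algebra of dimension \<open>d\<close> is isomorphic to
  one with carrier \<open>{..<d} \<rightarrow>\<^sub>E carrier k\<close>. The algebra \<open>A\<close> whose class is formed may have
  elements of any type.
\<close>

definition brauer_class ::
    "('a, 'r) ring_scheme \<Rightarrow> ('a, 'b, 's) module_scheme \<Rightarrow> ('a, nat \<Rightarrow> 'a) module set" where
  "brauer_class k A = {B. central_simple_algebra k B \<and> brauer_equivalent k A B}"

text \<open>
  The product of two classes is the class of \<open>A \<otimes> B\<close>, for any representatives \<open>A\<close> and \<open>B\<close>;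
  as with the product of cosets, no representatives are chosen.
\<close>

definition brauer_group :: "('a, 'r) ring_scheme \<Rightarrow> ('a, nat \<Rightarrow> 'a) module set monoid" where
  "brauer_group k =
     \<lparr>carrier = {brauer_class k A | A :: ('a, nat \<Rightarrow> 'a) module. central_simple_algebra k A},
      monoid.mult = (\<lambda>C D. \<Union>A\<in>C. \<Union>B\<in>D. brauer_class k (tensor_algebra k A B)),
      one = brauer_class k (base_algebra k)\<rparr>"

definition brauer_symbol ::
    "('a, 'r) ring_scheme \<Rightarrow> nat \<Rightarrow> 'a \<Rightarrow> 'a \<Rightarrow> 'a \<Rightarrow> ('a, nat \<Rightarrow> 'a) module set" where
  "brauer_symbol k q \<zeta> a b = brauer_class k (cyclic_algebra k q \<zeta> a b)"

section \<open>Galois extensions, crossed products and embedding problems\<close>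

definition galois_group :: "('a, 'r) ring_scheme \<Rightarrow> 'a set \<Rightarrow> ('a \<Rightarrow> 'a) monoid" where
  "galois_group L K =
     BijGroup (carrier L)
       \<lparr>carrier := {\<sigma> \<in> ring_hom L L \<inter> Bij (carrier L). \<forall>x\<in>K. \<sigma> x = x}\<rparr>"

definition galois_extension :: "('a, 'r) ring_scheme \<Rightarrow> 'a set \<Rightarrow> bool" where
  "galois_extension L K \<longleftrightarrow> field L \<and> subfield K L \<and>
     ring.finite_dimension L K (carrier L) \<and>
     {x \<in> carrier L. \<forall>\<sigma>\<in>carrier (galois_group L K). \<sigma> x = x} = K"

text \<open>
  The crossed product of \<open>L/K\<close> with a factor set \<open>f\<close>: the left \<open>L\<close>-space with basis
  \<open>u\<^sub>\<sigma>\<close> indexed by the Galois group, with \<open>u\<^sub>\<sigma> x = \<sigma>(x) u\<^sub>\<sigma>\<close> and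
  \<open>u\<^sub>\<sigma> u\<^sub>\<tau> = f(\<sigma>,\<tau>) u\<^sub>\<sigma>\<^sub>\<tau>\<close>; the function \<open>x\<close> stands for the sum of the \<open>x(\<sigma>) u\<^sub>\<sigma>\<close>.
  Since \<open>f\<close> is not assumed to be normalised, the unit is \<open>f(1,1)\<close>-inverse times \<open>u\<^sub>1\<close>.
\<close>

definition crossed_product ::
    "('a, 'r) ring_scheme \<Rightarrow> 'a set \<Rightarrow> (('a \<Rightarrow> 'a) \<times> ('a \<Rightarrow> 'a) \<Rightarrow> 'a) \<Rightarrow>
     ('a, ('a \<Rightarrow> 'a) \<Rightarrow> 'a) module" where
  "crossed_product L K f =
     (let F = galois_group L K in
      \<lparr>carrier = carrier F \<rightarrow>\<^sub>E carrier L,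
       monoid.mult = (\<lambda>x y. \<lambda>\<rho>\<in>carrier F.
                 \<Oplus>\<^bsub>L\<^esub>w\<in>{w \<in> carrier F \<times> carrier F. fst w \<otimes>\<^bsub>F\<^esub> snd w = \<rho>}.
                   x (fst w) \<otimes>\<^bsub>L\<^esub> (fst w) (y (snd w)) \<otimes>\<^bsub>L\<^esub> f w),
       one = (\<lambda>\<rho>\<in>carrier F. if \<rho> = \<one>\<^bsub>F\<^esub> then inv\<^bsub>L\<^esub> (f (\<one>\<^bsub>F\<^esub>, \<one>\<^bsub>F\<^esub>)) else \<zero>\<^bsub>L\<^esub>),
       ring.zero = (\<lambda>\<rho>\<in>carrier F. \<zero>\<^bsub>L\<^esub>),
       add = (\<lambda>x y. \<lambda>\<rho>\<in>carrier F. x \<rho> \<oplus>\<^bsub>L\<^esub> y \<rho>),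
       smult = (\<lambda>r x. \<lambda>\<rho>\<in>carrier F. r \<otimes>\<^bsub>L\<^esub> x \<rho>)\<rparr>)"

subsection \<open>Second cohomology\<close>

text \<open>
  The coefficients \<open>M\<close> are a subgroup of the multiplicative group of \<open>L\<close> on which the
  Galois group \<open>F\<close> acts by evaluation. The elements of \<open>H\<^sup>2(F,M)\<close> are represented as
  cosets of the group of coboundaries in the group of all functions from \<open>F \<times> F\<close> to \<open>M\<close>.
\<close>

definition two_cochains ::
    "('a \<Rightarrow> 'a) monoid \<Rightarrow> 'a monoid \<Rightarrow> (('a \<Rightarrow> 'a) \<times> ('a \<Rightarrow> 'a) \<Rightarrow> 'a) monoid" where
  "two_cochains F M = product_group (carrier F \<times> carrier F) (\<lambda>w. M)"

definition two_coboundaries ::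
    "('a \<Rightarrow> 'a) monoid \<Rightarrow> 'a monoid \<Rightarrow> (('a \<Rightarrow> 'a) \<times> ('a \<Rightarrow> 'a) \<Rightarrow> 'a) set" where
  "two_coboundaries F M =
     {restrict (\<lambda>(\<sigma>, \<tau>). \<sigma> (g \<tau>) \<otimes>\<^bsub>M\<^esub> inv\<^bsub>M\<^esub> (g (\<sigma> \<otimes>\<^bsub>F\<^esub> \<tau>)) \<otimes>\<^bsub>M\<^esub> g \<sigma>)
        (carrier F \<times> carrier F) | g. g \<in> carrier F \<rightarrow> carrier M}"

definition H2_class ::
    "('a \<Rightarrow> 'a) monoid \<Rightarrow> 'a monoid \<Rightarrow> (('a \<Rightarrow> 'a) \<times> ('a \<Rightarrow> 'a) \<Rightarrow> 'a) \<Rightarrow>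
     (('a \<Rightarrow> 'a) \<times> ('a \<Rightarrow> 'a) \<Rightarrow> 'a) set" where
  "H2_class F M f = two_coboundaries F M #>\<^bsub>two_cochains F M\<^esub> f"

subsection \<open>The obstruction\<close>

definition central_extension ::
    "'z monoid \<Rightarrow> 'g monoid \<Rightarrow> 'f monoid \<Rightarrow> ('z \<Rightarrow> 'g) \<Rightarrow> ('g \<Rightarrow> 'f) \<Rightarrow> bool" where
  "central_extension M G F \<iota> \<pi> \<longleftrightarrow> group M \<and> group G \<and> group F \<and>
     \<iota> \<in> mon M G \<and> \<pi> \<in> epi G F \<and> kernel G F \<pi> = \<iota> ` carrier M \<and>
     (\<forall>z\<in>carrier M. \<forall>g\<in>carrier G. \<iota> z \<otimes>\<^bsub>G\<^esub> g = g \<otimes>\<^bsub>G\<^esub> \<iota> z)"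

definition split_extension :: "'g monoid \<Rightarrow> 'f monoid \<Rightarrow> ('g \<Rightarrow> 'f) \<Rightarrow> bool" where
  "split_extension G F \<pi> \<longleftrightarrow> (\<exists>s\<in>hom F G. \<forall>x\<in>carrier F. \<pi> (s x) = x)"

definition sections :: "'g monoid \<Rightarrow> 'f monoid \<Rightarrow> ('g \<Rightarrow> 'f) \<Rightarrow> ('f \<Rightarrow> 'g) set" where
  "sections G F \<pi> = {s \<in> carrier F \<rightarrow>\<^sub>E carrier G. \<forall>x\<in>carrier F. \<pi> (s x) = x}"

text \<open>The values \<open>f(\<sigma>,\<tau>) \<in> M\<close> with \<open>s(\<sigma>) s(\<tau>) = f(\<sigma>,\<tau>) s(\<sigma>\<tau>)\<close>.\<close>

definition factor_set ::
    "'z monoid \<Rightarrow> 'g monoid \<Rightarrow> 'f monoid \<Rightarrow> ('z \<Rightarrow> 'g) \<Rightarrow> ('f \<Rightarrow> 'g) \<Rightarrow> 'f \<times> 'f \<Rightarrow> 'z" where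
  "factor_set M G F \<iota> s =
     restrict (\<lambda>(\<sigma>, \<tau>). inv_into (carrier M) \<iota>
         (s \<sigma> \<otimes>\<^bsub>G\<^esub> s \<tau> \<otimes>\<^bsub>G\<^esub> inv\<^bsub>G\<^esub> (s (\<sigma> \<otimes>\<^bsub>F\<^esub> \<tau>))))
       (carrier F \<times> carrier F)"

text \<open>The class in \<open>H\<^sup>2(F,M)\<close> of an extension of \<open>F\<close> by \<open>M\<close>; every section gives the same one.\<close>

definition extension_class ::
    "'a monoid \<Rightarrow> 'g monoid \<Rightarrow> ('a \<Rightarrow> 'a) monoid \<Rightarrow> ('a \<Rightarrow> 'g) \<Rightarrow> ('g \<Rightarrow> 'a \<Rightarrow> 'a) \<Rightarrow>
     (('a \<Rightarrow> 'a) \<times> ('a \<Rightarrow> 'a) \<Rightarrow> 'a) set" where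
  "extension_class M G F \<iota> \<pi> = (\<Union>s\<in>sections G F \<pi>. H2_class F M (factor_set M G F \<iota> s))"

text \<open>
  The obstruction to the embedding problem given by \<open>L/K\<close> and an extension of its Galois
  group by a subgroup \<open>M\<close> of the multiplicative group of \<open>L\<close>: the class of the extension
  is mapped to \<open>c\<close> in \<open>H\<^sup>2(F,L\<^sup>\<times>)\<close>, and then to the Brauer class of the crossed product
  of \<open>L/K\<close> with respect to \<open>c\<close>. Both unions are over representatives of one class.
\<close>

definition obstruction ::
    "('a, 'r) ring_scheme \<Rightarrow> 'a set \<Rightarrow> 'a monoid \<Rightarrow> 'g monoid \<Rightarrow> ('a \<Rightarrow> 'g) \<Rightarrow>
     ('g \<Rightarrow> 'a \<Rightarrow> 'a) \<Rightarrow> ('a, nat \<Rightarrow> 'a) module set" where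
  "obstruction L K M G \<iota> \<pi> =
     (let F = galois_group L K;
          c = (\<Union>f\<in>extension_class M G F \<iota> \<pi>. H2_class F (mult_of L) f)
      in \<Union>f\<in>c. brauer_class (L\<lparr>carrier := K\<rparr>) (crossed_product L K f))"

section \<open>Roots of unity\<close>

definition primitive_root_of_unity :: "('a, 'r) ring_scheme \<Rightarrow> nat \<Rightarrow> 'a \<Rightarrow> bool" where
  "primitive_root_of_unity k q \<zeta> \<longleftrightarrow> \<zeta> \<in> carrier k \<and> \<zeta> [^]\<^bsub>k\<^esub> q = \<one>\<^bsub>k\<^esub> \<and>
     (\<forall>e. 0 < e \<and> e < q \<longrightarrow> \<zeta> [^]\<^bsub>k\<^esub> e \<noteq> \<one>\<^bsub>k\<^esub>)"

end

(*
  The crossed product belonging to the obstruction is generated over k by the elements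
  A_i = alpha_i and by lifts U_i of the s_i, which satisfy U_i A_l = zeta^[i = l] A_l U_i,
  A_i^q = a_i, U_i^q = zeta^(j_i) and U_l U_i = zeta^(d_il) U_i U_l for i < l. Multiplying
  U_l by the product of the A_i^(d_il) over i < l decouples the pairs (U_l, A_l): the algebra
  becomes the tensor product of the cyclic algebras with parameters a_l and
  zeta^(j_l) prod_{i<l} a_i^(d_il), where injectivity of the map from the tensor product is
  automatic because tensor products of central simple algebras are simple. The formula then
  follows from the multiplicativity of the symbol in its second argument.
*)

theory Submission
  imports Defs
begin

text \<open>The isomorphisms with tensor products, cyclic algebras and crossed products are obtained
  without counting dimensions: a unital homomorphism from a central simple algebra to a nonzero
  algebra is injective, so it is enough to define one whose image contains generators of the target.
  The real work is therefore central simplicity of the sources. For tensor products it rests on an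
  element of minimal support, for cyclic algebras on averaging over conjugates by monomials, which
  divides by \<open>q\<close> and uses that \<open>p\<close> is nonzero in \<open>k\<close>. A
  presented algebra might collapse; that cyclic algebras do not is seen from a model in the tensor
  product of two matrix algebras. Multiplicativity of the symbol comes from an isomorphism between
  the tensor products of (a,b) with (a,c) and of (a,bc) with (1,c), where (1,c) is split. Each
  tensor product changes the type of the elements, so partial products are moved back to one fixed
  type. The obstruction is a union over all cocycles of a class, in general not normalised; the
  formula is proved for each of them, a cochain \<open>h\<close> absorbing the difference from the
  factor set of a section.\<close>

definition alg_hom ::
    "('a, 'r) ring_scheme \<Rightarrow> ('a, 'b, 's) module_scheme \<Rightarrow> ('a, 'c, 't) module_scheme \<Rightarrow>
     ('b \<Rightarrow> 'c) set" where
  "alg_hom k A B =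
     {h \<in> ring_hom A B. \<forall>r\<in>carrier k. \<forall>x\<in>carrier A. h (r \<odot>\<^bsub>A\<^esub> x) = r \<odot>\<^bsub>B\<^esub> h x}"

text \<open>The predicate \<open>k_algebra\<close> over a field in the form of a locale, so that one
  interpretation provides the facts on rings, modules and fields together.\<close>

locale k_alg = ring A + K: field k + M: module k A
  for k :: "('a, 'r) ring_scheme" and A :: "('a, 'b, 's) module_scheme" (structure) +
  assumes smult_mult_l: "\<lbrakk>r \<in> carrier k; x \<in> carrier A; y \<in> carrier A\<rbrakk> \<Longrightarrow>
          (r \<odot> x) \<otimes> y = r \<odot> (x \<otimes> y)"
    and smult_mult_r: "\<lbrakk>r \<in> carrier k; x \<in> carrier A; y \<in> carrier A\<rbrakk> \<Longrightarrow>
          x \<otimes> (r \<odot> y) = r \<odot> (x \<otimes> y)"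

lemma k_alg_iff: "k_alg k A \<longleftrightarrow> field k \<and> k_algebra k A"
  unfolding k_alg_def k_alg_axioms_def k_algebra_def by blast

lemma (in k_alg) field: "field k" ..

lemma (in k_alg) k_algebra: "k_algebra k A"
  using k_alg_axioms by (simp add: k_alg_iff)

section \<open>Linear spans\<close>

text \<open>Built by adding one scaled generator at a time: linear statements can then be proved by
  induction, without coefficient functions, and \<open>S\<close> may be infinite.\<close>

inductive_set lin_span ::
    "('a, 'r) ring_scheme \<Rightarrow> ('a, 'b, 's) module_scheme \<Rightarrow> 'b set \<Rightarrow> 'b set"
  for k A S where
    zero: "\<zero>\<^bsub>A\<^esub> \<in> lin_span k A S"
  | step: "r \<in> carrier k \<Longrightarrow> s \<in> S \<Longrightarrow> x \<in> lin_span k A S \<Longrightarrow> r \<odot>\<^bsub>A\<^esub> s \<oplus>\<^bsub>A\<^esub> x \<in> lin_span k A S"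

context module
begin

lemma lin_span_closed: "S \<subseteq> carrier M \<Longrightarrow> x \<in> lin_span R M S \<Longrightarrow> x \<in> carrier M"
  by (rotate_tac, induction rule: lin_span.induct) auto

lemma lin_span_add:
  assumes "S \<subseteq> carrier M" "x \<in> lin_span R M S" "y \<in> lin_span R M S"
  shows "x \<oplus>\<^bsub>M\<^esub> y \<in> lin_span R M S"
  using assms(2)
proof induction
  case zero
  then show ?case using assms lin_span_closed by simp
next
  case (step r s x)
  moreover have "r \<odot>\<^bsub>M\<^esub> s \<oplus>\<^bsub>M\<^esub> x \<oplus>\<^bsub>M\<^esub> y = r \<odot>\<^bsub>M\<^esub> s \<oplus>\<^bsub>M\<^esub> (x \<oplus>\<^bsub>M\<^esub> y)"
    using step assms lin_span_closed[OF assms(1)] by (intro M.a_assoc) auto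
  ultimately show ?case by (simp add: lin_span.step)
qed

lemma lin_span_base:
  assumes "S \<subseteq> carrier M" "s \<in> S" shows "s \<in> lin_span R M S"
proof -
  have "\<one> \<odot>\<^bsub>M\<^esub> s \<oplus>\<^bsub>M\<^esub> \<zero>\<^bsub>M\<^esub> \<in> lin_span R M S"
    using assms by (intro lin_span.intros) auto
  then show ?thesis using assms by (auto simp: subset_eq)
qed

lemma lin_span_smult:
  assumes "S \<subseteq> carrier M" "r \<in> carrier R" "x \<in> lin_span R M S"
  shows "r \<odot>\<^bsub>M\<^esub> x \<in> lin_span R M S"
  using assms(3)
proof induction
  case zero
  then show ?case using assms(2) by (simp add: lin_span.zero)
next
  case (step t s x)
  have "r \<odot>\<^bsub>M\<^esub> (t \<odot>\<^bsub>M\<^esub> s \<oplus>\<^bsub>M\<^esub> x) = (r \<otimes> t) \<odot>\<^bsub>M\<^esub> s \<oplus>\<^bsub>M\<^esub> r \<odot>\<^bsub>M\<^esub> x"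
    using step assms lin_span_closed[OF assms(1)] by (subst smult_r_distr) (auto simp: smult_assoc1)
  then show ?case using step assms by (simp add: lin_span.step)
qed

lemma lin_span_finsum:
  assumes "S \<subseteq> carrier M" "finite I" "\<And>i. i \<in> I \<Longrightarrow> f i \<in> lin_span R M S"
  shows "(\<Oplus>\<^bsub>M\<^esub>i\<in>I. f i) \<in> lin_span R M S"
  using assms(2,3)
proof (induction I)
  case empty
  then show ?case by (simp add: lin_span.zero)
next
  case (insert i I)
  then show ?case
    using lin_span_closed[OF assms(1)]
    by (subst M.finsum_insert) (auto intro!: lin_span_add[OF assms(1)])
qed

lemma lin_span_mono:
  assumes "T \<subseteq> carrier M" "\<And>s. s \<in> S \<Longrightarrow> s \<in> lin_span R M T" "x \<in> lin_span R M S"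
  shows "x \<in> lin_span R M T"
  using assms(3)
  by induction (blast intro: lin_span.zero lin_span_add[OF assms(1)] lin_span_smult[OF assms(1)] assms(2))+

text \<open>The induction rule in the shape of the closure conditions of a submodule; it also hands
  over membership in the carrier for the intermediate elements.\<close>

lemma lin_span_induct [consumes 2, case_names zero add smult base]:
  assumes "x \<in> lin_span R M S" "S \<subseteq> carrier M"
    and "P \<zero>\<^bsub>M\<^esub>"
    and "\<And>x y. x \<in> carrier M \<Longrightarrow> y \<in> carrier M \<Longrightarrow> P x \<Longrightarrow> P y \<Longrightarrow> P (x \<oplus>\<^bsub>M\<^esub> y)"
    and "\<And>r x. r \<in> carrier R \<Longrightarrow> x \<in> carrier M \<Longrightarrow> P x \<Longrightarrow> P (r \<odot>\<^bsub>M\<^esub> x)"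
    and "\<And>s. s \<in> S \<Longrightarrow> P s"
  shows "P x"
  using assms(1)
proof induction
  case zero
  then show ?case using assms by simp
next
  case (step r s x)
  then show ?case using lin_span_closed[OF assms(2)] assms by (meson smult_closed subsetD)
qed

text \<open>Links the inductive span to the sums with coefficient functions in
  \<open>finite_dim_algebra\<close>: adding \<open>r\<close> times a generator \<open>t\<close> only
  changes the coefficient at \<open>t\<close>.\<close>

lemma lin_span_finite_eq:
  assumes "finite S" "S \<subseteq> carrier M" "x \<in> lin_span R M S"
  shows "\<exists>c \<in> S \<rightarrow> carrier R. x = (\<Oplus>\<^bsub>M\<^esub>s\<in>S. c s \<odot>\<^bsub>M\<^esub> s)"
  using assms(3)
proof induction
  case zero
  have "(\<Oplus>\<^bsub>M\<^esub>s\<in>S. \<zero> \<odot>\<^bsub>M\<^esub> s) = (\<Oplus>\<^bsub>M\<^esub>s\<in>S. \<zero>\<^bsub>M\<^esub>)"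
    by (rule M.finsum_cong') (use assms in auto)
  then show ?case by (intro bexI[of _ "\<lambda>_. \<zero>"]) auto
next
  case (step r t x)
  then obtain c where c: "c \<in> S \<rightarrow> carrier R" "x = (\<Oplus>\<^bsub>M\<^esub>s\<in>S. c s \<odot>\<^bsub>M\<^esub> s)" by auto
  have SC: "s \<in> carrier M" "c s \<in> carrier R" if "s \<in> S" for s using that c assms by auto
  have "(\<Oplus>\<^bsub>M\<^esub>s\<in>S. (if t = s then r \<odot>\<^bsub>M\<^esub> s else \<zero>\<^bsub>M\<^esub>)) = r \<odot>\<^bsub>M\<^esub> t"
    using step assms by (intro M.add.finprod_singleton[of t S "\<lambda>s. r \<odot>\<^bsub>M\<^esub> s"]) auto
  then have "r \<odot>\<^bsub>M\<^esub> t \<oplus>\<^bsub>M\<^esub> x =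
      (\<Oplus>\<^bsub>M\<^esub>s\<in>S. (if t = s then r \<odot>\<^bsub>M\<^esub> s else \<zero>\<^bsub>M\<^esub>) \<oplus>\<^bsub>M\<^esub> c s \<odot>\<^bsub>M\<^esub> s)"
    using step assms c by (subst M.finsum_addf) auto
  also have "\<dots> = (\<Oplus>\<^bsub>M\<^esub>s\<in>S. ((if t = s then r else \<zero>) \<oplus> c s) \<odot>\<^bsub>M\<^esub> s)"
    using step SC by (intro M.finsum_cong') (auto simp: smult_l_distr)
  finally show ?case using step c by (intro bexI[of _ "\<lambda>s. (if t = s then r else \<zero>) \<oplus> c s"]) auto
qed

end

lemma finite_dim_algebra_iff_lin_span:
  fixes A (structure)
  assumes "k_alg k A"
  shows "finite_dim_algebra k A \<longleftrightarrow>
    (\<exists>S. finite S \<and> S \<subseteq> carrier A \<and> carrier A \<subseteq> lin_span k A S)"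
proof -
  interpret k_alg k A by fact
  have *: "carrier A \<subseteq> lin_span k A S \<longleftrightarrow>
     (\<forall>x\<in>carrier A. \<exists>c \<in> S \<rightarrow> carrier k. x = (\<Oplus>s\<in>S. c s \<odot> s))"
    if S: "finite S" "S \<subseteq> carrier A" for S
  proof
    show "carrier A \<subseteq> lin_span k A S \<Longrightarrow>
       \<forall>x\<in>carrier A. \<exists>c \<in> S \<rightarrow> carrier k. x = (\<Oplus>s\<in>S. c s \<odot> s)"
      using M.lin_span_finite_eq[OF S] by blast
    show "carrier A \<subseteq> lin_span k A S"
      if "\<forall>x\<in>carrier A. \<exists>c \<in> S \<rightarrow> carrier k. x = (\<Oplus>s\<in>S. c s \<odot> s)"
    proof
      fix x assume "x \<in> carrier A"
      from bspec[OF that this] obtain c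
        where c: "c \<in> S \<rightarrow> carrier k" "x = (\<Oplus>s\<in>S. c s \<odot> s)" by (rule bexE)
      have "(\<Oplus>s\<in>S. c s \<odot> s) \<in> lin_span k A S"
        by (rule M.lin_span_finsum[OF S(2,1)])
          (rule M.lin_span_smult[OF S(2) _ M.lin_span_base[OF S(2)]]; use c in auto)
      then show "x \<in> lin_span k A S" using c(2) by simp
    qed
  qed
  show ?thesis
    unfolding finite_dim_algebra_def using k_algebra * by auto
qed

text \<open>Associativity of a bilinear multiplication need only be checked on a spanning set.\<close>

lemma k_algI_span:
  fixes A :: "('a, 'b, 's) module_scheme" (structure) and k :: "('a, 'r) ring_scheme"
  assumes k: "field k" and A: "module k A"
    and m_closed: "\<And>x y. x \<in> carrier A \<Longrightarrow> y \<in> carrier A \<Longrightarrow> x \<otimes> y \<in> carrier A"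
    and one_closed: "\<one> \<in> carrier A"
    and dl: "\<And>x y z. x \<in> carrier A \<Longrightarrow> y \<in> carrier A \<Longrightarrow> z \<in> carrier A \<Longrightarrow>
        (x \<oplus> y) \<otimes> z = x \<otimes> z \<oplus> y \<otimes> z"
    and dr: "\<And>x y z. x \<in> carrier A \<Longrightarrow> y \<in> carrier A \<Longrightarrow> z \<in> carrier A \<Longrightarrow>
        z \<otimes> (x \<oplus> y) = z \<otimes> x \<oplus> z \<otimes> y"
    and sl: "\<And>r x y. r \<in> carrier k \<Longrightarrow> x \<in> carrier A \<Longrightarrow> y \<in> carrier A \<Longrightarrow>
        (r \<odot> x) \<otimes> y = r \<odot> (x \<otimes> y)"
    and sr: "\<And>r x y. r \<in> carrier k \<Longrightarrow> x \<in> carrier A \<Longrightarrow> y \<in> carrier A \<Longrightarrow>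
        x \<otimes> (r \<odot> y) = r \<odot> (x \<otimes> y)"
    and S: "S \<subseteq> carrier A" "carrier A \<subseteq> lin_span k A S"
    and assoc: "\<And>x y z. x \<in> S \<Longrightarrow> y \<in> S \<Longrightarrow> z \<in> S \<Longrightarrow>
        (x \<otimes> y) \<otimes> z = x \<otimes> (y \<otimes> z)"
    and one: "\<And>x. x \<in> S \<Longrightarrow> \<one> \<otimes> x = x" "\<And>x. x \<in> S \<Longrightarrow> x \<otimes> \<one> = x"
  shows "k_alg k A"
proof -
  interpret mod: module k A by fact
  have null: "x \<otimes> \<zero> = \<zero>" "\<zero> \<otimes> x = \<zero>" if "x \<in> carrier A" for x
    using dr[of "\<zero>" "\<zero>" x] dl[of "\<zero>" "\<zero>" x] that m_closed[of x "\<zero>"] m_closed[of "\<zero>" x]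
    by (simp_all)
  have span: "x \<in> lin_span k A S" if "x \<in> carrier A" for x using S that by auto
  have SC: "\<And>x. x \<in> S \<Longrightarrow> x \<in> carrier A" using S by auto
  \<comment> \<open>Both sides of associativity are linear in each argument, so the law spreads from
    \<open>S\<close> to the carrier one argument at a time, here in the leftmost one.\<close>
  have 1: "(x \<otimes> y) \<otimes> z = x \<otimes> (y \<otimes> z)" if "x \<in> carrier A" "y \<in> S" "z \<in> S" for x y z
    using span[OF that(1)] S(1)
    by (induction rule: mod.lin_span_induct) (use that SC in \<open>auto simp: null m_closed dl sl assoc\<close>)
  have 2: "(x \<otimes> y) \<otimes> z = x \<otimes> (y \<otimes> z)" if "x \<in> carrier A" "y \<in> carrier A" "z \<in> S" for x y z
    using span[OF that(2)] S(1)
    by (induction rule: mod.lin_span_induct) (use that SC in \<open>auto simp: null m_closed dl sl dr sr 1\<close>)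
  have 3: "(x \<otimes> y) \<otimes> z = x \<otimes> (y \<otimes> z)"
    if "x \<in> carrier A" "y \<in> carrier A" "z \<in> carrier A" for x y z
    using span[OF that(3)] S(1)
    by (induction rule: mod.lin_span_induct) (use that SC in \<open>auto simp: null m_closed dl sl dr sr 2\<close>)
  have 4: "\<one> \<otimes> x = x" if "x \<in> carrier A" for x
    using span[OF that(1)] S(1)
    by (induction rule: mod.lin_span_induct) (use that SC in \<open>auto simp: one_closed null m_closed dr sr one\<close>)
  have 5: "x \<otimes> \<one> = x" if "x \<in> carrier A" for x
    using span[OF that(1)] S(1)
    by (induction rule: mod.lin_span_induct) (use that SC in \<open>auto simp: one_closed null m_closed dl sl one\<close>)
  have "ring A"
  proof (rule ringI)
    show "abelian_group A" by (rule mod.M.abelian_group_axioms)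
    show "monoid A" by (rule monoidI) (simp_all add: m_closed one_closed 3 4 5)
  qed (use dl dr in auto)
  then show ?thesis
    using k A sl sr unfolding k_alg_iff k_algebra_def by auto
qed

section \<open>Homomorphisms of algebras\<close>

text \<open>For a linear map, both sides of the multiplicativity law are bilinear, so a spanning set
  decides it.\<close>

lemma alg_homI_span:
  fixes A (structure)
  assumes "k_alg k A" "k_alg k B" "S \<subseteq> carrier A" "carrier A \<subseteq> lin_span k A S"
    and closed: "\<And>x. x \<in> carrier A \<Longrightarrow> h x \<in> carrier B"
    and add: "\<And>x y. x \<in> carrier A \<Longrightarrow> y \<in> carrier A \<Longrightarrow> h (x \<oplus> y) = h x \<oplus>\<^bsub>B\<^esub> h y"
    and smult: "\<And>r x. r \<in> carrier k \<Longrightarrow> x \<in> carrier A \<Longrightarrow> h (r \<odot> x) = r \<odot>\<^bsub>B\<^esub> h x"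
    and one: "h \<one> = \<one>\<^bsub>B\<^esub>"
    and mult: "\<And>x y. x \<in> S \<Longrightarrow> y \<in> S \<Longrightarrow> h (x \<otimes> y) = h x \<otimes>\<^bsub>B\<^esub> h y"
  shows "h \<in> alg_hom k A B"
proof -
  interpret A: k_alg k A by fact
  interpret B: k_alg k B by fact
  have span: "x \<in> lin_span k A S" if "x \<in> carrier A" for x using assms that by auto
  have SC: "\<And>x. x \<in> S \<Longrightarrow> x \<in> carrier A" using assms by auto
  have null: "h \<zero> = \<zero>\<^bsub>B\<^esub>"
    using smult[of "\<zero>\<^bsub>k\<^esub>" "\<zero>"] closed[of "\<zero>"] by simp
  have 1: "h (x \<otimes> y) = h x \<otimes>\<^bsub>B\<^esub> h y" if "x \<in> carrier A" "y \<in> S" for x y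
    using span[OF that(1)] assms(3)
    by (induction rule: A.M.lin_span_induct)
      (use that SC in \<open>auto simp: null closed A.l_distr B.l_distr add smult A.smult_mult_l B.smult_mult_l mult\<close>)
  have 2: "h (x \<otimes> y) = h x \<otimes>\<^bsub>B\<^esub> h y" if "x \<in> carrier A" "y \<in> carrier A" for x y
    using span[OF that(2)] assms(3)
    by (induction rule: A.M.lin_span_induct)
      (use that SC in \<open>auto simp: null closed A.r_distr B.r_distr add smult A.smult_mult_r B.smult_mult_r 1\<close>)
  show ?thesis
    unfolding alg_hom_def ring_hom_def using closed add smult one 2 by auto
qed

lemma alg_homD:
  fixes A (structure)
  assumes "h \<in> alg_hom k A B"
  shows "\<And>x. x \<in> carrier A \<Longrightarrow> h x \<in> carrier B"
    and "\<And>x y. x \<in> carrier A \<Longrightarrow> y \<in> carrier A \<Longrightarrow> h (x \<oplus> y) = h x \<oplus>\<^bsub>B\<^esub> h y"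
    and "\<And>x y. x \<in> carrier A \<Longrightarrow> y \<in> carrier A \<Longrightarrow> h (x \<otimes> y) = h x \<otimes>\<^bsub>B\<^esub> h y"
    and "\<And>r x. r \<in> carrier k \<Longrightarrow> x \<in> carrier A \<Longrightarrow> h (r \<odot> x) = r \<odot>\<^bsub>B\<^esub> h x"
    and "h \<one> = \<one>\<^bsub>B\<^esub>"
  using assms unfolding alg_hom_def ring_hom_def by auto

lemma alg_homI:
  fixes A (structure)
  assumes "\<And>x. x \<in> carrier A \<Longrightarrow> h x \<in> carrier B"
    and "\<And>x y. x \<in> carrier A \<Longrightarrow> y \<in> carrier A \<Longrightarrow> h (x \<oplus> y) = h x \<oplus>\<^bsub>B\<^esub> h y"
    and "\<And>x y. x \<in> carrier A \<Longrightarrow> y \<in> carrier A \<Longrightarrow> h (x \<otimes> y) = h x \<otimes>\<^bsub>B\<^esub> h y"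
    and "\<And>r x. r \<in> carrier k \<Longrightarrow> x \<in> carrier A \<Longrightarrow> h (r \<odot> x) = r \<odot>\<^bsub>B\<^esub> h x"
    and "h \<one> = \<one>\<^bsub>B\<^esub>"
  shows "h \<in> alg_hom k A B"
  using assms unfolding alg_hom_def ring_hom_def by auto

lemma alg_hom_zero:
  fixes A (structure)
  assumes "k_alg k A" "k_alg k B" "h \<in> alg_hom k A B"
  shows "h \<zero> = \<zero>\<^bsub>B\<^esub>"
proof -
  interpret A: k_alg k A by fact
  interpret B: k_alg k B by fact
  show ?thesis using alg_homD(4)[OF assms(3), of "\<zero>\<^bsub>k\<^esub>" "\<zero>"] alg_homD(1)[OF assms(3), of "\<zero>"] by simp
qed

lemma alg_hom_ring_hom_ring:
  assumes "k_alg k A" "k_alg k B" "h \<in> alg_hom k A B"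
  shows "ring_hom_ring A B h"
  using assms unfolding k_alg_def alg_hom_def by (auto intro: ring_hom_ringI2)

lemma alg_hom_minus:
  assumes "k_alg k A" "k_alg k B" "h \<in> alg_hom k A B" "x \<in> carrier A" "y \<in> carrier A"
  shows "h (x \<ominus>\<^bsub>A\<^esub> y) = h x \<ominus>\<^bsub>B\<^esub> h y"
proof -
  interpret ring_hom_ring A B h by (rule alg_hom_ring_hom_ring) fact+
  show ?thesis using assms(4,5) by (simp add: R.minus_eq S.minus_eq)
qed

lemma alg_hom_pow:
  assumes "k_alg k A" "k_alg k B" "h \<in> alg_hom k A B" "x \<in> carrier A"
  shows "h (x [^]\<^bsub>A\<^esub> (n::nat)) = h x [^]\<^bsub>B\<^esub> n"
proof -
  interpret ring_hom_ring A B h by (rule alg_hom_ring_hom_ring) fact+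
  show ?thesis using assms(4) by (simp add: hom_nat_pow)
qed

lemma alg_hom_comp: "f \<in> alg_hom k A B \<Longrightarrow> g \<in> alg_hom k B C \<Longrightarrow> g \<circ> f \<in> alg_hom k A C"
  by (rule alg_homI) (simp_all add: alg_homD)

lemma algebra_iso_iff:
  "h \<in> algebra_iso k A B \<longleftrightarrow> h \<in> alg_hom k A B \<and> bij_betw h (carrier A) (carrier B)"
  unfolding algebra_iso_def alg_hom_def ring_iso_def by auto

lemma algebra_iso_inv:
  fixes A (structure)
  assumes "k_alg k A" "h \<in> algebra_iso k A B"
  shows "inv_into (carrier A) h \<in> algebra_iso k B A"
proof -
  interpret k_alg k A by fact
  have h: "h \<in> alg_hom k A B" "inj_on h (carrier A)" "h ` carrier A = carrier B"
    using assms by (auto simp: algebra_iso_iff bij_betw_def)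
  note hD = alg_homD[OF h(1)]
  let ?g = "inv_into (carrier A) h"
  have g: "h x \<in> carrier B" "?g (h x) = x" if "x \<in> carrier A" for x using h that by auto
  have "?g \<in> alg_hom k B A"
  proof (rule alg_homI)
    fix x assume "x \<in> carrier B" then show "?g x \<in> carrier A" using h by (metis inv_into_into)
  next
    fix x y assume "x \<in> carrier B" "y \<in> carrier B"
    then obtain x' y' where *: "x' \<in> carrier A" "y' \<in> carrier A" "x = h x'" "y = h y'"
      unfolding h(3)[symmetric] by blast
    then show "?g (x \<oplus>\<^bsub>B\<^esub> y) = ?g x \<oplus> ?g y" "?g (x \<otimes>\<^bsub>B\<^esub> y) = ?g x \<otimes> ?g y"
      using h hD(2,3)[of x' y'] g[of x'] g[of y'] g[of "x' \<oplus> y'"] g[of "x' \<otimes> y'"] by auto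
  next
    fix r x assume "r \<in> carrier k" "x \<in> carrier B"
    then obtain x' where *: "x' \<in> carrier A" "x = h x'" unfolding h(3)[symmetric] by blast
    then show "?g (r \<odot>\<^bsub>B\<^esub> x) = r \<odot> ?g x"
      using h hD(4)[of r x'] g[of x'] g[of "r \<odot> x'"] \<open>r \<in> carrier k\<close> by auto
  next
    show "?g \<one>\<^bsub>B\<^esub> = \<one>" using g[of "\<one>"] hD(5) by simp
  qed
  moreover have "bij_betw ?g (carrier B) (carrier A)"
    using h by (simp add: bij_betw_inv_into bij_betw_def[of h])
  ultimately show ?thesis by (simp add: algebra_iso_iff)
qed

definition alg_isomorphic ::
    "('a, 'r) ring_scheme \<Rightarrow> ('a, 'b, 's) module_scheme \<Rightarrow> ('a, 'c, 't) module_scheme \<Rightarrow> bool" where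
  "alg_isomorphic k A B \<longleftrightarrow> algebra_iso k A B \<noteq> {}"

lemma alg_isomorphicI:
  "h \<in> alg_hom k A B \<Longrightarrow> inj_on h (carrier A) \<Longrightarrow> carrier B \<subseteq> h ` carrier A \<Longrightarrow> alg_isomorphic k A B"
  unfolding alg_isomorphic_def using alg_homD(1)[of h k A B]
  by (auto simp: set_eq_iff algebra_iso_iff bij_betw_def intro!: exI[of _ h])

lemma alg_isomorphicE:
  assumes "alg_isomorphic k A B"
  obtains h where "h \<in> alg_hom k A B" "inj_on h (carrier A)" "h ` carrier A = carrier B"
  using assms unfolding alg_isomorphic_def by (auto simp: set_eq_iff algebra_iso_iff bij_betw_def)

lemma alg_isomorphic_sym: "k_alg k A \<Longrightarrow> alg_isomorphic k A B \<Longrightarrow> alg_isomorphic k B A"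
  unfolding alg_isomorphic_def using algebra_iso_inv by blast

lemma alg_isomorphic_trans:
  assumes "alg_isomorphic k A B" "alg_isomorphic k B C"
  shows "alg_isomorphic k A C"
proof -
  obtain f where f: "f \<in> alg_hom k A B" "inj_on f (carrier A)" "f ` carrier A = carrier B"
    using assms(1) by (rule alg_isomorphicE)
  obtain g where g: "g \<in> alg_hom k B C" "inj_on g (carrier B)" "g ` carrier B = carrier C"
    using assms(2) by (rule alg_isomorphicE)
  show ?thesis
    by (rule alg_isomorphicI[OF alg_hom_comp[OF f(1) g(1)]])
      (use f g in \<open>auto intro: comp_inj_on simp: image_comp[symmetric] simp del: comp_apply\<close>)
qed

text \<open>The zero of \<open>B\<close> is not determined by the other operations, hence the hypothesis on it.\<close>

lemma k_alg_image:
  fixes B (structure)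
  assumes A: "k_alg k A"
    and img: "h ` carrier A = carrier B"
    and add: "\<And>x y. x \<in> carrier A \<Longrightarrow> y \<in> carrier A \<Longrightarrow> h (x \<oplus>\<^bsub>A\<^esub> y) = h x \<oplus> h y"
    and mult: "\<And>x y. x \<in> carrier A \<Longrightarrow> y \<in> carrier A \<Longrightarrow> h (x \<otimes>\<^bsub>A\<^esub> y) = h x \<otimes> h y"
    and smult: "\<And>r x. r \<in> carrier k \<Longrightarrow> x \<in> carrier A \<Longrightarrow> h (r \<odot>\<^bsub>A\<^esub> x) = r \<odot> h x"
    and one: "h \<one>\<^bsub>A\<^esub> = \<one>" and zero: "h \<zero>\<^bsub>A\<^esub> = \<zero>"
  shows "k_alg k B" "h \<in> alg_hom k A B"
proof -
  interpret A: k_alg k A by fact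
  show "h \<in> alg_hom k A B" using assms by (auto intro!: alg_homI)
  have ex: "\<exists>x'\<in>carrier A. x = h x'" if "x \<in> carrier B" for x using that img by auto
  have cl: "\<And>x. x \<in> carrier A \<Longrightarrow> h x \<in> carrier B" using img by auto
  have "abelian_group B"
  proof (rule abelian_groupI)
    fix x y assume "x \<in> carrier B" "y \<in> carrier B"
    then obtain x' y' where "x' \<in> carrier A" "x = h x'" "y' \<in> carrier A" "y = h y'" using ex[of x] ex[of y] by auto
    then show "x \<oplus> y \<in> carrier B" by (simp add: add[symmetric] cl)
  next
    show "\<zero> \<in> carrier B" using cl[OF A.zero_closed] by (simp add: zero)
  next
    fix x y z assume "x \<in> carrier B" "y \<in> carrier B" "z \<in> carrier B"
    then obtain x' y' z' where "x' \<in> carrier A" "x = h x'" "y' \<in> carrier A" "y = h y'"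
      "z' \<in> carrier A" "z = h z'" using ex[of x] ex[of y] ex[of z] by auto
    then show "x \<oplus> y \<oplus> z = x \<oplus> (y \<oplus> z)"
      by (simp add: add[symmetric] A.a_assoc)
  next
    fix x y assume "x \<in> carrier B" "y \<in> carrier B"
    then obtain x' y' where "x' \<in> carrier A" "x = h x'" "y' \<in> carrier A" "y = h y'" using ex[of x] ex[of y] by auto
    then show "x \<oplus> y = y \<oplus> x" by (simp add: add[symmetric] A.a_comm)
  next
    fix x assume "x \<in> carrier B"
    then obtain x' where x': "x' \<in> carrier A" "x = h x'" using ex by auto
    then show "\<zero> \<oplus> x = x" using add[of "\<zero>\<^bsub>A\<^esub>" x'] zero by simp
    show "\<exists>y\<in>carrier B. y \<oplus> x = \<zero>"
      using x' add[of "\<ominus>\<^bsub>A\<^esub> x'" x'] zero by (intro bexI[of _ "h (\<ominus>\<^bsub>A\<^esub> x')"]) (auto simp: A.l_neg cl)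
  qed
  have clB: "x \<oplus> y \<in> carrier B" "x \<otimes> y \<in> carrier B" if "x \<in> carrier B" "y \<in> carrier B" for x y
    using ex[OF that(1)] ex[OF that(2)] add[symmetric] mult[symmetric] cl by auto
  have sclB: "r \<odot> x \<in> carrier B" if "r \<in> carrier k" "x \<in> carrier B" for r x
    using ex[OF that(2)] that smult[symmetric] cl by auto
  note hom = add[symmetric] mult[symmetric] smult[symmetric] one[symmetric]
  have "module k B"
  proof (rule moduleI)
    fix r t x assume *: "r \<in> carrier k" "t \<in> carrier k" "x \<in> carrier B"
    then obtain x' where "x' \<in> carrier A" "x = h x'" using ex by auto
    then show "(r \<oplus>\<^bsub>k\<^esub> t) \<odot> x = r \<odot> x \<oplus> t \<odot> x"
      "(r \<otimes>\<^bsub>k\<^esub> t) \<odot> x = r \<odot> (t \<odot> x)"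
      using * by (simp_all add: hom A.M.smult_l_distr A.M.smult_assoc1)
  next
    fix r x y assume *: "r \<in> carrier k" "x \<in> carrier B" "y \<in> carrier B"
    then obtain x' y' where "x' \<in> carrier A" "x = h x'" "y' \<in> carrier A" "y = h y'" using ex[of x] ex[of y] by auto
    then show "r \<odot> (x \<oplus> y) = r \<odot> x \<oplus> r \<odot> y"
      using * by (simp add: hom A.M.smult_r_distr)
  next
    fix x assume "x \<in> carrier B"
    then obtain x' where "x' \<in> carrier A" "x = h x'" using ex by auto
    then show "\<one>\<^bsub>k\<^esub> \<odot> x = x" by (simp add: hom)
  qed (use sclB A.K.is_cring \<open>abelian_group B\<close> in auto)
  have "monoid B"
  proof (rule monoidI)
    fix x y z assume "x \<in> carrier B" "y \<in> carrier B" "z \<in> carrier B"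
    then obtain x' y' z' where "x' \<in> carrier A" "x = h x'" "y' \<in> carrier A" "y = h y'"
      "z' \<in> carrier A" "z = h z'" using ex[of x] ex[of y] ex[of z] by auto
    then show "x \<otimes> y \<otimes> z = x \<otimes> (y \<otimes> z)" by (simp add: hom A.m_assoc)
  next
    fix x assume "x \<in> carrier B"
    then obtain x' where "x' \<in> carrier A" "x = h x'" using ex by auto
    then show "\<one> \<otimes> x = x" "x \<otimes> \<one> = x" by (simp_all add: hom)
  qed (use clB cl one[symmetric] in auto)
  have "ring B"
  proof (rule ringI)
    fix x y z assume "x \<in> carrier B" "y \<in> carrier B" "z \<in> carrier B"
    then obtain x' y' z' where "x' \<in> carrier A" "x = h x'" "y' \<in> carrier A" "y = h y'"
      "z' \<in> carrier A" "z = h z'" using ex[of x] ex[of y] ex[of z] by auto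
    then show "(x \<oplus> y) \<otimes> z = x \<otimes> z \<oplus> y \<otimes> z"
      "z \<otimes> (x \<oplus> y) = z \<otimes> x \<oplus> z \<otimes> y"
      by (simp_all add: hom A.l_distr A.r_distr)
  qed fact+
  have "(r \<odot> x) \<otimes> y = r \<odot> (x \<otimes> y)" "x \<otimes> (r \<odot> y) = r \<odot> (x \<otimes> y)"
    if *: "r \<in> carrier k" "x \<in> carrier B" "y \<in> carrier B" for r x y
  proof -
    from * obtain x' y' where "x' \<in> carrier A" "x = h x'" "y' \<in> carrier A" "y = h y'" using ex[of x] ex[of y] by auto
    then show "(r \<odot> x) \<otimes> y = r \<odot> (x \<otimes> y)" "x \<otimes> (r \<odot> y) = r \<odot> (x \<otimes> y)"
      using *(1) by (simp_all add: hom A.smult_mult_l A.smult_mult_r)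
  qed
  then show "k_alg k B"
    unfolding k_alg_iff k_algebra_def using A.field \<open>module k B\<close> \<open>ring B\<close> by auto
qed

section \<open>Quotients\<close>

text \<open>A two-sided ideal is closed under scalars because \<open>r \<odot> i\<close> equals
  \<open>(r \<odot> \<one>) \<otimes> i\<close>. Hence the union that defines a scalar multiple of a
  coset has all its members equal, and the algebra laws descend along the projection.\<close>

lemma
  fixes A (structure)
  assumes A: "k_alg k A" and I: "ideal I A"
  shows k_alg_quotient: "k_alg k (quotient_algebra A I)"
    and quotient_hom: "(\<lambda>x. I +> x) \<in> alg_hom k A (quotient_algebra A I)"
    and quotient_surj: "(\<lambda>x. I +> x) ` carrier A = carrier (quotient_algebra A I)"
proof -
  interpret k_alg k A by fact
  interpret ideal I A by fact
  show surj: "(\<lambda>x. I +> x) ` carrier A = carrier (quotient_algebra A I)"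
    by (auto simp: quotient_algebra_def FactRing_def A_RCOSETS_defs a_r_coset_def r_coset_def)
  have smultI: "r \<odot> i \<in> I" if "r \<in> carrier k" "i \<in> I" for r i
  proof -
    have "r \<odot> i = (r \<odot> \<one>) \<otimes> i" using that a_subset by (subst smult_mult_l) auto
    then show ?thesis using that by (auto intro: I_l_closed)
  qed
  have smult: "I +> (r \<odot> x) = (\<Union>y\<in>I +> x. I +> (r \<odot> y))"
    if "r \<in> carrier k" "x \<in> carrier A" for r x
  proof -
    have "I +> (r \<odot> y) = I +> (r \<odot> x)" if y: "y \<in> I +> x" for y
    proof -
      obtain i where i: "i \<in> I" "y = i \<oplus> x" using y by (auto simp: a_r_coset_def')
      have "r \<odot> y = r \<odot> i \<oplus> r \<odot> x"
        using i that \<open>r \<in> carrier k\<close> \<open>x \<in> carrier A\<close> a_subset by (simp add: M.smult_r_distr subset_iff)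
      then have "r \<odot> y \<in> I +> (r \<odot> x)"
        using smultI i \<open>r \<in> carrier k\<close> by (auto simp: a_r_coset_def')
      then show ?thesis
        by (rule a_repr_independence'[symmetric]) (use \<open>r \<in> carrier k\<close> \<open>x \<in> carrier A\<close> in auto)
    qed
    moreover have "x \<in> I +> x" using \<open>x \<in> carrier A\<close> by (rule a_rcos_self)
    ultimately show ?thesis by (metis (mono_tags, lifting) SUP_eq_const empty_iff)
  qed
  have zero: "I +> \<zero> = I" by (rule a_coset_join2) (auto simp: a_subgroup)
  show "k_alg k (quotient_algebra A I)" "(\<lambda>x. I +> x) \<in> alg_hom k A (quotient_algebra A I)"
    by (rule k_alg_image[OF A surj];
        simp add: quotient_algebra_def FactRing_def rcoset_mult_add a_rcos_sum smult zero)+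
qed

lemma quotient_eq_iff:
  fixes A (structure)
  assumes "k_alg k A" "ideal I A" "x \<in> carrier A" "y \<in> carrier A"
  shows "I +> x = I +> y \<longleftrightarrow> x \<ominus> y \<in> I"
proof -
  interpret k_alg k A by fact
  show ?thesis using quotient_eq_iff_same_a_r_cos[OF assms(2-4)] by simp
qed

lemma quotient_lift:
  fixes B (structure)
  assumes A: "k_alg k A" and B: "k_alg k B" and I: "ideal I A"
    and h: "h \<in> alg_hom k A B" and ker: "\<And>x. x \<in> I \<Longrightarrow> h x = \<zero>"
  obtains g where "g \<in> alg_hom k (quotient_algebra A I) B"
    "\<And>x. x \<in> carrier A \<Longrightarrow> g (I +>\<^bsub>A\<^esub> x) = h x"
proof -
  interpret A: k_alg k A by fact
  interpret B: k_alg k B by fact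
  let ?Q = "quotient_algebra A I" and ?p = "\<lambda>x. I +>\<^bsub>A\<^esub> x"
  note p = quotient_hom[OF A I] quotient_surj[OF A I]
  note pD = alg_homD[OF p(1)] and hD = alg_homD[OF h]
  \<comment> \<open>An arbitrary representative is chosen; two of them differ by an element of
    \<open>I\<close>, which \<open>h\<close> sends to zero.\<close>
  define g where "g C = h (SOME x. x \<in> carrier A \<and> ?p x = C)" for C
  have g: "g (?p x) = h x" if x: "x \<in> carrier A" for x
  proof -
    define y where "y = (SOME y. y \<in> carrier A \<and> ?p y = ?p x)"
    have y: "y \<in> carrier A \<and> ?p y = ?p x" unfolding y_def by (rule someI[of _ x]) (use x in auto)
    then have "y \<ominus>\<^bsub>A\<^esub> x \<in> I" using quotient_eq_iff[OF A I] x by blast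
    then have "h y \<ominus> h x = \<zero>" using ker alg_hom_minus[OF A B h] y x by metis
    then show ?thesis unfolding g_def y_def[symmetric] using hD(1) x y by simp
  qed
  have ex: "\<exists>x'\<in>carrier A. x = ?p x'" if "x \<in> carrier ?Q" for x using that p(2) by (metis imageE)
  have "g \<in> alg_hom k ?Q B"
  proof (rule alg_homI)
    fix x y assume "x \<in> carrier ?Q" "y \<in> carrier ?Q"
    then obtain x' y' where "x' \<in> carrier A" "x = ?p x'" "y' \<in> carrier A" "y = ?p y'"
      using ex[of x] ex[of y] by auto
    then show "g (x \<oplus>\<^bsub>?Q\<^esub> y) = g x \<oplus> g y" "g (x \<otimes>\<^bsub>?Q\<^esub> y) = g x \<otimes> g y"
      by (simp_all add: pD(2,3)[symmetric] g hD)
  next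
    fix r x assume "r \<in> carrier k" "x \<in> carrier ?Q"
    then obtain x' where "x' \<in> carrier A" "x = ?p x'" using ex[of x] by auto
    then show "g (r \<odot>\<^bsub>?Q\<^esub> x) = r \<odot> g x"
      using \<open>r \<in> carrier k\<close> by (simp add: pD(4)[symmetric] g hD)
  next
    fix x assume "x \<in> carrier ?Q"
    then show "g x \<in> carrier B" using ex[of x] g hD(1) by auto
  next
    show "g \<one>\<^bsub>?Q\<^esub> = \<one>" using g[of "\<one>\<^bsub>A\<^esub>"] pD(5) hD(5) by simp
  qed
  then show thesis using that g by blast
qed

lemma lin_span_image:
  assumes "k_alg k A" "k_alg k B" "h \<in> alg_hom k A B" "S \<subseteq> carrier A" "x \<in> lin_span k A S"
  shows "h x \<in> lin_span k B (h ` S)"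
proof -
  interpret A: k_alg k A by fact
  interpret B: k_alg k B by fact
  have S: "h ` S \<subseteq> carrier B" using assms alg_homD(1)[OF assms(3)] by auto
  show ?thesis using assms(5,4)
    by (induction rule: A.M.lin_span_induct)
      (auto simp: alg_homD[OF assms(3)] alg_hom_zero[OF assms(1-3)]
        intro: lin_span.zero B.M.lin_span_add[OF S] B.M.lin_span_smult[OF S] B.M.lin_span_base[OF S])
qed

section \<open>Monoid algebras\<close>

context field
begin

text \<open>The defining sum has an index set that depends on both supports and on \<open>z\<close>.
  Padding with zeros replaces it by one fixed rectangle, over which products of different functions
  can be compared term by term.\<close>

lemma monoid_algebra_mult:
  assumes M: "monoid M"
    and f: "f \<in> carrier (monoid_algebra R M)" and g: "g \<in> carrier (monoid_algebra R M)"
    and U: "finite U" "support R f \<subseteq> U" and V: "finite V" "support R g \<subseteq> V"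
  shows "(f \<otimes>\<^bsub>monoid_algebra R M\<^esub> g) z =
    (\<Oplus>w\<in>U \<times> V. if fst w \<otimes>\<^bsub>M\<^esub> snd w = z then f (fst w) \<otimes> g (snd w) else \<zero>)"
proof -
  have fg: "f x \<in> carrier R" "g x \<in> carrier R" for x
    using f g by (auto simp: monoid_algebra_def)
  show ?thesis unfolding monoid_algebra_def monoid.simps
    by (rule add.finprod_mono_neutral_cong_left)
      (use U V fg in \<open>auto simp: support_def subset_iff\<close>)
qed

lemma single_closed: "x \<in> carrier M \<Longrightarrow> single R x \<in> carrier (monoid_algebra R M)"
  by (auto simp: monoid_algebra_def single_def support_def)

lemma monoid_algebra_module:
  assumes M: "monoid M" shows "module R (monoid_algebra R M)"
proof -
  let ?P = "monoid_algebra R M"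
  have cl: "f x \<in> carrier R" if "f \<in> carrier ?P" for f x
    using that by (auto simp: monoid_algebra_def)
  have sup: "finite (support R f)" "support R f \<subseteq> carrier M" if "f \<in> carrier ?P" for f
    using that by (auto simp: monoid_algebra_def)
  have I: "f \<in> carrier ?P" if "\<And>x. f x \<in> carrier R" "support R f \<subseteq> U" "finite U" "U \<subseteq> carrier M" for f U
    using that finite_subset[of "support R f" U] by (auto simp: monoid_algebra_def)
  have add: "f \<oplus>\<^bsub>?P\<^esub> g \<in> carrier ?P" if "f \<in> carrier ?P" "g \<in> carrier ?P" for f g
    by (rule I[of _ "support R f \<union> support R g"])
      (use that cl[OF that(1)] cl[OF that(2)] sup[OF that(1)] sup[OF that(2)] in
        \<open>auto simp: monoid_algebra_def support_def\<close>)
  have smult: "r \<odot>\<^bsub>?P\<^esub> f \<in> carrier ?P" if "f \<in> carrier ?P" "r \<in> carrier R" for f r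
    by (rule I[of _ "support R f"])
      (use that cl[OF that(1)] sup[OF that(1)] in \<open>auto simp: monoid_algebra_def support_def\<close>)
  have eval: "(f \<oplus>\<^bsub>?P\<^esub> g) z = f z \<oplus> g z" "(r \<odot>\<^bsub>?P\<^esub> f) z = r \<otimes> f z" "\<zero>\<^bsub>?P\<^esub> z = \<zero>" for f g r z
    by (auto simp: monoid_algebra_def)
  show ?thesis
  proof (rule moduleI)
    show "abelian_group ?P"
    proof (rule abelian_groupI)
      show "\<zero>\<^bsub>?P\<^esub> \<in> carrier ?P" by (auto simp: monoid_algebra_def support_def)
      fix f assume f: "f \<in> carrier ?P"
      show "\<exists>g\<in>carrier ?P. g \<oplus>\<^bsub>?P\<^esub> f = \<zero>\<^bsub>?P\<^esub>"
        using smult[OF f, of "\<ominus> \<one>"] cl[OF f]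
        by (intro bexI[of _ "(\<ominus> \<one>) \<odot>\<^bsub>?P\<^esub> f"]) (auto simp: eval l_minus l_neg)
      show "\<zero>\<^bsub>?P\<^esub> \<oplus>\<^bsub>?P\<^esub> f = f" using cl[OF f] by (auto simp: eval)
    next
      fix f g assume f: "f \<in> carrier ?P" and g: "g \<in> carrier ?P"
      show "f \<oplus>\<^bsub>?P\<^esub> g \<in> carrier ?P" by (rule add) fact+
      show "f \<oplus>\<^bsub>?P\<^esub> g = g \<oplus>\<^bsub>?P\<^esub> f" using cl[OF f] cl[OF g] by (auto simp: eval a_comm)
      fix h assume h: "h \<in> carrier ?P"
      show "f \<oplus>\<^bsub>?P\<^esub> g \<oplus>\<^bsub>?P\<^esub> h = f \<oplus>\<^bsub>?P\<^esub> (g \<oplus>\<^bsub>?P\<^esub> h)"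
        using cl[OF f] cl[OF g] cl[OF h] by (auto simp: eval a_assoc)
    qed
  next
    fix r f g assume r: "r \<in> carrier R" and f: "f \<in> carrier ?P" and g: "g \<in> carrier ?P"
    show "r \<odot>\<^bsub>?P\<^esub> (f \<oplus>\<^bsub>?P\<^esub> g) = r \<odot>\<^bsub>?P\<^esub> f \<oplus>\<^bsub>?P\<^esub> r \<odot>\<^bsub>?P\<^esub> g"
      using r cl[OF f] cl[OF g] by (auto simp: eval r_distr)
  next
    fix r t f assume r: "r \<in> carrier R" and t: "t \<in> carrier R" and f: "f \<in> carrier ?P"
    show "r \<odot>\<^bsub>?P\<^esub> f \<in> carrier ?P" by (rule smult) fact+
    show "(r \<oplus> t) \<odot>\<^bsub>?P\<^esub> f = r \<odot>\<^bsub>?P\<^esub> f \<oplus>\<^bsub>?P\<^esub> t \<odot>\<^bsub>?P\<^esub> f" "(r \<otimes> t) \<odot>\<^bsub>?P\<^esub> f = r \<odot>\<^bsub>?P\<^esub> (t \<odot>\<^bsub>?P\<^esub> f)"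
      using r t cl[OF f] by (auto simp: eval l_distr m_assoc)
  next
    fix f assume f: "f \<in> carrier ?P"
    show "\<one> \<odot>\<^bsub>?P\<^esub> f = f" using cl[OF f] by (auto simp: eval)
  qed (rule is_cring)
qed

text \<open>Induction on the size of the support: subtracting the term at one point of the support
  removes exactly that point.\<close>

lemma monoid_algebra_span:
  assumes M: "monoid M"
  shows "carrier (monoid_algebra R M) \<subseteq> lin_span R (monoid_algebra R M) (single R ` carrier M)"
proof
  let ?P = "monoid_algebra R M"
  interpret P: module R ?P by (rule monoid_algebra_module[OF M])
  fix f assume "f \<in> carrier ?P"
  then show "f \<in> lin_span R ?P (single R ` carrier M)"
  proof (induction "card (support R f)" arbitrary: f)
    case 0
    then have "f = \<zero>\<^bsub>?P\<^esub>" by (auto simp: monoid_algebra_def support_def)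
    then show ?case by (simp add: lin_span.zero)
  next
    case (Suc n)
    then have fin: "finite (support R f)" and cl: "\<And>x. f x \<in> carrier R" and sup: "support R f \<subseteq> carrier M"
      by (auto simp: monoid_algebra_def)
    from Suc(2) have "support R f \<noteq> {}" by auto
    then obtain x where x: "x \<in> support R f" by auto
    define g where "g = f(x := \<zero>)"
    have sg: "support R g = support R f - {x}" by (auto simp: g_def support_def)
    then have "g \<in> carrier ?P" using fin cl sup by (auto simp: monoid_algebra_def g_def)
    moreover have "n = card (support R g)" using Suc(2) x fin by (simp add: sg)
    ultimately have "g \<in> lin_span R ?P (single R ` carrier M)" by (intro Suc(1))
    then have "f x \<odot>\<^bsub>?P\<^esub> single R x \<oplus>\<^bsub>?P\<^esub> g \<in> lin_span R ?P (single R ` carrier M)"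
      using cl x sup by (intro lin_span.step) auto
    also have "f x \<odot>\<^bsub>?P\<^esub> single R x \<oplus>\<^bsub>?P\<^esub> g = f"
      using cl by (auto simp: fun_eq_iff monoid_algebra_def single_def g_def)
    finally show ?case .
  qed
qed

lemma monoid_algebra_mult_single:
  assumes M: "monoid M" and x: "x \<in> carrier M" and y: "y \<in> carrier M"
  shows "single R x \<otimes>\<^bsub>monoid_algebra R M\<^esub> single R y = single R (x \<otimes>\<^bsub>M\<^esub> y)"
proof
  fix z
  have "(single R x \<otimes>\<^bsub>monoid_algebra R M\<^esub> single R y) z =
    (\<Oplus>w\<in>{x} \<times> {y}. if fst w \<otimes>\<^bsub>M\<^esub> snd w = z then single R x (fst w) \<otimes> single R y (snd w) else \<zero>)"
    by (rule monoid_algebra_mult[OF M single_closed[OF x] single_closed[OF y]])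
      (auto simp: support_def single_def)
  then show "(single R x \<otimes>\<^bsub>monoid_algebra R M\<^esub> single R y) z = single R (x \<otimes>\<^bsub>M\<^esub> y) z"
    by (simp add: single_def)
qed

lemma monoid_algebra_k_alg:
  assumes M: "monoid M" shows "k_alg R (monoid_algebra R M)"
proof -
  let ?P = "monoid_algebra R M"
  interpret P: module R ?P by (rule monoid_algebra_module[OF M])
  interpret M: monoid M by fact
  have cl: "f x \<in> carrier R" if "f \<in> carrier ?P" for f x
    using that by (auto simp: monoid_algebra_def)
  have sup: "finite (support R f)" "support R f \<subseteq> carrier M" if "f \<in> carrier ?P" for f
    using that by (auto simp: monoid_algebra_def)
  have mem: "f \<in> carrier ?P" if "\<And>x. f x \<in> carrier R" "finite (support R f)" "support R f \<subseteq> carrier M" for f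
    using that by (auto simp: monoid_algebra_def)
  note mult = monoid_algebra_mult[OF M]
  note single_mult = monoid_algebra_mult_single[OF M]
  have sub: "support R (f \<oplus>\<^bsub>?P\<^esub> g) \<subseteq> support R f \<union> support R g" "support R (r \<odot>\<^bsub>?P\<^esub> f) \<subseteq> support R f"
    if "f \<in> carrier ?P" "g \<in> carrier ?P" "r \<in> carrier R" for f g r
    using that cl by (auto simp: monoid_algebra_def support_def)
  have eval: "(f \<oplus>\<^bsub>?P\<^esub> g) z = f z \<oplus> g z" "(r \<odot>\<^bsub>?P\<^esub> f) z = r \<otimes> f z" for f g r z
    by (auto simp: monoid_algebra_def)
  show ?thesis
  proof (rule k_algI_span[OF field_axioms P.module_axioms, where S = "single R ` carrier M"])
    show "f \<otimes>\<^bsub>?P\<^esub> g \<in> carrier ?P" if f: "f \<in> carrier ?P" and g: "g \<in> carrier ?P" for f g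
    proof -
      have "support R (f \<otimes>\<^bsub>?P\<^esub> g) \<subseteq> (\<lambda>w. fst w \<otimes>\<^bsub>M\<^esub> snd w) ` (support R f \<times> support R g)"
      proof
        fix z assume "z \<in> support R (f \<otimes>\<^bsub>?P\<^esub> g)"
        then have *: "(f \<otimes>\<^bsub>?P\<^esub> g) z \<noteq> \<zero>" by (simp add: support_def)
        have "{w \<in> support R f \<times> support R g. fst w \<otimes>\<^bsub>M\<^esub> snd w = z} \<noteq> {}"
        proof
          assume "{w \<in> support R f \<times> support R g. fst w \<otimes>\<^bsub>M\<^esub> snd w = z} = {}"
          then have "(f \<otimes>\<^bsub>?P\<^esub> g) z = \<zero>"
            by (simp only: monoid_algebra_def monoid.simps finsum_empty)
          then show False using * by contradiction
        qed
        then show "z \<in> (\<lambda>w. fst w \<otimes>\<^bsub>M\<^esub> snd w) ` (support R f \<times> support R g)" by force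
      qed
      moreover have "(f \<otimes>\<^bsub>?P\<^esub> g) z \<in> carrier R" for z
        unfolding mult[OF f g sup(1)[OF f] order_refl sup(1)[OF g] order_refl]
        by (rule finsum_closed) (auto simp: cl f g)
      ultimately show ?thesis
        using sup[OF f] sup[OF g] by (intro mem) (auto elim!: finite_subset dest!: subsetD)
    qed
    show "\<one>\<^bsub>?P\<^esub> \<in> carrier ?P" using single_closed[of "\<one>\<^bsub>M\<^esub>" M] by (simp add: monoid_algebra_def)
    show "single R ` carrier M \<subseteq> carrier ?P" using single_closed by auto
    show "carrier ?P \<subseteq> lin_span R ?P (single R ` carrier M)" by (rule monoid_algebra_span[OF M])
    show "\<one>\<^bsub>?P\<^esub> \<otimes>\<^bsub>?P\<^esub> x = x" "x \<otimes>\<^bsub>?P\<^esub> \<one>\<^bsub>?P\<^esub> = x" if "x \<in> single R ` carrier M" for x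
    proof -
      have "\<one>\<^bsub>?P\<^esub> = single R \<one>\<^bsub>M\<^esub>" by (simp add: monoid_algebra_def)
      then show "\<one>\<^bsub>?P\<^esub> \<otimes>\<^bsub>?P\<^esub> x = x" "x \<otimes>\<^bsub>?P\<^esub> \<one>\<^bsub>?P\<^esub> = x" using that single_mult by auto
    qed
    show "(x \<otimes>\<^bsub>?P\<^esub> y) \<otimes>\<^bsub>?P\<^esub> z = x \<otimes>\<^bsub>?P\<^esub> (y \<otimes>\<^bsub>?P\<^esub> z)"
      if "x \<in> single R ` carrier M" "y \<in> single R ` carrier M" "z \<in> single R ` carrier M" for x y z
      using that by (auto simp: single_mult M.m_assoc)
  next
    fix f g h assume fgh: "f \<in> carrier ?P" "g \<in> carrier ?P" "h \<in> carrier ?P"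
    note s = sup(1)[OF fgh(1)] sup(1)[OF fgh(2)] sup(1)[OF fgh(3)]
    note fg = P.a_closed[OF fgh(1,2)]
    let ?U = "support R f \<union> support R g"
    have U: "finite ?U" using s by auto
    show "(f \<oplus>\<^bsub>?P\<^esub> g) \<otimes>\<^bsub>?P\<^esub> h = f \<otimes>\<^bsub>?P\<^esub> h \<oplus>\<^bsub>?P\<^esub> g \<otimes>\<^bsub>?P\<^esub> h"
    proof
      fix z
      show "((f \<oplus>\<^bsub>?P\<^esub> g) \<otimes>\<^bsub>?P\<^esub> h) z = (f \<otimes>\<^bsub>?P\<^esub> h \<oplus>\<^bsub>?P\<^esub> g \<otimes>\<^bsub>?P\<^esub> h) z"
        apply (subst eval)
        unfolding mult[OF fg fgh(3) U sub(1)[OF fgh(1,2) zero_closed] s(3) order_refl]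
          mult[OF fgh(1,3) U Un_upper1 s(3) order_refl] mult[OF fgh(2,3) U Un_upper2 s(3) order_refl]
        by (rule trans[OF finsum_cong'[OF refl] finsum_addf]; auto simp: cl fgh l_distr eval)
    qed
    show "h \<otimes>\<^bsub>?P\<^esub> (f \<oplus>\<^bsub>?P\<^esub> g) = h \<otimes>\<^bsub>?P\<^esub> f \<oplus>\<^bsub>?P\<^esub> h \<otimes>\<^bsub>?P\<^esub> g"
    proof
      fix z
      show "(h \<otimes>\<^bsub>?P\<^esub> (f \<oplus>\<^bsub>?P\<^esub> g)) z = (h \<otimes>\<^bsub>?P\<^esub> f \<oplus>\<^bsub>?P\<^esub> h \<otimes>\<^bsub>?P\<^esub> g) z"
        apply (subst eval)
        unfolding mult[OF fgh(3) fg s(3) order_refl U sub(1)[OF fgh(1,2) zero_closed]]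
          mult[OF fgh(3,1) s(3) order_refl U Un_upper1] mult[OF fgh(3,2) s(3) order_refl U Un_upper2]
        by (rule trans[OF finsum_cong'[OF refl] finsum_addf]; auto simp: cl fgh r_distr eval)
    qed
  next
    fix r f g assume rfg: "r \<in> carrier R" "f \<in> carrier ?P" "g \<in> carrier ?P"
    note s = sup(1)[OF rfg(2)] sup(1)[OF rfg(3)]
    note f = P.smult_closed[OF rfg(1,2)] and g = P.smult_closed[OF rfg(1,3)]
    show "(r \<odot>\<^bsub>?P\<^esub> f) \<otimes>\<^bsub>?P\<^esub> g = r \<odot>\<^bsub>?P\<^esub> (f \<otimes>\<^bsub>?P\<^esub> g)"
    proof
      fix z
      show "((r \<odot>\<^bsub>?P\<^esub> f) \<otimes>\<^bsub>?P\<^esub> g) z = (r \<odot>\<^bsub>?P\<^esub> (f \<otimes>\<^bsub>?P\<^esub> g)) z"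
        apply (subst eval)
        unfolding mult[OF f rfg(3) s(1) sub(2)[OF rfg(2,2,1)] s(2) order_refl]
          mult[OF rfg(2,3) s(1) order_refl s(2) order_refl]
        by (rule trans[OF finsum_cong'[OF refl] finsum_rdistr[symmetric]]; use s rfg in \<open>auto simp: cl m_assoc eval\<close>)
    qed
    show "f \<otimes>\<^bsub>?P\<^esub> (r \<odot>\<^bsub>?P\<^esub> g) = r \<odot>\<^bsub>?P\<^esub> (f \<otimes>\<^bsub>?P\<^esub> g)"
    proof
      fix z
      show "(f \<otimes>\<^bsub>?P\<^esub> (r \<odot>\<^bsub>?P\<^esub> g)) z = (r \<odot>\<^bsub>?P\<^esub> (f \<otimes>\<^bsub>?P\<^esub> g)) z"
        apply (subst eval)
        unfolding mult[OF rfg(2) g s(1) order_refl s(2) sub(2)[OF rfg(3,3,1)]]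
          mult[OF rfg(2,3) s(1) order_refl s(2) order_refl]
        by (rule trans[OF finsum_cong'[OF refl] finsum_rdistr[symmetric]]; use s rfg in \<open>auto simp: cl m_lcomm eval\<close>)
    qed
  qed
qed

text \<open>The universal property of the monoid algebra. The image of \<open>f\<close> is the sum
  of \<open>f x\<close> times \<open>\<phi> x\<close>; it may be taken over any finite set
  containing the support, which gives additivity.\<close>

lemma monoid_algebra_lift:
  assumes M: "monoid M" and A: "k_alg R A"
    and \<phi>: "\<And>x. x \<in> carrier M \<Longrightarrow> \<phi> x \<in> carrier A" "\<phi> \<one>\<^bsub>M\<^esub> = \<one>\<^bsub>A\<^esub>"
      "\<And>x y. x \<in> carrier M \<Longrightarrow> y \<in> carrier M \<Longrightarrow> \<phi> (x \<otimes>\<^bsub>M\<^esub> y) = \<phi> x \<otimes>\<^bsub>A\<^esub> \<phi> y"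
  obtains h where "h \<in> alg_hom R (monoid_algebra R M) A"
    "\<And>x. x \<in> carrier M \<Longrightarrow> h (single R x) = \<phi> x"
proof -
  let ?P = "monoid_algebra R M"
  interpret P: k_alg R ?P by (rule monoid_algebra_k_alg[OF M])
  interpret A: k_alg R A by fact
  interpret M: monoid M by fact
  have cl: "f x \<in> carrier R" if "f \<in> carrier ?P" for f x
    using that by (auto simp: monoid_algebra_def)
  have sup: "finite (support R f)" "support R f \<subseteq> carrier M" if "f \<in> carrier ?P" for f
    using that by (auto simp: monoid_algebra_def)
  define h where "h f = (\<Oplus>\<^bsub>A\<^esub>x\<in>support R f. f x \<odot>\<^bsub>A\<^esub> \<phi> x)" for f
  have h: "h f = (\<Oplus>\<^bsub>A\<^esub>x\<in>U. f x \<odot>\<^bsub>A\<^esub> \<phi> x)"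
    if "f \<in> carrier ?P" "finite U" "support R f \<subseteq> U" "U \<subseteq> carrier M" for f U
    unfolding h_def by (rule A.add.finprod_mono_neutral_cong_left)
      (use that cl[OF that(1)] \<phi>(1) in \<open>auto simp: support_def subset_iff\<close>)
  have hs: "h (single R x) = \<phi> x" if "x \<in> carrier M" for x
    using that \<phi>(1) h[OF single_closed[OF that], of "{x}"] by (auto simp: single_def support_def)
  have "h \<in> alg_hom R ?P A"
  proof (rule alg_homI_span[OF P.k_alg_axioms A, where S = "single R ` carrier M"])
    show "single R ` carrier M \<subseteq> carrier ?P" using single_closed by auto
    show "carrier ?P \<subseteq> lin_span R ?P (single R ` carrier M)" by (rule monoid_algebra_span[OF M])
    show "h f \<in> carrier A" if "f \<in> carrier ?P" for f
      unfolding h_def using sup[OF that] cl[OF that] \<phi>(1) by (auto intro!: A.finsum_closed)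
    show "h \<one>\<^bsub>?P\<^esub> = \<one>\<^bsub>A\<^esub>" using hs[of "\<one>\<^bsub>M\<^esub>"] \<phi>(2) by (simp add: monoid_algebra_def)
    show "h (x \<otimes>\<^bsub>?P\<^esub> y) = h x \<otimes>\<^bsub>A\<^esub> h y" if "x \<in> single R ` carrier M" "y \<in> single R ` carrier M" for x y
      using that by (auto simp: monoid_algebra_mult_single[OF M] hs \<phi>)
  next
    fix f g assume f: "f \<in> carrier ?P" and g: "g \<in> carrier ?P"
    let ?U = "support R f \<union> support R g"
    have U: "finite ?U" "?U \<subseteq> carrier M" using sup[OF f] sup[OF g] by auto
    have sub: "support R (f \<oplus>\<^bsub>?P\<^esub> g) \<subseteq> ?U" by (auto simp: support_def monoid_algebra_def)
    have "h (f \<oplus>\<^bsub>?P\<^esub> g) = (\<Oplus>\<^bsub>A\<^esub>x\<in>?U. (f \<oplus>\<^bsub>?P\<^esub> g) x \<odot>\<^bsub>A\<^esub> \<phi> x)"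
      by (rule h[OF P.a_closed[OF f g] U(1) sub U(2)])
    also have "\<dots> = (\<Oplus>\<^bsub>A\<^esub>x\<in>?U. f x \<odot>\<^bsub>A\<^esub> \<phi> x \<oplus>\<^bsub>A\<^esub> g x \<odot>\<^bsub>A\<^esub> \<phi> x)"
      by (rule A.finsum_cong')
        (use U(2) cl[OF f] cl[OF g] \<phi>(1) in \<open>auto simp: monoid_algebra_def A.M.smult_l_distr subset_iff\<close>)
    also have "\<dots> = h f \<oplus>\<^bsub>A\<^esub> h g"
      using U cl[OF f] cl[OF g] \<phi>(1) by (subst A.finsum_addf) (auto simp: h[OF f, of ?U] h[OF g, of ?U] subset_iff)
    finally show "h (f \<oplus>\<^bsub>?P\<^esub> g) = h f \<oplus>\<^bsub>A\<^esub> h g" .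
  next
    fix r f assume r: "r \<in> carrier R" and f: "f \<in> carrier ?P"
    have sub: "support R (r \<odot>\<^bsub>?P\<^esub> f) \<subseteq> support R f"
      using r by (auto simp: support_def monoid_algebra_def)
    have "h (r \<odot>\<^bsub>?P\<^esub> f) = (\<Oplus>\<^bsub>A\<^esub>x\<in>support R f. (r \<odot>\<^bsub>?P\<^esub> f) x \<odot>\<^bsub>A\<^esub> \<phi> x)"
      by (rule h[OF P.M.smult_closed[OF r f] sup(1)[OF f] sub sup(2)[OF f]])
    also have "\<dots> = (\<Oplus>\<^bsub>A\<^esub>x\<in>support R f. r \<odot>\<^bsub>A\<^esub> (f x \<odot>\<^bsub>A\<^esub> \<phi> x))"
      by (rule A.finsum_cong')
        (use r cl[OF f] sup[OF f] \<phi>(1) in \<open>auto simp: monoid_algebra_def A.M.smult_assoc1 subset_iff\<close>)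
    also have "\<dots> = r \<odot>\<^bsub>A\<^esub> h f"
      unfolding h_def using r cl[OF f] sup[OF f] \<phi>(1)
      by (subst A.M.finsum_smult_ldistr) (auto simp: subset_iff)
    finally show "h (r \<odot>\<^bsub>?P\<^esub> f) = r \<odot>\<^bsub>A\<^esub> h f" .
  qed
  then show thesis using that hs by blast
qed

end

lemma alg_hom_finsum:
  assumes "k_alg k A" "k_alg k B" "h \<in> alg_hom k A B" "\<And>i. i \<in> I \<Longrightarrow> f i \<in> carrier A"
  shows "h (\<Oplus>\<^bsub>A\<^esub>i\<in>I. f i) = (\<Oplus>\<^bsub>B\<^esub>i\<in>I. h (f i))"
proof -
  interpret A: k_alg k A by fact
  interpret B: k_alg k B by fact
  show ?thesis using assms(4)
    by (induction I rule: infinite_finite_induct)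
      (simp_all add: alg_hom_zero[OF assms(1-3)] alg_homD[OF assms(3)] A.finsum_closed Pi_iff)
qed

section \<open>Central simple algebras\<close>

text \<open>Simplicity in the form in which it is proved and applied: a nonzero element forces the
  unit into the ideal.\<close>

lemma central_simple_algebra_iff:
  fixes A (structure)
  assumes "k_alg k A"
  shows "central_simple_algebra k A \<longleftrightarrow> finite_dim_algebra k A \<and>
     (\<forall>x\<in>carrier A. (\<forall>y\<in>carrier A. x \<otimes> y = y \<otimes> x) \<longrightarrow> (\<exists>r\<in>carrier k. x = r \<odot> \<one>)) \<and>
     \<one> \<noteq> \<zero> \<and> (\<forall>I. ideal I A \<longrightarrow> (\<forall>x\<in>I. x \<noteq> \<zero> \<longrightarrow> \<one> \<in> I))"
proof -
  interpret k_alg k A by fact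
  have "(I = {\<zero>} \<or> I = carrier A) \<longleftrightarrow> (\<forall>x\<in>I. x \<noteq> \<zero> \<longrightarrow> \<one> \<in> I)" if "ideal I A" for I
  proof -
    interpret ideal I A by fact
    show ?thesis using one_imp_carrier additive_subgroup.zero_closed[OF additive_subgroup_axioms] by auto
  qed
  then show ?thesis
    unfolding central_simple_algebra_def using carrier_one_not_zero by auto
qed

lemma csa_k_alg: "field k \<Longrightarrow> central_simple_algebra k A \<Longrightarrow> k_alg k A"
  by (simp add: k_alg_iff central_simple_algebra_def finite_dim_algebra_def)

lemma
  fixes A (structure)
  assumes "field k" "central_simple_algebra k A"
  shows csa_finite_dim: "finite_dim_algebra k A"
    and csa_center: "\<lbrakk>x \<in> carrier A; \<And>y. y \<in> carrier A \<Longrightarrow> x \<otimes> y = y \<otimes> x\<rbrakk> \<Longrightarrow>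
      \<exists>r\<in>carrier k. x = r \<odot> \<one>"
    and csa_one_not_zero: "\<one> \<noteq> \<zero>"
    and csa_ideal: "\<lbrakk>ideal I A; x \<in> I; x \<noteq> \<zero>\<rbrakk> \<Longrightarrow> \<one> \<in> I"
  using assms(2) unfolding central_simple_algebra_iff[OF csa_k_alg[OF assms]] by auto

text \<open>The kernel is an ideal. If it contained a nonzero element it would contain
  \<open>\<one>\<close>, which is mapped to the nonzero unit of \<open>B\<close>. This takes the
  place of all comparisons of dimensions.\<close>

lemma csa_hom_inj:
  fixes A (structure)
  assumes "central_simple_algebra k A" "k_alg k B" "h \<in> alg_hom k A B" "\<one>\<^bsub>B\<^esub> \<noteq> \<zero>\<^bsub>B\<^esub>"
  shows "inj_on h (carrier A)"
proof -
  interpret B: k_alg k B by fact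
  have A: "k_alg k A" using csa_k_alg B.field assms(1) by blast
  interpret h: ring_hom_ring A B h by (rule alg_hom_ring_hom_ring[OF A]) fact+
  have ker: "x \<in> a_kernel A B h \<longleftrightarrow> x \<in> carrier A \<and> h x = \<zero>\<^bsub>B\<^esub>" for x
    by (simp only: a_kernel_def' mem_Collect_eq)
  have "x = \<zero>" if "x \<in> a_kernel A B h" for x
  proof (rule ccontr)
    assume "x \<noteq> \<zero>"
    from csa_ideal[OF B.field assms(1) h.kernel_is_ideal that this]
    have "h \<one> = \<zero>\<^bsub>B\<^esub>" by (simp only: ker)
    then show False using assms(4) by (simp only: alg_homD(5)[OF assms(3)])
  qed
  moreover have "\<zero> \<in> a_kernel A B h" by (simp only: ker h.R.zero_closed alg_hom_zero[OF A assms(2,3)] simp_thms)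
  ultimately have "a_kernel A B h = {\<zero>}" by blast
  then show ?thesis by (rule h.trivial_ker_imp_inj)
qed

lemma csa_iso:
  fixes B (structure)
  assumes "central_simple_algebra k A" "k_alg k B" "alg_isomorphic k A B"
  shows "central_simple_algebra k B"
proof -
  interpret B: k_alg k B by fact
  have A: "k_alg k A" using csa_k_alg B.field assms(1) by blast
  interpret A: k_alg k A by fact
  obtain h where h: "h \<in> alg_hom k A B" "inj_on h (carrier A)" "h ` carrier A = carrier B"
    using assms(3) by (rule alg_isomorphicE)
  note hD = alg_homD[OF h(1)]
  interpret h: ring_hom_ring A B h by (rule alg_hom_ring_hom_ring[OF A]) fact+
  note csa = csa_finite_dim[OF B.field assms(1)] csa_center[OF B.field assms(1)]
    csa_one_not_zero[OF B.field assms(1)] csa_ideal[OF B.field assms(1)]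
  have ex: "\<exists>x'\<in>carrier A. x = h x'" if "x \<in> carrier B" for x using that h(3) by auto
  have 1: "finite_dim_algebra k B"
  proof -
    obtain S where S: "finite S" "S \<subseteq> carrier A" "carrier A \<subseteq> lin_span k A S"
      using csa(1) unfolding finite_dim_algebra_iff_lin_span[OF A] by blast
    have "x \<in> lin_span k B (h ` S)" if "x \<in> carrier B" for x
      using ex[OF that] lin_span_image[OF A assms(2) h(1) S(2)] S(3) by auto
    moreover have "h ` S \<subseteq> carrier B" using S(2) h(3) by auto
    ultimately show ?thesis unfolding finite_dim_algebra_iff_lin_span[OF assms(2)]
      using S(1) by (intro exI[of _ "h ` S"]) auto
  qed
  have 2: "\<exists>r\<in>carrier k. x = r \<odot> \<one>"
    if x: "x \<in> carrier B" "\<And>y. y \<in> carrier B \<Longrightarrow> x \<otimes> y = y \<otimes> x" for x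
  proof -
    obtain x' where x': "x' \<in> carrier A" "x = h x'" using ex x(1) by auto
    have "x' \<otimes>\<^bsub>A\<^esub> y = y \<otimes>\<^bsub>A\<^esub> x'" if "y \<in> carrier A" for y
      by (rule inj_onD[OF h(2)]) (use that x' x(2)[of "h y"] hD in auto)
    then obtain r where "r \<in> carrier k" "x' = r \<odot>\<^bsub>A\<^esub> \<one>\<^bsub>A\<^esub>" using csa(2)[OF x'(1)] by auto
    then show ?thesis using x' hD by auto
  qed
  have 3: "\<one> \<noteq> \<zero>"
  proof
    assume "\<one> = \<zero>"
    then have "h \<one>\<^bsub>A\<^esub> = h \<zero>\<^bsub>A\<^esub>" by simp
    then show False using inj_onD[OF h(2), of "\<one>\<^bsub>A\<^esub>" "\<zero>\<^bsub>A\<^esub>"] csa(3) by auto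
  qed
  have 4: "\<one> \<in> I" if I: "ideal I B" and x: "x \<in> I" "x \<noteq> \<zero>" for I x
  proof -
    have "x \<in> carrier B" using I x(1) by (meson ideal.Icarr)
    then obtain x' where "x' \<in> carrier A" "x = h x'" using ex by auto
    then have "x' \<in> {r \<in> carrier A. h r \<in> I}" "x' \<noteq> \<zero>\<^bsub>A\<^esub>" using x by auto
    then have "\<one>\<^bsub>A\<^esub> \<in> {r \<in> carrier A. h r \<in> I}" by (rule csa(4)[OF h.ideal_vimage[OF I]])
    then show ?thesis using hD(5) by simp
  qed
  show ?thesis unfolding central_simple_algebra_iff[OF assms(2)] using 1 2 3 4 by blast
qed

section \<open>Coordinatewise modules and matrix algebras\<close>

text \<open>For an index set of pairs this is \<open>a\<close> times a matrix unit; for the Galois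
  group as index set it is \<open>a\<close> times a basis element of the crossed product.\<close>

definition delta :: "('a, 'b, 's) module_scheme \<Rightarrow> 'i set \<Rightarrow> 'i \<Rightarrow> 'b \<Rightarrow> 'i \<Rightarrow> 'b" where
  "delta M I i a = (\<lambda>j\<in>I. if j = i then a else \<zero>\<^bsub>M\<^esub>)"

lemma (in module) M_zero_closed: "\<zero>\<^bsub>M\<^esub> \<in> carrier M" by (rule M.zero_closed)

text \<open>Matrix algebras and crossed products carry the same componentwise module structure and
  differ only in their multiplication; this locale treats the common part once.\<close>

locale fun_module = M: module k M
  for k :: "('a, 'r) ring_scheme" and M :: "('a, 'b, 's) module_scheme"
    and I :: "'i set" and V :: "('a, 'i \<Rightarrow> 'b, 't) module_scheme" +
  assumes carrier: "carrier V = I \<rightarrow>\<^sub>E carrier M"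
    and add: "\<And>x y. x \<oplus>\<^bsub>V\<^esub> y = (\<lambda>i\<in>I. x i \<oplus>\<^bsub>M\<^esub> y i)"
    and zero: "\<zero>\<^bsub>V\<^esub> = (\<lambda>i\<in>I. \<zero>\<^bsub>M\<^esub>)"
    and smult: "\<And>r x. r \<odot>\<^bsub>V\<^esub> x = (\<lambda>i\<in>I. r \<odot>\<^bsub>M\<^esub> x i)"
begin

lemma mem: "x \<in> carrier V \<Longrightarrow> i \<in> I \<Longrightarrow> x i \<in> carrier M"
  by (auto simp: carrier)

lemma eqI: "x \<in> carrier V \<Longrightarrow> y \<in> carrier V \<Longrightarrow> (\<And>i. i \<in> I \<Longrightarrow> x i = y i) \<Longrightarrow> x = y"
  unfolding carrier by (rule PiE_ext)

lemma at:
  "i \<in> I \<Longrightarrow> (x \<oplus>\<^bsub>V\<^esub> y) i = x i \<oplus>\<^bsub>M\<^esub> y i" "i \<in> I \<Longrightarrow> \<zero>\<^bsub>V\<^esub> i = \<zero>\<^bsub>M\<^esub>"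
  "i \<in> I \<Longrightarrow> (r \<odot>\<^bsub>V\<^esub> x) i = r \<odot>\<^bsub>M\<^esub> x i" "i \<in> I \<Longrightarrow> delta M I j a i = (if i = j then a else \<zero>\<^bsub>M\<^esub>)"
  by (auto simp: add zero smult delta_def)

lemma V_module: "module k V"
proof -
  have cl: "(\<lambda>i\<in>I. f i) \<in> carrier V" if "\<And>i. i \<in> I \<Longrightarrow> f i \<in> carrier M" for f
    using that by (auto simp: carrier)
  have a: "x \<oplus>\<^bsub>V\<^esub> y \<in> carrier V" if "x \<in> carrier V" "y \<in> carrier V" for x y
    unfolding add by (rule cl) (use mem that in auto)
  have z: "\<zero>\<^bsub>V\<^esub> \<in> carrier V" unfolding zero by (rule cl) auto
  have s: "r \<odot>\<^bsub>V\<^esub> x \<in> carrier V" if "r \<in> carrier k" "x \<in> carrier V" for r x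
    unfolding smult by (rule cl) (use mem that in auto)
  show ?thesis
  proof (rule moduleI)
    show "abelian_group V"
    proof (rule abelian_groupI)
      fix x y t assume x: "x \<in> carrier V" and y: "y \<in> carrier V"
      show "x \<oplus>\<^bsub>V\<^esub> y = y \<oplus>\<^bsub>V\<^esub> x"
        by (rule eqI) (use x y mem a in \<open>auto simp: at M.M.a_comm\<close>)
      show "x \<oplus>\<^bsub>V\<^esub> y \<oplus>\<^bsub>V\<^esub> t = x \<oplus>\<^bsub>V\<^esub> (y \<oplus>\<^bsub>V\<^esub> t)" if t: "t \<in> carrier V"
        by (rule eqI) (use x y t mem a in \<open>auto simp: at M.M.a_assoc\<close>)
    next
      fix x assume x: "x \<in> carrier V"
      show "\<zero>\<^bsub>V\<^esub> \<oplus>\<^bsub>V\<^esub> x = x"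
        by (rule eqI) (use x mem a z in \<open>auto simp: at\<close>)
      have "(\<lambda>i\<in>I. \<ominus>\<^bsub>M\<^esub> x i) \<oplus>\<^bsub>V\<^esub> x = \<zero>\<^bsub>V\<^esub>"
        by (rule eqI) (use x mem a z cl[of "\<lambda>i. \<ominus>\<^bsub>M\<^esub> x i"] in \<open>auto simp: at M.M.l_neg\<close>)
      then show "\<exists>y\<in>carrier V. y \<oplus>\<^bsub>V\<^esub> x = \<zero>\<^bsub>V\<^esub>"
        using cl[of "\<lambda>i. \<ominus>\<^bsub>M\<^esub> x i"] x mem by auto
    qed (use a z in auto)
  next
    fix r t x assume *: "r \<in> carrier k" "t \<in> carrier k" "x \<in> carrier V"
    show "(r \<oplus>\<^bsub>k\<^esub> t) \<odot>\<^bsub>V\<^esub> x = r \<odot>\<^bsub>V\<^esub> x \<oplus>\<^bsub>V\<^esub> t \<odot>\<^bsub>V\<^esub> x"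
      by (rule eqI) (use * mem a s in \<open>auto simp: at M.smult_l_distr\<close>)
    show "(r \<otimes>\<^bsub>k\<^esub> t) \<odot>\<^bsub>V\<^esub> x = r \<odot>\<^bsub>V\<^esub> (t \<odot>\<^bsub>V\<^esub> x)"
      by (rule eqI) (use * mem a s in \<open>auto simp: at M.smult_assoc1\<close>)
  next
    fix r x y assume *: "r \<in> carrier k" "x \<in> carrier V" "y \<in> carrier V"
    show "r \<odot>\<^bsub>V\<^esub> (x \<oplus>\<^bsub>V\<^esub> y) = r \<odot>\<^bsub>V\<^esub> x \<oplus>\<^bsub>V\<^esub> r \<odot>\<^bsub>V\<^esub> y"
      by (rule eqI) (use * mem a s in \<open>auto simp: at M.smult_r_distr\<close>)
  next
    fix x assume x: "x \<in> carrier V"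
    show "\<one>\<^bsub>k\<^esub> \<odot>\<^bsub>V\<^esub> x = x"
      by (rule eqI) (use x mem s in \<open>auto simp: at\<close>)
  qed (use s M.is_cring in auto)
qed

lemma delta_closed: "a \<in> carrier M \<Longrightarrow> delta M I i a \<in> carrier V"
  by (auto simp: carrier delta_def)

lemma V_span:
  assumes "finite I"
  shows "carrier V \<subseteq> lin_span k V {delta M I i a | i a. i \<in> I \<and> a \<in> carrier M}" (is "_ \<subseteq> lin_span k V ?S")
proof
  interpret V: module k V by (rule V_module)
  have S: "?S \<subseteq> carrier V" using delta_closed by auto
  \<comment> \<open>Induction on a finite set \<open>J\<close> outside which \<open>x\<close>
    vanishes; each step splits off one component.\<close>
  have "x \<in> lin_span k V ?S" if "finite J" "J \<subseteq> I" "x \<in> carrier V" "\<And>i. i \<in> I - J \<Longrightarrow> x i = \<zero>\<^bsub>M\<^esub>" for x J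
    using that
  proof (induction J arbitrary: x)
    case empty
    then have "x = \<zero>\<^bsub>V\<^esub>" by (intro eqI) (auto simp: at V.M.zero_closed)
    then show ?case by (simp add: lin_span.zero)
  next
    case (insert j J)
    define y where "y = (\<lambda>i\<in>I. if i = j then \<zero>\<^bsub>M\<^esub> else x i)"
    have y: "y \<in> carrier V" using mem[OF insert.prems(2)] by (auto simp: y_def carrier)
    have y0: "y i = \<zero>\<^bsub>M\<^esub>" if "i \<in> I - J" for i
      using that insert.prems(3)[of i] by (auto simp: y_def)
    have "y \<in> lin_span k V ?S"
      by (rule insert.IH[OF _ y]) (use insert.prems y0 in auto)
    moreover have "delta M I j (x j) \<in> ?S" using insert.prems(1) mem[OF insert.prems(2)] by blast
    ultimately have "delta M I j (x j) \<oplus>\<^bsub>V\<^esub> y \<in> lin_span k V ?S"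
      using V.lin_span_add[OF S] V.lin_span_base[OF S] by blast
    moreover have "delta M I j (x j) \<oplus>\<^bsub>V\<^esub> y = x"
      by (rule eqI) (use insert y mem delta_closed[of "x j" j] in \<open>auto simp: at y_def\<close>)
    ultimately show ?case by simp
  qed
  from this[OF assms order_refl] show "x \<in> lin_span k V ?S" if "x \<in> carrier V" for x using that by simp
qed

end

text \<open>Rows and columns may be indexed by any set, so that iterated matrix algebras and tensor
  products of matrix algebras are indexed by products of sets and no numbering of pairs is
  required.\<close>

definition mat :: "'i set \<Rightarrow> ('a, 'b, 's) module_scheme \<Rightarrow> ('a, 'i \<times> 'i \<Rightarrow> 'b) module" where
  "mat I A =
     \<lparr>carrier = I \<times> I \<rightarrow>\<^sub>E carrier A,
      monoid.mult = (\<lambda>x y. restrict (\<lambda>(i, j). \<Oplus>\<^bsub>A\<^esub>l\<in>I. x (i, l) \<otimes>\<^bsub>A\<^esub> y (l, j)) (I \<times> I)),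
      one = restrict (\<lambda>(i, j). if i = j then \<one>\<^bsub>A\<^esub> else \<zero>\<^bsub>A\<^esub>) (I \<times> I),
      ring.zero = (\<lambda>ij\<in>I \<times> I. \<zero>\<^bsub>A\<^esub>),
      add = (\<lambda>x y. \<lambda>ij\<in>I \<times> I. x ij \<oplus>\<^bsub>A\<^esub> y ij),
      smult = (\<lambda>r x. \<lambda>ij\<in>I \<times> I. r \<odot>\<^bsub>A\<^esub> x ij)\<rparr>"

lemma matrix_algebra_eq_mat: "matrix_algebra n A = mat {..<n} A"
  by (simp add: matrix_algebra_def mat_def)

lemma mat_mult: "i \<in> I \<Longrightarrow> j \<in> I \<Longrightarrow> (x \<otimes>\<^bsub>mat I A\<^esub> y) (i, j) = (\<Oplus>\<^bsub>A\<^esub>l\<in>I. x (i, l) \<otimes>\<^bsub>A\<^esub> y (l, j))"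
  by (simp add: mat_def)

lemma mat_one: "i \<in> I \<Longrightarrow> j \<in> I \<Longrightarrow> \<one>\<^bsub>mat I A\<^esub> (i, j) = (if i = j then \<one>\<^bsub>A\<^esub> else \<zero>\<^bsub>A\<^esub>)"
  by (simp add: mat_def)

lemma mat_fun_module: "module k A \<Longrightarrow> fun_module k A (I \<times> I) (mat I A)"
  unfolding fun_module_def fun_module_axioms_def by (simp add: mat_def)

locale mat_alg = k_alg k A for k :: "('a, 'r) ring_scheme" and A :: "('a, 'b, 's) module_scheme" (structure) +
  fixes I :: "'i set"
  assumes fin: "finite I"
begin

sublocale F: fun_module k A "I \<times> I" "mat I A"
  by (rule mat_fun_module) unfold_locales

lemma mat_entry: "x \<in> carrier (mat I A) \<Longrightarrow> i \<in> I \<Longrightarrow> j \<in> I \<Longrightarrow> x (i, j) \<in> carrier A"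
  using F.mem by blast

lemma mat_eqI:
  assumes "x \<in> carrier (mat I A)" "y \<in> carrier (mat I A)"
    "\<And>i j. i \<in> I \<Longrightarrow> j \<in> I \<Longrightarrow> x (i, j) = y (i, j)"
  shows "x = y"
  by (rule F.eqI) (use assms in auto)

lemma mat_mult_closed: "x \<in> carrier (mat I A) \<Longrightarrow> y \<in> carrier (mat I A) \<Longrightarrow> x \<otimes>\<^bsub>mat I A\<^esub> y \<in> carrier (mat I A)"
  unfolding mat_def by (auto intro!: finsum_closed m_closed simp: PiE_iff)

lemma delta_mult:
  assumes x: "x \<in> carrier (mat I A)" and a: "a \<in> carrier A" and ij: "i \<in> I" "j \<in> I" and rs: "r \<in> I" "s \<in> I"
  shows "(delta A (I \<times> I) (i, j) a \<otimes>\<^bsub>mat I A\<^esub> x) (r, s) = (if r = i then a \<otimes> x (j, s) else \<zero>)"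
    "(x \<otimes>\<^bsub>mat I A\<^esub> delta A (I \<times> I) (i, j) a) (r, s) = (if s = j then x (r, i) \<otimes> a else \<zero>)"
proof -
  have "(\<Oplus>l\<in>I. delta A (I \<times> I) (i, j) a (r, l) \<otimes> x (l, s)) =
      (\<Oplus>l\<in>I. if j = l then (if r = i then a \<otimes> x (l, s) else \<zero>) else \<zero>)"
    by (rule finsum_cong') (use assms mat_entry[OF x] in \<open>auto simp: delta_def\<close>)
  also have "\<dots> = (if r = i then a \<otimes> x (j, s) else \<zero>)"
    by (rule add.finprod_singleton) (use assms fin mat_entry[OF x] in auto)
  finally show "(delta A (I \<times> I) (i, j) a \<otimes>\<^bsub>mat I A\<^esub> x) (r, s) = (if r = i then a \<otimes> x (j, s) else \<zero>)"
    using rs by (simp add: mat_mult)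
  have "(\<Oplus>l\<in>I. x (r, l) \<otimes> delta A (I \<times> I) (i, j) a (l, s)) =
      (\<Oplus>l\<in>I. if i = l then (if s = j then x (r, l) \<otimes> a else \<zero>) else \<zero>)"
    by (rule finsum_cong') (use assms mat_entry[OF x] in \<open>auto simp: delta_def\<close>)
  also have "\<dots> = (if s = j then x (r, i) \<otimes> a else \<zero>)"
    by (rule add.finprod_singleton) (use assms fin mat_entry[OF x] in auto)
  finally show "(x \<otimes>\<^bsub>mat I A\<^esub> delta A (I \<times> I) (i, j) a) (r, s) = (if s = j then x (r, i) \<otimes> a else \<zero>)"
    using rs by (simp add: mat_mult)
qed

lemma delta_mult_delta:
  assumes "a \<in> carrier A" "b \<in> carrier A" "i \<in> I" "j \<in> I" "r \<in> I" "s \<in> I"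
  shows "delta A (I \<times> I) (i, j) a \<otimes>\<^bsub>mat I A\<^esub> delta A (I \<times> I) (r, s) b =
    (if j = r then delta A (I \<times> I) (i, s) (a \<otimes> b) else \<zero>\<^bsub>mat I A\<^esub>)"
  by (rule mat_eqI)
    (use assms F.delta_closed mat_mult_closed module.M_zero_closed[OF F.V_module]
      in \<open>auto simp: delta_mult F.at\<close>)

lemma delta_zero: "delta A (I \<times> I) ij \<zero> = \<zero>\<^bsub>mat I A\<^esub>"
  by (auto simp: F.zero delta_def)

lemma mat_span:
  "carrier (mat I A) \<subseteq> lin_span k (mat I A) {delta A (I \<times> I) (i, j) a | i j a. i \<in> I \<and> j \<in> I \<and> a \<in> carrier A}"
proof -
  have "{delta A (I \<times> I) ij a | ij a. ij \<in> I \<times> I \<and> a \<in> carrier A} =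
     {delta A (I \<times> I) (i, j) a | i j a. i \<in> I \<and> j \<in> I \<and> a \<in> carrier A}" by auto
  then show ?thesis using F.V_span fin by simp
qed

lemma mat_k_alg: "k_alg k (mat I A)"
proof (rule k_algI_span[OF field F.V_module])
  interpret V: module k "mat I A" by (rule F.V_module)
  show one: "\<one>\<^bsub>mat I A\<^esub> \<in> carrier (mat I A)" by (auto simp: mat_def)
  let ?S = "{delta A (I \<times> I) (i, j) a | i j a. i \<in> I \<and> j \<in> I \<and> a \<in> carrier A}"
  show "?S \<subseteq> carrier (mat I A)" using F.delta_closed by auto
  show "x \<otimes>\<^bsub>mat I A\<^esub> y \<otimes>\<^bsub>mat I A\<^esub> z = x \<otimes>\<^bsub>mat I A\<^esub> (y \<otimes>\<^bsub>mat I A\<^esub> z)" if "x \<in> ?S" "y \<in> ?S" "z \<in> ?S" for x y z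
  proof -
    obtain i j a where x: "x = delta A (I \<times> I) (i, j) a" "i \<in> I" "j \<in> I" "a \<in> carrier A"
      using \<open>x \<in> ?S\<close> by blast
    obtain i' j' a' where y: "y = delta A (I \<times> I) (i', j') a'" "i' \<in> I" "j' \<in> I" "a' \<in> carrier A"
      using \<open>y \<in> ?S\<close> by blast
    obtain i'' j'' a'' where z: "z = delta A (I \<times> I) (i'', j'') a''" "i'' \<in> I" "j'' \<in> I" "a'' \<in> carrier A"
      using \<open>z \<in> ?S\<close> by blast
    note * = x y z
    have "\<zero>\<^bsub>mat I A\<^esub> \<otimes>\<^bsub>mat I A\<^esub> z = \<zero>\<^bsub>mat I A\<^esub>" "x \<otimes>\<^bsub>mat I A\<^esub> \<zero>\<^bsub>mat I A\<^esub> = \<zero>\<^bsub>mat I A\<^esub>"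
      using x y z delta_mult_delta[of \<open>\<zero>\<close> a'' i j' i'' j''] delta_mult_delta[of a \<open>\<zero>\<close> i j i' j'']
      by (auto simp: delta_zero)
    then show ?thesis using * by (auto simp: delta_mult_delta m_assoc)
  qed
  fix x y z assume x: "x \<in> carrier (mat I A)" and y: "y \<in> carrier (mat I A)" 
  note e = mat_entry[OF x] mat_entry[OF y]
  show "x \<otimes>\<^bsub>mat I A\<^esub> y \<in> carrier (mat I A)" using x y by (rule mat_mult_closed)
  show "(x \<oplus>\<^bsub>mat I A\<^esub> y) \<otimes>\<^bsub>mat I A\<^esub> z = x \<otimes>\<^bsub>mat I A\<^esub> z \<oplus>\<^bsub>mat I A\<^esub> y \<otimes>\<^bsub>mat I A\<^esub> z" if z: "z \<in> carrier (mat I A)"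
  proof (rule mat_eqI)
    fix i j assume ij: "i \<in> I" "j \<in> I"
    have "((x \<oplus>\<^bsub>mat I A\<^esub> y) \<otimes>\<^bsub>mat I A\<^esub> z) (i, j) = (\<Oplus>l\<in>I. x (i, l) \<otimes> z (l, j) \<oplus> y (i, l) \<otimes> z (l, j))"
      unfolding mat_mult[OF ij]
      by (rule finsum_cong') (use ij e mat_entry[OF z] in \<open>auto simp: F.at l_distr\<close>)
    also have "\<dots> = (\<Oplus>l\<in>I. x (i, l) \<otimes> z (l, j)) \<oplus> (\<Oplus>l\<in>I. y (i, l) \<otimes> z (l, j))"
      by (rule finsum_addf) (use ij e mat_entry[OF z] in auto)
    finally show "((x \<oplus>\<^bsub>mat I A\<^esub> y) \<otimes>\<^bsub>mat I A\<^esub> z) (i, j) = (x \<otimes>\<^bsub>mat I A\<^esub> z \<oplus>\<^bsub>mat I A\<^esub> y \<otimes>\<^bsub>mat I A\<^esub> z) (i, j)"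
      using ij by (simp add: F.add mat_mult)
  qed (use x y z mat_mult_closed in auto)
  show "z \<otimes>\<^bsub>mat I A\<^esub> (x \<oplus>\<^bsub>mat I A\<^esub> y) = z \<otimes>\<^bsub>mat I A\<^esub> x \<oplus>\<^bsub>mat I A\<^esub> z \<otimes>\<^bsub>mat I A\<^esub> y" if z: "z \<in> carrier (mat I A)"
  proof (rule mat_eqI)
    fix i j assume ij: "i \<in> I" "j \<in> I"
    have "(z \<otimes>\<^bsub>mat I A\<^esub> (x \<oplus>\<^bsub>mat I A\<^esub> y)) (i, j) = (\<Oplus>l\<in>I. z (i, l) \<otimes> x (l, j) \<oplus> z (i, l) \<otimes> y (l, j))"
      unfolding mat_mult[OF ij]
      by (rule finsum_cong') (use ij e mat_entry[OF z] in \<open>auto simp: F.at r_distr\<close>)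
    also have "\<dots> = (\<Oplus>l\<in>I. z (i, l) \<otimes> x (l, j)) \<oplus> (\<Oplus>l\<in>I. z (i, l) \<otimes> y (l, j))"
      by (rule finsum_addf) (use ij e mat_entry[OF z] in auto)
    finally show "(z \<otimes>\<^bsub>mat I A\<^esub> (x \<oplus>\<^bsub>mat I A\<^esub> y)) (i, j) = (z \<otimes>\<^bsub>mat I A\<^esub> x \<oplus>\<^bsub>mat I A\<^esub> z \<otimes>\<^bsub>mat I A\<^esub> y) (i, j)"
      using ij by (simp add: F.add mat_mult)
  qed (use x y z mat_mult_closed in auto)
next
  interpret V: module k "mat I A" by (rule F.V_module)
  fix r x y assume r: "r \<in> carrier k" and x: "x \<in> carrier (mat I A)" and y: "y \<in> carrier (mat I A)"
  note e = mat_entry[OF x] mat_entry[OF y]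
  show "(r \<odot>\<^bsub>mat I A\<^esub> x) \<otimes>\<^bsub>mat I A\<^esub> y = r \<odot>\<^bsub>mat I A\<^esub> (x \<otimes>\<^bsub>mat I A\<^esub> y)"
  proof (rule mat_eqI)
    fix i j assume ij: "i \<in> I" "j \<in> I"
    have "((r \<odot>\<^bsub>mat I A\<^esub> x) \<otimes>\<^bsub>mat I A\<^esub> y) (i, j) = (\<Oplus>l\<in>I. r \<odot> (x (i, l) \<otimes> y (l, j)))"
      unfolding mat_mult[OF ij]
      by (rule finsum_cong') (use r ij e in \<open>auto simp: F.at smult_mult_l\<close>)
    also have "\<dots> = r \<odot> (\<Oplus>l\<in>I. x (i, l) \<otimes> y (l, j))"
      by (rule M.finsum_smult_ldistr[symmetric]) (use r ij e fin in auto)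
    finally show "((r \<odot>\<^bsub>mat I A\<^esub> x) \<otimes>\<^bsub>mat I A\<^esub> y) (i, j) = (r \<odot>\<^bsub>mat I A\<^esub> (x \<otimes>\<^bsub>mat I A\<^esub> y)) (i, j)"
      using ij by (simp add: F.smult mat_mult)
  qed (use r x y mat_mult_closed in auto)
  show "x \<otimes>\<^bsub>mat I A\<^esub> (r \<odot>\<^bsub>mat I A\<^esub> y) = r \<odot>\<^bsub>mat I A\<^esub> (x \<otimes>\<^bsub>mat I A\<^esub> y)"
  proof (rule mat_eqI)
    fix i j assume ij: "i \<in> I" "j \<in> I"
    have "(x \<otimes>\<^bsub>mat I A\<^esub> (r \<odot>\<^bsub>mat I A\<^esub> y)) (i, j) = (\<Oplus>l\<in>I. r \<odot> (x (i, l) \<otimes> y (l, j)))"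
      unfolding mat_mult[OF ij]
      by (rule finsum_cong') (use r ij e in \<open>auto simp: F.at smult_mult_r\<close>)
    also have "\<dots> = r \<odot> (\<Oplus>l\<in>I. x (i, l) \<otimes> y (l, j))"
      by (rule M.finsum_smult_ldistr[symmetric]) (use r ij e fin in auto)
    finally show "(x \<otimes>\<^bsub>mat I A\<^esub> (r \<odot>\<^bsub>mat I A\<^esub> y)) (i, j) = (r \<odot>\<^bsub>mat I A\<^esub> (x \<otimes>\<^bsub>mat I A\<^esub> y)) (i, j)"
      using ij by (simp add: F.smult mat_mult)
  qed (use r x y mat_mult_closed in auto)
next
  let ?S = "{delta A (I \<times> I) (i, j) a | i j a. i \<in> I \<and> j \<in> I \<and> a \<in> carrier A}"
  show "carrier (mat I A) \<subseteq> lin_span k (mat I A) ?S" by (rule mat_span)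
  have one: "\<one>\<^bsub>mat I A\<^esub> \<in> carrier (mat I A)" by (auto simp: mat_def)
  fix x assume "x \<in> ?S"
  then obtain i j a where x: "x = delta A (I \<times> I) (i, j) a" "i \<in> I" "j \<in> I" "a \<in> carrier A" by auto
  show "\<one>\<^bsub>mat I A\<^esub> \<otimes>\<^bsub>mat I A\<^esub> x = x" "x \<otimes>\<^bsub>mat I A\<^esub> \<one>\<^bsub>mat I A\<^esub> = x"
    using x one F.delta_closed mat_mult_closed
    by (auto intro!: mat_eqI simp: delta_mult mat_one F.at)
qed

sublocale mat: k_alg k "mat I A" by (rule mat_k_alg)

lemma mat_eq_zeroD:
  assumes "x \<in> carrier (mat I A)" "x \<noteq> \<zero>\<^bsub>mat I A\<^esub>"
  shows "\<exists>i\<in>I. \<exists>j\<in>I. x (i, j) \<noteq> \<zero>"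
  using mat_eqI[OF assms(1) mat.zero_closed] assms(2) by (force simp: F.at)

text \<open>Isolates the entry at \<open>(j, r)\<close>. This moves a nonzero entry of a matrix in
  an ideal to a chosen corner, and it cuts single matrix units out of powers of the shift
  matrix.\<close>

lemma delta_sandwich:
  assumes "x \<in> carrier (mat I A)" "a \<in> carrier A" "b \<in> carrier A" "i \<in> I" "j \<in> I" "r \<in> I" "s \<in> I"
  shows "delta A (I \<times> I) (i, j) a \<otimes>\<^bsub>mat I A\<^esub> x \<otimes>\<^bsub>mat I A\<^esub> delta A (I \<times> I) (r, s) b =
    delta A (I \<times> I) (i, s) (a \<otimes> x (j, r) \<otimes> b)"
  by (rule mat_eqI)
    (use assms F.delta_closed mat_entry in \<open>auto simp: delta_mult F.at\<close>)

lemma delta_add: "a \<in> carrier A \<Longrightarrow> b \<in> carrier A \<Longrightarrow>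
    delta A (I \<times> I) ij (a \<oplus> b) = delta A (I \<times> I) ij a \<oplus>\<^bsub>mat I A\<^esub> delta A (I \<times> I) ij b"
  by (auto simp: F.add delta_def)

lemma delta_smult: "r \<in> carrier k \<Longrightarrow>
    delta A (I \<times> I) ij (r \<odot> a) = r \<odot>\<^bsub>mat I A\<^esub> delta A (I \<times> I) ij a"
  by (auto simp: F.smult delta_def)

lemma mat_finite_dim:
  assumes "finite_dim_algebra k A" shows "finite_dim_algebra k (mat I A)"
proof -
  obtain S where S: "finite S" "S \<subseteq> carrier A" "carrier A \<subseteq> lin_span k A S"
    using assms unfolding finite_dim_algebra_iff_lin_span[OF k_alg_axioms] by blast
  let ?T = "(\<lambda>(ij, s). delta A (I \<times> I) ij s) ` ((I \<times> I) \<times> S)"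
  have T: "finite ?T" "?T \<subseteq> carrier (mat I A)" using S fin F.delta_closed by auto
  have "delta A (I \<times> I) (i, j) a \<in> lin_span k (mat I A) ?T" if ij: "i \<in> I" "j \<in> I" and a: "a \<in> lin_span k A S" for i j a
    using a S(2)
  proof (induction rule: M.lin_span_induct)
    case (base s)
    then show ?case using ij by (intro mat.M.lin_span_base[OF T(2)]) force
  qed (auto simp: delta_zero delta_add delta_smult intro: lin_span.zero mat.M.lin_span_add[OF T(2)] mat.M.lin_span_smult[OF T(2)])
  then have *: "x \<in> lin_span k (mat I A) ?T"
    if "x \<in> {delta A (I \<times> I) (i, j) a | i j a. i \<in> I \<and> j \<in> I \<and> a \<in> carrier A}" for x
    using that S(3) by auto
  have "carrier (mat I A) \<subseteq> lin_span k (mat I A) ?T"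
    by (rule subsetI, rule mat.M.lin_span_mono[OF T(2) * subsetD[OF mat_span]])
  then show ?thesis unfolding finite_dim_algebra_iff_lin_span[OF mat_k_alg] using T by blast
qed

text \<open>An ideal of matrices is governed by the ideal of \<open>A\<close> formed by the entries
  it has in one fixed corner \<open>o'\<close>; a central matrix is a scalar matrix whose diagonal
  entry is central in \<open>A\<close>.\<close>

lemma mat_csa:
  assumes csa: "central_simple_algebra k A" and "I \<noteq> {}"
  shows "central_simple_algebra k (mat I A)"
proof -
  obtain o' where o: "o' \<in> I" using assms(2) by auto
  have 1: "finite_dim_algebra k (mat I A)" by (rule mat_finite_dim[OF csa_finite_dim[OF field csa]])
  have 2: "\<exists>r\<in>carrier k. x = r \<odot>\<^bsub>mat I A\<^esub> \<one>\<^bsub>mat I A\<^esub>"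
    if x: "x \<in> carrier (mat I A)" and c: "\<And>y. y \<in> carrier (mat I A) \<Longrightarrow> x \<otimes>\<^bsub>mat I A\<^esub> y = y \<otimes>\<^bsub>mat I A\<^esub> x" for x
  proof -
    \<comment> \<open>Commutation with the matrix unit at \<open>(i, j)\<close>, read entrywise.
      Suitable choices of indices make the off-diagonal entries zero, the diagonal entries equal,
      and the entry at \<open>o'\<close> central.\<close>
    have c': "(if s = j then x (r, i) \<otimes> a else \<zero>) = (if r = i then a \<otimes> x (j, s) else \<zero>)"
      if "i \<in> I" "j \<in> I" "a \<in> carrier A" "r \<in> I" "s \<in> I" for i j a r s
      using c[OF F.delta_closed[OF that(3)], of "(i, j)"]
      unfolding delta_mult(1)[OF x that(3,1,2,4,5), symmetric] delta_mult(2)[OF x that(3,1,2,4,5), symmetric] by simp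
    have "x (o', o') \<otimes> a = a \<otimes> x (o', o')" if "a \<in> carrier A" for a
      using c'[OF o o that o o] by simp
    then obtain t where t: "t \<in> carrier k" "x (o', o') = t \<odot> \<one>"
      using csa_center[OF field csa mat_entry[OF x o o]] by auto
    have "x (r, s) = (if r = s then t \<odot> \<one> else \<zero>)" if rs: "r \<in> I" "s \<in> I" for r s
    proof (cases "r = s")
      case True
      then show ?thesis using c'[OF o rs(2) one_closed o rs(2)] t mat_entry[OF x] o rs by simp
    next
      case False
      then show ?thesis using c'[OF rs(2) rs(2) one_closed rs] mat_entry[OF x] rs by simp
    qed
    then have "x = t \<odot>\<^bsub>mat I A\<^esub> \<one>\<^bsub>mat I A\<^esub>"
      using x t by (intro mat_eqI) (auto simp: F.at mat_one)
    then show ?thesis using t by blast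
  qed
  have 3: "\<one>\<^bsub>mat I A\<^esub> \<noteq> \<zero>\<^bsub>mat I A\<^esub>"
  proof
    assume "\<one>\<^bsub>mat I A\<^esub> = \<zero>\<^bsub>mat I A\<^esub>"
    then have "\<one>\<^bsub>mat I A\<^esub> (o', o') = \<zero>\<^bsub>mat I A\<^esub> (o', o')" by simp
    then show False using csa_one_not_zero[OF field csa] o by (simp add: mat_one F.at)
  qed
  have 4: "\<one>\<^bsub>mat I A\<^esub> \<in> J" if J: "ideal J (mat I A)" and x: "x \<in> J" "x \<noteq> \<zero>\<^bsub>mat I A\<^esub>" for J x
  proof -
    interpret J: ideal J "mat I A" by fact
    have xc: "x \<in> carrier (mat I A)" using x J.Icarr by auto
    obtain i j where ij: "i \<in> I" "j \<in> I" "x (i, j) \<noteq> \<zero>" using mat_eq_zeroD[OF xc x(2)] by auto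
    let ?D = "\<lambda>r s a. delta A (I \<times> I) (r, s) a"
    \<comment> \<open>The elements of \<open>A\<close> that, placed in the corner, give a matrix of
      \<open>J\<close>.\<close>
    let ?J = "{a \<in> carrier A. ?D o' o' a \<in> J}"
    have "ideal ?J A"
    proof (rule idealI)
      show "subgroup ?J (add_monoid A)"
      proof (rule add.subgroupI)
        show "?J \<noteq> {}" using delta_zero J.zero_closed by (auto intro!: exI[of _ "\<zero>"])
        show "a \<oplus> b \<in> ?J" if "a \<in> ?J" "b \<in> ?J" for a b
          using that by (auto simp: delta_add)
        fix a assume a: "a \<in> ?J"
        have "?D o' o' (\<ominus> a) = ?D o' o' (\<ominus> \<one>) \<otimes>\<^bsub>mat I A\<^esub> ?D o' o' a"
          using a o by (subst delta_mult_delta) (auto simp: l_minus)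
        also have "\<dots> \<in> J" using a F.delta_closed by (intro J.I_l_closed) auto
        finally show "\<ominus> a \<in> ?J" using a by simp
      qed auto
      fix a b assume a: "a \<in> ?J" and b: "b \<in> carrier A"
      have "?D o' o' (b \<otimes> a) = ?D o' o' b \<otimes>\<^bsub>mat I A\<^esub> ?D o' o' a" using a b o by (simp add: delta_mult_delta)
      then show "b \<otimes> a \<in> ?J" using a b F.delta_closed by (auto intro: J.I_l_closed)
      have "?D o' o' (a \<otimes> b) = ?D o' o' a \<otimes>\<^bsub>mat I A\<^esub> ?D o' o' b" using a b o by (simp add: delta_mult_delta)
      then show "a \<otimes> b \<in> ?J" using a b F.delta_closed by (auto intro: J.I_r_closed)
    qed unfold_locales
    moreover have "x (i, j) \<in> ?J"
    proof -
      have "?D o' i \<one> \<otimes>\<^bsub>mat I A\<^esub> x \<otimes>\<^bsub>mat I A\<^esub> ?D j o' \<one> = ?D o' o' (x (i, j))"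
        using xc ij o mat_entry[OF xc] by (subst delta_sandwich) auto
      moreover have "?D o' i \<one> \<otimes>\<^bsub>mat I A\<^esub> x \<otimes>\<^bsub>mat I A\<^esub> ?D j o' \<one> \<in> J"
        using x F.delta_closed by (intro J.I_r_closed J.I_l_closed) auto
      ultimately show ?thesis using mat_entry[OF xc] ij by simp
    qed
    ultimately have "\<one> \<in> ?J" using ij(3) by (rule csa_ideal[OF field csa])
    then have "?D o' o' \<one> \<in> J" by simp
    then have all: "?D r s a \<in> J" if "r \<in> I" "s \<in> I" "a \<in> carrier A" for r s a
    proof -
      have "?D r o' a \<otimes>\<^bsub>mat I A\<^esub> ?D o' o' \<one> \<otimes>\<^bsub>mat I A\<^esub> ?D o' s \<one> \<in> J"
        using \<open>?D o' o' \<one> \<in> J\<close> F.delta_closed that by (intro J.I_r_closed J.I_l_closed) auto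
      then show ?thesis using that o by (simp add: delta_mult_delta)
    qed
    have "x \<in> J" if "x \<in> lin_span k (mat I A) {?D i j a | i j a. i \<in> I \<and> j \<in> I \<and> a \<in> carrier A}" for x
      using that
    proof induction
      case (step r s x)
      then show ?case using all by (auto simp: delta_smult[symmetric])
    qed simp
    then show ?thesis using mat_span mat.one_closed by blast
  qed
  show ?thesis unfolding central_simple_algebra_iff[OF mat_k_alg] using 1 2 3 4 by blast
qed

end

lemma mat_map_hom:
  fixes B (structure)
  assumes "k_alg k A" "k_alg k B" "h \<in> alg_hom k A B" "finite I"
  shows "(\<lambda>x. \<lambda>ij\<in>I \<times> I. h (x ij)) \<in> alg_hom k (mat I A) (mat I B)"
proof -
  interpret A: mat_alg k A I using assms by (simp add: mat_alg_def mat_alg_axioms_def)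
  interpret B: mat_alg k B I using assms by (simp add: mat_alg_def mat_alg_axioms_def)
  note hD = alg_homD[OF assms(3)]
  let ?h = "\<lambda>x. \<lambda>ij\<in>I \<times> I. h (x ij)"
  have cl: "?h x \<in> carrier (mat I B)" if "x \<in> carrier (mat I A)" for x
    using A.F.mem[OF that] by (auto simp: B.F.carrier hD)
  have m: "h (x (i, l) \<otimes>\<^bsub>A\<^esub> y (l, j)) = h (x (i, l)) \<otimes> h (y (l, j))"
    if "x \<in> carrier (mat I A)" "y \<in> carrier (mat I A)" "i \<in> I" "j \<in> I" "l \<in> I" for x y i j l
    using that A.mat_entry by (intro hD(3)) auto
  show ?thesis
  proof (rule alg_homI)
    fix x y assume x: "x \<in> carrier (mat I A)" and y: "y \<in> carrier (mat I A)"
    show "?h (x \<oplus>\<^bsub>mat I A\<^esub> y) = ?h x \<oplus>\<^bsub>mat I B\<^esub> ?h y"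
      by (rule B.mat_eqI)
        (use cl x y A.mat_entry[OF x] A.mat_entry[OF y] in \<open>auto simp: A.F.at B.F.at hD\<close>)
    show "?h (x \<otimes>\<^bsub>mat I A\<^esub> y) = ?h x \<otimes>\<^bsub>mat I B\<^esub> ?h y"
    proof (rule B.mat_eqI)
      fix i j assume ij: "i \<in> I" "j \<in> I"
      have "?h (x \<otimes>\<^bsub>mat I A\<^esub> y) (i, j) = (\<Oplus>l\<in>I. h (x (i, l) \<otimes>\<^bsub>A\<^esub> y (l, j)))"
        using ij A.mat_entry[OF x] A.mat_entry[OF y]
        by (simp add: mat_mult alg_hom_finsum[OF assms(1-3)])
      also have "\<dots> = (\<Oplus>l\<in>I. h (x (i, l)) \<otimes> h (y (l, j)))"
        by (rule B.finsum_cong') (use ij A.mat_entry[OF x] A.mat_entry[OF y] in \<open>auto simp: hD\<close>)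
      also have "\<dots> = (\<Oplus>l\<in>I. ?h x (i, l) \<otimes> ?h y (l, j))"
        by (rule B.finsum_cong') (use ij A.mat_entry[OF x] A.mat_entry[OF y] in \<open>auto simp: hD\<close>)
      finally show "?h (x \<otimes>\<^bsub>mat I A\<^esub> y) (i, j) = (?h x \<otimes>\<^bsub>mat I B\<^esub> ?h y) (i, j)"
        using ij by (simp add: mat_mult)
    qed (use cl x y in auto)
  next
    fix r x assume r: "r \<in> carrier k" and x: "x \<in> carrier (mat I A)"
    show "?h (r \<odot>\<^bsub>mat I A\<^esub> x) = r \<odot>\<^bsub>mat I B\<^esub> ?h x"
      by (rule B.mat_eqI) (use cl r x A.mat_entry[OF x] in \<open>auto simp: A.F.at B.F.at hD\<close>)
  next
    show "?h \<one>\<^bsub>mat I A\<^esub> = \<one>\<^bsub>mat I B\<^esub>"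
      by (rule B.mat_eqI) (use cl in \<open>auto simp: mat_one hD alg_hom_zero[OF assms(1-3)]\<close>)
  qed (fact cl)
qed

lemma mat_map_iso:
  assumes "k_alg k A" "k_alg k B" "alg_isomorphic k A B" "finite I"
  shows "alg_isomorphic k (mat I A) (mat I B)"
proof -
  interpret A: mat_alg k A I using assms by (simp add: mat_alg_def mat_alg_axioms_def)
  interpret B: mat_alg k B I using assms by (simp add: mat_alg_def mat_alg_axioms_def)
  obtain h where h: "h \<in> alg_hom k A B" "inj_on h (carrier A)" "h ` carrier A = carrier B"
    using assms(3) by (rule alg_isomorphicE)
  show ?thesis
  proof (rule alg_isomorphicI[OF mat_map_hom[OF assms(1,2) h(1) assms(4)]])
    show "inj_on (\<lambda>x. \<lambda>ij\<in>I \<times> I. h (x ij)) (carrier (mat I A))"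
    proof (rule inj_onI)
      fix x y assume x: "x \<in> carrier (mat I A)" and y: "y \<in> carrier (mat I A)"
        and eq: "(\<lambda>ij\<in>I \<times> I. h (x ij)) = (\<lambda>ij\<in>I \<times> I. h (y ij))"
      show "x = y"
      proof (rule A.mat_eqI[OF x y])
        fix i j assume ij: "i \<in> I" "j \<in> I"
        have "h (x (i, j)) = h (y (i, j))" using fun_cong[OF eq, of "(i, j)"] ij by simp
        then show "x (i, j) = y (i, j)"
          by (rule inj_onD[OF h(2)]) (use A.mat_entry[OF x] A.mat_entry[OF y] ij in auto)
      qed
    qed
    show "carrier (mat I B) \<subseteq> (\<lambda>x. \<lambda>ij\<in>I \<times> I. h (x ij)) ` carrier (mat I A)"
    proof
      fix y assume y: "y \<in> carrier (mat I B)"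
      let ?x = "\<lambda>ij\<in>I \<times> I. inv_into (carrier A) h (y ij)"
      have in_img: "y (i, j) \<in> h ` carrier A" if "i \<in> I" "j \<in> I" for i j
        using B.mat_entry[OF y that] h(3) by simp
      have "?x \<in> carrier (mat I A)"
        using in_img inv_into_into[of _ h "carrier A"] by (auto simp: A.F.carrier)
      moreover have "(\<lambda>ij\<in>I \<times> I. h (?x ij)) = y"
        by (rule B.F.eqI) (use y B.F.mem[OF y] in_img h(3) in \<open>auto simp: B.F.carrier f_inv_into_f\<close>)
      ultimately show "y \<in> (\<lambda>x. \<lambda>ij\<in>I \<times> I. h (x ij)) ` carrier (mat I A)"
        by (intro image_eqI[of _ _ ?x]) simp_all
    qed
  qed
qed

section \<open>Scalar matrices, change of index set, and block matrices\<close>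

definition scalar_mat :: "('a, 'b, 's) module_scheme \<Rightarrow> 'i set \<Rightarrow> 'b \<Rightarrow> 'i \<times> 'i \<Rightarrow> 'b" where
  "scalar_mat A I a = (\<lambda>(i, j)\<in>I \<times> I. if i = j then a else \<zero>\<^bsub>A\<^esub>)"

context mat_alg
begin

lemma scalar_mat_closed: "a \<in> carrier A \<Longrightarrow> scalar_mat A I a \<in> carrier (mat I A)"
  by (auto simp: F.carrier scalar_mat_def)

lemma scalar_mat_at: "i \<in> I \<Longrightarrow> j \<in> I \<Longrightarrow> scalar_mat A I a (i, j) = (if i = j then a else \<zero>)"
  by (simp add: scalar_mat_def)

lemma scalar_mat_mult:
  assumes x: "x \<in> carrier (mat I A)" and a: "a \<in> carrier A" and ij: "i \<in> I" "j \<in> I"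
  shows "(scalar_mat A I a \<otimes>\<^bsub>mat I A\<^esub> x) (i, j) = a \<otimes> x (i, j)"
    "(x \<otimes>\<^bsub>mat I A\<^esub> scalar_mat A I a) (i, j) = x (i, j) \<otimes> a"
proof -
  have "(\<Oplus>l\<in>I. scalar_mat A I a (i, l) \<otimes> x (l, j)) = (\<Oplus>l\<in>I. if i = l then a \<otimes> x (l, j) else \<zero>)"
    by (rule finsum_cong') (use assms mat_entry[OF x] in \<open>auto simp: scalar_mat_def\<close>)
  also have "\<dots> = a \<otimes> x (i, j)"
    by (rule add.finprod_singleton) (use assms fin mat_entry[OF x] in auto)
  finally show "(scalar_mat A I a \<otimes>\<^bsub>mat I A\<^esub> x) (i, j) = a \<otimes> x (i, j)"
    using ij by (simp add: mat_mult)
  have "(\<Oplus>l\<in>I. x (i, l) \<otimes> scalar_mat A I a (l, j)) = (\<Oplus>l\<in>I. if j = l then x (i, l) \<otimes> a else \<zero>)"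
    by (rule finsum_cong') (use assms mat_entry[OF x] in \<open>auto simp: scalar_mat_def\<close>)
  also have "\<dots> = x (i, j) \<otimes> a"
    by (rule add.finprod_singleton) (use assms fin mat_entry[OF x] in auto)
  finally show "(x \<otimes>\<^bsub>mat I A\<^esub> scalar_mat A I a) (i, j) = x (i, j) \<otimes> a"
    using ij by (simp add: mat_mult)
qed

lemma scalar_mat_hom: "scalar_mat A I \<in> alg_hom k A (mat I A)"
proof (rule alg_homI)
  fix a b assume a: "a \<in> carrier A" and b: "b \<in> carrier A"
  show "scalar_mat A I (a \<oplus> b) = scalar_mat A I a \<oplus>\<^bsub>mat I A\<^esub> scalar_mat A I b"
    by (rule mat_eqI) (use scalar_mat_closed a b in \<open>auto simp: F.at scalar_mat_at\<close>)
  show "scalar_mat A I (a \<otimes> b) = scalar_mat A I a \<otimes>\<^bsub>mat I A\<^esub> scalar_mat A I b"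
    by (rule mat_eqI)
      (use scalar_mat_closed a b in \<open>auto simp: scalar_mat_mult scalar_mat_at\<close>)
next
  fix r a assume r: "r \<in> carrier k" and a: "a \<in> carrier A"
  show "scalar_mat A I (r \<odot> a) = r \<odot>\<^bsub>mat I A\<^esub> scalar_mat A I a"
    by (rule mat_eqI) (use scalar_mat_closed r a in \<open>auto simp: F.at scalar_mat_at\<close>)
next
  show "scalar_mat A I \<one> = \<one>\<^bsub>mat I A\<^esub>"
    by (rule mat_eqI) (use scalar_mat_closed in \<open>auto simp: mat_one scalar_mat_at\<close>)
qed (rule scalar_mat_closed)

lemma mat_singleton: assumes "I = {o'}" shows "alg_isomorphic k A (mat I A)"
proof (rule alg_isomorphicI[OF scalar_mat_hom])
  have at: "scalar_mat A I a (o', o') = a" for a using assms by (simp add: scalar_mat_def)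
  show "inj_on (scalar_mat A I) (carrier A)" by (rule inj_onI) (metis at)
  show "carrier (mat I A) \<subseteq> scalar_mat A I ` carrier A"
  proof
    fix x assume x: "x \<in> carrier (mat I A)"
    have "x = scalar_mat A I (x (o', o'))"
      by (rule mat_eqI) (use x scalar_mat_closed mat_entry[OF x] assms in \<open>auto simp: scalar_mat_def\<close>)
    then show "x \<in> scalar_mat A I ` carrier A" using mat_entry[OF x] assms by blast
  qed
qed

text \<open>Reconciles free index sets with the initial segments of the natural numbers on which
  \<open>matrix_algebra\<close> is based.\<close>

lemma mat_reindex:
  fixes J :: "'j set"
  assumes f: "bij_betw f J I"
  shows "alg_isomorphic k (mat I A) (mat J A)"
proof -
  have J: "finite J" using f fin bij_betw_finite by blast
  interpret J: mat_alg k A J using J by unfold_locales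
  have fI: "f i \<in> I" if "i \<in> J" for i using f that by (auto simp: bij_betw_def)
  have finj: "f i = f j \<longleftrightarrow> i = j" if "i \<in> J" "j \<in> J" for i j
    using f that by (auto simp: bij_betw_def inj_on_def)
  have fsurj: "\<exists>j\<in>J. i = f j" if "i \<in> I" for i using f that by (auto simp: bij_betw_def)
  define g where "g x = (\<lambda>(i, j)\<in>J \<times> J. x (f i, f j))" for x :: "'i \<times> 'i \<Rightarrow> 'b"
  have g_at: "g x (i, j) = x (f i, f j)" if "i \<in> J" "j \<in> J" for x i j using that by (simp add: g_def)
  have cl: "g x \<in> carrier (mat J A)" if "x \<in> carrier (mat I A)" for x
    using mat_entry[OF that] fI by (auto simp: g_def J.F.carrier)
  let ?S = "{delta A (I \<times> I) (i, j) a | i j a. i \<in> I \<and> j \<in> I \<and> a \<in> carrier A}"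
  have gd: "g (delta A (I \<times> I) (f i, f j) a) = delta A (J \<times> J) (i, j) a"
    if "i \<in> J" "j \<in> J" "a \<in> carrier A" for i j a
    by (rule J.mat_eqI)
      (use that cl F.delta_closed J.F.delta_closed fI in \<open>auto simp: g_at F.at J.F.at finj\<close>)
  have "g \<in> alg_hom k (mat I A) (mat J A)"
  proof (rule alg_homI_span[OF mat_k_alg J.mat_k_alg _ mat_span])
    show "?S \<subseteq> carrier (mat I A)" using F.delta_closed by auto
    fix x y assume "x \<in> ?S" "y \<in> ?S"
    then obtain i j a r s b where "i \<in> I" "j \<in> I" and a: "a \<in> carrier A" "x = delta A (I \<times> I) (i, j) a"
      and "r \<in> I" "s \<in> I" and b: "b \<in> carrier A" "y = delta A (I \<times> I) (r, s) b" by auto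
    from fsurj[OF \<open>i \<in> I\<close>] fsurj[OF \<open>j \<in> I\<close>] fsurj[OF \<open>r \<in> I\<close>] fsurj[OF \<open>s \<in> I\<close>]
    obtain i' j' r' s' where J: "i' \<in> J" "j' \<in> J" "r' \<in> J" "s' \<in> J"
      and eq: "i = f i'" "j = f j'" "r = f r'" "s = f s'" by auto
    have "g \<zero>\<^bsub>mat I A\<^esub> = \<zero>\<^bsub>mat J A\<^esub>"
      by (rule J.mat_eqI) (use cl fI in \<open>auto simp: g_at F.at J.F.at\<close>)
    then show "g (x \<otimes>\<^bsub>mat I A\<^esub> y) = g x \<otimes>\<^bsub>mat J A\<^esub> g y"
      using a b J fI by (simp add: eq gd delta_mult_delta J.delta_mult_delta finj)
  next
    fix x y assume x: "x \<in> carrier (mat I A)" and y: "y \<in> carrier (mat I A)"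
    show "g (x \<oplus>\<^bsub>mat I A\<^esub> y) = g x \<oplus>\<^bsub>mat J A\<^esub> g y"
      by (rule J.mat_eqI) (use cl fI x y in \<open>auto simp: g_at F.at J.F.at\<close>)
  next
    fix r x assume r: "r \<in> carrier k" and x: "x \<in> carrier (mat I A)"
    show "g (r \<odot>\<^bsub>mat I A\<^esub> x) = r \<odot>\<^bsub>mat J A\<^esub> g x"
      by (rule J.mat_eqI) (use cl fI r x in \<open>auto simp: g_at F.at J.F.at\<close>)
  next
    show "g \<one>\<^bsub>mat I A\<^esub> = \<one>\<^bsub>mat J A\<^esub>"
      by (rule J.mat_eqI) (use cl fI in \<open>auto simp: g_at mat_one finj\<close>)
  qed (rule cl)
  then show ?thesis
  proof (rule alg_isomorphicI)
    show "inj_on g (carrier (mat I A))"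
    proof (rule inj_onI, rule mat_eqI)
      fix x y i j assume "g x = g y" "i \<in> I" "j \<in> I"
      then obtain i' j' where *: "i' \<in> J" "j' \<in> J" "i = f i'" "j = f j'" using fsurj by blast
      then show "x (i, j) = y (i, j)"
        using g_at[OF *(1,2), of x] g_at[OF *(1,2), of y] \<open>g x = g y\<close> by simp
    qed
    show "carrier (mat J A) \<subseteq> g ` carrier (mat I A)"
    proof
      fix y assume y: "y \<in> carrier (mat J A)"
      define x where "x = (\<lambda>(i, j)\<in>I \<times> I. y (inv_into J f i, inv_into J f j))"
      have fi: "inv_into J f i \<in> J" if "i \<in> I" for i
        using that f inv_into_into[of i f J] by (simp add: bij_betw_def)
      have ff: "inv_into J f (f i) = i" if "i \<in> J" for i
        using that f by (simp add: bij_betw_def)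
      have "x \<in> carrier (mat I A)" using J.mat_entry[OF y] fi by (auto simp: x_def F.carrier)
      moreover have "g x = y"
        by (rule J.mat_eqI) (use cl \<open>x \<in> carrier (mat I A)\<close> y fI in \<open>auto simp: g_at x_def ff\<close>)
      ultimately show "y \<in> g ` carrier (mat I A)" by blast
    qed
  qed
qed

end

text \<open>Block matrices: an entry at a pair of pairs is an entry inside a block. It combines two
  Brauer equivalences into one.\<close>

lemma mat_mat:
  fixes I :: "'c set" and J :: "'d set" and A :: "('a, 'b, 's) module_scheme"
  assumes A: "k_alg k A" and I: "finite I" and J: "finite J"
  shows "alg_isomorphic k (mat (I \<times> J) A) (mat I (mat J A))"
proof -
  interpret IJ: mat_alg k A "I \<times> J" using assms by (simp add: mat_alg_def mat_alg_axioms_def)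
  interpret J: mat_alg k A J using assms by (simp add: mat_alg_def mat_alg_axioms_def)
  interpret I: mat_alg k "mat J A" I using J.mat_k_alg I by (simp add: mat_alg_def mat_alg_axioms_def)
  define g where "g x = (\<lambda>(i, j)\<in>I \<times> I. \<lambda>(i', j')\<in>J \<times> J. x ((i, i'), (j, j')))"
    for x :: "('c \<times> 'd) \<times> 'c \<times> 'd \<Rightarrow> 'b"
  have g_at: "g x (i, j) (i', j') = x ((i, i'), (j, j'))" if "i \<in> I" "j \<in> I" "i' \<in> J" "j' \<in> J" for x i j i' j'
    using that by (simp add: g_def)
  have cl: "g x \<in> carrier (mat I (mat J A))" if "x \<in> carrier (mat (I \<times> J) A)" for x
    using IJ.mat_entry[OF that] by (auto simp: g_def J.F.carrier I.F.carrier split: if_splits)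
  have eqI: "x = y" if "x \<in> carrier (mat I (mat J A))" "y \<in> carrier (mat I (mat J A))"
    "\<And>i j i' j'. i \<in> I \<Longrightarrow> j \<in> I \<Longrightarrow> i' \<in> J \<Longrightarrow> j' \<in> J \<Longrightarrow> x (i, j) (i', j') = y (i, j) (i', j')" for x y
    using that by (intro I.mat_eqI J.mat_eqI I.mat_entry) auto
  let ?S = "{delta A ((I \<times> J) \<times> (I \<times> J)) (i, j) a | i j a. i \<in> I \<times> J \<and> j \<in> I \<times> J \<and> a \<in> carrier A}"
  have gd: "g (delta A ((I \<times> J) \<times> (I \<times> J)) ((i, i'), (j, j')) a) =
      delta (mat J A) (I \<times> I) (i, j) (delta A (J \<times> J) (i', j') a)"
    if "i \<in> I" "j \<in> I" "i' \<in> J" "j' \<in> J" "a \<in> carrier A" for i j i' j' a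
    by (rule eqI)
      (use that cl IJ.F.delta_closed I.F.delta_closed J.F.delta_closed in
        \<open>auto simp: g_at IJ.F.at I.F.at J.F.at\<close>)
  have "g \<in> alg_hom k (mat (I \<times> J) A) (mat I (mat J A))"
  proof (rule alg_homI_span[OF IJ.mat_k_alg I.mat_k_alg _ IJ.mat_span])
    show "?S \<subseteq> carrier (mat (I \<times> J) A)" using IJ.F.delta_closed by auto
    have g0: "g \<zero>\<^bsub>mat (I \<times> J) A\<^esub> = \<zero>\<^bsub>mat I (mat J A)\<^esub>"
      by (rule eqI) (use cl in \<open>auto simp: g_at IJ.F.at I.F.at J.F.at\<close>)
    fix x y assume xS: "x \<in> ?S" and yS: "y \<in> ?S"
    obtain i i' j j' a where x: "i \<in> I" "i' \<in> J" "j \<in> I" "j' \<in> J" "a \<in> carrier A"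
      "x = delta A ((I \<times> J) \<times> (I \<times> J)) ((i, i'), (j, j')) a" using xS by auto
    obtain r r' s s' b where y: "r \<in> I" "r' \<in> J" "s \<in> I" "s' \<in> J" "b \<in> carrier A"
      "y = delta A ((I \<times> J) \<times> (I \<times> J)) ((r, r'), (s, s')) b" using yS by auto
    show "g (x \<otimes>\<^bsub>mat (I \<times> J) A\<^esub> y) = g x \<otimes>\<^bsub>mat I (mat J A)\<^esub> g y"
      using x y J.F.delta_closed
      by (simp add: gd IJ.delta_mult_delta I.delta_mult_delta J.delta_mult_delta g0 I.delta_zero)
  next
    fix x y assume x: "x \<in> carrier (mat (I \<times> J) A)" and y: "y \<in> carrier (mat (I \<times> J) A)"
    show "g (x \<oplus>\<^bsub>mat (I \<times> J) A\<^esub> y) = g x \<oplus>\<^bsub>mat I (mat J A)\<^esub> g y"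
      by (rule eqI) (use cl x y in \<open>auto simp: g_at IJ.F.at I.F.at J.F.at\<close>)
  next
    fix r x assume r: "r \<in> carrier k" and x: "x \<in> carrier (mat (I \<times> J) A)"
    show "g (r \<odot>\<^bsub>mat (I \<times> J) A\<^esub> x) = r \<odot>\<^bsub>mat I (mat J A)\<^esub> g x"
      by (rule eqI) (use cl r x in \<open>auto simp: g_at IJ.F.at I.F.at J.F.at\<close>)
  next
    show "g \<one>\<^bsub>mat (I \<times> J) A\<^esub> = \<one>\<^bsub>mat I (mat J A)\<^esub>"
      by (rule eqI) (use cl in \<open>auto simp: g_at mat_one J.F.at\<close>)
  qed (rule cl)
  then show ?thesis
  proof (rule alg_isomorphicI)
    show "inj_on g (carrier (mat (I \<times> J) A))"
    proof (rule inj_onI, rule IJ.mat_eqI)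
      fix x y p q assume g: "g x = g y" and pq: "p \<in> I \<times> J" "q \<in> I \<times> J"
      then show "x (p, q) = y (p, q)"
        using g_at[of "fst p" "fst q" "snd p" "snd q" x] g_at[of "fst p" "fst q" "snd p" "snd q" y] by auto
    qed
    show "carrier (mat I (mat J A)) \<subseteq> g ` carrier (mat (I \<times> J) A)"
    proof
      fix y assume y: "y \<in> carrier (mat I (mat J A))"
      define x where "x = (\<lambda>(p, q)\<in>(I \<times> J) \<times> (I \<times> J). y (fst p, fst q) (snd p, snd q))"
      have "x \<in> carrier (mat (I \<times> J) A)"
        using J.mat_entry[OF I.mat_entry[OF y]] by (auto simp: x_def IJ.F.carrier)
      moreover have "g x = y"
        by (rule eqI) (use cl \<open>x \<in> carrier (mat (I \<times> J) A)\<close> y in \<open>auto simp: g_at x_def\<close>)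
      ultimately show "y \<in> g ` carrier (mat (I \<times> J) A)" by blast
    qed
  qed
qed

section \<open>Bases\<close>

text \<open>A spanning set of least cardinality is a basis: if two expansions of one element
  differed at \<open>s\<close>, their difference would express \<open>s\<close> by the other
  generators, and \<open>s\<close> could be dropped.\<close>

lemma ex_coordinates:
  fixes M (structure)
  assumes k: "field k" and M: "module k M"
    and T: "finite T" "T \<subseteq> carrier M" "carrier M \<subseteq> lin_span k M T"
  obtains S c where "finite S" "S \<subseteq> carrier M"
    "\<And>x s. x \<in> carrier M \<Longrightarrow> s \<in> S \<Longrightarrow> c x s \<in> carrier k"
    "\<And>x. x \<in> carrier M \<Longrightarrow> x = (\<Oplus>s\<in>S. c x s \<odot> s)"
    "\<And>b s. (\<And>t. t \<in> S \<Longrightarrow> b t \<in> carrier k) \<Longrightarrow> s \<in> S \<Longrightarrow> c (\<Oplus>s\<in>S. b s \<odot> s) s = b s"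
proof -
  interpret K: field k by fact
  interpret M: module k M by fact
  define P where "P S \<longleftrightarrow> finite S \<and> S \<subseteq> carrier M \<and> carrier M \<subseteq> lin_span k M S" for S
  have "P T" using T by (simp add: P_def)
  then obtain S where S: "P S" and min: "\<And>S'. P S' \<Longrightarrow> card S \<le> card S'"
    using ex_has_least_nat[of P T card] by blast
  have Sf: "finite S" "S \<subseteq> carrier M" "carrier M \<subseteq> lin_span k M S" using S by (simp_all add: P_def)
  have SC: "\<And>s. s \<in> S \<Longrightarrow> s \<in> carrier M" using Sf by auto
  have uniq: "b s = b' s"
    if b: "\<And>t. t \<in> S \<Longrightarrow> b t \<in> carrier k" and b': "\<And>t. t \<in> S \<Longrightarrow> b' t \<in> carrier k"
      and eq: "(\<Oplus>s\<in>S. b s \<odot> s) = (\<Oplus>s\<in>S. b' s \<odot> s)" and s: "s \<in> S" for b b' s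
  proof (rule ccontr)
    assume neq: "b s \<noteq> b' s"
    let ?S = "S - {s}"
    have S': "?S \<subseteq> carrier M" "finite ?S" using Sf by auto
    define d where "d t = b t \<ominus>\<^bsub>k\<^esub> b' t" for t
    have d: "d t \<in> carrier k" if "t \<in> S" for t using that b b' by (simp add: d_def)
    have d0: "d s \<noteq> \<zero>\<^bsub>k\<^esub>" using neq b[OF s] b'[OF s] by (simp add: d_def)
    have "\<ominus>\<^bsub>k\<^esub> d s \<noteq> \<zero>\<^bsub>k\<^esub>"
    proof
      assume "\<ominus>\<^bsub>k\<^esub> d s = \<zero>\<^bsub>k\<^esub>"
      then have "\<ominus>\<^bsub>k\<^esub> (\<ominus>\<^bsub>k\<^esub> d s) = \<zero>\<^bsub>k\<^esub>" by simp
      then show False using d0 d[OF s] by (simp add: K.minus_minus)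
    qed
    then have mU: "\<ominus>\<^bsub>k\<^esub> d s \<in> Units k" using d[OF s] by (simp add: K.field_Units)
    have rest: "(\<Oplus>t\<in>?S. f t \<odot> t) \<in> lin_span k M ?S" if "\<And>t. t \<in> S \<Longrightarrow> f t \<in> carrier k" for f
      by (rule M.lin_span_finsum[OF S'(1,2)], rule M.lin_span_smult[OF S'(1) _ M.lin_span_base[OF S'(1)]])
        (use that in auto)
    have split: "(\<Oplus>t\<in>S. f t \<odot> t) = f s \<odot> s \<oplus> (\<Oplus>t\<in>?S. f t \<odot> t)"
      if "\<And>t. t \<in> S \<Longrightarrow> f t \<in> carrier k" for f
    proof -
      have "(\<Oplus>t\<in>insert s ?S. f t \<odot> t) = f s \<odot> s \<oplus> (\<Oplus>t\<in>?S. f t \<odot> t)"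
        by (rule M.M.finsum_insert) (use S' that SC s in auto)
      then show ?thesis using s by (simp add: insert_absorb)
    qed
    have cl: "(\<Oplus>t\<in>S. f t \<odot> t) \<in> carrier M" if "\<And>t. t \<in> S \<Longrightarrow> f t \<in> carrier k" for f
      by (rule M.M.finsum_closed) (use that SC in auto)
    have "(\<Oplus>t\<in>S. d t \<odot> t) \<oplus> (\<Oplus>t\<in>S. b' t \<odot> t) = (\<Oplus>t\<in>S. d t \<odot> t \<oplus> b' t \<odot> t)"
      by (rule M.M.finsum_addf[symmetric]) (use d b' SC in auto)
    also have "\<dots> = (\<Oplus>t\<in>S. b t \<odot> t)"
    proof (rule M.M.finsum_cong')
      fix t assume t: "t \<in> S"
      have "d t \<oplus>\<^bsub>k\<^esub> b' t = b t" using b[OF t] b'[OF t]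
        by (simp add: d_def K.minus_eq K.a_assoc K.l_neg)
      then show "d t \<odot> t \<oplus> b' t \<odot> t = b t \<odot> t"
        using d[OF t] b'[OF t] SC[OF t] by (simp add: M.smult_l_distr[symmetric])
    qed (use b SC in auto)
    finally have "(\<Oplus>t\<in>S. d t \<odot> t) = \<zero>"
      unfolding eq using cl[of d, OF d] cl[of b', OF b'] by (simp add: M.M.add.l_cancel_one)
    then have "d s \<odot> s \<oplus> (\<Oplus>t\<in>?S. d t \<odot> t) = \<zero>" using split[of d] d by simp
    then have "\<ominus> (d s \<odot> s) = (\<Oplus>t\<in>?S. d t \<odot> t)"
      using M.lin_span_closed[OF S'(1) rest[OF d]] d[OF s] SC[OF s]
      by (intro M.M.minus_equality) (simp_all add: M.M.a_comm)
    then have "(\<ominus>\<^bsub>k\<^esub> d s) \<odot> s \<in> lin_span k M ?S"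
      using rest[OF d] d[OF s] SC[OF s] by (simp add: M.smult_l_minus)
    then have "inv\<^bsub>k\<^esub> (\<ominus>\<^bsub>k\<^esub> d s) \<odot> ((\<ominus>\<^bsub>k\<^esub> d s) \<odot> s) \<in> lin_span k M ?S"
      by (rule M.lin_span_smult[OF S'(1) K.Units_inv_closed[OF mU]])
    moreover have "inv\<^bsub>k\<^esub> (\<ominus>\<^bsub>k\<^esub> d s) \<odot> ((\<ominus>\<^bsub>k\<^esub> d s) \<odot> s) = s"
      using mU K.Units_inv_closed[OF mU] SC[OF s] d[OF s] by (simp add: M.smult_assoc1[symmetric])
    ultimately have "s \<in> lin_span k M ?S" by simp
    then have St: "t \<in> lin_span k M ?S" if "t \<in> S" for t
      using M.lin_span_base[OF S'(1), of t] that by (cases "t = s") auto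
    have "carrier M \<subseteq> lin_span k M ?S"
      by (rule subsetI, rule M.lin_span_mono[OF S'(1) St subsetD[OF Sf(3)]])
    then have "P ?S" using S' by (simp add: P_def)
    then show False using min[of ?S] card_Diff1_less[OF Sf(1) s] by simp
  qed
  define c where "c x = (SOME c. c \<in> S \<rightarrow> carrier k \<and> x = (\<Oplus>s\<in>S. c s \<odot> s))" for x
  have c: "c x \<in> S \<rightarrow> carrier k \<and> x = (\<Oplus>s\<in>S. c x s \<odot> s)" if "x \<in> carrier M" for x
  proof -
    have "\<exists>c. c \<in> S \<rightarrow> carrier k \<and> x = (\<Oplus>s\<in>S. c s \<odot> s)"
      using M.lin_span_finite_eq[OF Sf(1,2) subsetD[OF Sf(3) that]] by blast
    then show ?thesis unfolding c_def by (rule someI_ex)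
  qed
  show thesis
  proof (rule that[OF Sf(1,2), of c])
    show "c x s \<in> carrier k" if "x \<in> carrier M" "s \<in> S" for x s
      using conjunct1[OF c[OF that(1)]] that(2) by (rule funcset_mem)
    show "x = (\<Oplus>s\<in>S. c x s \<odot> s)" if "x \<in> carrier M" for x by (rule conjunct2[OF c[OF that]])
    fix b s assume b: "\<And>t. t \<in> S \<Longrightarrow> b t \<in> carrier k" and s: "s \<in> S"
    let ?x = "\<Oplus>s\<in>S. b s \<odot> s"
    have "?x \<in> carrier M" by (rule M.M.finsum_closed) (use b SC in auto)
    note * = c[OF this]
    show "c ?x s = b s"
      by (rule uniq[OF _ b conjunct2[OF *, symmetric] s]) (rule funcset_mem[OF conjunct1[OF *]])
  qed
qed

section \<open>Tensor products\<close>

definition tensor_ideal ::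
    "('a, 'r) ring_scheme \<Rightarrow> ('a, 'b, 's) module_scheme \<Rightarrow> ('a, 'c, 't) module_scheme \<Rightarrow> ('b \<times> 'c \<Rightarrow> 'a) set" where
  "tensor_ideal k A B =
     (let P = monoid_algebra k (A \<times>\<times> B); t = (\<lambda>x y. single k (x, y))
      in Idl\<^bsub>P\<^esub>
           ({t (x \<oplus>\<^bsub>A\<^esub> x') y \<ominus>\<^bsub>P\<^esub> (t x y \<oplus>\<^bsub>P\<^esub> t x' y) | x x' y.
               x \<in> carrier A \<and> x' \<in> carrier A \<and> y \<in> carrier B} \<union>
            {t x (y \<oplus>\<^bsub>B\<^esub> y') \<ominus>\<^bsub>P\<^esub> (t x y \<oplus>\<^bsub>P\<^esub> t x y') | x y y'.
               x \<in> carrier A \<and> y \<in> carrier B \<and> y' \<in> carrier B} \<union>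
            {t (r \<odot>\<^bsub>A\<^esub> x) y \<ominus>\<^bsub>P\<^esub> r \<odot>\<^bsub>P\<^esub> t x y | r x y.
               r \<in> carrier k \<and> x \<in> carrier A \<and> y \<in> carrier B} \<union>
            {t x (r \<odot>\<^bsub>B\<^esub> y) \<ominus>\<^bsub>P\<^esub> r \<odot>\<^bsub>P\<^esub> t x y | r x y.
               r \<in> carrier k \<and> x \<in> carrier A \<and> y \<in> carrier B}))"

lemma tensor_algebra_eq:
  "tensor_algebra k A B = quotient_algebra (monoid_algebra k (A \<times>\<times> B)) (tensor_ideal k A B)"
  by (simp add: tensor_algebra_def tensor_ideal_def Let_def)

text \<open>The pure tensor of \<open>x\<close> and \<open>y\<close>.\<close>

definition tens ::
    "('a, 'r) ring_scheme \<Rightarrow> ('a, 'b, 's) module_scheme \<Rightarrow> ('a, 'c, 't) module_scheme \<Rightarrow>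
      'b \<Rightarrow> 'c \<Rightarrow> ('b \<times> 'c \<Rightarrow> 'a) set" where
  "tens k A B x y = tensor_ideal k A B +>\<^bsub>monoid_algebra k (A \<times>\<times> B)\<^esub> single k (x, y)"

locale alg_pair = A: k_alg k A + B: k_alg k B
  for k :: "('a, 'r) ring_scheme" and A :: "('a, 'b, 's) module_scheme" (structure) and B :: "('a, 'c, 't) module_scheme"
begin

abbreviation "AB \<equiv> tensor_algebra k A B"
abbreviation "t \<equiv> tens k A B"

lemma monoid_AB: "monoid (A \<times>\<times> B)"
  by (rule DirProd_monoid) unfold_locales

sublocale P: k_alg k "monoid_algebra k (A \<times>\<times> B)"
  by (rule A.K.monoid_algebra_k_alg[OF monoid_AB])

lemma single_closed: "x \<in> carrier A \<Longrightarrow> y \<in> carrier B \<Longrightarrow> single k (x, y) \<in> carrier (monoid_algebra k (A \<times>\<times> B))"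
  by (rule A.K.single_closed) simp

lemma ideal_AB: "ideal (tensor_ideal k A B) (monoid_algebra k (A \<times>\<times> B))"
  unfolding tensor_ideal_def Let_def
  by (rule P.genideal_ideal) (auto intro!: single_closed P.minus_closed P.a_closed P.M.smult_closed)

sublocale AB: k_alg k AB
  unfolding tensor_algebra_eq by (rule k_alg_quotient[OF P.k_alg_axioms ideal_AB])

lemma proj_hom: "(\<lambda>x. tensor_ideal k A B +>\<^bsub>monoid_algebra k (A \<times>\<times> B)\<^esub> x) \<in> alg_hom k (monoid_algebra k (A \<times>\<times> B)) AB"
  unfolding tensor_algebra_eq by (rule quotient_hom[OF P.k_alg_axioms ideal_AB])

lemma t_closed: "x \<in> carrier A \<Longrightarrow> y \<in> carrier B \<Longrightarrow> t x y \<in> carrier AB"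
  unfolding tens_def by (rule alg_homD(1)[OF proj_hom]) (rule single_closed)

lemma t_mult:
  assumes "x \<in> carrier A" "y \<in> carrier B" "x' \<in> carrier A" "y' \<in> carrier B"
  shows "t x y \<otimes>\<^bsub>AB\<^esub> t x' y' = t (x \<otimes> x') (y \<otimes>\<^bsub>B\<^esub> y')"
  unfolding tens_def
  using assms A.K.monoid_algebra_mult_single[OF monoid_AB, of "(x, y)" "(x', y')"]
  by (simp add: alg_homD(3)[OF proj_hom, symmetric] single_closed)

lemma t_one: "\<one>\<^bsub>AB\<^esub> = t \<one> \<one>\<^bsub>B\<^esub>"
  using alg_homD(5)[OF proj_hom] by (simp add: tens_def monoid_algebra_def DirProd_def)

lemma tensor_rels:
  defines "R \<equiv> tensor_ideal k A B" and "P \<equiv> monoid_algebra k (A \<times>\<times> B)"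
  shows "\<And>x x' y. x \<in> carrier A \<Longrightarrow> x' \<in> carrier A \<Longrightarrow> y \<in> carrier B \<Longrightarrow>
       single k (x \<oplus> x', y) \<ominus>\<^bsub>P\<^esub> (single k (x, y) \<oplus>\<^bsub>P\<^esub> single k (x', y)) \<in> R"
    and "\<And>x y y'. x \<in> carrier A \<Longrightarrow> y \<in> carrier B \<Longrightarrow> y' \<in> carrier B \<Longrightarrow>
       single k (x, y \<oplus>\<^bsub>B\<^esub> y') \<ominus>\<^bsub>P\<^esub> (single k (x, y) \<oplus>\<^bsub>P\<^esub> single k (x, y')) \<in> R"
    and "\<And>r x y. r \<in> carrier k \<Longrightarrow> x \<in> carrier A \<Longrightarrow> y \<in> carrier B \<Longrightarrow>
       single k (r \<odot> x, y) \<ominus>\<^bsub>P\<^esub> r \<odot>\<^bsub>P\<^esub> single k (x, y) \<in> R"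
    and "\<And>r x y. r \<in> carrier k \<Longrightarrow> x \<in> carrier A \<Longrightarrow> y \<in> carrier B \<Longrightarrow>
       single k (x, r \<odot>\<^bsub>B\<^esub> y) \<ominus>\<^bsub>P\<^esub> r \<odot>\<^bsub>P\<^esub> single k (x, y) \<in> R"
  unfolding R_def P_def tensor_ideal_def Let_def
  by (rule subsetD[OF P.genideal_self]; use single_closed in
      \<open>blast intro!: P.minus_closed P.a_closed P.M.smult_closed A.a_closed B.a_closed A.M.smult_closed B.M.smult_closed\<close>)+

lemma proj_eqI:
  assumes "u \<ominus>\<^bsub>monoid_algebra k (A \<times>\<times> B)\<^esub> v \<in> tensor_ideal k A B"
    "u \<in> carrier (monoid_algebra k (A \<times>\<times> B))" "v \<in> carrier (monoid_algebra k (A \<times>\<times> B))"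
  shows "tensor_ideal k A B +>\<^bsub>monoid_algebra k (A \<times>\<times> B)\<^esub> u = tensor_ideal k A B +>\<^bsub>monoid_algebra k (A \<times>\<times> B)\<^esub> v"
  using quotient_eq_iff[OF P.k_alg_axioms ideal_AB assms(2,3)] assms(1) by blast

lemma t_add_l:
  assumes "x \<in> carrier A" "x' \<in> carrier A" "y \<in> carrier B"
  shows "t (x \<oplus> x') y = t x y \<oplus>\<^bsub>AB\<^esub> t x' y"
  unfolding tens_def
  using proj_eqI[OF tensor_rels(1)[OF assms]] assms
  by (simp add: alg_homD(2)[OF proj_hom, symmetric] single_closed)

lemma t_add_r:
  assumes "x \<in> carrier A" "y \<in> carrier B" "y' \<in> carrier B"
  shows "t x (y \<oplus>\<^bsub>B\<^esub> y') = t x y \<oplus>\<^bsub>AB\<^esub> t x y'"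
  unfolding tens_def
  using proj_eqI[OF tensor_rels(2)[OF assms]] assms
  by (simp add: alg_homD(2)[OF proj_hom, symmetric] single_closed)

lemma t_smult_l:
  assumes "r \<in> carrier k" "x \<in> carrier A" "y \<in> carrier B"
  shows "t (r \<odot> x) y = r \<odot>\<^bsub>AB\<^esub> t x y"
  unfolding tens_def
  using proj_eqI[OF tensor_rels(3)[OF assms]] assms
  by (simp add: alg_homD(4)[OF proj_hom, symmetric] single_closed)

lemma t_smult_r:
  assumes "r \<in> carrier k" "x \<in> carrier A" "y \<in> carrier B"
  shows "t x (r \<odot>\<^bsub>B\<^esub> y) = r \<odot>\<^bsub>AB\<^esub> t x y"
  unfolding tens_def
  using proj_eqI[OF tensor_rels(4)[OF assms]] assms
  by (simp add: alg_homD(4)[OF proj_hom, symmetric] single_closed)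

lemma t_zero_l: "y \<in> carrier B \<Longrightarrow> t \<zero> y = \<zero>\<^bsub>AB\<^esub>"
  using t_smult_l[of "\<zero>\<^bsub>k\<^esub>" "\<zero>" y] t_closed by simp

lemma t_zero_r: "x \<in> carrier A \<Longrightarrow> t x \<zero>\<^bsub>B\<^esub> = \<zero>\<^bsub>AB\<^esub>"
  using t_smult_r[of "\<zero>\<^bsub>k\<^esub>" x "\<zero>\<^bsub>B\<^esub>"] t_closed by simp

lemma t_set: "{t x y | x y. x \<in> carrier A \<and> y \<in> carrier B} \<subseteq> carrier AB"
  using t_closed by auto

lemma t_span: "carrier AB \<subseteq> lin_span k AB {t x y | x y. x \<in> carrier A \<and> y \<in> carrier B}"
proof
  let ?P = "monoid_algebra k (A \<times>\<times> B)" and ?p = "\<lambda>x. tensor_ideal k A B +>\<^bsub>monoid_algebra k (A \<times>\<times> B)\<^esub> x"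
  fix z assume "z \<in> carrier AB"
  then have "z \<in> ?p ` carrier ?P"
    unfolding tensor_algebra_eq quotient_surj[OF P.k_alg_axioms ideal_AB] .
  then obtain u where u: "u \<in> carrier ?P" "z = ?p u" by blast
  have "z \<in> lin_span k AB (?p ` single k ` carrier (A \<times>\<times> B))" unfolding u(2)
    by (rule lin_span_image[OF P.k_alg_axioms AB.k_alg_axioms proj_hom])
      (use A.K.monoid_algebra_span[OF monoid_AB] u single_closed in auto)
  moreover have "?p ` single k ` carrier (A \<times>\<times> B) = {t x y | x y. x \<in> carrier A \<and> y \<in> carrier B}"
    by (auto simp: tens_def)
  ultimately show "z \<in> lin_span k AB {t x y | x y. x \<in> carrier A \<and> y \<in> carrier B}" by simp
qed

lemma t_induct [consumes 1, case_names zero add smult tens]: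
  assumes z: "z \<in> carrier AB" and "Q \<zero>\<^bsub>AB\<^esub>"
    and "\<And>u v. u \<in> carrier AB \<Longrightarrow> v \<in> carrier AB \<Longrightarrow> Q u \<Longrightarrow> Q v \<Longrightarrow> Q (u \<oplus>\<^bsub>AB\<^esub> v)"
    and "\<And>r u. r \<in> carrier k \<Longrightarrow> u \<in> carrier AB \<Longrightarrow> Q u \<Longrightarrow> Q (r \<odot>\<^bsub>AB\<^esub> u)"
    and "\<And>x y. x \<in> carrier A \<Longrightarrow> y \<in> carrier B \<Longrightarrow> Q (t x y)"
  shows "Q z"
  using subsetD[OF t_span z] t_set
  by (induction rule: AB.M.lin_span_induct) (use assms in auto)

text \<open>A map multiplicative on pairs extends to the monoid algebra of the product monoid;
  bilinearity says that the generating relations lie in its kernel, and the kernel is an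
  ideal.\<close>

lemma tensor_lift:
  assumes C: "k_alg k C"
    and cl: "\<And>x y. x \<in> carrier A \<Longrightarrow> y \<in> carrier B \<Longrightarrow> \<phi> x y \<in> carrier C"
    and add_l: "\<And>x x' y. x \<in> carrier A \<Longrightarrow> x' \<in> carrier A \<Longrightarrow> y \<in> carrier B \<Longrightarrow> \<phi> (x \<oplus> x') y = \<phi> x y \<oplus>\<^bsub>C\<^esub> \<phi> x' y"
    and add_r: "\<And>x y y'. x \<in> carrier A \<Longrightarrow> y \<in> carrier B \<Longrightarrow> y' \<in> carrier B \<Longrightarrow> \<phi> x (y \<oplus>\<^bsub>B\<^esub> y') = \<phi> x y \<oplus>\<^bsub>C\<^esub> \<phi> x y'"
    and smult_l: "\<And>r x y. r \<in> carrier k \<Longrightarrow> x \<in> carrier A \<Longrightarrow> y \<in> carrier B \<Longrightarrow> \<phi> (r \<odot> x) y = r \<odot>\<^bsub>C\<^esub> \<phi> x y"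
    and smult_r: "\<And>r x y. r \<in> carrier k \<Longrightarrow> x \<in> carrier A \<Longrightarrow> y \<in> carrier B \<Longrightarrow> \<phi> x (r \<odot>\<^bsub>B\<^esub> y) = r \<odot>\<^bsub>C\<^esub> \<phi> x y"
    and one: "\<phi> \<one> \<one>\<^bsub>B\<^esub> = \<one>\<^bsub>C\<^esub>"
    and mult: "\<And>x y x' y'. x \<in> carrier A \<Longrightarrow> y \<in> carrier B \<Longrightarrow> x' \<in> carrier A \<Longrightarrow> y' \<in> carrier B \<Longrightarrow>
        \<phi> (x \<otimes> x') (y \<otimes>\<^bsub>B\<^esub> y') = \<phi> x y \<otimes>\<^bsub>C\<^esub> \<phi> x' y'"
  obtains h where "h \<in> alg_hom k AB C" "\<And>x y. x \<in> carrier A \<Longrightarrow> y \<in> carrier B \<Longrightarrow> h (t x y) = \<phi> x y"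
proof -
  let ?P = "monoid_algebra k (A \<times>\<times> B)"
  interpret C: k_alg k C by fact
  obtain f where f: "f \<in> alg_hom k ?P C" "\<And>w. w \<in> carrier (A \<times>\<times> B) \<Longrightarrow> f (single k w) = case_prod \<phi> w"
    by (rule A.K.monoid_algebra_lift[OF monoid_AB C, of "case_prod \<phi>"]) (use cl one mult in auto)
  have fs: "f (single k (x, y)) = \<phi> x y" if "x \<in> carrier A" "y \<in> carrier B" for x y
    using f(2)[of "(x, y)"] that by simp
  note fD = alg_homD[OF f(1)]
  interpret f: ring_hom_ring ?P C f by (rule alg_hom_ring_hom_ring[OF P.k_alg_axioms C f(1)])
  have "tensor_ideal k A B \<subseteq> a_kernel ?P C f"
    unfolding tensor_ideal_def Let_def
  proof (rule P.genideal_minimal[OF f.kernel_is_ideal])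
    have *: "u \<ominus>\<^bsub>?P\<^esub> v \<in> a_kernel ?P C f" if "u \<in> carrier ?P" "v \<in> carrier ?P" "f u = f v" for u v
    proof -
      have "f (u \<ominus>\<^bsub>?P\<^esub> v) = \<zero>\<^bsub>C\<^esub>"
        using that(3) fD(1)[OF that(2)] alg_hom_minus[OF P.k_alg_axioms C f(1) that(1,2)] by simp
      then show ?thesis using P.minus_closed[OF that(1,2)] unfolding a_kernel_def' by blast
    qed
    show "{single k (x \<oplus> x', y) \<ominus>\<^bsub>?P\<^esub> (single k (x, y) \<oplus>\<^bsub>?P\<^esub> single k (x', y)) |x x' y.
          x \<in> carrier A \<and> x' \<in> carrier A \<and> y \<in> carrier B} \<union>
         {single k (x, y \<oplus>\<^bsub>B\<^esub> y') \<ominus>\<^bsub>?P\<^esub> (single k (x, y) \<oplus>\<^bsub>?P\<^esub> single k (x, y')) |x y y'.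
          x \<in> carrier A \<and> y \<in> carrier B \<and> y' \<in> carrier B} \<union>
         {single k (r \<odot> x, y) \<ominus>\<^bsub>?P\<^esub> r \<odot>\<^bsub>?P\<^esub> single k (x, y) |r x y.
          r \<in> carrier k \<and> x \<in> carrier A \<and> y \<in> carrier B} \<union>
         {single k (x, r \<odot>\<^bsub>B\<^esub> y) \<ominus>\<^bsub>?P\<^esub> r \<odot>\<^bsub>?P\<^esub> single k (x, y) |r x y.
          r \<in> carrier k \<and> x \<in> carrier A \<and> y \<in> carrier B} \<subseteq> a_kernel ?P C f"
      by (auto intro!: * simp: single_closed fD fs add_l add_r smult_l smult_r)
  qed
  then have ker: "f u = \<zero>\<^bsub>C\<^esub>" if "u \<in> tensor_ideal k A B" for u
    using that unfolding a_kernel_def' by blast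
  obtain h where h: "h \<in> alg_hom k AB C"
    "\<And>u. u \<in> carrier ?P \<Longrightarrow> h (tensor_ideal k A B +>\<^bsub>?P\<^esub> u) = f u"
    unfolding tensor_algebra_eq
    by (rule quotient_lift[OF P.k_alg_axioms C ideal_AB f(1) ker]) auto
  show thesis
    by (rule that[OF h(1)]) (simp add: tens_def h(2) single_closed fs)
qed

lemma t_finsum_r:
  assumes "x \<in> carrier A" "\<And>i. i \<in> I \<Longrightarrow> f i \<in> carrier B"
  shows "t x (\<Oplus>\<^bsub>B\<^esub>i\<in>I. f i) = (\<Oplus>\<^bsub>AB\<^esub>i\<in>I. t x (f i))"
  using assms(2)
proof (induction I rule: infinite_finite_induct)
  case (insert i I)
  then show ?case using assms(1) t_closed
    by (simp add: Pi_iff t_add_r)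
qed (use assms(1) in \<open>simp_all add: t_zero_r\<close>)

end

lemma (in module) finsum_smult_rdistr:
  assumes "\<And>i. i \<in> I \<Longrightarrow> f i \<in> carrier R" "x \<in> carrier M"
  shows "(\<Oplus>i\<in>I. f i) \<odot>\<^bsub>M\<^esub> x = (\<Oplus>\<^bsub>M\<^esub>i\<in>I. f i \<odot>\<^bsub>M\<^esub> x)"
  using assms(1)
  by (induction I rule: infinite_finite_induct) (use assms(2) in \<open>simp_all add: Pi_iff smult_l_distr\<close>)

lemma (in k_alg) smult_one_eq_zero:
  assumes "\<one> \<noteq> \<zero>" "r \<in> carrier k" "r \<odot> \<one> = \<zero>"
  shows "r = \<zero>\<^bsub>k\<^esub>"
proof (rule ccontr)
  assume "r \<noteq> \<zero>\<^bsub>k\<^esub>"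
  then have U: "r \<in> Units k" using assms(2) by (simp add: K.field_Units)
  have "inv\<^bsub>k\<^esub> r \<odot> (r \<odot> \<one>) = \<one>"
    using U K.Units_inv_closed[OF U] assms(2) by (simp add: M.smult_assoc1[symmetric])
  then show False using assms K.Units_inv_closed[OF U] by simp
qed

context alg_pair
begin

text \<open>Coordinates on a quotient have to come from a homomorphism out of it. With a basis
  \<open>S\<close> of \<open>B\<close>, left multiplication by \<open>y\<close> is a matrix over
  \<open>k\<close>; scaling its entries by \<open>x\<close> gives a homomorphism from the tensor
  product to matrices over \<open>A\<close>. Applied to the coordinate vector of the unit of
  \<open>B\<close>, the matrix of \<open>t x y\<close> returns the coordinates of \<open>y\<close>
  times \<open>x\<close>, which is the function \<open>\<kappa>\<close>.\<close>

lemma tensor_coordinates: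
  assumes "finite_dim_algebra k B"
  obtains S c \<kappa> where "finite S" "S \<subseteq> carrier B"
    "\<And>y s. y \<in> carrier B \<Longrightarrow> s \<in> S \<Longrightarrow> c y s \<in> carrier k"
    "\<And>y. y \<in> carrier B \<Longrightarrow> y = (\<Oplus>\<^bsub>B\<^esub>s\<in>S. c y s \<odot>\<^bsub>B\<^esub> s)"
    "\<And>z s. z \<in> carrier AB \<Longrightarrow> s \<in> S \<Longrightarrow> \<kappa> z s \<in> carrier A"
    "\<And>u v s. u \<in> carrier AB \<Longrightarrow> v \<in> carrier AB \<Longrightarrow> s \<in> S \<Longrightarrow> \<kappa> (u \<oplus>\<^bsub>AB\<^esub> v) s = \<kappa> u s \<oplus> \<kappa> v s"
    "\<And>x z s. x \<in> carrier A \<Longrightarrow> z \<in> carrier AB \<Longrightarrow> s \<in> S \<Longrightarrow> \<kappa> (t x \<one>\<^bsub>B\<^esub> \<otimes>\<^bsub>AB\<^esub> z) s = x \<otimes> \<kappa> z s"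
    "\<And>x z s. x \<in> carrier A \<Longrightarrow> z \<in> carrier AB \<Longrightarrow> s \<in> S \<Longrightarrow> \<kappa> (z \<otimes>\<^bsub>AB\<^esub> t x \<one>\<^bsub>B\<^esub>) s = \<kappa> z s \<otimes> x"
    "\<And>z. z \<in> carrier AB \<Longrightarrow> z = (\<Oplus>\<^bsub>AB\<^esub>s\<in>S. t (\<kappa> z s) s)"
    "\<And>x y s. x \<in> carrier A \<Longrightarrow> y \<in> carrier B \<Longrightarrow> s \<in> S \<Longrightarrow> \<kappa> (t x y) s = c y s \<odot> x"
proof -
  obtain T where T: "finite T" "T \<subseteq> carrier B" "carrier B \<subseteq> lin_span k B T"
    using assms unfolding finite_dim_algebra_iff_lin_span[OF B.k_alg_axioms] by blast
  obtain S c where S: "finite S" "S \<subseteq> carrier B"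
    and cC: "\<And>x s. x \<in> carrier B \<Longrightarrow> s \<in> S \<Longrightarrow> c x s \<in> carrier k"
    and exp: "\<And>x. x \<in> carrier B \<Longrightarrow> x = (\<Oplus>\<^bsub>B\<^esub>s\<in>S. c x s \<odot>\<^bsub>B\<^esub> s)"
    and uniq: "\<And>b s. (\<And>t. t \<in> S \<Longrightarrow> b t \<in> carrier k) \<Longrightarrow> s \<in> S \<Longrightarrow> c (\<Oplus>\<^bsub>B\<^esub>s\<in>S. b s \<odot>\<^bsub>B\<^esub> s) s = b s"
    using ex_coordinates[OF B.field B.M.module_axioms T] by blast
  have SC: "s \<in> carrier B" if "s \<in> S" for s using that S by auto
  have uniq': "c y s = b s" if "\<And>t. t \<in> S \<Longrightarrow> b t \<in> carrier k" "s \<in> S" "y = (\<Oplus>\<^bsub>B\<^esub>s\<in>S. b s \<odot>\<^bsub>B\<^esub> s)" for y b s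
    unfolding that(3) by (rule uniq[OF that(1,2)])
  have c_add: "c (x \<oplus>\<^bsub>B\<^esub> y) s = c x s \<oplus>\<^bsub>k\<^esub> c y s" if x: "x \<in> carrier B" and y: "y \<in> carrier B" and s: "s \<in> S" for x y s
  proof (rule uniq'[OF _ s])
    have "(\<Oplus>\<^bsub>B\<^esub>s\<in>S. (c x s \<oplus>\<^bsub>k\<^esub> c y s) \<odot>\<^bsub>B\<^esub> s) = (\<Oplus>\<^bsub>B\<^esub>s\<in>S. c x s \<odot>\<^bsub>B\<^esub> s \<oplus>\<^bsub>B\<^esub> c y s \<odot>\<^bsub>B\<^esub> s)"
      by (rule B.finsum_cong') (use x y cC SC in \<open>auto simp: B.M.smult_l_distr\<close>)
    also have "\<dots> = (\<Oplus>\<^bsub>B\<^esub>s\<in>S. c x s \<odot>\<^bsub>B\<^esub> s) \<oplus>\<^bsub>B\<^esub> (\<Oplus>\<^bsub>B\<^esub>s\<in>S. c y s \<odot>\<^bsub>B\<^esub> s)"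
      by (rule B.finsum_addf) (use x y cC SC in auto)
    finally show "x \<oplus>\<^bsub>B\<^esub> y = (\<Oplus>\<^bsub>B\<^esub>s\<in>S. (c x s \<oplus>\<^bsub>k\<^esub> c y s) \<odot>\<^bsub>B\<^esub> s)"
      unfolding exp[OF x, symmetric] exp[OF y, symmetric] by simp
  qed (use x y cC in auto)
  have c_smult: "c (r \<odot>\<^bsub>B\<^esub> x) s = r \<otimes>\<^bsub>k\<^esub> c x s" if r: "r \<in> carrier k" and x: "x \<in> carrier B" and s: "s \<in> S" for r x s
  proof (rule uniq'[OF _ s])
    have "(\<Oplus>\<^bsub>B\<^esub>s\<in>S. (r \<otimes>\<^bsub>k\<^esub> c x s) \<odot>\<^bsub>B\<^esub> s) = (\<Oplus>\<^bsub>B\<^esub>s\<in>S. r \<odot>\<^bsub>B\<^esub> (c x s \<odot>\<^bsub>B\<^esub> s))"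
      by (rule B.finsum_cong') (use r x cC SC in \<open>auto simp: B.M.smult_assoc1\<close>)
    also have "\<dots> = r \<odot>\<^bsub>B\<^esub> (\<Oplus>\<^bsub>B\<^esub>s\<in>S. c x s \<odot>\<^bsub>B\<^esub> s)"
      by (rule B.M.finsum_smult_ldistr[symmetric]) (use S r x cC SC in auto)
    finally show "r \<odot>\<^bsub>B\<^esub> x = (\<Oplus>\<^bsub>B\<^esub>s\<in>S. (r \<otimes>\<^bsub>k\<^esub> c x s) \<odot>\<^bsub>B\<^esub> s)"
      unfolding exp[OF x, symmetric] by simp
  qed (use r x cC in auto)
  have c_zero: "c \<zero>\<^bsub>B\<^esub> s = \<zero>\<^bsub>k\<^esub>" if "s \<in> S" for s
    using c_smult[OF A.K.zero_closed B.zero_closed that] cC[OF B.zero_closed that] by simp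
  have c_sum: "c (\<Oplus>\<^bsub>B\<^esub>i\<in>I. f i) s = (\<Oplus>\<^bsub>k\<^esub>i\<in>I. c (f i) s)" if "\<And>i. i \<in> I \<Longrightarrow> f i \<in> carrier B" "s \<in> S" for I f s
    using that by (induction I rule: infinite_finite_induct)
      (simp_all add: c_zero c_add cC Pi_iff B.finsum_closed)
  have c_S: "c u s = (if s = u then \<one>\<^bsub>k\<^esub> else \<zero>\<^bsub>k\<^esub>)" if u: "u \<in> S" and s: "s \<in> S" for u s
  proof (rule uniq'[OF _ s])
    have "(\<Oplus>\<^bsub>B\<^esub>s\<in>S. (if s = u then \<one>\<^bsub>k\<^esub> else \<zero>\<^bsub>k\<^esub>) \<odot>\<^bsub>B\<^esub> s) = (\<Oplus>\<^bsub>B\<^esub>s\<in>S. if u = s then s else \<zero>\<^bsub>B\<^esub>)"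
      by (rule B.finsum_cong') (use SC in auto)
    also have "\<dots> = u" by (rule B.add.finprod_singleton) (use S u SC in auto)
    finally show "u = (\<Oplus>\<^bsub>B\<^esub>s\<in>S. (if s = u then \<one>\<^bsub>k\<^esub> else \<zero>\<^bsub>k\<^esub>) \<odot>\<^bsub>B\<^esub> s)" by simp
  qed auto
  \<comment> \<open>The matrix of left multiplication by \<open>y\<close>, applied to the coordinate
    vector of the other factor. It gives multiplicativity of \<open>\<phi>\<close> and the value of
    \<open>\<kappa>\<close> on pure tensors.\<close>
  have c_mult: "c (y \<otimes>\<^bsub>B\<^esub> y') s = (\<Oplus>\<^bsub>k\<^esub>v\<in>S. c (y \<otimes>\<^bsub>B\<^esub> v) s \<otimes>\<^bsub>k\<^esub> c y' v)"
    if y: "y \<in> carrier B" and y': "y' \<in> carrier B" and s: "s \<in> S" for y y' s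
  proof -
    have "y \<otimes>\<^bsub>B\<^esub> y' = (\<Oplus>\<^bsub>B\<^esub>v\<in>S. y \<otimes>\<^bsub>B\<^esub> (c y' v \<odot>\<^bsub>B\<^esub> v))"
      by (subst exp[OF y'], rule B.finsum_rdistr) (use S y y' cC SC in auto)
    then have "c (y \<otimes>\<^bsub>B\<^esub> y') s = (\<Oplus>\<^bsub>k\<^esub>v\<in>S. c (y \<otimes>\<^bsub>B\<^esub> (c y' v \<odot>\<^bsub>B\<^esub> v)) s)"
      using y y' cC SC s by (simp add: c_sum)
    also have "\<dots> = (\<Oplus>\<^bsub>k\<^esub>v\<in>S. c (y \<otimes>\<^bsub>B\<^esub> v) s \<otimes>\<^bsub>k\<^esub> c y' v)"
      by (rule A.K.finsum_cong')
        (use y y' cC SC s in \<open>auto simp: B.smult_mult_r c_smult A.K.m_comm\<close>)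
    finally show ?thesis .
  qed
  interpret MA: mat_alg k A S using S by unfold_locales
  \<comment> \<open>The matrix of left multiplication by \<open>y\<close> in the basis
    \<open>S\<close>, scaled by \<open>x\<close>.\<close>
  define \<phi> where "\<phi> x y = (\<lambda>(s, u)\<in>S \<times> S. c (y \<otimes>\<^bsub>B\<^esub> u) s \<odot> x)" for x y
  have \<phi>_at: "\<phi> x y (s, u) = c (y \<otimes>\<^bsub>B\<^esub> u) s \<odot> x" if "s \<in> S" "u \<in> S" for x y s u
    using that by (simp add: \<phi>_def)
  have \<phi>_cl: "\<phi> x y \<in> carrier (mat S A)" if "x \<in> carrier A" "y \<in> carrier B" for x y
    using that cC SC by (auto simp: \<phi>_def MA.F.carrier)
  note cC' = cC[OF B.m_closed[OF _ SC]]
  obtain h where h: "h \<in> alg_hom k AB (mat S A)" "\<And>x y. x \<in> carrier A \<Longrightarrow> y \<in> carrier B \<Longrightarrow> h (t x y) = \<phi> x y"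
  proof (rule tensor_lift[OF MA.mat_k_alg, of \<phi>])
    fix x x' y assume "x \<in> carrier A" "x' \<in> carrier A" "y \<in> carrier B"
    then show "\<phi> (x \<oplus> x') y = \<phi> x y \<oplus>\<^bsub>mat S A\<^esub> \<phi> x' y"
      by (intro MA.mat_eqI) (auto simp: \<phi>_cl \<phi>_at MA.F.at A.M.smult_r_distr cC')
  next
    fix x y y' assume "x \<in> carrier A" "y \<in> carrier B" "y' \<in> carrier B"
    then show "\<phi> x (y \<oplus>\<^bsub>B\<^esub> y') = \<phi> x y \<oplus>\<^bsub>mat S A\<^esub> \<phi> x y'"
      by (intro MA.mat_eqI) (auto simp: \<phi>_cl \<phi>_at MA.F.at A.M.smult_l_distr cC' B.l_distr c_add SC)
  next
    fix r x y assume "r \<in> carrier k" "x \<in> carrier A" "y \<in> carrier B"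
    then show "\<phi> (r \<odot> x) y = r \<odot>\<^bsub>mat S A\<^esub> \<phi> x y" "\<phi> x (r \<odot>\<^bsub>B\<^esub> y) = r \<odot>\<^bsub>mat S A\<^esub> \<phi> x y"
      by (intro MA.mat_eqI; simp add: \<phi>_cl \<phi>_at MA.F.at A.M.smult_assoc1[symmetric] cC' A.K.m_comm
         B.smult_mult_l c_smult SC)+
  next
    show "\<phi> \<one> \<one>\<^bsub>B\<^esub> = \<one>\<^bsub>mat S A\<^esub>"
      by (intro MA.mat_eqI) (auto simp: \<phi>_cl \<phi>_at mat_one SC c_S)
  next
    fix x y x' y' assume *: "x \<in> carrier A" "y \<in> carrier B" "x' \<in> carrier A" "y' \<in> carrier B"
    show "\<phi> (x \<otimes> x') (y \<otimes>\<^bsub>B\<^esub> y') = \<phi> x y \<otimes>\<^bsub>mat S A\<^esub> \<phi> x' y'"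
    proof (rule MA.mat_eqI)
      fix s u assume su: "s \<in> S" "u \<in> S"
      have "(\<phi> x y \<otimes>\<^bsub>mat S A\<^esub> \<phi> x' y') (s, u) = (\<Oplus>v\<in>S. \<phi> x y (s, v) \<otimes> \<phi> x' y' (v, u))"
        by (rule mat_mult[OF su])
      also have "\<dots> = (\<Oplus>v\<in>S. (c (y \<otimes>\<^bsub>B\<^esub> v) s \<otimes>\<^bsub>k\<^esub> c (y' \<otimes>\<^bsub>B\<^esub> u) v) \<odot> (x \<otimes> x'))"
        by (rule A.finsum_cong')
          (use * su cC' SC in \<open>auto simp: \<phi>_at A.smult_mult_l A.smult_mult_r A.M.smult_assoc1[symmetric] A.K.m_comm\<close>)
      also have "\<dots> = (\<Oplus>\<^bsub>k\<^esub>v\<in>S. c (y \<otimes>\<^bsub>B\<^esub> v) s \<otimes>\<^bsub>k\<^esub> c (y' \<otimes>\<^bsub>B\<^esub> u) v) \<odot> (x \<otimes> x')"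
        by (rule A.M.finsum_smult_rdistr[symmetric]) (use * su cC' in auto)
      also have "\<dots> = \<phi> (x \<otimes> x') (y \<otimes>\<^bsub>B\<^esub> y') (s, u)"
        using * su SC by (simp add: \<phi>_at B.m_assoc c_mult[symmetric])
      finally show "\<phi> (x \<otimes> x') (y \<otimes>\<^bsub>B\<^esub> y') (s, u) = (\<phi> x y \<otimes>\<^bsub>mat S A\<^esub> \<phi> x' y') (s, u)" by simp
    qed (use * \<phi>_cl in auto)
  qed (use \<phi>_cl in auto)
  note hD = alg_homD[OF h(1)]
  have h_at: "h z (s, u) \<in> carrier A" if "z \<in> carrier AB" "s \<in> S" "u \<in> S" for z s u
    by (rule MA.mat_entry[OF hD(1)[OF that(1)] that(2,3)])
  \<comment> \<open>The matrix of \<open>z\<close> applied to the coordinate vector of the unit of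
    \<open>B\<close>.\<close>
  define \<kappa> where "\<kappa> z s = (\<Oplus>u\<in>S. c \<one>\<^bsub>B\<^esub> u \<odot> h z (s, u))" for z s
  have c1: "c \<one>\<^bsub>B\<^esub> u \<in> carrier k" if "u \<in> S" for u by (rule cC[OF B.one_closed that])
  have \<kappa>_cl: "\<kappa> z s \<in> carrier A" if "z \<in> carrier AB" "s \<in> S" for z s
    unfolding \<kappa>_def by (rule A.finsum_closed) (use that h_at c1 in auto)
  have \<kappa>_add: "\<kappa> (u \<oplus>\<^bsub>AB\<^esub> v) s = \<kappa> u s \<oplus> \<kappa> v s" if "u \<in> carrier AB" "v \<in> carrier AB" "s \<in> S" for u v s
  proof -
    have "\<kappa> (u \<oplus>\<^bsub>AB\<^esub> v) s = (\<Oplus>w\<in>S. c \<one>\<^bsub>B\<^esub> w \<odot> h u (s, w) \<oplus> c \<one>\<^bsub>B\<^esub> w \<odot> h v (s, w))"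
      unfolding \<kappa>_def by (rule A.finsum_cong')
        (use that h_at c1 in \<open>auto simp: hD MA.F.at A.M.smult_r_distr\<close>)
    also have "\<dots> = \<kappa> u s \<oplus> \<kappa> v s"
      unfolding \<kappa>_def by (rule A.finsum_addf) (use that h_at c1 in auto)
    finally show ?thesis .
  qed
  have \<kappa>_smult: "\<kappa> (r \<odot>\<^bsub>AB\<^esub> u) s = r \<odot> \<kappa> u s" if "r \<in> carrier k" "u \<in> carrier AB" "s \<in> S" for r u s
  proof -
    have "\<kappa> (r \<odot>\<^bsub>AB\<^esub> u) s = (\<Oplus>w\<in>S. r \<odot> (c \<one>\<^bsub>B\<^esub> w \<odot> h u (s, w)))"
      unfolding \<kappa>_def by (rule A.finsum_cong')
        (use that h_at c1 in \<open>auto simp: hD MA.F.at A.M.smult_assoc1[symmetric] A.K.m_comm\<close>)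
    also have "\<dots> = r \<odot> \<kappa> u s"
      unfolding \<kappa>_def by (rule A.M.finsum_smult_ldistr[symmetric]) (use that S h_at c1 in auto)
    finally show ?thesis .
  qed
  have \<kappa>_zero: "\<kappa> \<zero>\<^bsub>AB\<^esub> s = \<zero>" if "s \<in> S" for s
    using \<kappa>_smult[OF A.K.zero_closed AB.zero_closed that] \<kappa>_cl[OF AB.zero_closed that] by simp
  have \<kappa>_t: "\<kappa> (t x y) s = c y s \<odot> x" if x: "x \<in> carrier A" and y: "y \<in> carrier B" and s: "s \<in> S" for x y s
  proof -
    have "\<kappa> (t x y) s = (\<Oplus>u\<in>S. (c (y \<otimes>\<^bsub>B\<^esub> u) s \<otimes>\<^bsub>k\<^esub> c \<one>\<^bsub>B\<^esub> u) \<odot> x)"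
      unfolding \<kappa>_def
      by (rule A.finsum_cong') (use x y s c1 cC' in \<open>auto simp: h(2) \<phi>_at A.M.smult_assoc1[symmetric] A.K.m_comm\<close>)
    also have "\<dots> = (\<Oplus>\<^bsub>k\<^esub>u\<in>S. c (y \<otimes>\<^bsub>B\<^esub> u) s \<otimes>\<^bsub>k\<^esub> c \<one>\<^bsub>B\<^esub> u) \<odot> x"
      by (rule A.M.finsum_smult_rdistr[symmetric]) (use x y s c1 cC' in auto)
    also have "\<dots> = c y s \<odot> x" using c_mult[OF y B.one_closed s] y by simp
    finally show ?thesis .
  qed
  have \<kappa>_l: "\<kappa> (t x \<one>\<^bsub>B\<^esub> \<otimes>\<^bsub>AB\<^esub> z) s = x \<otimes> \<kappa> z s"
    if x: "x \<in> carrier A" and z: "z \<in> carrier AB" and s: "s \<in> S" for x z s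
    using z
  proof (induction rule: t_induct)
    case (tens x' y)
    then show ?case using x s cC by (simp add: t_mult \<kappa>_t A.smult_mult_r)
  qed (use x s t_closed[OF x B.one_closed] \<kappa>_cl[OF _ s] in
      \<open>simp_all add: \<kappa>_zero \<kappa>_add \<kappa>_smult AB.r_distr A.r_distr AB.smult_mult_r A.smult_mult_r\<close>)
  have \<kappa>_r: "\<kappa> (z \<otimes>\<^bsub>AB\<^esub> t x \<one>\<^bsub>B\<^esub>) s = \<kappa> z s \<otimes> x"
    if x: "x \<in> carrier A" and z: "z \<in> carrier AB" and s: "s \<in> S" for x z s
    using z
  proof (induction rule: t_induct)
    case (tens x' y)
    then show ?case using x s cC by (simp add: t_mult \<kappa>_t A.smult_mult_l)
  qed (use x s t_closed[OF x B.one_closed] \<kappa>_cl[OF _ s] in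
      \<open>simp_all add: \<kappa>_zero \<kappa>_add \<kappa>_smult AB.l_distr A.l_distr AB.smult_mult_l A.smult_mult_l\<close>)
  have \<kappa>_exp: "z = (\<Oplus>\<^bsub>AB\<^esub>s\<in>S. t (\<kappa> z s) s)" if "z \<in> carrier AB" for z
    using that
  proof (induction rule: t_induct)
    case zero
    have "(\<Oplus>\<^bsub>AB\<^esub>s\<in>S. t (\<kappa> \<zero>\<^bsub>AB\<^esub> s) s) = (\<Oplus>\<^bsub>AB\<^esub>s\<in>S. \<zero>\<^bsub>AB\<^esub>)"
      by (rule AB.finsum_cong') (simp_all add: \<kappa>_zero t_zero_l SC)
    then show ?case by simp
  next
    case (add u v)
    have "(\<Oplus>\<^bsub>AB\<^esub>s\<in>S. t (\<kappa> (u \<oplus>\<^bsub>AB\<^esub> v) s) s) = (\<Oplus>\<^bsub>AB\<^esub>s\<in>S. t (\<kappa> u s) s \<oplus>\<^bsub>AB\<^esub> t (\<kappa> v s) s)"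
      by (rule AB.finsum_cong') (use add(1,2) in \<open>simp_all add: \<kappa>_add t_add_l SC \<kappa>_cl t_closed\<close>)
    also have "\<dots> = (\<Oplus>\<^bsub>AB\<^esub>s\<in>S. t (\<kappa> u s) s) \<oplus>\<^bsub>AB\<^esub> (\<Oplus>\<^bsub>AB\<^esub>s\<in>S. t (\<kappa> v s) s)"
      by (rule AB.finsum_addf) (use add(1,2) in \<open>simp_all add: SC \<kappa>_cl t_closed\<close>)
    finally show ?case using add(3,4) by simp
  next
    case (smult r u)
    have "(\<Oplus>\<^bsub>AB\<^esub>s\<in>S. t (\<kappa> (r \<odot>\<^bsub>AB\<^esub> u) s) s) = (\<Oplus>\<^bsub>AB\<^esub>s\<in>S. r \<odot>\<^bsub>AB\<^esub> t (\<kappa> u s) s)"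
      by (rule AB.finsum_cong') (use smult(1,2) in \<open>simp_all add: \<kappa>_smult t_smult_l SC \<kappa>_cl t_closed\<close>)
    also have "\<dots> = r \<odot>\<^bsub>AB\<^esub> (\<Oplus>\<^bsub>AB\<^esub>s\<in>S. t (\<kappa> u s) s)"
      by (rule AB.M.finsum_smult_ldistr[symmetric]) (use S smult(1,2) in \<open>simp_all add: SC \<kappa>_cl t_closed\<close>)
    finally show ?case using smult(3) by simp
  next
    case (tens x y)
    have "(\<Oplus>\<^bsub>AB\<^esub>s\<in>S. t (\<kappa> (t x y) s) s) = (\<Oplus>\<^bsub>AB\<^esub>s\<in>S. t x (c y s \<odot>\<^bsub>B\<^esub> s))"
      by (rule AB.finsum_cong') (use tens in \<open>simp_all add: \<kappa>_t t_smult_l t_smult_r SC cC t_closed\<close>)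
    also have "\<dots> = t x (\<Oplus>\<^bsub>B\<^esub>s\<in>S. c y s \<odot>\<^bsub>B\<^esub> s)"
      by (rule t_finsum_r[symmetric]) (use tens in \<open>simp_all add: SC cC\<close>)
    finally show ?case using exp[OF tens(2)] by simp
  qed
  show thesis
    by (rule that[OF S cC exp \<kappa>_cl \<kappa>_add \<kappa>_l \<kappa>_r \<kappa>_exp \<kappa>_t])
qed

lemma tensor_finite_dim:
  assumes "finite_dim_algebra k A" "finite_dim_algebra k B"
  shows "finite_dim_algebra k AB"
proof -
  obtain S where S: "finite S" "S \<subseteq> carrier A" "carrier A \<subseteq> lin_span k A S"
    using assms(1) unfolding finite_dim_algebra_iff_lin_span[OF A.k_alg_axioms] by blast
  obtain T where T: "finite T" "T \<subseteq> carrier B" "carrier B \<subseteq> lin_span k B T"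
    using assms(2) unfolding finite_dim_algebra_iff_lin_span[OF B.k_alg_axioms] by blast
  let ?U = "(\<lambda>(x, y). t x y) ` (S \<times> T)"
  have SC: "\<And>s. s \<in> S \<Longrightarrow> s \<in> carrier A" "\<And>s. s \<in> T \<Longrightarrow> s \<in> carrier B" using S T by auto
  have U: "?U \<subseteq> carrier AB" using SC t_closed by auto
  note span_intros = lin_span.zero AB.M.lin_span_add[OF U] AB.M.lin_span_smult[OF U]
  have 1: "t x y \<in> lin_span k AB ?U" if x: "x \<in> S" and y: "y \<in> carrier B" for x y
    using subsetD[OF T(3) y] T(2)
  proof (induction rule: B.M.lin_span_induct)
    case (base s)
    then show ?case using x by (intro AB.M.lin_span_base[OF U]) auto
  qed (use SC x in \<open>simp_all add: t_zero_r t_add_r t_smult_r span_intros\<close>)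
  have 2: "t x y \<in> lin_span k AB ?U" if x: "x \<in> carrier A" and y: "y \<in> carrier B" for x y
    using subsetD[OF S(3) x] S(2)
    by (induction rule: A.M.lin_span_induct)
      (use 1 y in \<open>simp_all add: t_zero_l t_add_l t_smult_l span_intros\<close>)
  have "z \<in> lin_span k AB ?U" if "z \<in> carrier AB" for z
    using that by (induction rule: t_induct) (use 2 in \<open>simp_all add: span_intros\<close>)
  then have "carrier AB \<subseteq> lin_span k AB ?U" by (rule subsetI)
  then show ?thesis unfolding finite_dim_algebra_iff_lin_span[OF AB.k_alg_axioms]
    using U S(1) T(1) by (intro exI[of _ ?U]) simp
qed

text \<open>An element whose coordinates commute with \<open>A\<close> has scalar coordinates and so
  lies in the copy of \<open>B\<close>; there the centre and the ideals of \<open>B\<close> decide.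
  In a nonzero ideal such an element is found by minimality: among the elements with fewest nonzero
  coordinates one can, as \<open>A\<close> is simple, choose one with a coordinate equal to
  \<open>\<one>\<close>. Its commutators with \<open>A\<close> lose that coordinate and must
  vanish.\<close>

theorem tensor_csa:
  assumes csaA: "central_simple_algebra k A" and csaB: "central_simple_algebra k B"
  shows "central_simple_algebra k AB"
proof -
  note A1 = csa_one_not_zero[OF A.field csaA] and B1 = csa_one_not_zero[OF A.field csaB]
  obtain S c \<kappa> where S: "finite S" "S \<subseteq> carrier B"
    and cC: "\<And>y s. y \<in> carrier B \<Longrightarrow> s \<in> S \<Longrightarrow> c y s \<in> carrier k"
    and c: "\<And>y. y \<in> carrier B \<Longrightarrow> y = (\<Oplus>\<^bsub>B\<^esub>s\<in>S. c y s \<odot>\<^bsub>B\<^esub> s)"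
    and \<kappa>C: "\<And>z s. z \<in> carrier AB \<Longrightarrow> s \<in> S \<Longrightarrow> \<kappa> z s \<in> carrier A"
    and \<kappa>_add: "\<And>u v s. u \<in> carrier AB \<Longrightarrow> v \<in> carrier AB \<Longrightarrow> s \<in> S \<Longrightarrow> \<kappa> (u \<oplus>\<^bsub>AB\<^esub> v) s = \<kappa> u s \<oplus> \<kappa> v s"
    and \<kappa>_l: "\<And>x z s. x \<in> carrier A \<Longrightarrow> z \<in> carrier AB \<Longrightarrow> s \<in> S \<Longrightarrow> \<kappa> (t x \<one>\<^bsub>B\<^esub> \<otimes>\<^bsub>AB\<^esub> z) s = x \<otimes> \<kappa> z s"
    and \<kappa>_r: "\<And>x z s. x \<in> carrier A \<Longrightarrow> z \<in> carrier AB \<Longrightarrow> s \<in> S \<Longrightarrow> \<kappa> (z \<otimes>\<^bsub>AB\<^esub> t x \<one>\<^bsub>B\<^esub>) s = \<kappa> z s \<otimes> x"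
    and \<kappa>: "\<And>z. z \<in> carrier AB \<Longrightarrow> z = (\<Oplus>\<^bsub>AB\<^esub>s\<in>S. t (\<kappa> z s) s)"
    and \<kappa>_t: "\<And>x y s. x \<in> carrier A \<Longrightarrow> y \<in> carrier B \<Longrightarrow> s \<in> S \<Longrightarrow> \<kappa> (t x y) s = c y s \<odot> x"
    using tensor_coordinates[OF csa_finite_dim[OF A.field csaB]] by blast
  have SC: "\<And>s. s \<in> S \<Longrightarrow> s \<in> carrier B" using S by auto
  have inj: "y = \<zero>\<^bsub>B\<^esub>" if y: "y \<in> carrier B" and 0: "t \<one> y = \<zero>\<^bsub>AB\<^esub>" for y
  proof -
    have "c y s = \<zero>\<^bsub>k\<^esub>" if s: "s \<in> S" for s
    proof (rule A.smult_one_eq_zero[OF A1 cC[OF y s]])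
      have "c y s \<odot> \<one> = \<kappa> (t \<zero> y) s"
        using \<kappa>_t[OF A.one_closed y s] y by (simp add: 0 t_zero_l)
      also have "\<dots> = \<zero>" using cC[OF y s] by (simp add: \<kappa>_t[OF A.zero_closed y s])
      finally show "c y s \<odot> \<one> = \<zero>" .
    qed
    then have "(\<Oplus>\<^bsub>B\<^esub>s\<in>S. c y s \<odot>\<^bsub>B\<^esub> s) = (\<Oplus>\<^bsub>B\<^esub>s\<in>S. \<zero>\<^bsub>B\<^esub>)"
      by (intro B.finsum_cong') (simp_all add: SC)
    then show ?thesis using c[OF y] by simp
  qed
  \<comment> \<open>The coordinates are scalars because \<open>A\<close> is central; they can be
    moved to the second factor and summed there.\<close>
  have central: "\<exists>b\<in>carrier B. z = t \<one> b"
    if z: "z \<in> carrier AB" and comm: "\<And>s x. s \<in> S \<Longrightarrow> x \<in> carrier A \<Longrightarrow> \<kappa> z s \<otimes> x = x \<otimes> \<kappa> z s" for z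
  proof -
    have "\<forall>s\<in>S. \<exists>r. r \<in> carrier k \<and> \<kappa> z s = r \<odot> \<one>"
      using csa_center[OF A.field csaA \<kappa>C[OF z] comm] by blast
    then obtain r where r: "\<And>s. s \<in> S \<Longrightarrow> r s \<in> carrier k" "\<And>s. s \<in> S \<Longrightarrow> \<kappa> z s = r s \<odot> \<one>" by metis
    have "z = (\<Oplus>\<^bsub>AB\<^esub>s\<in>S. t (\<kappa> z s) s)" by (rule \<kappa>[OF z])
    also have "\<dots> = (\<Oplus>\<^bsub>AB\<^esub>s\<in>S. t \<one> (r s \<odot>\<^bsub>B\<^esub> s))"
      by (rule AB.finsum_cong') (simp_all add: r SC t_closed t_smult_l t_smult_r)
    also have "\<dots> = t \<one> (\<Oplus>\<^bsub>B\<^esub>s\<in>S. r s \<odot>\<^bsub>B\<^esub> s)"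
      by (rule t_finsum_r[symmetric]) (simp_all add: r SC)
    finally show ?thesis by (rule bexI) (simp add: B.finsum_closed Pi_iff r SC)
  qed
  have 1: "finite_dim_algebra k AB"
    by (rule tensor_finite_dim[OF csa_finite_dim[OF A.field csaA] csa_finite_dim[OF A.field csaB]])
  have 2: "\<exists>r\<in>carrier k. z = r \<odot>\<^bsub>AB\<^esub> \<one>\<^bsub>AB\<^esub>"
    if z: "z \<in> carrier AB" and comm: "\<And>w. w \<in> carrier AB \<Longrightarrow> z \<otimes>\<^bsub>AB\<^esub> w = w \<otimes>\<^bsub>AB\<^esub> z" for z
  proof -
    obtain b where b: "b \<in> carrier B" "z = t \<one> b"
      using central[OF z] \<kappa>_l[OF _ z] \<kappa>_r[OF _ z] comm[OF t_closed[OF _ B.one_closed]] by force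
    have "b \<otimes>\<^bsub>B\<^esub> y = y \<otimes>\<^bsub>B\<^esub> b" if y: "y \<in> carrier B" for y
    proof -
      have "t \<one> (b \<otimes>\<^bsub>B\<^esub> y) = t \<one> (y \<otimes>\<^bsub>B\<^esub> b)"
        using comm[OF t_closed[OF A.one_closed y]] b y by (simp add: t_mult)
      moreover have "t \<one> (b \<otimes>\<^bsub>B\<^esub> y \<ominus>\<^bsub>B\<^esub> y \<otimes>\<^bsub>B\<^esub> b) = t \<one> (b \<otimes>\<^bsub>B\<^esub> y) \<oplus>\<^bsub>AB\<^esub> t \<one> ((\<ominus>\<^bsub>k\<^esub> \<one>\<^bsub>k\<^esub>) \<odot>\<^bsub>B\<^esub> (y \<otimes>\<^bsub>B\<^esub> b))"
        using b y by (simp add: B.minus_eq t_add_r B.M.smult_l_minus)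
      moreover have "t \<one> ((\<ominus>\<^bsub>k\<^esub> \<one>\<^bsub>k\<^esub>) \<odot>\<^bsub>B\<^esub> (y \<otimes>\<^bsub>B\<^esub> b)) = \<ominus>\<^bsub>AB\<^esub> t \<one> (y \<otimes>\<^bsub>B\<^esub> b)"
        using b y t_closed by (simp add: t_smult_r AB.M.smult_l_minus del: B.M.smult_l_minus)
      ultimately have "t \<one> (b \<otimes>\<^bsub>B\<^esub> y \<ominus>\<^bsub>B\<^esub> y \<otimes>\<^bsub>B\<^esub> b) = \<zero>\<^bsub>AB\<^esub>"
        using b y t_closed by (simp add: AB.r_neg)
      then have "b \<otimes>\<^bsub>B\<^esub> y \<ominus>\<^bsub>B\<^esub> y \<otimes>\<^bsub>B\<^esub> b = \<zero>\<^bsub>B\<^esub>" using b y by (intro inj) auto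
      then show ?thesis using b y by simp
    qed
    then obtain r where r: "r \<in> carrier k" "b = r \<odot>\<^bsub>B\<^esub> \<one>\<^bsub>B\<^esub>"
      using csa_center[OF A.field csaB b(1)] by auto
    then show ?thesis using b(2) by (auto simp: t_smult_r t_one)
  qed
  have 3: "\<one>\<^bsub>AB\<^esub> \<noteq> \<zero>\<^bsub>AB\<^esub>"
    using inj[OF B.one_closed] B1 by (auto simp: t_one)
  have 4: "\<one>\<^bsub>AB\<^esub> \<in> J" if J: "ideal J AB" and x: "x \<in> J" "x \<noteq> \<zero>\<^bsub>AB\<^esub>" for J x
  proof -
    interpret J: ideal J AB by fact
    define supp where "supp z = {s \<in> S. \<kappa> z s \<noteq> \<zero>}" for z
    obtain z where z: "z \<in> J" "z \<noteq> \<zero>\<^bsub>AB\<^esub>"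
      and min: "\<And>w. w \<in> J \<Longrightarrow> w \<noteq> \<zero>\<^bsub>AB\<^esub> \<Longrightarrow> card (supp z) \<le> card (supp w)"
      using ex_has_least_nat[of "\<lambda>z. z \<in> J \<and> z \<noteq> \<zero>\<^bsub>AB\<^esub>" x "\<lambda>z. card (supp z)"] x by blast
    have zC: "z \<in> carrier AB" using z J.Icarr by blast
    have "supp z \<noteq> {}"
    proof
      assume "supp z = {}"
      then have "\<kappa> z s = \<zero>" if "s \<in> S" for s using that by (auto simp: supp_def)
      then have "(\<Oplus>\<^bsub>AB\<^esub>s\<in>S. t (\<kappa> z s) s) = (\<Oplus>\<^bsub>AB\<^esub>s\<in>S. \<zero>\<^bsub>AB\<^esub>)"
        by (intro AB.finsum_cong') (simp_all add: SC t_zero_l)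
      then show False using \<kappa>[OF zC] z(2) by simp
    qed
    then obtain s0 where s0: "s0 \<in> S" "\<kappa> z s0 \<noteq> \<zero>" by (auto simp: supp_def)
    \<comment> \<open>The values at \<open>s0\<close> of those elements of \<open>J\<close> whose
      support lies inside that of \<open>z\<close>. They form an ideal of \<open>A\<close>
      containing the nonzero element \<open>\<kappa> z s0\<close>.\<close>
    define I where "I = {\<kappa> w s0 | w. w \<in> J \<and> (\<forall>s\<in>S. \<kappa> z s = \<zero> \<longrightarrow> \<kappa> w s = \<zero>)}"
    have IE: "\<exists>w. w \<in> J \<and> w \<in> carrier AB \<and> a = \<kappa> w s0 \<and> (\<forall>s\<in>S. \<kappa> z s = \<zero> \<longrightarrow> \<kappa> w s = \<zero>)" if "a \<in> I" for a
      using that J.Icarr unfolding I_def by blast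
    have II: "\<kappa> w s0 \<in> I" if "w \<in> J" "\<And>s. s \<in> S \<Longrightarrow> \<kappa> z s = \<zero> \<Longrightarrow> \<kappa> w s = \<zero>" for w
      using that unfolding I_def by blast
    have IC: "I \<subseteq> carrier A" using IE \<kappa>C[OF _ s0(1)] by blast
    have Il: "x \<otimes> a \<in> I" "a \<otimes> x \<in> I" if a: "a \<in> I" and x: "x \<in> carrier A" for a x
    proof -
      obtain w where w: "w \<in> J" "w \<in> carrier AB" "a = \<kappa> w s0" "\<forall>s\<in>S. \<kappa> z s = \<zero> \<longrightarrow> \<kappa> w s = \<zero>"
        using IE[OF a] by blast
      have tx: "t x \<one>\<^bsub>B\<^esub> \<in> carrier AB" using x by (simp add: t_closed)
      have "\<kappa> (t x \<one>\<^bsub>B\<^esub> \<otimes>\<^bsub>AB\<^esub> w) s0 \<in> I"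
        by (rule II[OF J.I_l_closed[OF w(1) tx]]) (use w x in \<open>simp add: \<kappa>_l\<close>)
      then show "x \<otimes> a \<in> I" using w x s0 by (simp add: \<kappa>_l)
      have "\<kappa> (w \<otimes>\<^bsub>AB\<^esub> t x \<one>\<^bsub>B\<^esub>) s0 \<in> I"
        by (rule II[OF J.I_r_closed[OF w(1) tx]]) (use w x in \<open>simp add: \<kappa>_r\<close>)
      then show "a \<otimes> x \<in> I" using w x s0 by (simp add: \<kappa>_r)
    qed
    have "ideal I A"
    proof (rule idealI)
      show "subgroup I (add_monoid A)"
      proof (rule A.add.subgroupI[OF IC])
        show "I \<noteq> {}" using II[OF z(1)] by blast
        show "\<ominus> a \<in> I" if "a \<in> I" for a
          using Il(1)[OF that, of "\<ominus> \<one>"] that IC by (simp add: A.l_minus subset_iff)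
        show "a \<oplus> b \<in> I" if a: "a \<in> I" and b: "b \<in> I" for a b
        proof -
          obtain v where v: "v \<in> J" "v \<in> carrier AB" "a = \<kappa> v s0" "\<forall>s\<in>S. \<kappa> z s = \<zero> \<longrightarrow> \<kappa> v s = \<zero>"
            using IE[OF a] by blast
          obtain w where w: "w \<in> J" "w \<in> carrier AB" "b = \<kappa> w s0" "\<forall>s\<in>S. \<kappa> z s = \<zero> \<longrightarrow> \<kappa> w s = \<zero>"
            using IE[OF b] by blast
          have "\<kappa> (v \<oplus>\<^bsub>AB\<^esub> w) s0 \<in> I"
            by (rule II[OF J.a_closed[OF v(1) w(1)]]) (use v w in \<open>simp add: \<kappa>_add\<close>)
          then show ?thesis using v w s0 by (simp add: \<kappa>_add)
        qed
      qed
    qed (use Il A.ring_axioms in simp_all)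
    from csa_ideal[OF A.field csaA this _ s0(2)] II[OF z(1)] have "\<one> \<in> I" by blast
    then obtain w where w: "w \<in> J" "w \<in> carrier AB" "\<one> = \<kappa> w s0" "\<forall>s\<in>S. \<kappa> z s = \<zero> \<longrightarrow> \<kappa> w s = \<zero>"
      using IE by blast
    have comm: "\<kappa> w s \<otimes> x = x \<otimes> \<kappa> w s" if s: "s \<in> S" and x: "x \<in> carrier A" for s x
    proof -
      \<comment> \<open>The commutator of \<open>x\<close>, placed in the first factor, with
        \<open>w\<close>. At \<open>s0\<close> its coordinate is \<open>x\<close> minus
        \<open>x\<close>, so its support is strictly smaller than that of \<open>z\<close>, and
        minimality makes it zero.\<close>
      define u where "u = t x \<one>\<^bsub>B\<^esub> \<otimes>\<^bsub>AB\<^esub> w \<oplus>\<^bsub>AB\<^esub> w \<otimes>\<^bsub>AB\<^esub> t (\<ominus> x) \<one>\<^bsub>B\<^esub>"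
      have tx: "t x \<one>\<^bsub>B\<^esub> \<in> carrier AB" "t (\<ominus> x) \<one>\<^bsub>B\<^esub> \<in> carrier AB" using x by (simp_all add: t_closed)
      have uJ: "u \<in> J" unfolding u_def
        by (rule J.a_closed[OF J.I_l_closed[OF w(1) tx(1)] J.I_r_closed[OF w(1) tx(2)]])
      have \<kappa>u: "\<kappa> u s = x \<otimes> \<kappa> w s \<ominus> \<kappa> w s \<otimes> x" if "s \<in> S" for s
        using that w(2) x tx \<kappa>C[OF w(2) that]
        by (simp add: u_def \<kappa>_add \<kappa>_l \<kappa>_r A.minus_eq A.r_minus)
      have "u = \<zero>\<^bsub>AB\<^esub>"
      proof (rule ccontr)
        assume "u \<noteq> \<zero>\<^bsub>AB\<^esub>"
        then have le: "card (supp z) \<le> card (supp u)" by (rule min[OF uJ])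
        have "\<kappa> u s0 = \<zero>" using \<kappa>u[OF s0(1)] x w(3)[symmetric] by (simp add: A.minus_eq A.r_neg)
        moreover have "\<kappa> u s = \<zero>" if "s \<in> S" "\<kappa> z s = \<zero>" for s
          using \<kappa>u[OF that(1)] that w(4) x by (simp add: A.minus_eq)
        ultimately have "supp u \<subseteq> supp z - {s0}" by (auto simp: supp_def)
        then have "card (supp u) \<le> card (supp z - {s0})" using S(1) by (intro card_mono) (auto simp: supp_def)
        also have "\<dots> < card (supp z)" using S(1) s0 by (intro card_Diff1_less) (auto simp: supp_def)
        finally show False using le by simp
      qed
      then have "\<kappa> u s = \<kappa> (t \<zero> \<one>\<^bsub>B\<^esub>) s" by (simp add: t_zero_l)
      also have "\<dots> = \<zero>" using cC[OF B.one_closed s] by (simp add: \<kappa>_t[OF A.zero_closed B.one_closed s])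
      finally show ?thesis using \<kappa>u[OF s] x \<kappa>C[OF w(2) s] by simp
    qed
    obtain b where b: "b \<in> carrier B" "w = t \<one> b" using central[OF w(2) comm] by blast
    have b0: "b \<noteq> \<zero>\<^bsub>B\<^esub>"
    proof
      assume "b = \<zero>\<^bsub>B\<^esub>"
      then have "w = t \<zero> \<one>\<^bsub>B\<^esub>" using b(2) by (simp add: t_zero_l t_zero_r)
      then have "\<kappa> w s0 = \<zero>" using cC[OF B.one_closed s0(1)] by (simp add: \<kappa>_t[OF A.zero_closed B.one_closed s0(1)])
      then show False using A1 w(3) by simp
    qed
    have t1: "t \<one> y \<in> carrier AB" if "y \<in> carrier B" for y using that by (simp add: t_closed)
    have "(\<lambda>y. t \<one> y) \<in> alg_hom k B AB"
      by (rule alg_homI) (simp_all add: t_closed t_add_r t_mult t_smult_r t_one)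
    then interpret emb: ring_hom_ring B AB "\<lambda>y. t \<one> y"
      by (rule alg_hom_ring_hom_ring[OF B.k_alg_axioms AB.k_alg_axioms])
    \<comment> \<open>The preimage of \<open>J\<close> in \<open>B\<close> is an ideal that contains
      the nonzero element \<open>b\<close>.\<close>
    have "\<one>\<^bsub>B\<^esub> \<in> {y \<in> carrier B. t \<one> y \<in> J}"
      by (rule csa_ideal[OF A.field csaB emb.ideal_vimage[OF J] _ b0]) (use b w(1) in simp)
    then show ?thesis by (simp only: mem_Collect_eq emb.hom_one)
  qed
  show ?thesis unfolding central_simple_algebra_iff[OF AB.k_alg_axioms] using 1 2 3 4 by blast
qed

text \<open>Commutation of the two images is what makes the product of \<open>f x\<close> and
  \<open>g y\<close> multiplicative in the pair.\<close>

lemma tensor_hom: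
  assumes C: "k_alg k C" and f: "f \<in> alg_hom k A C" and g: "g \<in> alg_hom k B C"
    and comm: "\<And>x y. x \<in> carrier A \<Longrightarrow> y \<in> carrier B \<Longrightarrow> f x \<otimes>\<^bsub>C\<^esub> g y = g y \<otimes>\<^bsub>C\<^esub> f x"
  obtains h where "h \<in> alg_hom k AB C"
    "\<And>x y. x \<in> carrier A \<Longrightarrow> y \<in> carrier B \<Longrightarrow> h (t x y) = f x \<otimes>\<^bsub>C\<^esub> g y"
proof -
  interpret C: k_alg k C by fact
  note fD = alg_homD[OF f] and gD = alg_homD[OF g]
  show thesis
  proof (rule tensor_lift[OF C, of "\<lambda>x y. f x \<otimes>\<^bsub>C\<^esub> g y"])
    fix x y x' y' assume *: "x \<in> carrier A" "y \<in> carrier B" "x' \<in> carrier A" "y' \<in> carrier B"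
    have "f (x \<otimes> x') \<otimes>\<^bsub>C\<^esub> g (y \<otimes>\<^bsub>B\<^esub> y') = f x \<otimes>\<^bsub>C\<^esub> (f x' \<otimes>\<^bsub>C\<^esub> g y) \<otimes>\<^bsub>C\<^esub> g y'"
      using * by (simp add: fD gD C.m_assoc)
    also have "\<dots> = f x \<otimes>\<^bsub>C\<^esub> g y \<otimes>\<^bsub>C\<^esub> (f x' \<otimes>\<^bsub>C\<^esub> g y')"
      using * by (simp add: comm[OF *(3,2)] fD gD C.m_assoc)
    finally show "f (x \<otimes> x') \<otimes>\<^bsub>C\<^esub> g (y \<otimes>\<^bsub>B\<^esub> y') = f x \<otimes>\<^bsub>C\<^esub> g y \<otimes>\<^bsub>C\<^esub> (f x' \<otimes>\<^bsub>C\<^esub> g y')" .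
  qed (simp_all add: fD gD C.l_distr C.r_distr C.smult_mult_l C.smult_mult_r that)
qed

text \<open>Injectivity is automatic, as \<open>A \<otimes> B\<close> is simple.\<close>

theorem tensor_iso:
  assumes csa: "central_simple_algebra k A" "central_simple_algebra k B"
    and C: "k_alg k C" and C1: "\<one>\<^bsub>C\<^esub> \<noteq> \<zero>\<^bsub>C\<^esub>"
    and f: "f \<in> alg_hom k A C" and g: "g \<in> alg_hom k B C"
    and comm: "\<And>x y. x \<in> carrier A \<Longrightarrow> y \<in> carrier B \<Longrightarrow> f x \<otimes>\<^bsub>C\<^esub> g y = g y \<otimes>\<^bsub>C\<^esub> f x"
    and gen: "\<And>S. subring S C \<Longrightarrow> f ` carrier A \<subseteq> S \<Longrightarrow> g ` carrier B \<subseteq> S \<Longrightarrow> carrier C \<subseteq> S"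
  shows "alg_isomorphic k AB C"
proof -
  interpret C: k_alg k C by fact
  note fD = alg_homD[OF f] and gD = alg_homD[OF g]
  obtain h where h: "h \<in> alg_hom k AB C" "\<And>x y. x \<in> carrier A \<Longrightarrow> y \<in> carrier B \<Longrightarrow> h (t x y) = f x \<otimes>\<^bsub>C\<^esub> g y"
    using tensor_hom[OF C f g comm] by blast
  interpret h: ring_hom_ring AB C h by (rule alg_hom_ring_hom_ring[OF AB.k_alg_axioms C h(1)])
  show ?thesis
  proof (rule alg_isomorphicI[OF h(1)])
    show "inj_on h (carrier AB)" by (rule csa_hom_inj[OF tensor_csa[OF csa] C h(1) C1])
    show "carrier C \<subseteq> h ` carrier AB"
    proof (rule gen)
      show "subring (h ` carrier AB) C" by (rule h.img_is_subring[OF AB.carrier_is_subring])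
      show "f ` carrier A \<subseteq> h ` carrier AB"
      proof
        fix u assume "u \<in> f ` carrier A"
        then obtain x where x: "x \<in> carrier A" "u = f x" by auto
        then have "u = h (t x \<one>\<^bsub>B\<^esub>)" by (simp add: h(2) gD fD)
        then show "u \<in> h ` carrier AB" using x t_closed[of x "\<one>\<^bsub>B\<^esub>"] by blast
      qed
      show "g ` carrier B \<subseteq> h ` carrier AB"
      proof
        fix u assume "u \<in> g ` carrier B"
        then obtain y where y: "y \<in> carrier B" "u = g y" by auto
        then have "u = h (t \<one> y)" by (simp add: h(2) gD fD)
        then show "u \<in> h ` carrier AB" using y t_closed[of "\<one>" y] by blast
      qed
    qed
  qed
qed

end

section \<open>The Brauer group is a commutative monoid\<close>

declare alg_isomorphic_trans [trans]

text \<open>A subring need not be closed under scalars; containing the scalar multiples of the unit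
  turns it into a subalgebra.\<close>

lemma (in k_alg) subring_lin_span:
  assumes S: "subring S A" and scal: "\<And>r. r \<in> carrier k \<Longrightarrow> r \<odot> \<one> \<in> S"
    and G: "G \<subseteq> S" and x: "x \<in> lin_span k A G"
  shows "x \<in> S"
proof -
  have sub: "S \<subseteq> carrier A" by (rule subringE(1)[OF S])
  show ?thesis using x
  proof induction
    case zero
    then show ?case by (rule subringE(2)[OF S])
  next
    case (step r s x)
    have s: "s \<in> S" "s \<in> carrier A" using step G sub by auto
    have "r \<odot> s = (r \<odot> \<one>) \<otimes> s" using s step by (simp add: smult_mult_l)
    then have "r \<odot> s \<in> S" using subringE(6)[OF S scal[OF step(1)] s(1)] by simp
    then show ?case by (rule subringE(7)[OF S _ step(4)])
  qed
qed

lemma subring_vimage: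
  assumes "k_alg k A" "k_alg k B" "h \<in> alg_hom k A B" "subring S B"
  shows "subring {x \<in> carrier A. h x \<in> S} A"
proof -
  interpret A: k_alg k A by fact
  interpret h: ring_hom_ring A B h by (rule alg_hom_ring_hom_ring) fact+
  show ?thesis
    by (rule A.subringI) (use subringE[OF assms(4)] in auto)
qed

lemma (in alg_pair) tensor_generated:
  assumes S: "subring S AB" and l: "\<And>x. x \<in> carrier A \<Longrightarrow> t x \<one>\<^bsub>B\<^esub> \<in> S"
    and r: "\<And>y. y \<in> carrier B \<Longrightarrow> t \<one> y \<in> S"
  shows "carrier AB \<subseteq> S"
proof
  fix z assume "z \<in> carrier AB"
  then have z: "z \<in> lin_span k AB {t x y | x y. x \<in> carrier A \<and> y \<in> carrier B}" using t_span by blast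
  show "z \<in> S"
  proof (rule AB.subring_lin_span[OF S _ _ z])
    show "c \<odot>\<^bsub>AB\<^esub> \<one>\<^bsub>AB\<^esub> \<in> S" if "c \<in> carrier k" for c
      using l[of "c \<odot> \<one>"] that by (simp add: t_one t_smult_l)
    show "{t x y | x y. x \<in> carrier A \<and> y \<in> carrier B} \<subseteq> S"
    proof
      fix u assume "u \<in> {t x y | x y. x \<in> carrier A \<and> y \<in> carrier B}"
      then obtain x y where "x \<in> carrier A" "y \<in> carrier B" "u = t x y" by auto
      then show "u \<in> S" using subringE(6)[OF S l[of x] r[of y]] by (simp add: t_mult)
    qed
  qed
qed

lemma alg_pairI: "k_alg k A \<Longrightarrow> k_alg k B \<Longrightarrow> alg_pair k A B"
  by (simp add: alg_pair_def)

lemma (in alg_pair) t_hom_l: "(\<lambda>x. t x \<one>\<^bsub>B\<^esub>) \<in> alg_hom k A AB"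
  by (rule alg_homI) (simp_all add: t_closed t_add_l t_mult t_smult_l t_one)

lemma (in alg_pair) t_hom_r: "(\<lambda>y. t \<one> y) \<in> alg_hom k B AB"
  by (rule alg_homI) (simp_all add: t_closed t_add_r t_mult t_smult_r t_one)

section \<open>Isomorphisms between tensor products, and Brauer equivalence\<close>

context
  fixes k :: "('a, 'r) ring_scheme"
  assumes k: "field k"
begin

interpretation K: field k by (rule k)

lemmas csa_alg = csa_k_alg[OF k]

lemma csa_tensor:
  "central_simple_algebra k A \<Longrightarrow> central_simple_algebra k B \<Longrightarrow> central_simple_algebra k (tensor_algebra k A B)"
  by (rule alg_pair.tensor_csa[OF alg_pairI]) (simp_all add: csa_alg)

lemma tensor_cong_iso:
  assumes csa: "central_simple_algebra k A" "central_simple_algebra k B"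
    "central_simple_algebra k A'" "central_simple_algebra k B'"
    and iso: "alg_isomorphic k A A'" "alg_isomorphic k B B'"
  shows "alg_isomorphic k (tensor_algebra k A B) (tensor_algebra k A' B')"
proof -
  interpret AB: alg_pair k A B using csa by (intro alg_pairI csa_alg)
  interpret AB': alg_pair k A' B' using csa by (intro alg_pairI csa_alg)
  obtain f where f: "f \<in> alg_hom k A A'" "inj_on f (carrier A)" "f ` carrier A = carrier A'"
    using iso(1) by (rule alg_isomorphicE)
  obtain g where g: "g \<in> alg_hom k B B'" "inj_on g (carrier B)" "g ` carrier B = carrier B'"
    using iso(2) by (rule alg_isomorphicE)
  show ?thesis
  proof (rule AB.tensor_iso[OF csa(1,2) AB'.AB.k_alg_axioms csa_one_not_zero[OF k csa_tensor[OF csa(3,4)]]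
        alg_hom_comp[OF f(1) AB'.t_hom_l] alg_hom_comp[OF g(1) AB'.t_hom_r]])
    fix x y assume "x \<in> carrier A" "y \<in> carrier B"
    then show "((\<lambda>x. AB'.t x \<one>\<^bsub>B'\<^esub>) \<circ> f) x \<otimes>\<^bsub>AB'.AB\<^esub> (AB'.t \<one>\<^bsub>A'\<^esub> \<circ> g) y =
       (AB'.t \<one>\<^bsub>A'\<^esub> \<circ> g) y \<otimes>\<^bsub>AB'.AB\<^esub> ((\<lambda>x. AB'.t x \<one>\<^bsub>B'\<^esub>) \<circ> f) x"
      by (simp add: AB'.t_mult alg_homD[OF f(1)] alg_homD[OF g(1)])
  next
    fix S assume S: "subring S AB'.AB" and l: "((\<lambda>x. AB'.t x \<one>\<^bsub>B'\<^esub>) \<circ> f) ` carrier A \<subseteq> S"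
      and r: "(AB'.t \<one>\<^bsub>A'\<^esub> \<circ> g) ` carrier B \<subseteq> S"
    have l': "(\<lambda>x. AB'.t x \<one>\<^bsub>B'\<^esub>) ` carrier A' \<subseteq> S" using l unfolding image_comp[symmetric] f(3) .
    have r': "AB'.t \<one>\<^bsub>A'\<^esub> ` carrier B' \<subseteq> S" using r unfolding image_comp[symmetric] g(3) .
    show "carrier AB'.AB \<subseteq> S" by (rule AB'.tensor_generated[OF S]) (use l' r' in auto)
  qed
qed

lemma tensor_comm_iso:
  fixes B (structure)
  assumes csa: "central_simple_algebra k A" "central_simple_algebra k B"
  shows "alg_isomorphic k (tensor_algebra k A B) (tensor_algebra k B A)"
proof -
  interpret AB: alg_pair k A B using csa by (intro alg_pairI csa_alg)
  interpret BA: alg_pair k B A using csa by (intro alg_pairI csa_alg)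
  show ?thesis
  proof (rule AB.tensor_iso[OF csa BA.AB.k_alg_axioms csa_one_not_zero[OF k csa_tensor[OF csa(2,1)]] BA.t_hom_r BA.t_hom_l])
    fix x y assume "x \<in> carrier A" "y \<in> carrier B"
    then show "BA.t \<one> x \<otimes>\<^bsub>BA.AB\<^esub> BA.t y \<one>\<^bsub>A\<^esub> = BA.t y \<one>\<^bsub>A\<^esub> \<otimes>\<^bsub>BA.AB\<^esub> BA.t \<one> x"
      by (simp add: BA.t_mult)
  next
    fix S assume S: "subring S BA.AB" and l: "BA.t \<one> ` carrier A \<subseteq> S"
      and r: "(\<lambda>x. BA.t x \<one>\<^bsub>A\<^esub>) ` carrier B \<subseteq> S"
    show "carrier BA.AB \<subseteq> S" by (rule BA.tensor_generated[OF S]) (use l r in auto)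
  qed
qed

text \<open>The tensor product of \<open>A\<close> and \<open>B\<close> is sent to the right-hand
  side by putting the unit of \<open>C\<close> in the last place, and \<open>C\<close> is put in the
  last place with units before it. The images commute and generate the target.\<close>

lemma tensor_assoc_iso:
  fixes A (structure)
  assumes csa: "central_simple_algebra k A" "central_simple_algebra k B" "central_simple_algebra k C"
  shows "alg_isomorphic k (tensor_algebra k (tensor_algebra k A B) C) (tensor_algebra k A (tensor_algebra k B C))"
proof -
  interpret AB: alg_pair k A B using csa by (intro alg_pairI csa_alg)
  interpret BC: alg_pair k B C using csa by (intro alg_pairI csa_alg)
  interpret L: alg_pair k AB.AB C using csa by (intro alg_pairI csa_alg csa_tensor)
  interpret R: alg_pair k A BC.AB using csa by (intro alg_pairI csa_alg csa_tensor)
  have commf: "R.t x \<one>\<^bsub>BC.AB\<^esub> \<otimes>\<^bsub>R.AB\<^esub> R.t \<one> w = R.t \<one> w \<otimes>\<^bsub>R.AB\<^esub> R.t x \<one>\<^bsub>BC.AB\<^esub>"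
    if "x \<in> carrier A" "w \<in> carrier BC.AB" for x w
    using that by (simp add: R.t_mult)
  let ?g = "R.t \<one> \<circ> BC.t \<one>\<^bsub>B\<^esub>"
  have g: "?g \<in> alg_hom k C R.AB" by (rule alg_hom_comp[OF BC.t_hom_r R.t_hom_r])
  obtain f where f: "f \<in> alg_hom k AB.AB R.AB"
    "\<And>x y. x \<in> carrier A \<Longrightarrow> y \<in> carrier B \<Longrightarrow>
       f (AB.t x y) = R.t x \<one>\<^bsub>BC.AB\<^esub> \<otimes>\<^bsub>R.AB\<^esub> (R.t \<one> \<circ> (\<lambda>y. BC.t y \<one>\<^bsub>C\<^esub>)) y"
    by (rule AB.tensor_hom[OF R.AB.k_alg_axioms R.t_hom_l alg_hom_comp[OF BC.t_hom_l R.t_hom_r]])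
      (auto simp: commf BC.t_closed)
  have f': "f (AB.t x y) = R.t x (BC.t y \<one>\<^bsub>C\<^esub>)" if "x \<in> carrier A" "y \<in> carrier B" for x y
    using that by (simp add: f(2) R.t_mult BC.t_closed)
  note fD = alg_homD[OF f(1)] and gD = alg_homD[OF g]
  have comm: "f u \<otimes>\<^bsub>R.AB\<^esub> ?g z = ?g z \<otimes>\<^bsub>R.AB\<^esub> f u" if u: "u \<in> carrier AB.AB" and z: "z \<in> carrier C" for u z
    using u
  proof (induction rule: AB.t_induct)
    case (tens x y)
    then show ?case using z by (simp add: f' R.t_mult BC.t_mult BC.t_closed)
  qed (use gD(1)[OF z] in \<open>simp_all add: fD alg_hom_zero[OF AB.AB.k_alg_axioms R.AB.k_alg_axioms f(1)]
      R.AB.l_distr R.AB.r_distr R.AB.smult_mult_l R.AB.smult_mult_r del: o_apply\<close>)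
  show ?thesis
  proof (rule L.tensor_iso[OF csa_tensor[OF csa(1,2)] csa(3) R.AB.k_alg_axioms
       csa_one_not_zero[OF k csa_tensor[OF csa(1) csa_tensor[OF csa(2,3)]]] f(1) g comm])
    fix S assume S: "subring S R.AB" and l: "f ` carrier AB.AB \<subseteq> S" and r: "?g ` carrier C \<subseteq> S"
    have "carrier BC.AB \<subseteq> {w \<in> carrier BC.AB. R.t \<one> w \<in> S}"
    proof (rule BC.tensor_generated[OF subring_vimage[OF BC.AB.k_alg_axioms R.AB.k_alg_axioms R.t_hom_r S]])
      fix y assume y: "y \<in> carrier B"
      have "f (AB.t \<one> y) \<in> S" using l y AB.t_closed[of "\<one>" y] by blast
      then show "BC.t y \<one>\<^bsub>C\<^esub> \<in> {w \<in> carrier BC.AB. R.t \<one> w \<in> S}" using y by (simp add: f' BC.t_closed)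
    next
      fix z assume z: "z \<in> carrier C"
      then show "BC.t \<one>\<^bsub>B\<^esub> z \<in> {w \<in> carrier BC.AB. R.t \<one> w \<in> S}" using r BC.t_closed[of "\<one>\<^bsub>B\<^esub>" z] by auto
    qed
    then have 2: "R.t \<one> w \<in> S" if "w \<in> carrier BC.AB" for w using that by blast
    have 1: "R.t x \<one>\<^bsub>BC.AB\<^esub> \<in> S" if x: "x \<in> carrier A" for x
    proof -
      have "f (AB.t x \<one>\<^bsub>B\<^esub>) \<in> S" using l x AB.t_closed[of x "\<one>\<^bsub>B\<^esub>"] by blast
      then show ?thesis using x by (simp add: f' BC.t_one)
    qed
    show "carrier R.AB \<subseteq> S" by (rule R.tensor_generated[OF S 1 2])
  qed
qed

lemma base_algebra_csa: "central_simple_algebra k (base_algebra k)"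
proof -
  let ?B = "base_algebra k"
  have [simp]: "carrier ?B = carrier k" "\<one>\<^bsub>?B\<^esub> = \<one>\<^bsub>k\<^esub>" "\<zero>\<^bsub>?B\<^esub> = \<zero>\<^bsub>k\<^esub>"
    "x \<otimes>\<^bsub>?B\<^esub> y = x \<otimes>\<^bsub>k\<^esub> y" "x \<oplus>\<^bsub>?B\<^esub> y = x \<oplus>\<^bsub>k\<^esub> y" "r \<odot>\<^bsub>?B\<^esub> y = r \<otimes>\<^bsub>k\<^esub> y" for x y r
    by (simp_all add: base_algebra_def)
  have ag: "abelian_group ?B"
    by (rule abelian_groupI) (auto simp: K.a_ac intro: K.add.l_inv_ex)
  have "module k ?B"
    by (rule moduleI) (simp_all add: K.is_cring ag K.l_distr K.r_distr K.m_assoc)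
  moreover have "ring ?B"
    by (rule ringI[OF ag monoidI]) (simp_all add: K.l_distr K.r_distr K.m_assoc)
  ultimately have B: "k_alg k ?B"
    unfolding k_alg_iff k_algebra_def using k by (simp add: K.m_assoc K.m_lcomm)
  interpret B: k_alg k ?B by (rule B)
  have "carrier ?B \<subseteq> lin_span k ?B {\<one>\<^bsub>?B\<^esub>}"
  proof
    fix x assume "x \<in> carrier ?B"
    then show "x \<in> lin_span k ?B {\<one>\<^bsub>?B\<^esub>}"
      using B.M.lin_span_smult[OF _ _ B.M.lin_span_base, of "{\<one>\<^bsub>?B\<^esub>}" x "\<one>\<^bsub>?B\<^esub>"] by simp
  qed
  then have 1: "finite_dim_algebra k ?B"
    unfolding finite_dim_algebra_iff_lin_span[OF B] by (intro exI[of _ "{\<one>\<^bsub>?B\<^esub>}"]) simp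
  have 2: "\<one>\<^bsub>?B\<^esub> \<in> I" if I: "ideal I ?B" and x: "x \<in> I" "x \<noteq> \<zero>\<^bsub>?B\<^esub>" for I x
  proof -
    interpret I: ideal I ?B by fact
    have "x \<in> Units k" using I.Icarr[OF x(1)] x(2) by (simp add: K.field_Units)
    then show ?thesis using I.I_l_closed[OF x(1), of "inv\<^bsub>k\<^esub> x"] by simp
  qed
  have 3: "\<exists>r\<in>carrier k. x = r \<odot>\<^bsub>?B\<^esub> \<one>\<^bsub>?B\<^esub>" if "x \<in> carrier ?B" for x
    using that by (intro bexI[of _ x]) simp_all
  show ?thesis
    unfolding central_simple_algebra_iff[OF B] using 1 2 3 by simp
qed

lemma base_tensor_iso:
  fixes A (structure)
  assumes csa: "central_simple_algebra k A"
  shows "alg_isomorphic k (tensor_algebra k (base_algebra k) A) A"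
proof -
  interpret A: k_alg k A by (rule csa_alg[OF csa])
  have [simp]: "carrier (base_algebra k) = carrier k" by (simp add: base_algebra_def)
  interpret T: alg_pair k "base_algebra k" A using csa base_algebra_csa by (intro alg_pairI csa_alg)
  have f: "(\<lambda>r. r \<odot> \<one>) \<in> alg_hom k (base_algebra k) A"
    by (rule alg_homI)
      (simp_all add: base_algebra_def A.M.smult_l_distr A.M.smult_assoc1 A.smult_mult_l)
  have g: "id \<in> alg_hom k A A" by (simp add: alg_hom_def)
  show ?thesis
    by (rule T.tensor_iso[OF base_algebra_csa csa A.k_alg_axioms csa_one_not_zero[OF k csa] f g])
      (auto simp: A.smult_mult_l A.smult_mult_r)
qed

text \<open>The first factor acts on the outer blocks: each entry \<open>x\<close> becomes the inner
  scalar matrix with value \<open>x\<close> tensor 1. The second factor becomes an outer scalar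
  matrix with one inner matrix. A product of two matrix units is then a matrix unit of the nested
  algebra with a pure tensor as entry.\<close>

lemma mat_tensor_iso:
  fixes B (structure) and I :: "'i set" and J :: "'j set"
  assumes csa: "central_simple_algebra k A" "central_simple_algebra k B"
    and I: "finite I" "I \<noteq> {}" and J: "finite J" "J \<noteq> {}"
  shows "alg_isomorphic k (tensor_algebra k (mat I A) (mat J B)) (mat I (mat J (tensor_algebra k A B)))"
proof -
  note kA = csa_alg[OF csa(1)] and kB = csa_alg[OF csa(2)]
  interpret AB: alg_pair k A B by (rule alg_pairI[OF kA kB])
  interpret IA: mat_alg k A I using kA I by (simp add: mat_alg_def mat_alg_axioms_def)
  interpret JB: mat_alg k B J using kB J by (simp add: mat_alg_def mat_alg_axioms_def)
  interpret J: mat_alg k AB.AB J using AB.AB.k_alg_axioms J by (simp add: mat_alg_def mat_alg_axioms_def)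
  interpret IJ: mat_alg k "mat J AB.AB" I using J.mat_k_alg I by (simp add: mat_alg_def mat_alg_axioms_def)
  interpret L: alg_pair k "mat I A" "mat J B" by (rule alg_pairI[OF IA.mat_k_alg JB.mat_k_alg])
  let ?M = "mat I (mat J AB.AB)"
  define f1 where "f1 = scalar_mat AB.AB J \<circ> (\<lambda>x. AB.t x \<one>)"
  have f1: "f1 \<in> alg_hom k A (mat J AB.AB)"
    unfolding f1_def by (rule alg_hom_comp[OF AB.t_hom_l J.scalar_mat_hom])
  define f where "f U = (\<lambda>ij\<in>I \<times> I. f1 (U ij))" for U
  have f: "f \<in> alg_hom k (mat I A) ?M"
    unfolding f_def by (rule mat_map_hom[OF kA J.mat_k_alg f1 I(1)])
  define g1 where "g1 Y = (\<lambda>ij\<in>J \<times> J. AB.t \<one>\<^bsub>A\<^esub> (Y ij))" for Y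
  have g1: "g1 \<in> alg_hom k (mat J B) (mat J AB.AB)"
    unfolding g1_def by (rule mat_map_hom[OF kB AB.AB.k_alg_axioms AB.t_hom_r J(1)])
  define g where "g = scalar_mat (mat J AB.AB) I \<circ> g1"
  have g: "g \<in> alg_hom k (mat J B) ?M"
    unfolding g_def by (rule alg_hom_comp[OF g1 IJ.scalar_mat_hom])
  note fD = alg_homD[OF f] and gD = alg_homD[OF g] and f1D = alg_homD[OF f1] and g1D = alg_homD[OF g1]
  have comm1: "f1 x \<otimes>\<^bsub>mat J AB.AB\<^esub> g1 Y = g1 Y \<otimes>\<^bsub>mat J AB.AB\<^esub> f1 x"
    if x: "x \<in> carrier A" and Y: "Y \<in> carrier (mat J B)" for x Y
  proof (rule J.mat_eqI)
    have tx: "AB.t x \<one> \<in> carrier AB.AB" using x by (simp add: AB.t_closed)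
    fix i j assume ij: "i \<in> J" "j \<in> J"
    have "g1 Y (i, j) = AB.t \<one>\<^bsub>A\<^esub> (Y (i, j))" using ij by (simp add: g1_def)
    then show "(f1 x \<otimes>\<^bsub>mat J AB.AB\<^esub> g1 Y) (i, j) = (g1 Y \<otimes>\<^bsub>mat J AB.AB\<^esub> f1 x) (i, j)"
      using x JB.mat_entry[OF Y ij]
      unfolding f1_def o_apply J.scalar_mat_mult(1)[OF g1D(1)[OF Y] tx ij] J.scalar_mat_mult(2)[OF g1D(1)[OF Y] tx ij]
      by (simp add: AB.t_mult)
  qed (use f1D(1)[OF x] g1D(1)[OF Y] in auto)
  have comm: "f U \<otimes>\<^bsub>?M\<^esub> g Y = g Y \<otimes>\<^bsub>?M\<^esub> f U"
    if U: "U \<in> carrier (mat I A)" and Y: "Y \<in> carrier (mat J B)" for U Y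
  proof (rule IJ.mat_eqI)
    fix i j assume ij: "i \<in> I" "j \<in> I"
    have "f U (i, j) = f1 (U (i, j))" using ij by (simp add: f_def)
    then show "(f U \<otimes>\<^bsub>?M\<^esub> g Y) (i, j) = (g Y \<otimes>\<^bsub>?M\<^esub> f U) (i, j)"
      unfolding g_def o_apply IJ.scalar_mat_mult(1)[OF fD(1)[OF U] g1D(1)[OF Y] ij]
        IJ.scalar_mat_mult(2)[OF fD(1)[OF U] g1D(1)[OF Y] ij]
      using comm1[OF IA.mat_entry[OF U ij] Y] by simp
  qed (use fD(1)[OF U] gD(1)[OF Y] in auto)
  let ?DI = "\<lambda>i j. delta (mat J AB.AB) (I \<times> I) (i, j)" and ?DJ = "\<lambda>i j. delta AB.AB (J \<times> J) (i, j)"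
  have fg: "f (delta A (I \<times> I) (i, j) x) \<otimes>\<^bsub>?M\<^esub> g (delta B (J \<times> J) (i', j') y) = ?DI i j (?DJ i' j' (AB.t x y))"
    if x: "x \<in> carrier A" and y: "y \<in> carrier B" and ij: "i \<in> I" "j \<in> I" "i' \<in> J" "j' \<in> J" for x y i j i' j'
  proof (rule IJ.mat_eqI)
    have U: "delta A (I \<times> I) (i, j) x \<in> carrier (mat I A)" by (rule IA.F.delta_closed[OF x])
    have Y: "delta B (J \<times> J) (i', j') y \<in> carrier (mat J B)" by (rule JB.F.delta_closed[OF y])
    have txy: "AB.t x y \<in> carrier AB.AB" "AB.t x \<one> \<in> carrier AB.AB" using x y by (simp_all add: AB.t_closed)
    have 1: "f1 x \<otimes>\<^bsub>mat J AB.AB\<^esub> g1 (delta B (J \<times> J) (i', j') y) = ?DJ i' j' (AB.t x y)"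
    proof (rule J.mat_eqI)
      fix r s assume rs: "r \<in> J" "s \<in> J"
      show "(f1 x \<otimes>\<^bsub>mat J AB.AB\<^esub> g1 (delta B (J \<times> J) (i', j') y)) (r, s) = ?DJ i' j' (AB.t x y) (r, s)"
        unfolding f1_def o_apply J.scalar_mat_mult(1)[OF g1D(1)[OF Y] txy(2) rs]
        using rs x y by (simp add: g1_def JB.F.at J.F.at AB.t_mult AB.t_zero_r AB.t_closed)
    qed (use f1D(1)[OF x] g1D(1)[OF Y] J.F.delta_closed[OF txy(1)] in auto)
    fix r s assume rs: "r \<in> I" "s \<in> I"
    have "(f (delta A (I \<times> I) (i, j) x) \<otimes>\<^bsub>?M\<^esub> g (delta B (J \<times> J) (i', j') y)) (r, s) =
      f1 (delta A (I \<times> I) (i, j) x (r, s)) \<otimes>\<^bsub>mat J AB.AB\<^esub> g1 (delta B (J \<times> J) (i', j') y)"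
      unfolding g_def o_apply IJ.scalar_mat_mult(2)[OF fD(1)[OF U] g1D(1)[OF Y] rs]
      using rs by (simp add: f_def)
    also have "\<dots> = ?DI i j (?DJ i' j' (AB.t x y)) (r, s)"
    proof (cases "(r, s) = (i, j)")
      case True
      then show ?thesis using rs 1 by (simp add: IA.F.at IJ.F.at)
    next
      case False
      then have "delta A (I \<times> I) (i, j) x (r, s) = \<zero>\<^bsub>A\<^esub>" "?DI i j (?DJ i' j' (AB.t x y)) (r, s) = \<zero>\<^bsub>mat J AB.AB\<^esub>"
        using rs by (auto simp: IA.F.at IJ.F.at)
      then show ?thesis using alg_hom_zero[OF kA J.mat_k_alg f1] g1D(1)[OF Y] by simp
    qed
    finally show "(f (delta A (I \<times> I) (i, j) x) \<otimes>\<^bsub>?M\<^esub> g (delta B (J \<times> J) (i', j') y)) (r, s) =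
      ?DI i j (?DJ i' j' (AB.t x y)) (r, s)" .
  qed (use fD(1)[OF IA.F.delta_closed[OF x]] gD(1)[OF JB.F.delta_closed[OF y]]
      IJ.F.delta_closed[OF J.F.delta_closed[OF AB.t_closed[OF x y]]] in auto)
  show ?thesis
  proof (rule L.tensor_iso[OF IA.mat_csa[OF csa(1) I(2)] JB.mat_csa[OF csa(2) J(2)] IJ.mat_k_alg _ f g comm])
    show "\<one>\<^bsub>?M\<^esub> \<noteq> \<zero>\<^bsub>?M\<^esub>"
      by (rule csa_one_not_zero[OF k IJ.mat_csa[OF J.mat_csa[OF csa_tensor[OF csa] J(2)] I(2)]])
    fix S assume S: "subring S ?M" and fS: "f ` carrier (mat I A) \<subseteq> S" and gS: "g ` carrier (mat J B) \<subseteq> S"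
    have scal: "r \<odot>\<^bsub>?M\<^esub> \<one>\<^bsub>?M\<^esub> \<in> S" if r: "r \<in> carrier k" for r
    proof -
      have "f (r \<odot>\<^bsub>mat I A\<^esub> \<one>\<^bsub>mat I A\<^esub>) \<in> S" using fS r by auto
      then show ?thesis using r by (simp add: fD)
    qed
    have smul: "r \<odot>\<^bsub>?M\<^esub> z \<in> S" if r: "r \<in> carrier k" and z: "z \<in> S" for r z
    proof -
      have "z \<in> carrier ?M" using subringE(1)[OF S] z by auto
      then have "r \<odot>\<^bsub>?M\<^esub> z = (r \<odot>\<^bsub>?M\<^esub> \<one>\<^bsub>?M\<^esub>) \<otimes>\<^bsub>?M\<^esub> z" using r by (simp add: IJ.mat.smult_mult_l)
      then show ?thesis using subringE(6)[OF S scal[OF r] z] by simp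
    qed
    note S0 = subringE(2)[OF S] and S_add = subringE(7)[OF S]
    \<comment> \<open>For entries that are pure tensors this is the product formula
      \<open>fg\<close>; linearity gives all other entries.\<close>
    have DD: "?DI i j (?DJ i' j' u) \<in> S"
      if u: "u \<in> carrier AB.AB" and ij: "i \<in> I" "j \<in> I" "i' \<in> J" "j' \<in> J" for u i j i' j'
      using u
    proof (induction rule: AB.t_induct)
      case zero
      then show ?case by (simp add: J.delta_zero IJ.delta_zero S0)
    next
      case (add u v)
      then show ?case by (simp add: J.delta_add IJ.delta_add J.F.delta_closed S_add)
    next
      case (smult r u)
      then show ?case by (simp add: J.delta_smult IJ.delta_smult smul)
    next
      case (tens x y)
      have "f (delta A (I \<times> I) (i, j) x) \<in> S" "g (delta B (J \<times> J) (i', j') y) \<in> S"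
        using fS gS IA.F.delta_closed[OF tens(1)] JB.F.delta_closed[OF tens(2)] by blast+
      then show ?case using subringE(6)[OF S] fg[OF tens ij] by metis
    qed
    have D: "?DI i j Y \<in> S" if Y: "Y \<in> carrier (mat J AB.AB)" and ij: "i \<in> I" "j \<in> I" for Y i j
    proof -
      have sub: "{?DJ i j a | i j a. i \<in> J \<and> j \<in> J \<and> a \<in> carrier AB.AB} \<subseteq> carrier (mat J AB.AB)"
        using J.F.delta_closed by auto
      show ?thesis using subsetD[OF J.mat_span Y] sub
      proof (induction rule: J.mat.M.lin_span_induct)
        case (base s)
        then show ?case using DD ij by blast
      qed (use S0 in \<open>simp_all add: IJ.delta_zero IJ.delta_add IJ.delta_smult S_add smul\<close>)
    qed
    show "carrier ?M \<subseteq> S"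
    proof
      fix U assume U: "U \<in> carrier ?M"
      show "U \<in> S"
        by (rule IJ.mat.subring_lin_span[OF S scal _ subsetD[OF IJ.mat_span U]]) (use D in auto)
    qed
  qed
qed

text \<open>Numbering the index sets leads back to initial segments, so equivalences may be
  established with whatever finite index sets a construction produces, products in
  particular.\<close>

lemma brauer_equivalentI:
  fixes I :: "'i set" and J :: "'j set"
  assumes A: "k_alg k A" and B: "k_alg k B"
    and I: "finite I" "I \<noteq> {}" and J: "finite J" "J \<noteq> {}"
    and iso: "alg_isomorphic k (mat I A) (mat J B)"
  shows "brauer_equivalent k A B"
proof -
  interpret IA: mat_alg k A I using A I by (simp add: mat_alg_def mat_alg_axioms_def)
  interpret JB: mat_alg k B J using B J by (simp add: mat_alg_def mat_alg_axioms_def)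
  obtain e where e: "bij_betw e {0..<card I} I" using ex_bij_betw_nat_finite[OF I(1)] by blast
  obtain e' where e': "bij_betw e' {0..<card J} J" using ex_bij_betw_nat_finite[OF J(1)] by blast
  have 1: "alg_isomorphic k (mat I A) (mat {..<card I} A)"
    by (rule IA.mat_reindex) (use e in \<open>simp add: atLeast0LessThan\<close>)
  have 2: "alg_isomorphic k (mat J B) (mat {..<card J} B)"
    by (rule JB.mat_reindex) (use e' in \<open>simp add: atLeast0LessThan\<close>)
  have "alg_isomorphic k (mat {..<card I} A) (mat {..<card J} B)"
    by (rule alg_isomorphic_trans[OF alg_isomorphic_sym[OF IA.mat_k_alg 1] alg_isomorphic_trans[OF iso 2]])
  moreover have "card I > 0" "card J > 0" using I J by (simp_all add: card_gt_0_iff)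
  ultimately show ?thesis
    unfolding brauer_equivalent_def matrix_algebra_eq_mat alg_isomorphic_def by blast
qed

lemma brauer_equivalentE:
  assumes "brauer_equivalent k A B"
  obtains I J :: "nat set" where "finite I" "I \<noteq> {}" "finite J" "J \<noteq> {}"
    "alg_isomorphic k (mat I A) (mat J B)"
proof -
  obtain r s :: nat where "r > 0" "s > 0" "alg_isomorphic k (mat {..<r} A) (mat {..<s} B)"
    using assms unfolding brauer_equivalent_def matrix_algebra_eq_mat alg_isomorphic_def by blast
  then show thesis using that[of "{..<r}" "{..<s}"] by auto
qed

lemma mat_kalg: "k_alg k A \<Longrightarrow> finite I \<Longrightarrow> k_alg k (mat I A)"
  by (rule mat_alg.mat_k_alg) (simp add: mat_alg_def mat_alg_axioms_def)

lemma iso_brauer_equivalent: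
  assumes "k_alg k A" "k_alg k B" "alg_isomorphic k A B"
  shows "brauer_equivalent k A B"
  by (rule brauer_equivalentI[OF assms(1,2), of "{()}" "{()}"])
    (simp_all add: mat_map_iso[OF assms(1,2,3)])

lemma brauer_equivalent_sym:
  assumes "k_alg k A" "k_alg k B" "brauer_equivalent k A B"
  shows "brauer_equivalent k B A"
proof -
  obtain I J :: "nat set" where IJ: "finite I" "I \<noteq> {}" "finite J" "J \<noteq> {}"
    "alg_isomorphic k (mat I A) (mat J B)"
    using assms(3) by (rule brauer_equivalentE)
  show ?thesis
    by (rule brauer_equivalentI[OF assms(2,1) IJ(3,4,1,2) alg_isomorphic_sym[OF mat_kalg[OF assms(1) IJ(1)] IJ(5)]])
qed

text \<open>Both equivalences are enlarged until the middle algebras agree: matrices over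
  \<open>B\<close> indexed by \<open>I' \<times> J\<close> arise from one side, by
  \<open>J \<times> I'\<close> from the other, and swapping the coordinates identifies them.\<close>

lemma brauer_equivalent_trans:
  assumes A: "k_alg k A" and B: "k_alg k B" and C: "k_alg k C"
    and AB: "brauer_equivalent k A B" and BC: "brauer_equivalent k B C"
  shows "brauer_equivalent k A C"
proof -
  obtain I J :: "nat set" where IJ: "finite I" "I \<noteq> {}" "finite J" "J \<noteq> {}"
    "alg_isomorphic k (mat I A) (mat J B)"
    using AB by (rule brauer_equivalentE)
  obtain I' J' :: "nat set" where IJ': "finite I'" "I' \<noteq> {}" "finite J'" "J' \<noteq> {}"
    "alg_isomorphic k (mat I' B) (mat J' C)"
    using BC by (rule brauer_equivalentE)
  interpret JB: mat_alg k B "J \<times> I'" using B IJ IJ' by (simp add: mat_alg_def mat_alg_axioms_def)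
  have "alg_isomorphic k (mat (I' \<times> I) A) (mat I' (mat I A))" by (rule mat_mat[OF A IJ'(1) IJ(1)])
  also have "alg_isomorphic k \<dots> (mat I' (mat J B))"
    by (rule mat_map_iso[OF mat_kalg[OF A IJ(1)] mat_kalg[OF B IJ(3)] IJ(5) IJ'(1)])
  also have "alg_isomorphic k \<dots> (mat (I' \<times> J) B)"
    by (rule alg_isomorphic_sym[OF mat_kalg[OF B finite_cartesian_product[OF IJ'(1) IJ(3)]] mat_mat[OF B IJ'(1) IJ(3)]])
  also have "alg_isomorphic k \<dots> (mat (J \<times> I') B)"
    by (rule alg_isomorphic_sym[OF JB.mat_k_alg JB.mat_reindex[of prod.swap]])
      (auto simp: bij_betw_def inj_on_def)
  also have "alg_isomorphic k \<dots> (mat J (mat I' B))" by (rule mat_mat[OF B IJ(3) IJ'(1)])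
  also have "alg_isomorphic k \<dots> (mat J (mat J' C))"
    by (rule mat_map_iso[OF mat_kalg[OF B IJ'(1)] mat_kalg[OF C IJ'(3)] IJ'(5) IJ(3)])
  also have "alg_isomorphic k \<dots> (mat (J \<times> J') C)"
    by (rule alg_isomorphic_sym[OF mat_kalg[OF C finite_cartesian_product[OF IJ(3) IJ'(3)]] mat_mat[OF C IJ(3) IJ'(3)]])
  finally show ?thesis
    by (rule brauer_equivalentI[OF A C, rotated -1]) (use IJ IJ' in auto)
qed

lemma mat_csa: "central_simple_algebra k A \<Longrightarrow> finite I \<Longrightarrow> I \<noteq> {} \<Longrightarrow> central_simple_algebra k (mat I A)"
  by (rule mat_alg.mat_csa) (simp_all add: mat_alg_def mat_alg_axioms_def csa_alg)

lemma mat_tensor_iso':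
  assumes "central_simple_algebra k A" "central_simple_algebra k B" "finite I" "I \<noteq> {}" "finite J" "J \<noteq> {}"
  shows "alg_isomorphic k (mat (I \<times> J) (tensor_algebra k A B)) (tensor_algebra k (mat I A) (mat J B))"
  by (rule alg_isomorphic_trans[OF mat_mat alg_isomorphic_sym[OF _ mat_tensor_iso]])
    (use assms in \<open>simp_all add: csa_alg csa_tensor mat_csa\<close>)

text \<open>This makes the product of Brauer classes well defined; under tensor products the index
  sets of the matrices multiply.\<close>

lemma brauer_equivalent_tensor:
  assumes csa: "central_simple_algebra k A" "central_simple_algebra k B"
    "central_simple_algebra k A'" "central_simple_algebra k B'"
    and eq: "brauer_equivalent k A A'" "brauer_equivalent k B B'"
  shows "brauer_equivalent k (tensor_algebra k A B) (tensor_algebra k A' B')"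
proof -
  obtain I J :: "nat set" where IJ: "finite I" "I \<noteq> {}" "finite J" "J \<noteq> {}"
    "alg_isomorphic k (mat I A) (mat J A')"
    using eq(1) by (rule brauer_equivalentE)
  obtain I' J' :: "nat set" where IJ': "finite I'" "I' \<noteq> {}" "finite J'" "J' \<noteq> {}"
    "alg_isomorphic k (mat I' B) (mat J' B')"
    using eq(2) by (rule brauer_equivalentE)
  have "alg_isomorphic k (mat (I \<times> I') (tensor_algebra k A B)) (tensor_algebra k (mat I A) (mat I' B))"
    by (rule mat_tensor_iso') (use csa IJ IJ' in auto)
  also have "alg_isomorphic k \<dots> (tensor_algebra k (mat J A') (mat J' B'))"
    by (rule tensor_cong_iso) (use csa IJ IJ' mat_csa in auto)
  also have "alg_isomorphic k \<dots> (mat (J \<times> J') (tensor_algebra k A' B'))"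
    by (rule alg_isomorphic_sym[OF _ mat_tensor_iso'])
      (use csa IJ IJ' in \<open>simp_all add: mat_kalg csa_alg csa_tensor\<close>)
  finally show ?thesis
    by (rule brauer_equivalentI[rotated -1]) (use csa IJ IJ' in \<open>simp_all add: csa_alg csa_tensor\<close>)
qed

end

text \<open>Coefficients with respect to a finite spanning set, once chosen, determine the element.
  The sequence of coefficients is therefore an injective code of type
  \<open>nat \<Rightarrow> 'a\<close>, and the operations are copied along this code.\<close>

lemma finite_dim_transport:
  fixes A :: "('a, 'b, 's) module_scheme" (structure)
  assumes A: "k_alg k A" and fd: "finite_dim_algebra k A"
  obtains B :: "('a, nat \<Rightarrow> 'a) module" where "k_alg k B" "alg_isomorphic k A B"
proof -
  interpret k_alg k A by fact
  obtain S where S: "finite S" "\<And>x. x \<in> carrier A \<Longrightarrow> \<exists>c \<in> S \<rightarrow> carrier k. x = (\<Oplus>s\<in>S. c s \<odot> s)"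
    and SC: "S \<subseteq> carrier A"
    using fd unfolding finite_dim_algebra_def by blast
  obtain e where e: "bij_betw e {0..<card S} S" using ex_bij_betw_nat_finite[OF S(1)] by blast
  define c where "c x = (SOME c. c \<in> S \<rightarrow> carrier k \<and> x = (\<Oplus>s\<in>S. c s \<odot> s))" for x
  have c: "c x \<in> S \<rightarrow> carrier k \<and> x = (\<Oplus>s\<in>S. c x s \<odot> s)" if "x \<in> carrier A" for x
  proof -
    have "\<exists>c. c \<in> S \<rightarrow> carrier k \<and> x = (\<Oplus>s\<in>S. c s \<odot> s)" using S(2)[OF that] by blast
    then show ?thesis unfolding c_def by (rule someI_ex)
  qed
  define \<phi> where "\<phi> x = (\<lambda>n. if n < card S then c x (e n) else \<zero>\<^bsub>k\<^esub>)" for x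
  have inj: "inj_on \<phi> (carrier A)"
  proof (rule inj_onI)
    fix x y assume x: "x \<in> carrier A" and y: "y \<in> carrier A" and eq: "\<phi> x = \<phi> y"
    have "c x s = c y s" if "s \<in> S" for s
    proof -
      have "s \<in> e ` {0..<card S}" using bij_betw_imp_surj_on[OF e] that by simp
      then obtain n where "n < card S" "s = e n" by auto
      then show ?thesis using fun_cong[OF eq, of n] by (simp add: \<phi>_def)
    qed
    then have eq': "(\<Oplus>s\<in>S. c x s \<odot> s) = (\<Oplus>s\<in>S. c y s \<odot> s)"
      using c[OF y] SC by (intro finsum_cong') (auto simp: Pi_iff subset_iff)
    show "x = y"
      using trans[OF trans[OF conjunct2[OF c[OF x]] eq'] conjunct2[OF c[OF y], symmetric]] by blast
  qed
  let ?i = "inv_into (carrier A) \<phi>"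
  have i: "?i (\<phi> x) = x" if "x \<in> carrier A" for x using inj that by simp
  define B :: "('a, nat \<Rightarrow> 'a) module" where
    "B = \<lparr>carrier = \<phi> ` carrier A, monoid.mult = \<lambda>x y. \<phi> (?i x \<otimes> ?i y), one = \<phi> \<one>, ring.zero = \<phi> \<zero>,
      add = \<lambda>x y. \<phi> (?i x \<oplus> ?i y), smult = \<lambda>r x. \<phi> (r \<odot> ?i x)\<rparr>"
  have *: "k_alg k B" "\<phi> \<in> alg_hom k A B"
    by (rule k_alg_image[OF A, of \<phi>]; simp add: B_def i)+
  then have "alg_isomorphic k A B" by (intro alg_isomorphicI[OF _ inj]) (auto simp: B_def)
  with *(1) show thesis by (rule that)
qed

lemma csa_transport:
  assumes k: "field k" and csa: "central_simple_algebra k A"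
  obtains B :: "('a, nat \<Rightarrow> 'a) module" where "central_simple_algebra k B" "alg_isomorphic k A B"
proof -
  obtain B :: "('a, nat \<Rightarrow> 'a) module" where B: "k_alg k B" "alg_isomorphic k A B"
    by (rule finite_dim_transport[OF csa_alg[OF k csa] csa_finite_dim[OF k csa]])
  show thesis by (rule that[OF csa_iso[OF csa B] B(2)])
qed

section \<open>Brauer classes and their product\<close>

context
  fixes k :: "('a, 'r) ring_scheme"
  assumes k: "field k"
begin

lemma brauer_class_eq:
  assumes csa: "central_simple_algebra k A" "central_simple_algebra k B" and eq: "brauer_equivalent k A B"
  shows "brauer_class k A = brauer_class k B"
proof -
  note kA = csa_alg[OF k csa(1)] and kB = csa_alg[OF k csa(2)]
  have "brauer_equivalent k A C \<longleftrightarrow> brauer_equivalent k B C" if "central_simple_algebra k C"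
    for C :: "('a, nat \<Rightarrow> 'a) module"
    using brauer_equivalent_trans[OF k kA kB csa_alg[OF k that] eq]
      brauer_equivalent_trans[OF k kB kA csa_alg[OF k that] brauer_equivalent_sym[OF k kA kB eq]] by blast
  then show ?thesis unfolding brauer_class_def by blast
qed

lemma brauer_class_iso:
  assumes "central_simple_algebra k A" "k_alg k B" "alg_isomorphic k A B"
  shows "brauer_class k A = brauer_class k B"
  by (rule brauer_class_eq[OF assms(1) csa_iso[OF assms] iso_brauer_equivalent[OF k csa_alg[OF k assms(1)] assms(2,3)]])

text \<open>Members of a class have elements of one fixed type, so \<open>A\<close> itself may fail
  to be a member and a transported copy is exhibited. Products of classes are unions over members,
  which would be empty otherwise.\<close>

lemma brauer_class_nonempty:
  assumes "central_simple_algebra k A"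
  shows "brauer_class k A \<noteq> {}"
proof -
  obtain B :: "('a, nat \<Rightarrow> 'a) module" where B: "central_simple_algebra k B" "alg_isomorphic k A B"
    by (rule csa_transport[OF k assms])
  have "B \<in> brauer_class k A"
    unfolding brauer_class_def using B iso_brauer_equivalent[OF k csa_alg[OF k assms] csa_alg[OF k B(1)]] by blast
  then show ?thesis by blast
qed

lemma brauer_class_closed:
  assumes "central_simple_algebra k A"
  shows "brauer_class k A \<in> carrier (brauer_group k)"
proof -
  obtain B :: "('a, nat \<Rightarrow> 'a) module" where B: "central_simple_algebra k B" "alg_isomorphic k A B"
    by (rule csa_transport[OF k assms])
  have "brauer_class k A = brauer_class k B" by (rule brauer_class_iso[OF assms csa_alg[OF k B(1)] B(2)])
  then show ?thesis using B(1) by (auto simp: brauer_group_def)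
qed

text \<open>All sets in the defining union coincide, since equivalent factors have equivalent tensor
  products, and the union runs over nonempty classes.\<close>

lemma brauer_mult:
  assumes csa: "central_simple_algebra k A" "central_simple_algebra k B"
  shows "brauer_class k A \<otimes>\<^bsub>brauer_group k\<^esub> brauer_class k B = brauer_class k (tensor_algebra k A B)"
proof -
  have *: "brauer_class k (tensor_algebra k A' B') = brauer_class k (tensor_algebra k A B)"
    if "A' \<in> brauer_class k A" "B' \<in> brauer_class k B" for A' B'
  proof -
    have csa': "central_simple_algebra k A'" "central_simple_algebra k B'"
      and eq: "brauer_equivalent k A A'" "brauer_equivalent k B B'"
      using that by (simp_all add: brauer_class_def)
    show ?thesis
      by (rule brauer_class_eq[symmetric, OF csa_tensor[OF k csa] csa_tensor[OF k csa']
            brauer_equivalent_tensor[OF k csa csa' eq]])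
  qed
  have "(\<Union>A'\<in>brauer_class k A. \<Union>B'\<in>brauer_class k B. brauer_class k (tensor_algebra k A' B')) =
      (\<Union>A'\<in>brauer_class k A. \<Union>B'\<in>brauer_class k B. brauer_class k (tensor_algebra k A B))"
    by (intro SUP_cong refl *)
  also have "\<dots> = brauer_class k (tensor_algebra k A B)"
    using brauer_class_nonempty[OF csa(1)] brauer_class_nonempty[OF csa(2)] by simp
  finally show ?thesis by (simp add: brauer_group_def)
qed

lemma brauer_one: "\<one>\<^bsub>brauer_group k\<^esub> = brauer_class k (base_algebra k)"
  by (simp add: brauer_group_def)

text \<open>Gives the finite products and the powers in the formula their laws; each axiom is one of
  the isomorphisms of tensor products, read on classes.\<close>

theorem brauer_comm_monoid: "comm_monoid (brauer_group k)"
proof -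
  let ?C = "\<lambda>A :: ('a, nat \<Rightarrow> 'a) module. central_simple_algebra k A"
  have ex: "\<exists>A. ?C A \<and> x = brauer_class k A" if "x \<in> carrier (brauer_group k)" for x
    using that by (auto simp: brauer_group_def)
  show ?thesis
  proof (rule comm_monoidI)
    fix x y assume "x \<in> carrier (brauer_group k)" "y \<in> carrier (brauer_group k)"
    then obtain A B where AB: "?C A" "?C B" "x = brauer_class k A" "y = brauer_class k B" using ex by blast
    show "x \<otimes>\<^bsub>brauer_group k\<^esub> y \<in> carrier (brauer_group k)"
      using AB by (simp add: brauer_mult brauer_class_closed csa_tensor[OF k])
    show "x \<otimes>\<^bsub>brauer_group k\<^esub> y = y \<otimes>\<^bsub>brauer_group k\<^esub> x"
      using brauer_class_iso[OF csa_tensor[OF k AB(1,2)] csa_alg[OF k csa_tensor[OF k AB(2,1)]]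
          tensor_comm_iso[OF k AB(1,2)]] AB by (simp add: brauer_mult)
  next
    show "\<one>\<^bsub>brauer_group k\<^esub> \<in> carrier (brauer_group k)"
      unfolding brauer_one by (rule brauer_class_closed[OF base_algebra_csa[OF k]])
  next
    fix x y z assume "x \<in> carrier (brauer_group k)" "y \<in> carrier (brauer_group k)" "z \<in> carrier (brauer_group k)"
    then obtain A B C where AB: "?C A" "?C B" "?C C" "x = brauer_class k A" "y = brauer_class k B" "z = brauer_class k C"
      using ex by meson
    show "x \<otimes>\<^bsub>brauer_group k\<^esub> y \<otimes>\<^bsub>brauer_group k\<^esub> z = x \<otimes>\<^bsub>brauer_group k\<^esub> (y \<otimes>\<^bsub>brauer_group k\<^esub> z)"
      using brauer_class_iso[OF csa_tensor[OF k csa_tensor[OF k AB(1,2)] AB(3)]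
          csa_alg[OF k csa_tensor[OF k AB(1) csa_tensor[OF k AB(2,3)]]] tensor_assoc_iso[OF k AB(1,2,3)]] AB(1-3)
      by (simp add: AB(4-6) brauer_mult csa_tensor[OF k])
  next
    fix x assume "x \<in> carrier (brauer_group k)"
    then obtain A where A: "?C A" "x = brauer_class k A" using ex by blast
    show "\<one>\<^bsub>brauer_group k\<^esub> \<otimes>\<^bsub>brauer_group k\<^esub> x = x"
      unfolding brauer_one A(2) brauer_mult[OF base_algebra_csa[OF k] A(1)]
      by (rule brauer_class_iso[OF csa_tensor[OF k base_algebra_csa[OF k] A(1)] csa_alg[OF k A(1)] base_tensor_iso[OF k A(1)]])
  qed
qed

lemma mat_brauer_class:
  assumes csa: "central_simple_algebra k A" and I: "finite I" "I \<noteq> {}"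
  shows "brauer_class k (mat I A) = brauer_class k A"
proof -
  note kA = csa_alg[OF k csa] and kM = csa_alg[OF k mat_csa[OF k csa I]]
  have one: "finite {()}" "{()} \<noteq> {}" by simp_all
  interpret M: mat_alg k "mat I A" "{()}" using kM by (simp add: mat_alg_def mat_alg_axioms_def)
  have "brauer_equivalent k (mat I A) A"
    by (rule brauer_equivalentI[OF k kM kA one I alg_isomorphic_sym[OF kM M.mat_singleton[OF refl]]])
  then show ?thesis by (rule brauer_class_eq[OF mat_csa[OF k csa I] csa])
qed

end

section \<open>Cyclic algebras\<close>

context k_alg
begin

lemma smult_mult_smult:
  "r \<in> carrier k \<Longrightarrow> s \<in> carrier k \<Longrightarrow> x \<in> carrier A \<Longrightarrow> y \<in> carrier A \<Longrightarrow>
    (r \<odot> x) \<otimes> (s \<odot> y) = (r \<otimes>\<^bsub>k\<^esub> s) \<odot> (x \<otimes> y)"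
  by (simp add: smult_mult_l smult_mult_r M.smult_assoc1[symmetric] K.m_comm)

lemma smult_pow: "r \<in> carrier k \<Longrightarrow> x \<in> carrier A \<Longrightarrow> (r \<odot> x) [^] (n::nat) = r [^]\<^bsub>k\<^esub> n \<odot> x [^] n"
  by (induction n) (simp_all add: smult_mult_smult)

text \<open>Each of the \<open>m\<close> factors \<open>x\<close> passes each of the
  \<open>n\<close> factors \<open>y\<close> at the cost of one factor \<open>z\<close>.\<close>

lemma quasi_commute_pow:
  assumes xy: "x \<in> carrier A" "y \<in> carrier A" "z \<in> carrier k" "x \<otimes> y = z \<odot> (y \<otimes> x)"
  shows "x [^] (m::nat) \<otimes> y [^] (n::nat) = z [^]\<^bsub>k\<^esub> (m * n) \<odot> (y [^] n \<otimes> x [^] m)"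
proof -
  have 1: "x \<otimes> y [^] n = z [^]\<^bsub>k\<^esub> n \<odot> (y [^] n \<otimes> x)" for n :: nat
  proof (induction n)
    case (Suc n)
    have "x \<otimes> y [^] Suc n = (x \<otimes> y [^] n) \<otimes> y" using xy by (simp add: m_assoc)
    also have "\<dots> = z [^]\<^bsub>k\<^esub> n \<odot> (y [^] n \<otimes> (x \<otimes> y))"
      using xy(1-3) by (simp add: Suc smult_mult_l m_assoc)
    also have "\<dots> = z [^]\<^bsub>k\<^esub> Suc n \<odot> (y [^] Suc n \<otimes> x)"
      using xy(1-3) by (simp add: xy(4) smult_mult_r m_assoc M.smult_assoc1)
    finally show ?case .
  qed (use xy in simp)
  show ?thesis
  proof (induction m)
    case (Suc m)
    have "x [^] Suc m \<otimes> y [^] n = x [^] m \<otimes> (x \<otimes> y [^] n)" using xy by (simp add: m_assoc)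
    also have "\<dots> = z [^]\<^bsub>k\<^esub> n \<odot> ((x [^] m \<otimes> y [^] n) \<otimes> x)"
      using xy(1-3) by (simp add: 1 smult_mult_r m_assoc)
    also have "\<dots> = (z [^]\<^bsub>k\<^esub> n \<otimes>\<^bsub>k\<^esub> z [^]\<^bsub>k\<^esub> (m * n)) \<odot> (y [^] n \<otimes> x [^] Suc m)"
      using xy(1-3) by (simp add: Suc smult_mult_l m_assoc M.smult_assoc1)
    also have "z [^]\<^bsub>k\<^esub> n \<otimes>\<^bsub>k\<^esub> z [^]\<^bsub>k\<^esub> (m * n) = z [^]\<^bsub>k\<^esub> (Suc m * n)" using xy(3) by (simp add: K.nat_pow_mult)
    finally show ?case .
  qed (use xy in simp)
qed

lemma pow_reduce:
  assumes "y \<in> carrier A" "a \<in> carrier k" "y [^] q = a \<odot> \<one>"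
  shows "y [^] (n::nat) = a [^]\<^bsub>k\<^esub> (n div q) \<odot> y [^] (n mod q)"
proof -
  have "y [^] n = y [^] (q * (n div q)) \<otimes> y [^] (n mod q)" using assms(1) by (simp add: nat_pow_mult)
  also have "y [^] (q * (n div q)) = a [^]\<^bsub>k\<^esub> (n div q) \<odot> \<one>"
    using assms by (simp add: nat_pow_pow[symmetric] smult_pow)
  finally show ?thesis using assms by (simp add: smult_mult_l)
qed

lemma lin_span_subring:
  assumes G: "G \<subseteq> carrier A" and one: "\<one> \<in> lin_span k A G"
    and mult: "\<And>g h. g \<in> G \<Longrightarrow> h \<in> G \<Longrightarrow> g \<otimes> h \<in> lin_span k A G"
  shows "subring (lin_span k A G) A"
proof (rule subringI)
  note si = lin_span.zero M.lin_span_add[OF G] M.lin_span_smult[OF G]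
  show "lin_span k A G \<subseteq> carrier A" using M.lin_span_closed[OF G] by blast
  show "\<one> \<in> lin_span k A G" by (rule one)
  show "\<ominus> x \<in> lin_span k A G" if "x \<in> lin_span k A G" for x
    using si(3)[OF _ that, of "\<ominus>\<^bsub>k\<^esub> \<one>\<^bsub>k\<^esub>"] M.lin_span_closed[OF G that] by (simp add: M.smult_l_minus)
  show "x \<oplus> y \<in> lin_span k A G" if "x \<in> lin_span k A G" "y \<in> lin_span k A G" for x y
    using that by (rule si(2))
  have 1: "g \<otimes> y \<in> lin_span k A G" if g: "g \<in> G" and y: "y \<in> lin_span k A G" for g y
    using y G
  proof (induction rule: M.lin_span_induct)
    case (base s)
    then show ?case by (rule mult[OF g])
  qed (use subsetD[OF G g] in \<open>simp_all add: r_distr smult_mult_r si\<close>)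
  show "x \<otimes> y \<in> lin_span k A G" if x: "x \<in> lin_span k A G" and y: "y \<in> lin_span k A G" for x y
    using x G
  proof (induction rule: M.lin_span_induct)
    case (base s)
    then show ?case using y by (rule 1)
  qed (use M.lin_span_closed[OF G y] in \<open>simp_all add: l_distr smult_mult_l si\<close>)
qed

lemma centralizer_subring:
  assumes "v \<in> carrier A"
  shows "subring {u \<in> carrier A. u \<otimes> v = v \<otimes> u} A"
proof (rule subringI)
  show "x \<otimes> y \<in> {u \<in> carrier A. u \<otimes> v = v \<otimes> u}"
    if "x \<in> {u \<in> carrier A. u \<otimes> v = v \<otimes> u}" "y \<in> {u \<in> carrier A. u \<otimes> v = v \<otimes> u}" for x y
  proof -
    have xy: "x \<in> carrier A" "y \<in> carrier A" "x \<otimes> v = v \<otimes> x" "y \<otimes> v = v \<otimes> y"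
      using that by simp_all
    have "x \<otimes> y \<otimes> v = x \<otimes> v \<otimes> y" using xy(1,2,4) assms by (simp add: m_assoc)
    also have "\<dots> = v \<otimes> (x \<otimes> y)" unfolding xy(3) using xy(1,2) assms by (simp add: m_assoc)
    finally show ?thesis using xy(1,2) by simp
  qed
qed (use assms in \<open>auto simp: l_minus r_minus l_distr r_distr\<close>)

end

text \<open>\<open>x\<close> stands for the first generator, whose power is \<open>b\<close>, and
  \<open>y\<close> for the second, whose power is \<open>a\<close>: the parameters are crossed in
  the same way as in \<open>cyclic_algebra\<close>.\<close>

definition cyc_pair ::
    "('a, 'r) ring_scheme \<Rightarrow> nat \<Rightarrow> 'a \<Rightarrow> 'a \<Rightarrow> 'a \<Rightarrow> ('a, 'b, 's) module_scheme \<Rightarrow> 'b \<Rightarrow> 'b \<Rightarrow> bool" where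
  "cyc_pair k q \<zeta> a b C x y \<longleftrightarrow> x \<in> carrier C \<and> y \<in> carrier C \<and>
     x [^]\<^bsub>C\<^esub> q = b \<odot>\<^bsub>C\<^esub> \<one>\<^bsub>C\<^esub> \<and> y [^]\<^bsub>C\<^esub> q = a \<odot>\<^bsub>C\<^esub> \<one>\<^bsub>C\<^esub> \<and> x \<otimes>\<^bsub>C\<^esub> y = \<zeta> \<odot>\<^bsub>C\<^esub> (y \<otimes>\<^bsub>C\<^esub> x)"

definition cyc_ideal ::
    "('a, 'r) ring_scheme \<Rightarrow> nat \<Rightarrow> 'a \<Rightarrow> 'a \<Rightarrow> 'a \<Rightarrow> (nat list \<Rightarrow> 'a) set" where
  "cyc_ideal k q \<zeta> a b =
    (let P = monoid_algebra k (free_monoid {1, 2::nat}); i1 = single k [1]; i2 = single k [2]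
     in Idl\<^bsub>P\<^esub> {i1 [^]\<^bsub>P\<^esub> q \<ominus>\<^bsub>P\<^esub> b \<odot>\<^bsub>P\<^esub> \<one>\<^bsub>P\<^esub>,
            i2 [^]\<^bsub>P\<^esub> q \<ominus>\<^bsub>P\<^esub> a \<odot>\<^bsub>P\<^esub> \<one>\<^bsub>P\<^esub>,
            i1 \<otimes>\<^bsub>P\<^esub> i2 \<ominus>\<^bsub>P\<^esub> \<zeta> \<odot>\<^bsub>P\<^esub> (i2 \<otimes>\<^bsub>P\<^esub> i1)})"

definition cyc_gen ::
    "('a, 'r) ring_scheme \<Rightarrow> nat \<Rightarrow> 'a \<Rightarrow> 'a \<Rightarrow> 'a \<Rightarrow> nat \<Rightarrow> (nat list \<Rightarrow> 'a) set" where
  "cyc_gen k q \<zeta> a b i = cyc_ideal k q \<zeta> a b +>\<^bsub>monoid_algebra k (free_monoid {1, 2::nat})\<^esub> single k [i]"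

text \<open>Cyclic algebras are treated for any positive \<open>q\<close> with nonzero image in
  \<open>k\<close>; that \<open>q\<close> is a power of \<open>p\<close> enters only where this
  locale is interpreted.\<close>

locale kummer = K: field k for k :: "('a, 'r) ring_scheme" +
  fixes q :: nat and \<zeta> :: 'a
  assumes prim: "primitive_root_of_unity k q \<zeta>" and q_pos: "q > 0"
    and q_nonzero: "[q] \<cdot>\<^bsub>k\<^esub> \<one>\<^bsub>k\<^esub> \<noteq> \<zero>\<^bsub>k\<^esub>"
begin

lemma zeta: "\<zeta> \<in> carrier k" "\<zeta> [^]\<^bsub>k\<^esub> q = \<one>\<^bsub>k\<^esub>"
  using prim by (simp_all add: primitive_root_of_unity_def)

lemma zeta_pow_mod: "\<zeta> [^]\<^bsub>k\<^esub> (n::nat) = \<zeta> [^]\<^bsub>k\<^esub> (n mod q)"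
proof -
  have "\<zeta> [^]\<^bsub>k\<^esub> n = \<zeta> [^]\<^bsub>k\<^esub> (q * (n div q)) \<otimes>\<^bsub>k\<^esub> \<zeta> [^]\<^bsub>k\<^esub> (n mod q)" using zeta by (simp add: K.nat_pow_mult)
  then show ?thesis using zeta by (simp add: K.nat_pow_pow[symmetric])
qed

lemma zeta_pow_eq_one: "\<zeta> [^]\<^bsub>k\<^esub> (n::nat) = \<one>\<^bsub>k\<^esub> \<longleftrightarrow> q dvd n"
proof
  assume "\<zeta> [^]\<^bsub>k\<^esub> n = \<one>\<^bsub>k\<^esub>"
  then have "\<zeta> [^]\<^bsub>k\<^esub> (n mod q) = \<one>\<^bsub>k\<^esub>" by (simp add: zeta_pow_mod[of n])
  then have "n mod q = 0" using prim q_pos unfolding primitive_root_of_unity_def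
    by (metis mod_less_divisor neq0_conv)
  then show "q dvd n" by auto
next
  assume "q dvd n"
  then show "\<zeta> [^]\<^bsub>k\<^esub> n = \<one>\<^bsub>k\<^esub>" using zeta_pow_mod[of n] by simp
qed

lemma zeta_unit: "\<zeta> \<noteq> \<zero>\<^bsub>k\<^esub>"
proof
  assume "\<zeta> = \<zero>\<^bsub>k\<^esub>"
  then have "\<zeta> [^]\<^bsub>k\<^esub> q = \<zero>\<^bsub>k\<^esub>" using q_pos by (simp add: K.nat_pow_zero)
  then show False using zeta by simp
qed

text \<open>Orthogonality of characters. If \<open>u\<close>, the \<open>i\<close>-th power of
  \<open>\<zeta>\<close>, is not 1, the geometric sum of its powers is unchanged under
  multiplication by \<open>u\<close> and is therefore zero.\<close>

lemma sum_roots: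
  "(\<Oplus>\<^bsub>k\<^esub>s\<in>{..<q}. \<zeta> [^]\<^bsub>k\<^esub> (s * i)) = (if q dvd i then [q] \<cdot>\<^bsub>k\<^esub> \<one>\<^bsub>k\<^esub> else \<zero>\<^bsub>k\<^esub>)"
proof (cases "q dvd i")
  case True
  have "(\<Oplus>\<^bsub>k\<^esub>s\<in>{..<q}. \<zeta> [^]\<^bsub>k\<^esub> (s * i)) = (\<Oplus>\<^bsub>k\<^esub>s\<in>{..<q}. \<one>\<^bsub>k\<^esub>)"
    by (rule K.finsum_cong') (use True in \<open>simp_all add: zeta_pow_eq_one\<close>)
  then show ?thesis using True by (simp add: K.add.finprod_const)
next
  case False
  define u where "u = \<zeta> [^]\<^bsub>k\<^esub> i"
  have u: "u \<in> carrier k" "u \<noteq> \<one>\<^bsub>k\<^esub>" using False zeta by (simp_all add: u_def zeta_pow_eq_one)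
  have uq: "u [^]\<^bsub>k\<^esub> q = \<one>\<^bsub>k\<^esub>" using zeta_pow_eq_one[of "i * q"] zeta by (simp add: u_def K.nat_pow_pow)
  let ?s = "\<lambda>n::nat. \<Oplus>\<^bsub>k\<^esub>s\<in>{..<n}. u [^]\<^bsub>k\<^esub> s"
  have sC: "?s n \<in> carrier k" for n using u by (intro K.finsum_closed) auto
  have step: "u \<otimes>\<^bsub>k\<^esub> ?s n \<oplus>\<^bsub>k\<^esub> \<one>\<^bsub>k\<^esub> = ?s n \<oplus>\<^bsub>k\<^esub> u [^]\<^bsub>k\<^esub> n" for n :: nat
  proof (induction n)
    case 0
    then show ?case using u by simp
  next
    case (Suc n)
    have e: "?s (Suc n) = u [^]\<^bsub>k\<^esub> n \<oplus>\<^bsub>k\<^esub> ?s n"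
      using u by (simp add: lessThan_Suc K.finsum_insert)
    have "u \<otimes>\<^bsub>k\<^esub> ?s (Suc n) \<oplus>\<^bsub>k\<^esub> \<one>\<^bsub>k\<^esub> = u [^]\<^bsub>k\<^esub> Suc n \<oplus>\<^bsub>k\<^esub> (u \<otimes>\<^bsub>k\<^esub> ?s n \<oplus>\<^bsub>k\<^esub> \<one>\<^bsub>k\<^esub>)"
      unfolding e using u sC[of n] by (simp add: K.r_distr K.a_assoc K.m_comm)
    also have "\<dots> = ?s (Suc n) \<oplus>\<^bsub>k\<^esub> u [^]\<^bsub>k\<^esub> Suc n"
      unfolding Suc e using u sC[of n] by (simp add: K.a_ac del: K.nat_pow_Suc)
    finally show ?case .
  qed
  have "u \<otimes>\<^bsub>k\<^esub> ?s q = ?s q" using step[of q] u sC[of q] by (simp add: uq)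
  then have "?s q = \<zero>\<^bsub>k\<^esub>"
    using K.m_rcancel[of "?s q" u "\<one>\<^bsub>k\<^esub>"] u sC[of q] by auto
  moreover have "(\<Oplus>\<^bsub>k\<^esub>s\<in>{..<q}. \<zeta> [^]\<^bsub>k\<^esub> (s * i)) = ?s q"
    by (rule K.finsum_cong') (use zeta u in \<open>auto simp: u_def K.nat_pow_pow mult.commute\<close>)
  ultimately show ?thesis using False by simp
qed

abbreviation "W \<equiv> free_monoid {1, 2::nat}"
abbreviation "P \<equiv> monoid_algebra k W"

lemma monoid_W: "monoid W"
  by (rule monoidI) (auto simp: free_monoid_def)

sublocale P: k_alg k P
  by (rule K.monoid_algebra_k_alg[OF monoid_W])

lemma letter: "single k [1] \<in> carrier P" "single k [2] \<in> carrier P"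
  by (rule K.single_closed; simp add: free_monoid_def)+

context
  notes One_nat_def [simp del]
  fixes a b assumes ab: "a \<in> carrier k" "b \<in> carrier k"
begin

abbreviation "C \<equiv> cyclic_algebra k q \<zeta> a b"
abbreviation "I \<equiv> cyc_ideal k q \<zeta> a b"
abbreviation "i1 \<equiv> cyc_gen k q \<zeta> a b 1"
abbreviation "i2 \<equiv> cyc_gen k q \<zeta> a b 2"

lemma cyclic_algebra_eq: "C = quotient_algebra P I"
  by (simp add: cyclic_algebra_def cyc_ideal_def Let_def)

lemma rel_sub: "{single k [1] [^]\<^bsub>P\<^esub> q \<ominus>\<^bsub>P\<^esub> b \<odot>\<^bsub>P\<^esub> \<one>\<^bsub>P\<^esub>,
            single k [2] [^]\<^bsub>P\<^esub> q \<ominus>\<^bsub>P\<^esub> a \<odot>\<^bsub>P\<^esub> \<one>\<^bsub>P\<^esub>,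
            single k [1] \<otimes>\<^bsub>P\<^esub> single k [2] \<ominus>\<^bsub>P\<^esub> \<zeta> \<odot>\<^bsub>P\<^esub> (single k [2] \<otimes>\<^bsub>P\<^esub> single k [1])} \<subseteq> carrier P"
  using letter ab zeta by simp

lemma ideal_I: "ideal I P"
  unfolding cyc_ideal_def Let_def by (rule P.genideal_ideal[OF rel_sub])

lemma cyc_k_alg: "k_alg k C"
  unfolding cyclic_algebra_eq by (rule k_alg_quotient[OF P.k_alg_axioms ideal_I])

lemma cyc_proj: "(\<lambda>x. I +>\<^bsub>P\<^esub> x) \<in> alg_hom k P C"
  unfolding cyclic_algebra_eq by (rule quotient_hom[OF P.k_alg_axioms ideal_I])

lemma cyc_gens: "cyc_pair k q \<zeta> a b C i1 i2"
proof -
  note pD = alg_homD[OF cyc_proj] and pp = alg_hom_pow[OF P.k_alg_axioms cyc_k_alg cyc_proj]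
  have eq: "I +>\<^bsub>P\<^esub> u = I +>\<^bsub>P\<^esub> v" if "u \<ominus>\<^bsub>P\<^esub> v \<in> I" "u \<in> carrier P" "v \<in> carrier P" for u v
    using quotient_eq_iff[OF P.k_alg_axioms ideal_I that(2,3)] that(1) by blast
  note self = subsetD[OF P.genideal_self[OF rel_sub]]
  have 1: "I +>\<^bsub>P\<^esub> (single k [1] [^]\<^bsub>P\<^esub> q) = I +>\<^bsub>P\<^esub> (b \<odot>\<^bsub>P\<^esub> \<one>\<^bsub>P\<^esub>)"
    by (rule eq) (use self letter ab in \<open>auto simp: cyc_ideal_def Let_def\<close>)
  have 2: "I +>\<^bsub>P\<^esub> (single k [2] [^]\<^bsub>P\<^esub> q) = I +>\<^bsub>P\<^esub> (a \<odot>\<^bsub>P\<^esub> \<one>\<^bsub>P\<^esub>)"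
    by (rule eq) (use self letter ab in \<open>auto simp: cyc_ideal_def Let_def\<close>)
  have 3: "I +>\<^bsub>P\<^esub> (single k [1] \<otimes>\<^bsub>P\<^esub> single k [2]) = I +>\<^bsub>P\<^esub> (\<zeta> \<odot>\<^bsub>P\<^esub> (single k [2] \<otimes>\<^bsub>P\<^esub> single k [1]))"
    by (rule eq) (use self letter zeta in \<open>auto simp: cyc_ideal_def Let_def\<close>)
  show ?thesis
    unfolding cyc_pair_def cyc_gen_def
    using 1 2 3 letter ab zeta
    by (simp add: pD(1) pp[symmetric] pD(3)[symmetric] pD(4)[symmetric] pD(5)[symmetric])
qed

text \<open>The classes of words span the algebra, and each of them lies in \<open>S\<close> by
  induction on the length of the word.\<close>

lemma cyc_generated:
  assumes S: "subring S C" and scal: "\<And>r. r \<in> carrier k \<Longrightarrow> r \<odot>\<^bsub>C\<^esub> \<one>\<^bsub>C\<^esub> \<in> S"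
    and i: "i1 \<in> S" "i2 \<in> S"
  shows "carrier C \<subseteq> S"
proof
  interpret C: k_alg k C by (rule cyc_k_alg)
  note pD = alg_homD[OF cyc_proj]
  let ?p = "\<lambda>x. I +>\<^bsub>P\<^esub> x"
  fix z assume "z \<in> carrier C"
  then have "z \<in> ?p ` carrier P" unfolding cyclic_algebra_eq quotient_surj[OF P.k_alg_axioms ideal_I] .
  then obtain u where u: "u \<in> carrier P" "z = ?p u" by blast
  have word: "?p (single k w) \<in> S" if "w \<in> carrier W" for w
    using that
  proof (induction w)
    case Nil
    have "\<one>\<^bsub>P\<^esub> = single k []" by (simp add: monoid_algebra_def free_monoid_def)
    then show ?case using subringE(3)[OF S] pD(5) by simp
  next
    case (Cons l w)
    then have w: "w \<in> carrier W" "[l] \<in> carrier W" by (auto simp: free_monoid_def)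
    have "single k (l # w) = single k [l] \<otimes>\<^bsub>P\<^esub> single k w"
      using K.monoid_algebra_mult_single[OF monoid_W w(2,1)] by (simp add: free_monoid_def)
    then have "?p (single k (l # w)) = ?p (single k [l]) \<otimes>\<^bsub>C\<^esub> ?p (single k w)"
      using pD(3)[OF K.single_closed[OF w(2)] K.single_closed[OF w(1)]] by simp
    moreover have "?p (single k [l]) \<in> S"
      using w(2) i by (auto simp: free_monoid_def cyc_gen_def)
    ultimately show ?case using subringE(6)[OF S] Cons.IH[OF w(1)] by simp
  qed
  have sub: "single k ` carrier W \<subseteq> carrier P" by (rule image_subsetI) (rule K.single_closed)
  have "z \<in> lin_span k C (?p ` single k ` carrier W)" unfolding u(2)
    by (rule lin_span_image[OF P.k_alg_axioms cyc_k_alg cyc_proj sub subsetD[OF K.monoid_algebra_span[OF monoid_W] u(1)]])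
  then show "z \<in> S"
    by (rule C.subring_lin_span[OF S scal, rotated -1]) (use word in auto)
qed

text \<open>Words are evaluated as products of \<open>x\<close> and \<open>y\<close>; the three
  relations hold for such a pair, so the ideal they generate lies in the kernel.\<close>

lemma cyc_lift:
  assumes B: "k_alg k B" and xy: "cyc_pair k q \<zeta> a b B x y"
  obtains h where "h \<in> alg_hom k C B" "h i1 = x" "h i2 = y"
proof -
  interpret B: k_alg k B by fact
  have xyC: "x \<in> carrier B" "y \<in> carrier B" using xy by (simp_all add: cyc_pair_def)
  define \<phi> where "\<phi> w = foldr (\<lambda>l u. (if l = (1::nat) then x else y) \<otimes>\<^bsub>B\<^esub> u) w \<one>\<^bsub>B\<^esub>" for w
  have \<phi>C: "\<phi> w \<in> carrier B" for w by (induction w) (simp_all add: \<phi>_def xyC)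
  have \<phi>_app: "\<phi> (v @ w) = \<phi> v \<otimes>\<^bsub>B\<^esub> \<phi> w" for v w
  proof (induction v)
    case (Cons l v)
    then show ?case using \<phi>C[of v] \<phi>C[of w] xyC by (simp add: \<phi>_def B.m_assoc)
  qed (use \<phi>C[of w] in \<open>simp add: \<phi>_def\<close>)
  obtain f where f: "f \<in> alg_hom k P B" "\<And>w. w \<in> carrier W \<Longrightarrow> f (single k w) = \<phi> w"
    by (rule K.monoid_algebra_lift[OF monoid_W B, of \<phi>])
      (simp_all add: \<phi>C \<phi>_app free_monoid_def, simp add: \<phi>_def)
  note fD = alg_homD[OF f(1)] and fp = alg_hom_pow[OF P.k_alg_axioms B f(1)]
    and fm = alg_hom_minus[OF P.k_alg_axioms B f(1)]
  have fl: "f (single k [1]) = x" "f (single k [2]) = y"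
    using xyC by (simp_all add: f(2) free_monoid_def \<phi>_def)
  interpret f: ring_hom_ring P B f by (rule alg_hom_ring_hom_ring[OF P.k_alg_axioms B f(1)])
  have rel: "f (single k [1] [^]\<^bsub>P\<^esub> q \<ominus>\<^bsub>P\<^esub> b \<odot>\<^bsub>P\<^esub> \<one>\<^bsub>P\<^esub>) = \<zero>\<^bsub>B\<^esub>"
    "f (single k [2] [^]\<^bsub>P\<^esub> q \<ominus>\<^bsub>P\<^esub> a \<odot>\<^bsub>P\<^esub> \<one>\<^bsub>P\<^esub>) = \<zero>\<^bsub>B\<^esub>"
    "f (single k [1] \<otimes>\<^bsub>P\<^esub> single k [2] \<ominus>\<^bsub>P\<^esub> \<zeta> \<odot>\<^bsub>P\<^esub> (single k [2] \<otimes>\<^bsub>P\<^esub> single k [1])) = \<zero>\<^bsub>B\<^esub>"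
    using xy xyC letter ab zeta by (simp_all add: fm fD fp fl cyc_pair_def)
  have "I \<subseteq> a_kernel P B f"
    unfolding cyc_ideal_def Let_def
    by (rule P.genideal_minimal[OF f.kernel_is_ideal])
      (use rel rel_sub in \<open>unfold a_kernel_def', blast\<close>)
  then have ker: "f u = \<zero>\<^bsub>B\<^esub>" if "u \<in> I" for u using that unfolding a_kernel_def' by blast
  obtain h where h: "h \<in> alg_hom k C B" "\<And>u. u \<in> carrier P \<Longrightarrow> h (I +>\<^bsub>P\<^esub> u) = f u"
    unfolding cyclic_algebra_eq
    by (rule quotient_lift[OF P.k_alg_axioms B ideal_I f(1) ker]) auto
  show thesis
    by (rule that[OF h(1)]) (simp_all only: cyc_gen_def h(2)[OF letter(1)] h(2)[OF letter(2)] fl)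
qed

text \<open>The elements whose image centralises \<open>v\<close> form a subring containing the
  scalars and both generators.\<close>

lemma cyc_commute:
  fixes B (structure)
  assumes B: "k_alg k B" and h: "h \<in> alg_hom k C B" and v: "v \<in> carrier B"
    and c: "h i1 \<otimes> v = v \<otimes> h i1" "h i2 \<otimes> v = v \<otimes> h i2" and u: "u \<in> carrier C"
  shows "h u \<otimes> v = v \<otimes> h u"
proof -
  interpret B: k_alg k B by fact
  interpret C: k_alg k C by (rule cyc_k_alg)
  note hD = alg_homD[OF h]
  have iC: "i1 \<in> carrier C" "i2 \<in> carrier C" using cyc_gens by (simp_all add: cyc_pair_def)
  let ?S = "{u \<in> carrier C. h u \<in> {w \<in> carrier B. w \<otimes> v = v \<otimes> w}}"
  have "carrier C \<subseteq> ?S"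
  proof (rule cyc_generated[OF subring_vimage[OF cyc_k_alg B h B.centralizer_subring[OF v]]])
    show "r \<odot>\<^bsub>C\<^esub> \<one>\<^bsub>C\<^esub> \<in> ?S" if "r \<in> carrier k" for r
      using that v by (simp add: hD B.smult_mult_l B.smult_mult_r)
  qed (use iC hD(1) c in auto)
  then show ?thesis using u by blast
qed

end

end

section \<open>Averaging over monomials and central simplicity of cyclic algebras\<close>

lemma (in k_alg) smult_nonzero:
  assumes "r \<in> carrier k" "r \<noteq> \<zero>\<^bsub>k\<^esub>" "z \<in> carrier A" "r \<odot> z = \<zero>"
  shows "z = \<zero>"
proof -
  have U: "r \<in> Units k" using assms(1,2) by (simp add: K.field_Units)
  have "inv\<^bsub>k\<^esub> r \<odot> (r \<odot> z) = z"
    using U K.Units_inv_closed[OF U] assms(1,3) by (simp add: M.smult_assoc1[symmetric])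
  then show ?thesis using assms(4) K.Units_inv_closed[OF U] by simp
qed

text \<open>Sums of two-sided multiplications are linear and map ideals into themselves; the
  averaging operators used for cyclic algebras are of this kind.\<close>

lemma (in k_alg) sandwich_sum:
  fixes I :: "'i set"
  assumes I: "finite I" and uv: "\<And>s. s \<in> I \<Longrightarrow> u s \<in> carrier A" "\<And>s. s \<in> I \<Longrightarrow> v s \<in> carrier A"
  defines "T \<equiv> \<lambda>z. \<Oplus>s\<in>I. u s \<otimes> z \<otimes> v s"
  shows "z \<in> carrier A \<Longrightarrow> T z \<in> carrier A"
    and "\<lbrakk>z \<in> carrier A; w \<in> carrier A\<rbrakk> \<Longrightarrow> T (z \<oplus> w) = T z \<oplus> T w"
    and "\<lbrakk>r \<in> carrier k; z \<in> carrier A\<rbrakk> \<Longrightarrow> T (r \<odot> z) = r \<odot> T z"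
    and "\<lbrakk>ideal J A; z \<in> J\<rbrakk> \<Longrightarrow> T z \<in> J"
proof -
  show "T z \<in> carrier A" if "z \<in> carrier A"
    unfolding T_def by (rule finsum_closed) (use uv that in auto)
  show "T (z \<oplus> w) = T z \<oplus> T w" if zw: "z \<in> carrier A" "w \<in> carrier A"
    unfolding T_def
    by (rule trans[OF finsum_cong'[OF refl] finsum_addf]) (use uv zw in \<open>auto simp: r_distr l_distr\<close>)
  show "T (r \<odot> z) = r \<odot> T z" if rz: "r \<in> carrier k" "z \<in> carrier A"
    unfolding T_def
    by (rule trans[OF finsum_cong'[OF refl] M.finsum_smult_ldistr[symmetric, OF I]])
      (use uv rz in \<open>auto simp: smult_mult_l smult_mult_r\<close>)
  show "T z \<in> J" if J: "ideal J A" and z: "z \<in> J"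
  proof -
    interpret J: ideal J A by fact
    have "(\<Oplus>s\<in>I'. u s \<otimes> z \<otimes> v s) \<in> J" if "finite I'" "I' \<subseteq> I" for I'
      using that
    proof (induction I')
      case (insert s I')
      then have "u s \<otimes> z \<otimes> v s \<in> J" using uv[of s] z by (intro J.I_r_closed J.I_l_closed) auto
      moreover have "u s \<otimes> z \<otimes> v s \<in> carrier A" if "s \<in> I" for s using uv that J.Icarr[OF z] by simp
      ultimately show ?case using insert by (subst finsum_insert) (auto intro: J.a_closed)
    qed simp
    then show ?thesis unfolding T_def using I by blast
  qed
qed

context kummer
begin

lemma zeta_pow_closed [simp]: "\<zeta> [^]\<^bsub>k\<^esub> (n::nat) \<in> carrier k"
  using zeta by simp

text \<open>Averaging the conjugates of an element by the monomials in \<open>x\<close> and \<open>y\<close> projects onto the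
  multiples of \<open>1\<close>.\<close>

theorem cyc_pair_csa:
  fixes A (structure)
  assumes A: "k_alg k A" and A1: "\<one> \<noteq> \<zero>"
    and xy: "cyc_pair k q \<zeta> a b A x y"
    and ab: "a \<in> carrier k" "a \<noteq> \<zero>\<^bsub>k\<^esub>" "b \<in> carrier k" "b \<noteq> \<zero>\<^bsub>k\<^esub>"
    and gen: "\<And>S. subring S A \<Longrightarrow> (\<And>r. r \<in> carrier k \<Longrightarrow> r \<odot> \<one> \<in> S) \<Longrightarrow> x \<in> S \<Longrightarrow> y \<in> S \<Longrightarrow> carrier A \<subseteq> S"
  shows "central_simple_algebra k A"
proof -
  interpret A: k_alg k A by fact
  have xC: "x \<in> carrier A" and yC: "y \<in> carrier A" and xq: "x [^] q = b \<odot> \<one>"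
    and yq: "y [^] q = a \<odot> \<one>" and comm: "x \<otimes> y = \<zeta> \<odot> (y \<otimes> x)"
    using xy by (simp_all add: cyc_pair_def)
  define Q where "Q = [q] \<cdot>\<^bsub>k\<^esub> \<one>\<^bsub>k\<^esub>"
  have Q: "Q \<in> carrier k" "Q \<noteq> \<zero>\<^bsub>k\<^esub>" using q_nonzero by (simp_all add: Q_def)
  define m where "m i j = y [^] i \<otimes> x [^] j" for i j :: nat
  have mC [simp]: "m i j \<in> carrier A" for i j using xC yC by (simp add: m_def)
  note qc = A.quasi_commute_pow[OF xC yC zeta(1) comm]
  have mm: "m i j \<otimes> m r s = \<zeta> [^]\<^bsub>k\<^esub> (j * r) \<odot> m (i + r) (j + s)" for i j r s
  proof -
    have "m i j \<otimes> m r s = y [^] i \<otimes> (x [^] j \<otimes> y [^] r) \<otimes> x [^] s"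
      using xC yC by (simp add: m_def A.m_assoc)
    also have "\<dots> = \<zeta> [^]\<^bsub>k\<^esub> (j * r) \<odot> (y [^] i \<otimes> y [^] r \<otimes> (x [^] j \<otimes> x [^] s))"
      using xC yC by (simp add: qc A.smult_mult_l A.smult_mult_r A.m_assoc)
    finally show ?thesis using xC yC by (simp add: m_def A.nat_pow_mult)
  qed
  have m0: "m 0 0 = \<one>" by (simp add: m_def)
  have red: "m i j = (a [^]\<^bsub>k\<^esub> (i div q) \<otimes>\<^bsub>k\<^esub> b [^]\<^bsub>k\<^esub> (j div q)) \<odot> m (i mod q) (j mod q)" for i j
    using A.pow_reduce[OF yC ab(1) yq, of i] A.pow_reduce[OF xC ab(3) xq, of j] ab xC yC
    by (simp add: m_def A.smult_mult_smult)
  \<comment> \<open>By \<open>red\<close> every monomial is a scalar multiple of one with both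
    exponents below \<open>q\<close>, and by \<open>mm\<close> the span of these is closed under
    multiplication.\<close>
  define G where "G = {m i j | i j. i < q \<and> j < q}"
  have G: "G \<subseteq> carrier A" by (auto simp: G_def)
  have mG: "m i j \<in> lin_span k A G" for i j
  proof -
    have "m (i mod q) (j mod q) \<in> G" unfolding G_def using mod_less_divisor[OF q_pos] by blast
    then show ?thesis
      by (subst red) (rule A.M.lin_span_smult[OF G _ A.M.lin_span_base[OF G]], use ab in auto)
  qed
  have span: "carrier A \<subseteq> lin_span k A G"
  proof (rule gen)
    show "subring (lin_span k A G) A"
    proof (rule A.lin_span_subring[OF G])
      show "\<one> \<in> lin_span k A G" using mG[of 0 0] by (simp add: m0)
      fix g h assume "g \<in> G" "h \<in> G"
      then obtain i j r s where "g = m i j" "h = m r s" by (auto simp: G_def)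
      then show "g \<otimes> h \<in> lin_span k A G" using A.M.lin_span_smult[OF G _ mG] by (simp add: mm)
    qed
    show "r \<odot> \<one> \<in> lin_span k A G" if "r \<in> carrier k" for r
      using A.M.lin_span_smult[OF G that mG[of 0 0]] by (simp add: m0)
    show "x \<in> lin_span k A G" using mG[of 0 1] xC by (simp add: m_def)
    show "y \<in> lin_span k A G" using mG[of 1 0] yC by (simp add: m_def)
  qed
  have fd: "finite_dim_algebra k A"
  proof -
    have "G = (\<lambda>(i, j). m i j) ` ({..<q} \<times> {..<q})" by (auto simp: G_def)
    then have "finite G" by simp
    then show ?thesis unfolding finite_dim_algebra_iff_lin_span[OF A] using G span by blast
  qed
  have induct: "R z" if z: "z \<in> carrier A" and "R \<zero>"
    "\<And>u v. u \<in> carrier A \<Longrightarrow> v \<in> carrier A \<Longrightarrow> R u \<Longrightarrow> R v \<Longrightarrow> R (u \<oplus> v)"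
    "\<And>r u. r \<in> carrier k \<Longrightarrow> u \<in> carrier A \<Longrightarrow> R u \<Longrightarrow> R (r \<odot> u)"
    "\<And>i j. i < q \<Longrightarrow> j < q \<Longrightarrow> R (m i j)" for R z
    using subsetD[OF span z] G
    by (rule A.M.lin_span_induct) (use that in \<open>auto simp: G_def\<close>)
  \<comment> \<open>As \<open>x [^] q\<close> is the scalar \<open>b\<close>, the element
    \<open>x [^] (q - s)\<close> is \<open>b\<close> times the inverse of \<open>x [^] s\<close>. So
    this is \<open>b\<close> times the sum of the conjugates of \<open>z\<close> by the powers of
    \<open>x\<close>.\<close>
  define p1 where "p1 z = (\<Oplus>s\<in>{..<q}. x [^] s \<otimes> z \<otimes> x [^] (q - s))" for z
  define p2 where "p2 z = (\<Oplus>s\<in>{..<q}. y [^] (q - s) \<otimes> z \<otimes> y [^] s)" for z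
  have fin: "finite {..<q}" by simp
  note p1L = A.sandwich_sum[where u = "\<lambda>s. x [^] s" and v = "\<lambda>s. x [^] (q - s)",
      OF fin A.nat_pow_closed[OF xC] A.nat_pow_closed[OF xC], folded p1_def]
  note p2L = A.sandwich_sum[where u = "\<lambda>s. y [^] (q - s)" and v = "\<lambda>s. y [^] s",
      OF fin A.nat_pow_closed[OF yC] A.nat_pow_closed[OF yC], folded p2_def]
  define p where "p z = p2 (p1 z)" for z
  have pC: "p z \<in> carrier A" if "z \<in> carrier A" for z unfolding p_def by (rule p2L(1)[OF p1L(1)[OF that]])
  have p_add: "p (z \<oplus> w) = p z \<oplus> p w" if "z \<in> carrier A" "w \<in> carrier A" for z w
    unfolding p_def p1L(2)[OF that] by (rule p2L(2)[OF p1L(1)[OF that(1)] p1L(1)[OF that(2)]])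
  have p_smult: "p (r \<odot> z) = r \<odot> p z" if "r \<in> carrier k" "z \<in> carrier A" for r z
    unfolding p_def p1L(3)[OF that] by (rule p2L(3)[OF that(1) p1L(1)[OF that(2)]])
  have p_J: "p z \<in> J" if "ideal J A" "z \<in> J" for J z
    unfolding p_def by (rule p2L(4)[OF that(1) p1L(4)[OF that]])
  have p_zero: "p \<zero> = \<zero>"
    using p_smult[OF K.zero_closed A.zero_closed] pC[OF A.zero_closed] by simp
  have sum_scal: "(\<Oplus>s\<in>{..<q}. \<zeta> [^]\<^bsub>k\<^esub> (s * i) \<odot> w) = (if q dvd i then Q else \<zero>\<^bsub>k\<^esub>) \<odot> w"
    if "w \<in> carrier A" for w i
    unfolding Q_def sum_roots[symmetric] by (rule A.M.finsum_smult_rdistr[symmetric]) (use that in auto)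
  have p1m: "p1 (m i j) = (if q dvd i then Q else \<zero>\<^bsub>k\<^esub>) \<odot> (b \<odot> m i j)" for i j
  proof -
    have "p1 (m i j) = (\<Oplus>s\<in>{..<q}. \<zeta> [^]\<^bsub>k\<^esub> (s * i) \<odot> (b \<odot> m i j))"
      unfolding p1_def
    proof (rule A.finsum_cong'[OF refl])
      fix s assume s: "s \<in> {..<q}"
      have "x [^] s \<otimes> m i j \<otimes> x [^] (q - s) = m 0 s \<otimes> m i j \<otimes> m 0 (q - s)"
        using xC by (simp add: m_def)
      also have "\<dots> = \<zeta> [^]\<^bsub>k\<^esub> (s * i) \<odot> m i (j + q)"
        using s by (simp add: mm A.smult_mult_l ac_simps)
      also have "m i (j + q) = b \<odot> m i j"
        using xC yC ab by (simp add: m_def A.nat_pow_mult[symmetric] xq A.smult_mult_r)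
      finally show "x [^] s \<otimes> m i j \<otimes> x [^] (q - s) = \<zeta> [^]\<^bsub>k\<^esub> (s * i) \<odot> (b \<odot> m i j)" .
    qed (use ab in auto)
    then show ?thesis using ab by (simp add: sum_scal)
  qed
  have p2m: "p2 (m i j) = (if q dvd j then Q else \<zero>\<^bsub>k\<^esub>) \<odot> (a \<odot> m i j)" for i j
  proof -
    have "p2 (m i j) = (\<Oplus>s\<in>{..<q}. \<zeta> [^]\<^bsub>k\<^esub> (s * j) \<odot> (a \<odot> m i j))"
      unfolding p2_def
    proof (rule A.finsum_cong'[OF refl])
      fix s assume s: "s \<in> {..<q}"
      have "y [^] (q - s) \<otimes> m i j \<otimes> y [^] s = m (q - s) 0 \<otimes> m i j \<otimes> m s 0"
        using yC by (simp add: m_def)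
      also have "\<dots> = \<zeta> [^]\<^bsub>k\<^esub> (s * j) \<odot> m (q + i) j"
        using s by (simp add: mm A.smult_mult_l ac_simps)
      also have "m (q + i) j = a \<odot> m i j"
        using xC yC ab by (simp add: m_def A.nat_pow_mult[symmetric] yq A.smult_mult_l)
      finally show "y [^] (q - s) \<otimes> m i j \<otimes> y [^] s = \<zeta> [^]\<^bsub>k\<^esub> (s * j) \<odot> (a \<odot> m i j)" .
    qed (use ab in auto)
    then show ?thesis using ab by (simp add: sum_scal)
  qed
  \<comment> \<open>The factor by which \<open>p\<close> scales the unit. It is nonzero because
    \<open>q\<close>, \<open>a\<close> and \<open>b\<close> are nonzero in \<open>k\<close>.\<close>
  define N where "N = (Q \<otimes>\<^bsub>k\<^esub> b) \<otimes>\<^bsub>k\<^esub> (Q \<otimes>\<^bsub>k\<^esub> a)"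
  have N: "N \<in> carrier k" "N \<noteq> \<zero>\<^bsub>k\<^esub>" using Q ab by (simp_all add: N_def K.integral_iff)
  have pm: "p (m i j) = (if q dvd i \<and> q dvd j then N \<odot> m i j else \<zero>)" for i j
  proof -
    let ?r = "(if q dvd i then Q else \<zero>\<^bsub>k\<^esub>) \<otimes>\<^bsub>k\<^esub> b"
    have r: "?r \<in> carrier k" using Q ab by simp
    have "p (m i j) = p2 (?r \<odot> m i j)"
      unfolding p_def p1m using Q ab by (simp add: A.M.smult_assoc1)
    also have "\<dots> = ?r \<odot> ((if q dvd j then Q else \<zero>\<^bsub>k\<^esub>) \<odot> (a \<odot> m i j))"
      by (simp only: p2L(3)[OF r mC] p2m)
    also have "\<dots> = (if q dvd i \<and> q dvd j then N \<odot> m i j else \<zero>)"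
      using Q ab by (simp add: N_def A.M.smult_assoc1)
    finally show ?thesis .
  qed
  have p_scal: "\<exists>r\<in>carrier k. p z = r \<odot> \<one>" if z: "z \<in> carrier A" for z
  proof (rule induct[OF z])
    show "\<exists>r\<in>carrier k. p \<zero> = r \<odot> \<one>" by (intro bexI[of _ "\<zero>\<^bsub>k\<^esub>"]) (simp_all add: p_zero)
    show "\<exists>r\<in>carrier k. p (u \<oplus> v) = r \<odot> \<one>" if uv: "u \<in> carrier A" "v \<in> carrier A"
      "\<exists>r\<in>carrier k. p u = r \<odot> \<one>" "\<exists>r\<in>carrier k. p v = r \<odot> \<one>" for u v
    proof -
      obtain r s where "r \<in> carrier k" "p u = r \<odot> \<one>" "s \<in> carrier k" "p v = s \<odot> \<one>" using uv by blast
      then show ?thesis using uv by (intro bexI[of _ "r \<oplus>\<^bsub>k\<^esub> s"]) (simp_all add: p_add A.M.smult_l_distr)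
    qed
    show "\<exists>r\<in>carrier k. p (s \<odot> u) = r \<odot> \<one>" if su: "s \<in> carrier k" "u \<in> carrier A"
      "\<exists>r\<in>carrier k. p u = r \<odot> \<one>" for s u
    proof -
      obtain r where "r \<in> carrier k" "p u = r \<odot> \<one>" using su by blast
      then show ?thesis using su by (intro bexI[of _ "s \<otimes>\<^bsub>k\<^esub> r"]) (simp_all add: p_smult A.M.smult_assoc1)
    qed
    show "\<exists>r\<in>carrier k. p (m i j) = r \<odot> \<one>" if ij: "i < q" "j < q" for i j
    proof (cases "i = 0 \<and> j = 0")
      case True
      then show ?thesis using N pm[of 0 0] by (auto simp: m0)
    next
      case False
      then have "\<not> (q dvd i \<and> q dvd j)" using ij by (metis nat_dvd_not_less neq0_conv)
      then show ?thesis by (intro bexI[of _ "\<zero>\<^bsub>k\<^esub>"]) (auto simp: pm)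
    qed
  qed
  \<comment> \<open>Conjugation fixes a central element, so \<open>p\<close> multiplies it by
    \<open>N\<close>; on the other hand every value of \<open>p\<close> is a scalar.\<close>
  have center: "\<exists>r\<in>carrier k. z = r \<odot> \<one>"
    if z: "z \<in> carrier A" and c: "\<And>w. w \<in> carrier A \<Longrightarrow> z \<otimes> w = w \<otimes> z" for z
  proof -
    have 1: "p1 w = (Q \<otimes>\<^bsub>k\<^esub> b) \<odot> w" if w: "w \<in> carrier A" "\<And>v. v \<in> carrier A \<Longrightarrow> w \<otimes> v = v \<otimes> w" for w
    proof -
      have "p1 w = (\<Oplus>s\<in>{..<q}. \<zeta> [^]\<^bsub>k\<^esub> (s * 0) \<odot> (b \<odot> w))"
        unfolding p1_def
      proof (rule A.finsum_cong'[OF refl])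
        fix s assume s: "s \<in> {..<q}"
        have "x [^] s \<otimes> w \<otimes> x [^] (q - s) = w \<otimes> (x [^] s \<otimes> x [^] (q - s))"
          using w(2)[of "x [^] s"] w(1) xC by (simp add: A.m_assoc[symmetric])
        also have "x [^] s \<otimes> x [^] (q - s) = b \<odot> \<one>" using s xC by (simp add: A.nat_pow_mult xq)
        finally show "x [^] s \<otimes> w \<otimes> x [^] (q - s) = \<zeta> [^]\<^bsub>k\<^esub> (s * 0) \<odot> (b \<odot> w)"
          using w(1) ab by (simp add: A.smult_mult_r)
      qed (use ab w in auto)
      then show ?thesis using ab w(1) Q by (simp only: sum_scal A.M.smult_closed) (simp add: A.M.smult_assoc1)
    qed
    have 2: "p2 w = (Q \<otimes>\<^bsub>k\<^esub> a) \<odot> w" if w: "w \<in> carrier A" "\<And>v. v \<in> carrier A \<Longrightarrow> w \<otimes> v = v \<otimes> w" for w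
    proof -
      have "p2 w = (\<Oplus>s\<in>{..<q}. \<zeta> [^]\<^bsub>k\<^esub> (s * 0) \<odot> (a \<odot> w))"
        unfolding p2_def
      proof (rule A.finsum_cong'[OF refl])
        fix s assume s: "s \<in> {..<q}"
        have "y [^] (q - s) \<otimes> w \<otimes> y [^] s = w \<otimes> (y [^] (q - s) \<otimes> y [^] s)"
          using w(2)[of "y [^] (q - s)"] w(1) yC by (simp add: A.m_assoc[symmetric])
        also have "y [^] (q - s) \<otimes> y [^] s = a \<odot> \<one>" using s yC by (simp add: A.nat_pow_mult yq)
        finally show "y [^] (q - s) \<otimes> w \<otimes> y [^] s = \<zeta> [^]\<^bsub>k\<^esub> (s * 0) \<odot> (a \<odot> w)"
          using w(1) ab by (simp add: A.smult_mult_r)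
      qed (use ab w in auto)
      then show ?thesis using ab w(1) Q by (simp only: sum_scal A.M.smult_closed) (simp add: A.M.smult_assoc1)
    qed
    have p1z: "p1 z = (Q \<otimes>\<^bsub>k\<^esub> b) \<odot> z" by (rule 1[OF z]) (rule c)
    have p2z: "p2 z = (Q \<otimes>\<^bsub>k\<^esub> a) \<odot> z" by (rule 2[OF z]) (rule c)
    have "p z = (Q \<otimes>\<^bsub>k\<^esub> b) \<odot> p2 z"
      unfolding p_def p1z by (rule p2L(3)[OF _ z]) (use Q ab in simp)
    also have "\<dots> = N \<odot> z" unfolding p2z N_def using Q ab z by (simp add: A.M.smult_assoc1)
    finally have pz: "p z = N \<odot> z" .
    obtain r where r: "r \<in> carrier k" "p z = r \<odot> \<one>" using p_scal[OF z] by blast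
    have U: "N \<in> Units k" using N by (simp add: K.field_Units)
    have "z = inv\<^bsub>k\<^esub> N \<odot> (N \<odot> z)"
      using U K.Units_inv_closed[OF U] N z by (simp add: A.M.smult_assoc1[symmetric])
    also have "\<dots> = (inv\<^bsub>k\<^esub> N \<otimes>\<^bsub>k\<^esub> r) \<odot> \<one>"
      unfolding pz[symmetric] r(2) using K.Units_inv_closed[OF U] r(1) by (simp add: A.M.smult_assoc1)
    finally show ?thesis using K.Units_inv_closed[OF U] r(1) by blast
  qed
  \<comment> \<open>Up to the unit \<open>a\<close> times \<open>b\<close> this is the inverse of
    the monomial \<open>m (fst ij) (snd ij)\<close>.\<close>
  define m' where "m' ij = x [^] (q - snd ij) \<otimes> y [^] (q - fst ij)" for ij :: "nat \<times> nat"
  have m'C [simp]: "m' ij \<in> carrier A" for ij using xC yC by (simp add: m'_def)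
  let ?I = "{..<q} \<times> {..<q}"
  \<comment> \<open>Up to a nonzero scalar, \<open>p (z \<otimes> m' ij)\<close> reads off a
    coefficient of \<open>z\<close> at the monomial \<open>m (fst ij) (snd ij)\<close>. Summing
    these coefficients against the monomials rebuilds \<open>z\<close>, up to the factor
    \<open>N'\<close>.\<close>
  define T where "T z = (\<Oplus>ij\<in>?I. p (z \<otimes> m' ij) \<otimes> m (fst ij) (snd ij))" for z
  define N' where "N' = N \<otimes>\<^bsub>k\<^esub> (a \<otimes>\<^bsub>k\<^esub> b)"
  have N': "N' \<in> carrier k" "N' \<noteq> \<zero>\<^bsub>k\<^esub>" using N ab by (simp_all add: N'_def K.integral_iff)
  have T: "T z = N' \<odot> z" if z: "z \<in> carrier A" for z
  proof (rule induct[OF z])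
    show "T \<zero> = N' \<odot> \<zero>"
    proof -
      have "T \<zero> = (\<Oplus>ij\<in>?I. \<zero>)" unfolding T_def by (rule A.finsum_cong') (simp_all add: p_zero)
      then show ?thesis using N' by simp
    qed
    show "T (u \<oplus> v) = N' \<odot> (u \<oplus> v)"
      if "u \<in> carrier A" "v \<in> carrier A" "T u = N' \<odot> u" "T v = N' \<odot> v" for u v
    proof -
      have "T (u \<oplus> v) = T u \<oplus> T v"
        unfolding T_def
        by (rule trans[OF A.finsum_cong'[OF refl] A.finsum_addf])
          (use that(1,2) pC in \<open>auto simp: A.l_distr p_add\<close>)
      then show ?thesis using that N' by (simp add: A.M.smult_r_distr)
    qed
    show "T (r \<odot> u) = N' \<odot> (r \<odot> u)"
      if "r \<in> carrier k" "u \<in> carrier A" "T u = N' \<odot> u" for r u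
    proof -
      have "T (r \<odot> u) = r \<odot> T u"
        unfolding T_def
        by (rule trans[OF A.finsum_cong'[OF refl] A.M.finsum_smult_ldistr[symmetric]])
          (use that(1,2) pC in \<open>auto simp: A.smult_mult_l p_smult\<close>)
      then show ?thesis using that N' by (simp add: A.M.smult_assoc1[symmetric] K.m_comm)
    qed
    show "T (m r s) = N' \<odot> m r s" if rs: "r < q" "s < q" for r s
    proof -
      have mm': "m r s \<otimes> m' (i, j) = \<zeta> [^]\<^bsub>k\<^esub> ((s + (q - j)) * (q - i)) \<odot> m (r + (q - i)) (s + (q - j))" for i j
      proof -
        have "m r s \<otimes> m' (i, j) = m r s \<otimes> m 0 (q - j) \<otimes> m (q - i) 0"
          using xC yC by (simp add: m_def m'_def A.m_assoc)
        then show ?thesis by (simp add: mm)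
      qed
      have "T (m r s) = (\<Oplus>ij\<in>?I. if (r, s) = ij then N' \<odot> m (fst ij) (snd ij) else \<zero>)"
        unfolding T_def
      proof (rule A.finsum_cong'[OF refl])
        fix ij assume "ij \<in> ?I"
        then obtain i j where ij: "ij = (i, j)" "i < q" "j < q" by auto
        \<comment> \<open>\<open>q - i\<close> plays the part of \<open>- i\<close> modulo
          \<open>q\<close>. The sum lies strictly between 0 and \<open>2 * q\<close>, so it is
          divisible by \<open>q\<close> only if it equals \<open>q\<close>.\<close>
        have dv: "q dvd r + (q - i) \<longleftrightarrow> r = i" "q dvd s + (q - j) \<longleftrightarrow> s = j"
        proof -
          have *: "q dvd u + (q - v) \<longleftrightarrow> u = v" if "u < q" "v < q" for u v :: nat
          proof
            assume "q dvd u + (q - v)"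
            then obtain c where c: "u + (q - v) = q * c" by (auto simp: dvd_def)
            have "0 < q * c" "q * c < q * 2" using c that by linarith+
            then have "c = 1" by (simp only: mult_less_cancel1) auto
            then show "u = v" using c that by simp
          qed (use that in simp)
          show "q dvd r + (q - i) \<longleftrightarrow> r = i" "q dvd s + (q - j) \<longleftrightarrow> s = j" using * rs ij by simp_all
        qed
        show "p (m r s \<otimes> m' ij) \<otimes> m (fst ij) (snd ij) =
          (if (r, s) = ij then N' \<odot> m (fst ij) (snd ij) else \<zero>)"
        proof (cases "(r, s) = (i, j)")
          case True
          have z1: "\<zeta> [^]\<^bsub>k\<^esub> ((s + (q - j)) * (q - i)) = \<one>\<^bsub>k\<^esub>"
            using True ij by (simp add: zeta_pow_eq_one)
          have "m q q = (a \<otimes>\<^bsub>k\<^esub> b) \<odot> \<one>" using ab by (simp add: m_def xq yq A.smult_mult_smult)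
          moreover have "p (m r s \<otimes> m' (i, j)) = N \<odot> m q q"
            unfolding mm' z1 using True ij by (simp add: pm)
          ultimately have "p (m r s \<otimes> m' (i, j)) = N' \<odot> \<one>"
            using ab N by (simp add: N'_def A.M.smult_assoc1)
          then show ?thesis using True ij N' by (simp add: A.smult_mult_l)
        next
          case False
          then have "p (m r s \<otimes> m' (i, j)) = \<zero>"
            unfolding mm' p_smult[OF zeta_pow_closed mC] pm dv by auto
          then show ?thesis using False ij by auto
        qed
      qed (use N' in auto)
      also have "\<dots> = N' \<odot> m (fst (r, s)) (snd (r, s))"
        by (rule A.add.finprod_singleton) (use rs N' in auto)
      finally show ?thesis by simp
    qed
  qed
  \<comment> \<open>If all coefficients of \<open>z\<close> vanished, \<open>T z\<close> and hence
    \<open>z\<close> would be zero. So some \<open>p (z \<otimes> m' ij)\<close> is a nonzero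
    scalar, and it lies in \<open>J\<close> because \<open>p\<close> preserves ideals.\<close>
  have ideal: "\<one> \<in> J" if J: "ideal J A" and z: "z \<in> J" "z \<noteq> \<zero>" for J z
  proof -
    interpret J: ideal J A by fact
    have zC: "z \<in> carrier A" by (rule J.Icarr[OF z(1)])
    have "\<exists>ij\<in>?I. p (z \<otimes> m' ij) \<noteq> \<zero>"
    proof (rule ccontr)
      assume "\<not> ?thesis"
      then have "T z = (\<Oplus>ij\<in>?I. \<zero>)" unfolding T_def by (intro A.finsum_cong') auto
      then have "N' \<odot> z = \<zero>" using T[OF zC] by simp
      then show False using A.smult_nonzero[OF N' zC] z(2) by blast
    qed
    then obtain ij where ij: "p (z \<otimes> m' ij) \<noteq> \<zero>" by blast
    have pJ: "p (z \<otimes> m' ij) \<in> J" by (rule p_J[OF J J.I_r_closed[OF z(1) m'C]])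
    obtain r where r: "r \<in> carrier k" "p (z \<otimes> m' ij) = r \<odot> \<one>"
      using p_scal[OF A.m_closed[OF zC m'C]] by blast
    have "r \<noteq> \<zero>\<^bsub>k\<^esub>" using r ij by auto
    then have U: "r \<in> Units k" using r(1) by (simp add: K.field_Units)
    have "(inv\<^bsub>k\<^esub> r \<odot> \<one>) \<otimes> (r \<odot> \<one>) \<in> J"
      using J.I_l_closed[OF pJ, of "inv\<^bsub>k\<^esub> r \<odot> \<one>"] K.Units_inv_closed[OF U] r(2) by simp
    then show ?thesis using U K.Units_inv_closed[OF U] r(1) by (simp add: A.smult_mult_smult)
  qed
  show ?thesis unfolding central_simple_algebra_iff[OF A] using fd center A1 ideal by blast
qed

end

section \<open>Clock and shift matrices, split symbols, and multiplicativity of the symbol\<close>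

definition diag_mat :: "('a, 'r) ring_scheme \<Rightarrow> nat \<Rightarrow> (nat \<Rightarrow> 'a) \<Rightarrow> nat \<times> nat \<Rightarrow> 'a" where
  "diag_mat k q d = (\<lambda>(i, j)\<in>{..<q} \<times> {..<q}. if i = j then d i else \<zero>\<^bsub>k\<^esub>)"

text \<open>The cyclic permutation matrix with its wrap-around entry replaced by \<open>c\<close>, a
  companion matrix of X^q - c; its \<open>q\<close>-th power is the scalar \<open>c\<close>.\<close>

definition shift_mat :: "('a, 'r) ring_scheme \<Rightarrow> nat \<Rightarrow> 'a \<Rightarrow> nat \<times> nat \<Rightarrow> 'a" where
  "shift_mat k q c =
     (\<lambda>(i, j)\<in>{..<q} \<times> {..<q}. if j = (i + 1) mod q then (if i + 1 < q then \<one>\<^bsub>k\<^esub> else c) else \<zero>\<^bsub>k\<^esub>)"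

context kummer
begin

abbreviation "B0 \<equiv> base_algebra k"
abbreviation "MM \<equiv> mat {..<q} B0"

lemma B0_simps [simp]:
  "carrier B0 = carrier k" "\<one>\<^bsub>B0\<^esub> = \<one>\<^bsub>k\<^esub>" "\<zero>\<^bsub>B0\<^esub> = \<zero>\<^bsub>k\<^esub>"
  "x \<otimes>\<^bsub>B0\<^esub> y = x \<otimes>\<^bsub>k\<^esub> y" "x \<oplus>\<^bsub>B0\<^esub> y = x \<oplus>\<^bsub>k\<^esub> y" "r \<odot>\<^bsub>B0\<^esub> y = r \<otimes>\<^bsub>k\<^esub> y"
  by (simp_all add: base_algebra_def)

lemma B0_k_alg: "k_alg k B0"
  by (rule csa_alg[OF K.field_axioms base_algebra_csa[OF K.field_axioms]])

interpretation M: mat_alg k B0 "{..<q}"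
  using B0_k_alg by (simp add: mat_alg_def mat_alg_axioms_def)

lemma MM_csa: "central_simple_algebra k MM"
  by (rule mat_csa[OF K.field_axioms base_algebra_csa[OF K.field_axioms]]) (use q_pos in auto)

lemma diag_at: "i < q \<Longrightarrow> j < q \<Longrightarrow> diag_mat k q d (i, j) = (if i = j then d i else \<zero>\<^bsub>k\<^esub>)"
  by (simp add: diag_mat_def)

lemma diag_closed: "(\<And>i. i < q \<Longrightarrow> d i \<in> carrier k) \<Longrightarrow> diag_mat k q d \<in> carrier MM"
  by (auto simp: diag_mat_def M.F.carrier)

lemma diag_mult:
  assumes d: "\<And>i. i < q \<Longrightarrow> d i \<in> carrier k" and x: "x \<in> carrier MM" and ij: "i < q" "j < q"
  shows "(diag_mat k q d \<otimes>\<^bsub>MM\<^esub> x) (i, j) = d i \<otimes>\<^bsub>k\<^esub> x (i, j)"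
    "(x \<otimes>\<^bsub>MM\<^esub> diag_mat k q d) (i, j) = x (i, j) \<otimes>\<^bsub>k\<^esub> d j"
proof -
  have ij': "i \<in> {..<q}" "j \<in> {..<q}" using ij by simp_all
  have xC: "x (i, j) \<in> carrier k" if "i < q" "j < q" for i j using M.mat_entry[OF x] that by simp
  have "(\<Oplus>\<^bsub>B0\<^esub>l\<in>{..<q}. diag_mat k q d (i, l) \<otimes>\<^bsub>B0\<^esub> x (l, j)) =
      (\<Oplus>\<^bsub>B0\<^esub>l\<in>{..<q}. if i = l then d i \<otimes>\<^bsub>k\<^esub> x (l, j) else \<zero>\<^bsub>B0\<^esub>)"
    by (rule M.finsum_cong') (use ij d xC in \<open>auto simp: diag_at\<close>)
  also have "\<dots> = d i \<otimes>\<^bsub>k\<^esub> x (i, j)"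
    by (rule M.add.finprod_singleton) (use ij d xC in auto)
  finally show "(diag_mat k q d \<otimes>\<^bsub>MM\<^esub> x) (i, j) = d i \<otimes>\<^bsub>k\<^esub> x (i, j)" by (simp only: mat_mult[OF ij'])
  have "(\<Oplus>\<^bsub>B0\<^esub>l\<in>{..<q}. x (i, l) \<otimes>\<^bsub>B0\<^esub> diag_mat k q d (l, j)) =
      (\<Oplus>\<^bsub>B0\<^esub>l\<in>{..<q}. if j = l then x (i, l) \<otimes>\<^bsub>k\<^esub> d l else \<zero>\<^bsub>B0\<^esub>)"
    by (rule M.finsum_cong') (use ij d xC in \<open>auto simp: diag_at\<close>)
  also have "\<dots> = x (i, j) \<otimes>\<^bsub>k\<^esub> d j"
    by (rule M.add.finprod_singleton) (use ij d xC in auto)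
  finally show "(x \<otimes>\<^bsub>MM\<^esub> diag_mat k q d) (i, j) = x (i, j) \<otimes>\<^bsub>k\<^esub> d j" by (simp only: mat_mult[OF ij'])
qed

lemma diag_mult_diag:
  assumes "\<And>i. i < q \<Longrightarrow> d i \<in> carrier k" "\<And>i. i < q \<Longrightarrow> e i \<in> carrier k"
  shows "diag_mat k q d \<otimes>\<^bsub>MM\<^esub> diag_mat k q e = diag_mat k q (\<lambda>i. d i \<otimes>\<^bsub>k\<^esub> e i)"
  by (rule M.mat_eqI)
    (use assms diag_closed M.mat.m_closed in \<open>auto simp: diag_mult diag_at\<close>)

lemma one_diag: "\<one>\<^bsub>MM\<^esub> = diag_mat k q (\<lambda>i. \<one>\<^bsub>k\<^esub>)"
  by (rule M.mat_eqI) (use diag_closed in \<open>auto simp: mat_one diag_at\<close>)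

lemma diag_cong: "(\<And>i. i < q \<Longrightarrow> d i = e i) \<Longrightarrow> diag_mat k q d = diag_mat k q e"
  by (auto simp: diag_mat_def restrict_def fun_eq_iff)

lemma diag_pow:
  assumes "\<And>i. i < q \<Longrightarrow> d i \<in> carrier k"
  shows "diag_mat k q d [^]\<^bsub>MM\<^esub> (n::nat) = diag_mat k q (\<lambda>i. d i [^]\<^bsub>k\<^esub> n)"
  by (induction n) (simp_all add: one_diag diag_mult_diag assms)

lemma shift_at: "i < q \<Longrightarrow> j < q \<Longrightarrow>
    shift_mat k q c (i, j) = (if j = (i + 1) mod q then (if i + 1 < q then \<one>\<^bsub>k\<^esub> else c) else \<zero>\<^bsub>k\<^esub>)"
  by (simp add: shift_mat_def)

lemma shift_closed: "c \<in> carrier k \<Longrightarrow> shift_mat k q c \<in> carrier MM"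
  by (auto simp: shift_mat_def M.F.carrier)

text \<open>A path of at most \<open>q\<close> steps wraps around at most once, so the factor
  \<open>c\<close> occurs at most to the first power; this is the reason for the bound on
  \<open>n\<close>.\<close>

lemma shift_pow:
  assumes c: "c \<in> carrier k" and n: "n \<le> q" and ij: "i < q" "j < q"
  shows "(shift_mat k q c [^]\<^bsub>MM\<^esub> n) (i, j) =
    (if j = (i + n) mod q then (if i + n < q then \<one>\<^bsub>k\<^esub> else c) else \<zero>\<^bsub>k\<^esub>)"
  using n ij
proof (induction n arbitrary: j)
  case 0
  then show ?case by (auto simp: mat_one)
next
  case (Suc n)
  let ?x = "shift_mat k q c" and ?l = "(i + n) mod q"
  let ?w = "if i + n < q then \<one>\<^bsub>k\<^esub> else c"
  have l: "?l < q" using q_pos by simp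
  have xC: "?x (i, j) \<in> carrier k" if "i < q" "j < q" for i j using M.mat_entry[OF shift_closed[OF c]] that by simp
  have ij': "i \<in> {..<q}" "j \<in> {..<q}" using Suc.prems by simp_all
  have "(?x [^]\<^bsub>MM\<^esub> Suc n) (i, j) = (\<Oplus>\<^bsub>B0\<^esub>t\<in>{..<q}. (?x [^]\<^bsub>MM\<^esub> n) (i, t) \<otimes>\<^bsub>B0\<^esub> ?x (t, j))"
    by (simp only: M.mat.nat_pow_Suc mat_mult[OF ij'])
  also have "\<dots> = (\<Oplus>\<^bsub>B0\<^esub>t\<in>{..<q}. if ?l = t then ?w \<otimes>\<^bsub>k\<^esub> ?x (t, j) else \<zero>\<^bsub>B0\<^esub>)"
  proof (rule M.finsum_cong'[OF refl])
    fix t assume "t \<in> {..<q}"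
    then show "(?x [^]\<^bsub>MM\<^esub> n) (i, t) \<otimes>\<^bsub>B0\<^esub> ?x (t, j) = (if ?l = t then ?w \<otimes>\<^bsub>k\<^esub> ?x (t, j) else \<zero>\<^bsub>B0\<^esub>)"
      using Suc.IH[of t] Suc.prems xC[of t j] by auto
  qed (use Suc.prems xC c in auto)
  also have "\<dots> = ?w \<otimes>\<^bsub>k\<^esub> ?x (?l, j)"
    by (rule M.add.finprod_singleton) (use Suc.prems xC c l in auto)
  also have "\<dots> = (if j = (i + Suc n) mod q then (if i + Suc n < q then \<one>\<^bsub>k\<^esub> else c) else \<zero>\<^bsub>k\<^esub>)"
  proof -
    have e: "(?l + 1) mod q = (i + Suc n) mod q" by (simp add: mod_Suc_eq)
    show ?thesis
    proof (cases "i + n < q")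
      case True
      then show ?thesis unfolding shift_at[OF l Suc.prems(3)] e using c by auto
    next
      case False
      then have "?l = i + n - q" using Suc.prems by (simp add: le_mod_geq)
      then have "?l + 1 < q" using Suc.prems False by simp
      then show ?thesis unfolding shift_at[OF l Suc.prems(3)] e using c False by auto
    qed
  qed
  finally show ?case .
qed

text \<open>The clock matrix: conjugation by a shift matrix with nonzero \<open>c\<close> multiplies
  it by \<open>\<zeta>\<close>.\<close>

definition "Dm = diag_mat k q (\<lambda>i. \<zeta> [^]\<^bsub>k\<^esub> i)"

lemma Dm_closed: "Dm \<in> carrier MM"
  unfolding Dm_def by (rule diag_closed) simp

lemma Dm_pow: "Dm [^]\<^bsub>MM\<^esub> (n::nat) = diag_mat k q (\<lambda>i. \<zeta> [^]\<^bsub>k\<^esub> (i * n))"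
  unfolding Dm_def by (subst diag_pow) (simp_all add: zeta K.nat_pow_pow)

lemma Dm_pow_q: "Dm [^]\<^bsub>MM\<^esub> q = \<one>\<^bsub>MM\<^esub>"
  unfolding Dm_pow one_diag by (rule diag_cong) (simp add: zeta_pow_eq_one)

lemma shift_pow_q:
  assumes c: "c \<in> carrier k" shows "shift_mat k q c [^]\<^bsub>MM\<^esub> q = c \<odot>\<^bsub>MM\<^esub> \<one>\<^bsub>MM\<^esub>"
  by (rule M.mat_eqI)
    (use c shift_closed in \<open>auto simp: shift_pow mat_one M.F.at\<close>)

lemma shift_Dm:
  assumes c: "c \<in> carrier k"
  shows "shift_mat k q c \<otimes>\<^bsub>MM\<^esub> Dm = \<zeta> \<odot>\<^bsub>MM\<^esub> (Dm \<otimes>\<^bsub>MM\<^esub> shift_mat k q c)"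
proof (rule M.mat_eqI)
  fix i j assume "i \<in> {..<q}" "j \<in> {..<q}"
  then have ij: "i < q" "j < q" by simp_all
  have m: "(shift_mat k q c \<otimes>\<^bsub>MM\<^esub> Dm) (i, j) = shift_mat k q c (i, j) \<otimes>\<^bsub>k\<^esub> \<zeta> [^]\<^bsub>k\<^esub> j"
    "(Dm \<otimes>\<^bsub>MM\<^esub> shift_mat k q c) (i, j) = \<zeta> [^]\<^bsub>k\<^esub> i \<otimes>\<^bsub>k\<^esub> shift_mat k q c (i, j)"
    unfolding Dm_def by (rule diag_mult[OF _ shift_closed[OF c] ij], simp)+
  have z: "\<zeta> [^]\<^bsub>k\<^esub> ((i + 1) mod q) = \<zeta> \<otimes>\<^bsub>k\<^esub> \<zeta> [^]\<^bsub>k\<^esub> i"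
    using zeta_pow_mod[of "i + 1"] zeta by (simp add: K.m_comm)
  have "shift_mat k q c (i, j) \<otimes>\<^bsub>k\<^esub> \<zeta> [^]\<^bsub>k\<^esub> j = \<zeta> \<otimes>\<^bsub>k\<^esub> (\<zeta> [^]\<^bsub>k\<^esub> i \<otimes>\<^bsub>k\<^esub> shift_mat k q c (i, j))"
    unfolding shift_at[OF ij]
  proof (cases "j = (i + 1) mod q")
    case True
    then show "(if j = (i + 1) mod q then (if i + 1 < q then \<one>\<^bsub>k\<^esub> else c) else \<zero>\<^bsub>k\<^esub>) \<otimes>\<^bsub>k\<^esub> \<zeta> [^]\<^bsub>k\<^esub> j =
      \<zeta> \<otimes>\<^bsub>k\<^esub> (\<zeta> [^]\<^bsub>k\<^esub> i \<otimes>\<^bsub>k\<^esub> (if j = (i + 1) mod q then (if i + 1 < q then \<one>\<^bsub>k\<^esub> else c) else \<zero>\<^bsub>k\<^esub>))"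
      using c zeta z by (simp add: K.m_ac)
  qed (use zeta in simp)
  then show "(shift_mat k q c \<otimes>\<^bsub>MM\<^esub> Dm) (i, j) = (\<zeta> \<odot>\<^bsub>MM\<^esub> (Dm \<otimes>\<^bsub>MM\<^esub> shift_mat k q c)) (i, j)"
    using ij by (simp add: m M.F.at)
qed (use shift_closed[OF c] Dm_closed zeta in auto)

text \<open>Fourier inversion over the powers of the clock matrix produces the diagonal matrix
  units, and powers of the shift, cut out between two of these, produce the others.\<close>

lemma MM_generated:
  assumes S: "subring S MM" and scal: "\<And>r. r \<in> carrier k \<Longrightarrow> r \<odot>\<^bsub>MM\<^esub> \<one>\<^bsub>MM\<^esub> \<in> S"
    and D: "Dm \<in> S" and P: "shift_mat k q c \<in> S" and c: "c \<in> carrier k" "c \<noteq> \<zero>\<^bsub>k\<^esub>"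
  shows "carrier MM \<subseteq> S"
proof -
  have smul: "r \<odot>\<^bsub>MM\<^esub> z \<in> S" if r: "r \<in> carrier k" and z: "z \<in> S" for r z
  proof -
    have "z \<in> carrier MM" using subringE(1)[OF S] z by auto
    then have "r \<odot>\<^bsub>MM\<^esub> z = (r \<odot>\<^bsub>MM\<^esub> \<one>\<^bsub>MM\<^esub>) \<otimes>\<^bsub>MM\<^esub> z" using r by (simp add: M.mat.smult_mult_l)
    then show ?thesis using subringE(6)[OF S scal[OF r] z] by simp
  qed
  have pw: "z [^]\<^bsub>MM\<^esub> (n::nat) \<in> S" if "z \<in> S" for z n
    by (induction n) (use that subringE(3,6)[OF S] in auto)
  define Q where "Q = [q] \<cdot>\<^bsub>k\<^esub> \<one>\<^bsub>k\<^esub>"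
  have Q: "Q \<in> carrier k" "Q \<noteq> \<zero>\<^bsub>k\<^esub>" using q_nonzero by (simp_all add: Q_def)
  then have QU: "Q \<in> Units k" by (simp add: K.field_Units)
  let ?E = "\<lambda>i j a. delta B0 ({..<q} \<times> {..<q}) (i, j) a"
  have sumS: "finite I \<Longrightarrow> (\<And>s. s \<in> I \<Longrightarrow> f s \<in> S) \<Longrightarrow> (\<Oplus>\<^bsub>MM\<^esub>s\<in>I. f s) \<in> S" for I :: "nat set" and f
  proof (induction I rule: finite_induct)
    case empty
    then show ?case by (simp add: subringE(2)[OF S])
  next
    case (insert s I)
    have "f t \<in> carrier MM" if "t \<in> insert s I" for t
      using insert.prems[OF that] subringE(1)[OF S] by blast
    then show ?case using insert subringE(7)[OF S] by (subst M.mat.finsum_insert) auto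
  qed
  have eval: "(\<Oplus>\<^bsub>MM\<^esub>s\<in>I. f s) (r, t) = (\<Oplus>\<^bsub>k\<^esub>s\<in>I. f s (r, t))"
    if "finite I" "\<And>s. s \<in> I \<Longrightarrow> f s \<in> carrier MM" "r < q" "t < q" for I :: "nat set" and f r t
    using that
  proof (induction I rule: finite_induct)
    case empty
    then show ?case by (simp add: M.F.at)
  next
    case (insert s I)
    have "f u \<in> carrier MM" "f u (r, t) \<in> carrier k" if "u \<in> insert s I" for u
      using insert.prems(1)[OF that] M.mat_entry[OF insert.prems(1)[OF that], of r t] insert.prems by simp_all
    then show ?case using insert by (simp add: M.mat.finsum_insert K.finsum_insert M.F.at Pi_iff)
  qed
  have Eii: "?E i i \<one>\<^bsub>k\<^esub> \<in> S" if i: "i < q" for i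
  proof -
    \<comment> \<open>\<open>q - i\<close> stands for the exponent \<open>- i\<close>. Weighted in
      this way, the powers of \<open>Dm\<close> add up to \<open>Q\<close> times the diagonal matrix
      unit at \<open>i\<close>.\<close>
    let ?f = "\<lambda>s::nat. \<zeta> [^]\<^bsub>k\<^esub> (s * (q - i)) \<odot>\<^bsub>MM\<^esub> Dm [^]\<^bsub>MM\<^esub> s"
    have fC: "?f s \<in> carrier MM" for s using Dm_closed by simp
    have "(\<Oplus>\<^bsub>MM\<^esub>s\<in>{..<q}. ?f s) = Q \<odot>\<^bsub>MM\<^esub> ?E i i \<one>\<^bsub>k\<^esub>"
    proof (rule M.mat_eqI)
      fix r t assume "r \<in> {..<q}" "t \<in> {..<q}"
      then have rt: "r < q" "t < q" by simp_all
      have "(\<Oplus>\<^bsub>MM\<^esub>s\<in>{..<q}. ?f s) (r, t) = (\<Oplus>\<^bsub>k\<^esub>s\<in>{..<q}. ?f s (r, t))"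
        by (rule eval[OF _ fC rt]) simp
      also have "\<dots> = (\<Oplus>\<^bsub>k\<^esub>s\<in>{..<q}. if r = t then \<zeta> [^]\<^bsub>k\<^esub> (s * (q - i + r)) else \<zero>\<^bsub>k\<^esub>)"
        by (rule K.finsum_cong') (use rt zeta in \<open>auto simp: M.F.at Dm_pow diag_at K.nat_pow_mult algebra_simps\<close>)
      also have "\<dots> = (if r = t then (if q dvd (q - i + r) then Q else \<zero>\<^bsub>k\<^esub>) else \<zero>\<^bsub>k\<^esub>)"
        by (simp add: sum_roots Q_def)
      also have "q dvd (q - i + r) \<longleftrightarrow> i = r"
      proof
        assume "q dvd q - i + r"
        then obtain e where e: "q - i + r = q * e" by (auto simp: dvd_def)
        have "0 < q * e" "q * e < q * 2" using e rt i by linarith+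
        then have "e = 1" by (simp only: mult_less_cancel1) auto
        then show "i = r" using e rt i by simp
      qed (use i in simp)
      finally show "(\<Oplus>\<^bsub>MM\<^esub>s\<in>{..<q}. ?f s) (r, t) = (Q \<odot>\<^bsub>MM\<^esub> ?E i i \<one>\<^bsub>k\<^esub>) (r, t)"
        using rt Q by (auto simp: M.F.at)
    next
      show "(\<Oplus>\<^bsub>MM\<^esub>s\<in>{..<q}. ?f s) \<in> carrier MM" using fC by (intro M.mat.finsum_closed) blast
      show "Q \<odot>\<^bsub>MM\<^esub> ?E i i \<one>\<^bsub>k\<^esub> \<in> carrier MM" using Q M.F.delta_closed[of "\<one>\<^bsub>k\<^esub>"] by simp
    qed
    moreover have "(\<Oplus>\<^bsub>MM\<^esub>s\<in>{..<q}. ?f s) \<in> S" by (rule sumS) (simp_all add: smul pw[OF D])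
    ultimately have "inv\<^bsub>k\<^esub> Q \<odot>\<^bsub>MM\<^esub> (Q \<odot>\<^bsub>MM\<^esub> ?E i i \<one>\<^bsub>k\<^esub>) \<in> S" using smul K.Units_inv_closed[OF QU] by simp
    then show ?thesis using Q QU K.Units_inv_closed[OF QU] M.F.delta_closed[of "\<one>\<^bsub>k\<^esub>"]
      by (simp add: M.mat.M.smult_assoc1[symmetric])
  qed
  have Eij: "?E i j a \<in> S" if ij: "i < q" "j < q" and a: "a \<in> carrier k" for i j a
  proof -
    \<comment> \<open>The number of shifts leading from row \<open>i\<close> to column
      \<open>j\<close>, that is \<open>j - i\<close> modulo \<open>q\<close>; the entry met there is
      1 or \<open>c\<close>, hence invertible.\<close>
    define n where "n = (j + (q - i)) mod q"
    have n: "n \<le> q" using q_pos by (simp add: n_def less_imp_le)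
    have "(i + n) mod q = (i + (j + (q - i))) mod q" by (simp add: n_def mod_add_right_eq)
    also have "i + (j + (q - i)) = j + q" using ij by simp
    finally have jn: "(i + n) mod q = j" using ij by simp
    define w where "w = (shift_mat k q c [^]\<^bsub>MM\<^esub> n) (i, j)"
    have w: "w \<in> carrier k" "w \<noteq> \<zero>\<^bsub>k\<^esub>" using shift_pow[OF c(1) n ij] c jn by (auto simp: w_def)
    then have wU: "w \<in> Units k" by (simp add: K.field_Units)
    have eq: "?E i i \<one>\<^bsub>k\<^esub> \<otimes>\<^bsub>MM\<^esub> (shift_mat k q c [^]\<^bsub>MM\<^esub> n) \<otimes>\<^bsub>MM\<^esub> ?E j j \<one>\<^bsub>k\<^esub> = ?E i j w"
      using shift_closed[OF c(1)] ij w by (subst M.delta_sandwich) (simp_all add: w_def)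
    have "?E i j w \<in> S"
      using subringE(6)[OF S subringE(6)[OF S Eii[OF ij(1)] pw[OF P, of n]] Eii[OF ij(2)]] by (simp only: eq)
    then have "(a \<otimes>\<^bsub>k\<^esub> inv\<^bsub>k\<^esub> w) \<odot>\<^bsub>MM\<^esub> ?E i j w \<in> S" using smul a K.Units_inv_closed[OF wU] by simp
    moreover have "(a \<otimes>\<^bsub>k\<^esub> inv\<^bsub>k\<^esub> w) \<odot>\<^bsub>MM\<^esub> ?E i j w = ?E i j ((a \<otimes>\<^bsub>k\<^esub> inv\<^bsub>k\<^esub> w) \<odot>\<^bsub>B0\<^esub> w)"
      by (rule M.delta_smult[symmetric]) (use a K.Units_inv_closed[OF wU] in simp)
    ultimately show ?thesis using a w wU K.Units_inv_closed[OF wU] by (simp add: K.m_assoc)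
  qed
  show ?thesis
  proof
    fix z assume "z \<in> carrier MM"
    show "z \<in> S"
      by (rule M.mat.subring_lin_span[OF S scal _ subsetD[OF M.mat_span \<open>z \<in> carrier MM\<close>]]) (use Eij in auto)
  qed
qed

text \<open>What remains after the averaging argument is that the presented algebra is not zero. A
  pair with the required relations is given by the shift with value \<open>b\<close> tensor 1 and
  the clock tensor the shift with value \<open>a\<close>: the first factor realises the commutation,
  the second gives the power \<open>a\<close>.\<close>

lemma cyc_csa:
  assumes ab: "a \<in> carrier k" "a \<noteq> \<zero>\<^bsub>k\<^esub>" "b \<in> carrier k" "b \<noteq> \<zero>\<^bsub>k\<^esub>"
  shows "central_simple_algebra k (cyclic_algebra k q \<zeta> a b)"
proof -
  let ?C = "cyclic_algebra k q \<zeta> a b"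
  interpret C: k_alg k ?C by (rule cyc_k_alg[OF ab(1,3)])
  interpret T: alg_pair k MM MM by (rule alg_pairI[OF M.mat_k_alg M.mat_k_alg])
  let ?x = "T.t (shift_mat k q b) \<one>\<^bsub>MM\<^esub>" and ?y = "T.t Dm (shift_mat k q a)"
  have tp: "T.t u v [^]\<^bsub>T.AB\<^esub> (n::nat) = T.t (u [^]\<^bsub>MM\<^esub> n) (v [^]\<^bsub>MM\<^esub> n)" if "u \<in> carrier MM" "v \<in> carrier MM" for u v n
    by (induction n) (simp_all add: T.t_one T.t_mult that)
  note sC = shift_closed[OF ab(1)] shift_closed[OF ab(3)]
  have "cyc_pair k q \<zeta> a b T.AB ?x ?y"
    unfolding cyc_pair_def
    using sC Dm_closed ab zeta
    by (simp add: T.t_closed tp shift_pow_q Dm_pow_q T.t_mult T.t_smult_l T.t_smult_r T.t_one shift_Dm)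
  then obtain h where h: "h \<in> alg_hom k ?C T.AB"
    using cyc_lift[OF ab(1,3) T.AB.k_alg_axioms] by blast
  have "\<one>\<^bsub>?C\<^esub> \<noteq> \<zero>\<^bsub>?C\<^esub>"
  proof
    assume "\<one>\<^bsub>?C\<^esub> = \<zero>\<^bsub>?C\<^esub>"
    then have "\<one>\<^bsub>T.AB\<^esub> = \<zero>\<^bsub>T.AB\<^esub>"
      using alg_homD(5)[OF h] alg_hom_zero[OF C.k_alg_axioms T.AB.k_alg_axioms h] by simp
    then show False using csa_one_not_zero[OF K.field_axioms T.tensor_csa[OF MM_csa MM_csa]] by contradiction
  qed
  then show ?thesis
    by (rule cyc_pair_csa[OF C.k_alg_axioms _ cyc_gens[OF ab(1,3)] ab cyc_generated[OF ab(1,3)]])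
qed

abbreviation "BR \<equiv> brauer_group k"
abbreviation "smb \<equiv> brauer_symbol k q \<zeta>"

lemma symbol_closed:
  assumes ab: "a \<in> carrier k" "a \<noteq> \<zero>\<^bsub>k\<^esub>" "b \<in> carrier k" "b \<noteq> \<zero>\<^bsub>k\<^esub>"
  shows "smb a b \<in> carrier BR"
  unfolding brauer_symbol_def by (rule brauer_class_closed[OF K.field_axioms cyc_csa[OF ab]])

lemma csa_surj_iso:
  fixes B (structure)
  assumes "central_simple_algebra k A" "k_alg k B" "h \<in> alg_hom k A B" "\<one> \<noteq> \<zero>"
    and gen: "\<And>S. subring S B \<Longrightarrow> h ` carrier A \<subseteq> S \<Longrightarrow> carrier B \<subseteq> S"
  shows "alg_isomorphic k A B"
proof (rule alg_isomorphicI[OF assms(3) csa_hom_inj[OF assms(1-4)]])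
  have A: "k_alg k A" by (rule csa_alg[OF K.field_axioms assms(1)])
  interpret A: k_alg k A by fact
  interpret h: ring_hom_ring A B h by (rule alg_hom_ring_hom_ring[OF A assms(2,3)])
  show "carrier B \<subseteq> h ` carrier A"
    by (rule gen[OF h.img_is_subring[OF A.carrier_is_subring] order_refl])
qed

lemma alg_hom_image_scalar:
  fixes B (structure)
  assumes A: "k_alg k A" and h: "h \<in> alg_hom k A B" and S: "h ` carrier A \<subseteq> S" and r: "r \<in> carrier k"
  shows "r \<odot> \<one> \<in> S"
proof -
  interpret A: k_alg k A by fact
  have "h (r \<odot>\<^bsub>A\<^esub> \<one>\<^bsub>A\<^esub>) \<in> S" using S r by blast
  then show ?thesis using r by (simp add: alg_homD[OF h])
qed

text \<open>The homomorphism to matrices given by the pair is injective by simplicity; it is onto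
  once clock and shift lie in every subring containing the pair. A full matrix algebra over
  \<open>k\<close> has the trivial class.\<close>

lemma split_symbol:
  assumes ab: "a \<in> carrier k" "a \<noteq> \<zero>\<^bsub>k\<^esub>" "b \<in> carrier k" "b \<noteq> \<zero>\<^bsub>k\<^esub>"
    and xy: "cyc_pair k q \<zeta> a b MM x y"
    and gen: "\<And>S. subring S MM \<Longrightarrow> x \<in> S \<Longrightarrow> y \<in> S \<Longrightarrow> Dm \<in> S \<and> (\<exists>c\<in>carrier k - {\<zero>\<^bsub>k\<^esub>}. shift_mat k q c \<in> S)"
  shows "smb a b = \<one>\<^bsub>BR\<^esub>"
proof -
  note csa = cyc_csa[OF ab] and C = cyc_k_alg[OF ab(1,3)]
  obtain h where h: "h \<in> alg_hom k (cyclic_algebra k q \<zeta> a b) MM"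
    "h (cyc_gen k q \<zeta> a b 1) = x" "h (cyc_gen k q \<zeta> a b 2) = y"
    by (rule cyc_lift[OF ab(1,3) M.mat_k_alg xy])
  have gC: "cyc_gen k q \<zeta> a b 1 \<in> carrier (cyclic_algebra k q \<zeta> a b)"
    "cyc_gen k q \<zeta> a b 2 \<in> carrier (cyclic_algebra k q \<zeta> a b)"
    using cyc_gens[OF ab(1,3)] unfolding cyc_pair_def by blast+
  have "alg_isomorphic k (cyclic_algebra k q \<zeta> a b) MM"
  proof (rule csa_surj_iso[OF csa M.mat_k_alg h(1) csa_one_not_zero[OF K.field_axioms MM_csa]])
    fix S assume S: "subring S MM" and hS: "h ` carrier (cyclic_algebra k q \<zeta> a b) \<subseteq> S"
    have "x \<in> S" "y \<in> S" using hS gC h(2,3) by blast+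
    from gen[OF S this] obtain c where "Dm \<in> S" "c \<in> carrier k" "c \<noteq> \<zero>\<^bsub>k\<^esub>" "shift_mat k q c \<in> S" by blast
    then show "carrier MM \<subseteq> S"
      by (intro MM_generated[OF S alg_hom_image_scalar[OF C h(1) hS]])
  qed
  then have "smb a b = brauer_class k MM"
    unfolding brauer_symbol_def by (rule brauer_class_iso[OF K.field_axioms csa M.mat_k_alg])
  also have "\<dots> = brauer_class k B0"
    by (rule mat_brauer_class[OF K.field_axioms base_algebra_csa[OF K.field_axioms]]) (use q_pos in auto)
  finally show ?thesis by (simp only: brauer_one[OF K.field_axioms])
qed

lemma symbol_one_left:
  assumes c: "c \<in> carrier k" "c \<noteq> \<zero>\<^bsub>k\<^esub>"
  shows "smb \<one>\<^bsub>k\<^esub> c = \<one>\<^bsub>BR\<^esub>"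
proof (rule split_symbol[OF K.one_closed K.one_not_zero c])
  show "cyc_pair k q \<zeta> \<one>\<^bsub>k\<^esub> c MM (shift_mat k q c) Dm"
    unfolding cyc_pair_def using c shift_closed Dm_closed shift_pow_q Dm_pow_q shift_Dm by simp
qed (use c in blast)

text \<open>Now the clock has to come first and the shift second. Exchanging them inverts the root
  of unity in the commutation rule, so the clock is replaced by its inverse, the power with exponent
  \<open>q - 1\<close>.\<close>

lemma symbol_one_right:
  assumes c: "c \<in> carrier k" "c \<noteq> \<zero>\<^bsub>k\<^esub>"
  shows "smb c \<one>\<^bsub>k\<^esub> = \<one>\<^bsub>BR\<^esub>"
proof (rule split_symbol[OF c K.one_closed K.one_not_zero])
  let ?P = "shift_mat k q c" and ?D' = "Dm [^]\<^bsub>MM\<^esub> (q - 1)"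
  have P: "?P \<in> carrier MM" by (rule shift_closed[OF c(1)])
  have D': "?D' \<in> carrier MM" using Dm_closed by simp
  have 1: "?D' [^]\<^bsub>MM\<^esub> q = \<one>\<^bsub>MM\<^esub>"
    unfolding M.mat.nat_pow_pow[OF Dm_closed] mult.commute[of "q - 1"] M.mat.nat_pow_pow[OF Dm_closed, symmetric] Dm_pow_q
    by simp
  have "?P \<otimes>\<^bsub>MM\<^esub> ?D' = \<zeta> [^]\<^bsub>k\<^esub> (q - 1) \<odot>\<^bsub>MM\<^esub> (?D' \<otimes>\<^bsub>MM\<^esub> ?P)"
    using M.mat.quasi_commute_pow[OF P Dm_closed zeta(1) shift_Dm[OF c(1)], of 1 "q - 1"] P by simp
  then have "\<zeta> \<odot>\<^bsub>MM\<^esub> (?P \<otimes>\<^bsub>MM\<^esub> ?D') = (\<zeta> \<otimes>\<^bsub>k\<^esub> \<zeta> [^]\<^bsub>k\<^esub> (q - 1)) \<odot>\<^bsub>MM\<^esub> (?D' \<otimes>\<^bsub>MM\<^esub> ?P)"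
    using P D' zeta by (simp add: M.mat.M.smult_assoc1)
  moreover have "\<zeta> \<otimes>\<^bsub>k\<^esub> \<zeta> [^]\<^bsub>k\<^esub> (q - 1) = \<one>\<^bsub>k\<^esub>"
    using K.nat_pow_Suc2[OF zeta(1), of "q - 1"] q_pos zeta by simp
  ultimately have "?D' \<otimes>\<^bsub>MM\<^esub> ?P = \<zeta> \<odot>\<^bsub>MM\<^esub> (?P \<otimes>\<^bsub>MM\<^esub> ?D')" using P D' by simp
  then show "cyc_pair k q \<zeta> c \<one>\<^bsub>k\<^esub> MM ?D' ?P"
    unfolding cyc_pair_def using P D' 1 c shift_pow_q by simp
  fix S assume S: "subring S MM" and xS: "?D' \<in> S" and yS: "?P \<in> S"
  have pw: "z [^]\<^bsub>MM\<^esub> (n::nat) \<in> S" if "z \<in> S" for z n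
    by (induction n) (use that subringE(3,6)[OF S] in auto)
  \<comment> \<open>The clock is the inverse of its inverse: \<open>(q - 1) * (q - 1)\<close> is 1
    modulo \<open>q\<close>. The case \<open>q = 1\<close> is separate because \<open>q - 2\<close>
    is truncated there.\<close>
  have "?D' [^]\<^bsub>MM\<^esub> (q - 1) = Dm"
  proof (cases "q = 1")
    case True
    have "Dm [^]\<^bsub>MM\<^esub> q = Dm [^]\<^bsub>MM\<^esub> (1::nat)" by (simp only: True)
    then have "\<one>\<^bsub>MM\<^esub> = Dm" by (simp only: Dm_pow_q M.mat.nat_pow_eone[OF Dm_closed])
    moreover have "q - 1 = 0" using True by simp
    ultimately show ?thesis by (simp only: M.mat.nat_pow_0)
  next
    case False
    then have "(q - 1) * (q - 1) = q * (q - 2) + 1" using q_pos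
      by (cases q; cases "q - 1") (auto simp: algebra_simps)
    then have "?D' [^]\<^bsub>MM\<^esub> (q - 1) = Dm [^]\<^bsub>MM\<^esub> (q * (q - 2) + 1)"
      using Dm_closed by (simp add: M.mat.nat_pow_pow)
    also have "\<dots> = Dm [^]\<^bsub>MM\<^esub> (q * (q - 2)) \<otimes>\<^bsub>MM\<^esub> Dm"
      using Dm_closed by (simp add: M.mat.nat_pow_mult[symmetric])
    also have "Dm [^]\<^bsub>MM\<^esub> (q * (q - 2)) = \<one>\<^bsub>MM\<^esub>"
      unfolding M.mat.nat_pow_pow[OF Dm_closed, symmetric] Dm_pow_q by simp
    finally show ?thesis using Dm_closed by simp
  qed
  then have "Dm \<in> S" using pw[OF xS, of "q - 1"] by simp
  then show "Dm \<in> S \<and> (\<exists>c\<in>carrier k - {\<zero>\<^bsub>k\<^esub>}. shift_mat k q c \<in> S)" using yS c by blast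
qed

text \<open>Let x, y and x', y' generate the two cyclic algebras. In the tensor product, x tensor x'
  and y tensor 1 form a pair for \<open>a\<close> and the product of \<open>b\<close> and
  \<open>c\<close>, while 1 tensor x' and y^(-1) tensor y' form a pair for 1 and \<open>c\<close>.
  The two pairs commute, since the factors \<open>\<zeta>\<close> arising from x' and y' and from x
  and y^(-1) cancel, and together they generate everything. The symbol with first argument 1 is
  trivial.\<close>

theorem symbol_mult_right:
  assumes a: "a \<in> carrier k" "a \<noteq> \<zero>\<^bsub>k\<^esub>" and b: "b \<in> carrier k" "b \<noteq> \<zero>\<^bsub>k\<^esub>" and c: "c \<in> carrier k" "c \<noteq> \<zero>\<^bsub>k\<^esub>"
  shows "smb a (b \<otimes>\<^bsub>k\<^esub> c) = smb a b \<otimes>\<^bsub>BR\<^esub> smb a c"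
proof -
  let ?A = "cyclic_algebra k q \<zeta> a b" and ?B = "cyclic_algebra k q \<zeta> a c"
  let ?D = "cyclic_algebra k q \<zeta> a (b \<otimes>\<^bsub>k\<^esub> c)" and ?E = "cyclic_algebra k q \<zeta> \<one>\<^bsub>k\<^esub> c"
  have bc: "b \<otimes>\<^bsub>k\<^esub> c \<in> carrier k" "b \<otimes>\<^bsub>k\<^esub> c \<noteq> \<zero>\<^bsub>k\<^esub>" using b c by (simp_all add: K.integral_iff)
  note csa = cyc_csa[OF a b] cyc_csa[OF a c] cyc_csa[OF a bc] cyc_csa[OF K.one_closed K.one_not_zero c]
  note fld = K.field_axioms
  interpret T: alg_pair k ?A ?B by (rule alg_pairI[OF csa_alg[OF fld csa(1)] csa_alg[OF fld csa(2)]])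
  interpret U: alg_pair k ?D ?E by (rule alg_pairI[OF csa_alg[OF fld csa(3)] csa_alg[OF fld csa(4)]])
  define x y x' y' where "x = cyc_gen k q \<zeta> a b 1" and "y = cyc_gen k q \<zeta> a b 2"
    and "x' = cyc_gen k q \<zeta> a c 1" and "y' = cyc_gen k q \<zeta> a c 2"
  have xy: "x \<in> carrier ?A" "y \<in> carrier ?A" "x [^]\<^bsub>?A\<^esub> q = b \<odot>\<^bsub>?A\<^esub> \<one>\<^bsub>?A\<^esub>"
    "y [^]\<^bsub>?A\<^esub> q = a \<odot>\<^bsub>?A\<^esub> \<one>\<^bsub>?A\<^esub>" "x \<otimes>\<^bsub>?A\<^esub> y = \<zeta> \<odot>\<^bsub>?A\<^esub> (y \<otimes>\<^bsub>?A\<^esub> x)"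
    using cyc_gens[OF a(1) b(1)] by (simp_all only: cyc_pair_def x_def y_def)
  have xy': "x' \<in> carrier ?B" "y' \<in> carrier ?B" "x' [^]\<^bsub>?B\<^esub> q = c \<odot>\<^bsub>?B\<^esub> \<one>\<^bsub>?B\<^esub>"
    "y' [^]\<^bsub>?B\<^esub> q = a \<odot>\<^bsub>?B\<^esub> \<one>\<^bsub>?B\<^esub>" "x' \<otimes>\<^bsub>?B\<^esub> y' = \<zeta> \<odot>\<^bsub>?B\<^esub> (y' \<otimes>\<^bsub>?B\<^esub> x')"
    using cyc_gens[OF a(1) c(1)] by (simp_all only: cyc_pair_def x'_def y'_def)
  have aU: "a \<in> Units k" and cU: "c \<in> Units k" using a c by (simp_all add: K.field_Units)
  note ai = K.Units_inv_closed[OF aU] and ci = K.Units_inv_closed[OF cU]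
  have tp: "T.t u v [^]\<^bsub>T.AB\<^esub> (n::nat) = T.t (u [^]\<^bsub>?A\<^esub> n) (v [^]\<^bsub>?B\<^esub> n)" if "u \<in> carrier ?A" "v \<in> carrier ?B" for u v n
    by (induction n) (simp_all add: T.t_one T.t_mult that)
  let ?X = "T.t x x'" and ?Y = "T.t y \<one>\<^bsub>?B\<^esub>" and ?X' = "T.t \<one>\<^bsub>?A\<^esub> x'"
  \<comment> \<open>The inverse of \<open>y\<close>, available because its \<open>q\<close>-th power
    is the nonzero scalar \<open>a\<close>.\<close>
  define yi where "yi = inv\<^bsub>k\<^esub> a \<odot>\<^bsub>?A\<^esub> y [^]\<^bsub>?A\<^esub> (q - 1)"
  let ?Y' = "T.t yi y'"
  have yiC: "yi \<in> carrier ?A" using xy ai by (simp add: yi_def)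
  have ym: "y \<otimes>\<^bsub>?A\<^esub> y [^]\<^bsub>?A\<^esub> (q - 1) = a \<odot>\<^bsub>?A\<^esub> \<one>\<^bsub>?A\<^esub>" "y [^]\<^bsub>?A\<^esub> (q - 1) \<otimes>\<^bsub>?A\<^esub> y = a \<odot>\<^bsub>?A\<^esub> \<one>\<^bsub>?A\<^esub>"
    using T.A.nat_pow_Suc2[OF xy(2), of "q - 1"] T.A.nat_pow_Suc[of y "q - 1"] q_pos xy(4) by simp_all
  have yyi: "y \<otimes>\<^bsub>?A\<^esub> yi = \<one>\<^bsub>?A\<^esub>" "yi \<otimes>\<^bsub>?A\<^esub> y = \<one>\<^bsub>?A\<^esub>"
    using ym xy(2) a ai aU by (simp_all add: yi_def T.A.smult_mult_l T.A.smult_mult_r T.A.M.smult_assoc1[symmetric])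
  have yiq: "yi [^]\<^bsub>?A\<^esub> q = inv\<^bsub>k\<^esub> a \<odot>\<^bsub>?A\<^esub> \<one>\<^bsub>?A\<^esub>"
  proof -
    have "y [^]\<^bsub>?A\<^esub> n \<otimes>\<^bsub>?A\<^esub> yi [^]\<^bsub>?A\<^esub> n = \<one>\<^bsub>?A\<^esub>" for n :: nat
    proof (induction n)
      case (Suc n)
      have "y [^]\<^bsub>?A\<^esub> Suc n \<otimes>\<^bsub>?A\<^esub> yi [^]\<^bsub>?A\<^esub> Suc n = y [^]\<^bsub>?A\<^esub> n \<otimes>\<^bsub>?A\<^esub> (y \<otimes>\<^bsub>?A\<^esub> yi) \<otimes>\<^bsub>?A\<^esub> yi [^]\<^bsub>?A\<^esub> n"
        unfolding T.A.nat_pow_Suc2[OF yiC] using xy(2) yiC by (simp add: T.A.m_assoc)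
      then show ?case using Suc xy(2) yiC by (simp add: yyi)
    qed simp
    from this[of q] have "a \<odot>\<^bsub>?A\<^esub> yi [^]\<^bsub>?A\<^esub> q = \<one>\<^bsub>?A\<^esub>" using a yiC by (simp add: xy(4) T.A.smult_mult_l)
    then have "inv\<^bsub>k\<^esub> a \<odot>\<^bsub>?A\<^esub> (a \<odot>\<^bsub>?A\<^esub> yi [^]\<^bsub>?A\<^esub> q) = inv\<^bsub>k\<^esub> a \<odot>\<^bsub>?A\<^esub> \<one>\<^bsub>?A\<^esub>" by simp
    then show ?thesis using a ai aU yiC by (simp add: T.A.M.smult_assoc1[symmetric])
  qed
  have xyi: "yi \<otimes>\<^bsub>?A\<^esub> x = \<zeta> \<odot>\<^bsub>?A\<^esub> (x \<otimes>\<^bsub>?A\<^esub> yi)"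
  proof -
    have "yi \<otimes>\<^bsub>?A\<^esub> x = yi \<otimes>\<^bsub>?A\<^esub> (x \<otimes>\<^bsub>?A\<^esub> y) \<otimes>\<^bsub>?A\<^esub> yi" using xy(1,2) yiC yyi by (simp add: T.A.m_assoc)
    also have "\<dots> = \<zeta> \<odot>\<^bsub>?A\<^esub> (yi \<otimes>\<^bsub>?A\<^esub> y \<otimes>\<^bsub>?A\<^esub> x \<otimes>\<^bsub>?A\<^esub> yi)"
      unfolding xy(5) using xy(1,2) yiC zeta by (simp add: T.A.smult_mult_l T.A.smult_mult_r T.A.m_assoc)
    finally show ?thesis using xy(1) yiC by (simp add: yyi)
  qed
  have p1: "cyc_pair k q \<zeta> a (b \<otimes>\<^bsub>k\<^esub> c) T.AB ?X ?Y"
    unfolding cyc_pair_def using xy xy' a b c zeta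
    by (simp add: T.t_closed tp T.t_mult T.t_smult_l T.t_smult_r T.t_one T.AB.M.smult_assoc1[symmetric] K.m_comm)
  have p2: "cyc_pair k q \<zeta> \<one>\<^bsub>k\<^esub> c T.AB ?X' ?Y'"
    unfolding cyc_pair_def using xy xy' a ai aU yiC c zeta
    by (simp add: T.t_closed tp yiq T.t_mult T.t_smult_l T.t_smult_r T.t_one T.AB.M.smult_assoc1[symmetric])
  obtain f where f: "f \<in> alg_hom k ?D T.AB" "f (cyc_gen k q \<zeta> a (b \<otimes>\<^bsub>k\<^esub> c) 1) = ?X" "f (cyc_gen k q \<zeta> a (b \<otimes>\<^bsub>k\<^esub> c) 2) = ?Y"
    by (rule cyc_lift[OF a(1) bc(1) T.AB.k_alg_axioms p1])
  obtain g where g: "g \<in> alg_hom k ?E T.AB" "g (cyc_gen k q \<zeta> \<one>\<^bsub>k\<^esub> c 1) = ?X'" "g (cyc_gen k q \<zeta> \<one>\<^bsub>k\<^esub> c 2) = ?Y'"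
    by (rule cyc_lift[OF K.one_closed c(1) T.AB.k_alg_axioms p2])
  have tC: "?X \<in> carrier T.AB" "?Y \<in> carrier T.AB" "?X' \<in> carrier T.AB" "?Y' \<in> carrier T.AB"
    using xy xy' yiC by (simp_all add: T.t_closed)
  have c1: "?X \<otimes>\<^bsub>T.AB\<^esub> ?X' = ?X' \<otimes>\<^bsub>T.AB\<^esub> ?X" "?Y \<otimes>\<^bsub>T.AB\<^esub> ?X' = ?X' \<otimes>\<^bsub>T.AB\<^esub> ?Y" "?Y \<otimes>\<^bsub>T.AB\<^esub> ?Y' = ?Y' \<otimes>\<^bsub>T.AB\<^esub> ?Y"
    using xy xy' yiC yyi by (simp_all add: T.t_mult)
  have c2: "?X \<otimes>\<^bsub>T.AB\<^esub> ?Y' = ?Y' \<otimes>\<^bsub>T.AB\<^esub> ?X"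
    using xy xy' yiC zeta by (simp add: T.t_mult xyi T.t_smult_l T.t_smult_r)
  have commX: "f u \<otimes>\<^bsub>T.AB\<^esub> ?X' = ?X' \<otimes>\<^bsub>T.AB\<^esub> f u" if "u \<in> carrier ?D" for u
    by (rule cyc_commute[OF a(1) bc(1) T.AB.k_alg_axioms f(1) tC(3) _ _ that]) (simp_all only: f c1)
  have commY: "f u \<otimes>\<^bsub>T.AB\<^esub> ?Y' = ?Y' \<otimes>\<^bsub>T.AB\<^esub> f u" if "u \<in> carrier ?D" for u
    by (rule cyc_commute[OF a(1) bc(1) T.AB.k_alg_axioms f(1) tC(4) _ _ that]) (simp_all only: f c1 c2)
  have comm: "f u \<otimes>\<^bsub>T.AB\<^esub> g v = g v \<otimes>\<^bsub>T.AB\<^esub> f u" if u: "u \<in> carrier ?D" and v: "v \<in> carrier ?E" for u v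
    by (rule cyc_commute[OF K.one_closed c(1) T.AB.k_alg_axioms g(1) alg_homD(1)[OF f(1) u] _ _ v, symmetric])
      (simp_all only: g commX[OF u] commY[OF u])
  have "alg_isomorphic k U.AB T.AB"
  proof (rule U.tensor_iso[OF csa(3,4) T.AB.k_alg_axioms csa_one_not_zero[OF fld T.tensor_csa[OF csa(1,2)]] f(1) g(1) comm])
    fix S assume S: "subring S T.AB" and fS: "f ` carrier ?D \<subseteq> S" and gS: "g ` carrier ?E \<subseteq> S"
    note scal = alg_hom_image_scalar[OF U.A.k_alg_axioms f(1) fS]
    note Sm = subringE(6)[OF S]
    have X: "?X \<in> S" "?Y \<in> S" using fS f(2,3) cyc_gens[OF a(1) bc(1)] unfolding cyc_pair_def by (metis image_subset_iff)+
    have X': "?X' \<in> S" "?Y' \<in> S" using gS g(2,3) cyc_gens[OF K.one_closed c(1)] unfolding cyc_pair_def by (metis image_subset_iff)+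
    have pw: "z [^]\<^bsub>T.AB\<^esub> (n::nat) \<in> S" if "z \<in> S" for z n
      by (induction n) (use that subringE(3,6)[OF S] in auto)
    have x'm: "x' \<otimes>\<^bsub>?B\<^esub> x' [^]\<^bsub>?B\<^esub> (q - 1) = c \<odot>\<^bsub>?B\<^esub> \<one>\<^bsub>?B\<^esub>"
      using T.B.nat_pow_Suc2[OF xy'(1), of "q - 1"] q_pos xy'(3) by simp
    have xS: "T.t x \<one>\<^bsub>?B\<^esub> \<in> S"
    proof -
      \<comment> \<open>\<open>?X\<close> is multiplied by the inverse of \<open>?X'\<close>, which
        is its power with exponent \<open>q - 1\<close> divided by \<open>c\<close>; this removes
        the second tensor factor.\<close>
      have eq: "(inv\<^bsub>k\<^esub> c \<odot>\<^bsub>T.AB\<^esub> \<one>\<^bsub>T.AB\<^esub>) \<otimes>\<^bsub>T.AB\<^esub> (?X \<otimes>\<^bsub>T.AB\<^esub> ?X' [^]\<^bsub>T.AB\<^esub> (q - 1)) = T.t x \<one>\<^bsub>?B\<^esub>"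
        using xy xy' c ci cU
        by (simp add: tp T.t_mult x'm T.t_smult_r T.t_closed T.AB.smult_mult_l T.AB.M.smult_assoc1[symmetric] del: One_nat_def)
      show ?thesis using Sm[OF scal[OF ci] Sm[OF X(1) pw[OF X'(1), of "q - 1"]]] by (simp only: eq)
    qed
    have y'S: "T.t \<one>\<^bsub>?A\<^esub> y' \<in> S"
      using Sm[OF X(2) X'(2)] xy xy' yiC by (simp add: T.t_mult yyi)
    have "carrier ?A \<subseteq> {u \<in> carrier ?A. T.t u \<one>\<^bsub>?B\<^esub> \<in> S}"
      by (rule cyc_generated[OF a(1) b(1) subring_vimage[OF T.A.k_alg_axioms T.AB.k_alg_axioms T.t_hom_l S]])
        (use scal xS X(2) xy in \<open>auto simp: T.t_smult_l T.t_one[symmetric] x_def y_def\<close>)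
    then have 1: "T.t u \<one>\<^bsub>?B\<^esub> \<in> S" if "u \<in> carrier ?A" for u using that by blast
    have "carrier ?B \<subseteq> {u \<in> carrier ?B. T.t \<one>\<^bsub>?A\<^esub> u \<in> S}"
      by (rule cyc_generated[OF a(1) c(1) subring_vimage[OF T.B.k_alg_axioms T.AB.k_alg_axioms T.t_hom_r S]])
        (use scal y'S X'(1) xy' in \<open>auto simp: T.t_smult_r T.t_one[symmetric] x'_def y'_def\<close>)
    then have 2: "T.t \<one>\<^bsub>?A\<^esub> u \<in> S" if "u \<in> carrier ?B" for u using that by blast
    show "carrier T.AB \<subseteq> S" by (rule T.tensor_generated[OF S 1 2])
  qed
  then have "brauer_class k U.AB = brauer_class k T.AB"
    by (rule brauer_class_iso[OF fld csa_tensor[OF fld csa(3,4)] T.AB.k_alg_axioms])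
  then have "smb a (b \<otimes>\<^bsub>k\<^esub> c) \<otimes>\<^bsub>BR\<^esub> smb \<one>\<^bsub>k\<^esub> c = smb a b \<otimes>\<^bsub>BR\<^esub> smb a c"
    unfolding brauer_symbol_def brauer_mult[OF fld csa(3,4)] brauer_mult[OF fld csa(1,2)] .
  moreover have "smb a (b \<otimes>\<^bsub>k\<^esub> c) \<otimes>\<^bsub>BR\<^esub> \<one>\<^bsub>BR\<^esub> = smb a (b \<otimes>\<^bsub>k\<^esub> c)"
    by (rule monoid.r_one[OF comm_monoid.axioms(1)[OF brauer_comm_monoid[OF fld]] symbol_closed[OF a bc]])
  ultimately show ?thesis unfolding symbol_one_left[OF c] by simp
qed

end

section \<open>Algebras generated by commuting Kummer elements and quasi-commuting units\<close>

text \<open>Records what the computation of the class uses of the crossed product, detached from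
  Galois groups and cocycles. The assumption \<open>gen\<close> carries the information that a count
  of dimensions would otherwise supply.\<close>

locale kummer_gens = kummer k q \<zeta> + C: k_alg k C
  for k :: "('a, 'r) ring_scheme" and q :: nat and \<zeta> :: 'a and C :: "('a, 'c, 's) module_scheme" (structure) +
  fixes m :: nat and a :: "nat \<Rightarrow> 'a" and A U :: "nat \<Rightarrow> 'c" and j :: "nat \<Rightarrow> nat" and d :: "nat \<Rightarrow> nat \<Rightarrow> nat"
  assumes C1: "\<one> \<noteq> \<zero>"
    and a: "\<And>i. i \<in> {1..m} \<Longrightarrow> a i \<in> carrier k" "\<And>i. i \<in> {1..m} \<Longrightarrow> a i \<noteq> \<zero>\<^bsub>k\<^esub>"
    and A: "\<And>i. i \<in> {1..m} \<Longrightarrow> A i \<in> carrier C"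
    and U: "\<And>i. i \<in> {1..m} \<Longrightarrow> U i \<in> carrier C"
    and A_comm: "\<And>i l. i \<in> {1..m} \<Longrightarrow> l \<in> {1..m} \<Longrightarrow> A i \<otimes> A l = A l \<otimes> A i"
    and A_pow: "\<And>i. i \<in> {1..m} \<Longrightarrow> A i [^] q = a i \<odot> \<one>"
    and U_A: "\<And>i. i \<in> {1..m} \<Longrightarrow> U i \<otimes> A i = \<zeta> \<odot> (A i \<otimes> U i)"
    and U_A_comm: "\<And>i l. i \<in> {1..m} \<Longrightarrow> l \<in> {1..m} \<Longrightarrow> i \<noteq> l \<Longrightarrow> U l \<otimes> A i = A i \<otimes> U l"
    and U_pow: "\<And>i. i \<in> {1..m} \<Longrightarrow> U i [^] q = \<zeta> [^]\<^bsub>k\<^esub> j i \<odot> \<one>"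
    and U_U: "\<And>i l. i \<in> {1..m} \<Longrightarrow> l \<in> {1..m} \<Longrightarrow> i < l \<Longrightarrow>
        U l \<otimes> U i = \<zeta> [^]\<^bsub>k\<^esub> d i l \<odot> (U i \<otimes> U l)"
    and gen: "\<And>S. subring S C \<Longrightarrow> (\<And>r. r \<in> carrier k \<Longrightarrow> r \<odot> \<one> \<in> S) \<Longrightarrow>
        A ` {1..m} \<subseteq> S \<Longrightarrow> U ` {1..m} \<subseteq> S \<Longrightarrow> carrier C \<subseteq> S"
begin

text \<open>Replacing \<open>U l\<close> by \<open>V l\<close>, its product with the \<open>A i\<close> raised to the power \<open>d i l\<close> for \<open>i < l\<close>, makes all pairs
  \<open>(V l, A l)\<close> commute with each other.\<close>

primrec W :: "nat \<Rightarrow> nat \<Rightarrow> 'c" where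
  "W l 0 = \<one>"
| "W l (Suc n) = W l n \<otimes> A (Suc n) [^] d (Suc n) l"

text \<open>The scalar that turns out to be the \<open>q\<close>-th power of
  \<open>W l n\<close>.\<close>

primrec w :: "nat \<Rightarrow> nat \<Rightarrow> 'a" where
  "w l 0 = \<one>\<^bsub>k\<^esub>"
| "w l (Suc n) = w l n \<otimes>\<^bsub>k\<^esub> a (Suc n) [^]\<^bsub>k\<^esub> d (Suc n) l"

definition V where "V l = U l \<otimes> W l (l - 1)"
text \<open>The \<open>q\<close>-th power of \<open>V l\<close>, and so the second parameter of the
  \<open>l\<close>-th cyclic factor. The correction stops at \<open>l - 1\<close> since it involves
  only indices below \<open>l\<close>.\<close>

definition b where "b l = \<zeta> [^]\<^bsub>k\<^esub> j l \<otimes>\<^bsub>k\<^esub> w l (l - 1)"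

lemma w_closed: "n \<le> m \<Longrightarrow> w l n \<in> carrier k \<and> w l n \<noteq> \<zero>\<^bsub>k\<^esub>"
proof (induction n)
  case (Suc n)
  have "a (Suc n) [^]\<^bsub>k\<^esub> e \<noteq> \<zero>\<^bsub>k\<^esub>" for e :: nat
    using a[of "Suc n"] Suc.prems by (induction e) (simp_all add: K.integral_iff)
  then show ?case using Suc a[of "Suc n"] by (simp add: K.integral_iff)
qed simp

lemma W_closed: "n \<le> m \<Longrightarrow> W l n \<in> carrier C"
  by (induction n) (simp_all add: A)

lemma pow_commute:
  assumes "x \<in> carrier C" "y \<in> carrier C" "x \<otimes> y = y \<otimes> x"
  shows "x \<otimes> y [^] (n::nat) = y [^] n \<otimes> x"
  using C.quasi_commute_pow[OF assms(1,2) K.one_closed, of 1 n] assms by simp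

lemma mult_commute:
  assumes "x \<in> carrier C" "y \<in> carrier C" "z \<in> carrier C"
    "x \<otimes> y = y \<otimes> x" "x \<otimes> z = z \<otimes> x"
  shows "x \<otimes> (y \<otimes> z) = (y \<otimes> z) \<otimes> x"
proof -
  have "x \<otimes> (y \<otimes> z) = y \<otimes> (x \<otimes> z)"
    using assms(1-3) by (simp add: C.m_assoc[symmetric] assms(4))
  then show ?thesis using assms(1-3) by (simp add: assms(5) C.m_assoc)
qed

lemma W_commute:
  assumes n: "n \<le> m" and x: "x \<in> carrier C" and c: "\<And>i. i \<in> {1..n} \<Longrightarrow> x \<otimes> A i = A i \<otimes> x"
  shows "x \<otimes> W l n = W l n \<otimes> x"
  using n c
proof (induction n)
  case (Suc n)
  then have "x \<otimes> W l n = W l n \<otimes> x" by simp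
  moreover have "x \<otimes> A (Suc n) [^] d (Suc n) l = A (Suc n) [^] d (Suc n) l \<otimes> x"
    using Suc.prems by (intro pow_commute x A) auto
  ultimately show ?case unfolding W.simps
    using Suc.prems by (intro mult_commute x W_closed C.nat_pow_closed A) auto
qed (use x in simp)

lemma W_A: "n \<le> m \<Longrightarrow> i \<in> {1..m} \<Longrightarrow> A i \<otimes> W l n = W l n \<otimes> A i"
  by (rule W_commute) (auto intro: A A_comm)

lemma W_W: "n \<le> m \<Longrightarrow> n' \<le> m \<Longrightarrow> W l n \<otimes> W l' n' = W l' n' \<otimes> W l n"
  by (rule W_commute) (auto intro: W_closed W_A[symmetric])

lemma W_U: "n \<le> m \<Longrightarrow> i \<in> {1..m} \<Longrightarrow> n < i \<Longrightarrow> U i \<otimes> W l n = W l n \<otimes> U i"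
  by (rule W_commute) (auto intro: U U_A_comm)

text \<open>Of the factors of \<open>W l n\<close> only the power of \<open>A i\<close> fails to
  commute with \<open>U i\<close>, and its exponent is \<open>d i l\<close>.\<close>

lemma U_W:
  assumes "n \<le> m" "i \<in> {1..m}" "i \<le> n"
  shows "U i \<otimes> W l n = \<zeta> [^]\<^bsub>k\<^esub> d i l \<odot> (W l n \<otimes> U i)"
  using assms(1,3)
proof (induction n)
  case (Suc n)
  let ?A = "A (Suc n) [^] d (Suc n) l"
  have AC: "A (Suc n) \<in> carrier C" and WC: "W l n \<in> carrier C" and UC: "U i \<in> carrier C"
    using Suc.prems assms(2) by (auto intro: A W_closed U)
  have "U i \<otimes> W l (Suc n) = (U i \<otimes> W l n) \<otimes> ?A" using AC WC UC by (simp add: C.m_assoc)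
  also have "\<dots> = \<zeta> [^]\<^bsub>k\<^esub> d i l \<odot> (W l (Suc n) \<otimes> U i)"
  proof (cases "i = Suc n")
    case True
    have "U i \<otimes> ?A = \<zeta> [^]\<^bsub>k\<^esub> d i l \<odot> (?A \<otimes> U i)"
      using C.quasi_commute_pow[OF UC AC zeta(1), of 1 "d i l"] U_A[OF assms(2)] True UC by simp
    moreover have "U i \<otimes> W l n = W l n \<otimes> U i" by (rule W_U) (use Suc.prems assms(2) True in auto)
    ultimately show ?thesis using AC WC UC by (simp add: C.m_assoc C.smult_mult_r)
  next
    case False
    then have i: "i \<le> n" "n \<le> m" using Suc.prems by auto
    have "U i \<otimes> ?A = ?A \<otimes> U i"
      by (rule pow_commute[OF UC AC U_A_comm]) (use Suc.prems assms(2) False in auto)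
    then show ?thesis using Suc.IH[OF i(2,1)] AC WC UC by (simp add: C.m_assoc C.smult_mult_l)
  qed
  finally show ?case .
qed (use assms(2) in simp)

lemma W_pow: "n \<le> m \<Longrightarrow> W l n [^] q = w l n \<odot> \<one>"
proof (induction n)
  case (Suc n)
  have AC: "A (Suc n) \<in> carrier C" and WC: "W l n \<in> carrier C" using Suc.prems by (auto intro: A W_closed)
  have aC: "a (Suc n) \<in> carrier k" using Suc.prems by (auto intro: a)
  have "W l n \<otimes> A (Suc n) [^] d (Suc n) l = A (Suc n) [^] d (Suc n) l \<otimes> W l n"
    by (rule pow_commute[OF WC AC W_A[symmetric]]) (use Suc.prems in auto)
  then have "W l (Suc n) [^] q = W l n [^] q \<otimes> (A (Suc n) [^] d (Suc n) l) [^] q"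
    unfolding W.simps using AC WC by (intro C.pow_mult_distrib) auto
  also have "(A (Suc n) [^] d (Suc n) l) [^] q = (A (Suc n) [^] q) [^] d (Suc n) l"
    using AC by (simp add: C.nat_pow_pow mult.commute)
  also have "\<dots> = a (Suc n) [^]\<^bsub>k\<^esub> d (Suc n) l \<odot> \<one>"
    using A_pow[of "Suc n"] Suc.prems aC by (simp add: C.smult_pow)
  finally show ?case using Suc w_closed[of n l] aC by (simp add: C.smult_mult_smult)
qed simp

lemma V_closed: "l \<in> {1..m} \<Longrightarrow> V l \<in> carrier C"
  unfolding V_def by (intro C.m_closed U W_closed) auto

lemma b_closed: "l \<in> {1..m} \<Longrightarrow> b l \<in> carrier k" "l \<in> {1..m} \<Longrightarrow> b l \<noteq> \<zero>\<^bsub>k\<^esub>"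
proof -
  have "\<zeta> [^]\<^bsub>k\<^esub> e \<noteq> \<zero>\<^bsub>k\<^esub>" for e :: nat using zeta zeta_unit by (induction e) (simp_all add: K.integral_iff)
  then show "l \<in> {1..m} \<Longrightarrow> b l \<in> carrier k" "l \<in> {1..m} \<Longrightarrow> b l \<noteq> \<zero>\<^bsub>k\<^esub>"
    using w_closed[of "l - 1" l] by (auto simp: b_def K.integral_iff)
qed

text \<open>The correction \<open>W l (l - 1)\<close> is built from \<open>A i\<close> with
  \<open>i < l\<close>. It commutes with \<open>U l\<close> and \<open>A l\<close>, so it alters the
  \<open>q\<close>-th power but not the commutation rule of the pair.\<close>

lemma V_A_pair:
  assumes l: "l \<in> {1..m}" shows "cyc_pair k q \<zeta> (a l) (b l) C (V l) (A l)"
proof -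
  have n: "l - 1 \<le> m" "l - 1 < l" using l by auto
  note cl = U[OF l] A[OF l] W_closed[OF n(1), of l]
  have "V l [^] q = U l [^] q \<otimes> W l (l - 1) [^] q"
    unfolding V_def using cl W_U[OF n(1) l n(2)] by (intro C.pow_mult_distrib) auto
  then have "V l [^] q = b l \<odot> \<one>"
    using w_closed[OF n(1), of l] by (simp add: U_pow[OF l] W_pow[OF n(1)] C.smult_mult_smult b_def del: One_nat_def)
  moreover have "V l \<otimes> A l = \<zeta> \<odot> (A l \<otimes> V l)"
  proof -
    have "V l \<otimes> A l = (U l \<otimes> A l) \<otimes> W l (l - 1)"
      unfolding V_def using cl by (simp add: C.m_assoc W_A[OF n(1) l] del: One_nat_def)
    then show ?thesis unfolding V_def using cl zeta by (simp add: U_A[OF l] C.smult_mult_l C.m_assoc del: One_nat_def)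
  qed
  ultimately show ?thesis unfolding cyc_pair_def using V_closed[OF l] A[OF l] A_pow[OF l] by simp
qed

lemma V_A_commute:
  assumes l: "l \<in> {1..m}" and i: "i \<in> {1..m}" and il: "i \<noteq> l"
  shows "V l \<otimes> A i = A i \<otimes> V l"
  unfolding V_def
  by (rule mult_commute[symmetric]) (use l i il in \<open>auto intro: U A W_closed W_A U_A_comm[symmetric]\<close>)

text \<open>Moving \<open>U i\<close> past \<open>W l (l - 1)\<close> produces the same power of
  \<open>\<zeta>\<close> as exchanging \<open>U l\<close> and \<open>U i\<close>, whereas
  \<open>W i (i - 1)\<close> commutes with \<open>U l\<close>. The equation is shown after
  multiplication by that power, which is then cancelled.\<close>

lemma V_V_commute:
  assumes l: "l \<in> {1..m}" and i: "i \<in> {1..m}" and il: "i < l"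
  shows "V l \<otimes> V i = V i \<otimes> V l"
proof -
  have n: "l - 1 \<le> m" "i - 1 \<le> m" "i \<le> l - 1" "i - 1 < l" using l i il by auto
  let ?z = "\<zeta> [^]\<^bsub>k\<^esub> d i l" and ?Wl = "W l (l - 1)" and ?Wi = "W i (i - 1)"
  note cl = U[OF l] U[OF i] W_closed[OF n(1), of l] W_closed[OF n(2), of i]
  have "?z \<odot> (V l \<otimes> V i) = U l \<otimes> (?z \<odot> (?Wl \<otimes> U i)) \<otimes> ?Wi"
    unfolding V_def using cl by (simp add: C.m_assoc C.smult_mult_l C.smult_mult_r)
  also have "\<dots> = (U l \<otimes> U i) \<otimes> (?Wl \<otimes> ?Wi)"
    unfolding U_W[OF n(1) i n(3), symmetric] using cl by (simp add: C.m_assoc)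
  also have "\<dots> = ?z \<odot> ((U i \<otimes> U l) \<otimes> (?Wi \<otimes> ?Wl))"
    unfolding U_U[OF i l il] W_W[OF n(1,2)] using cl by (simp add: C.smult_mult_l)
  also have "(U i \<otimes> U l) \<otimes> (?Wi \<otimes> ?Wl) = U i \<otimes> (U l \<otimes> ?Wi) \<otimes> ?Wl"
    using cl by (simp add: C.m_assoc)
  also have "\<dots> = V i \<otimes> V l"
    unfolding W_U[OF n(2) l n(4)] V_def using cl by (simp add: C.m_assoc)
  finally have eq: "?z \<odot> (V l \<otimes> V i) = ?z \<odot> (V i \<otimes> V l)" .
  have "\<zeta> [^]\<^bsub>k\<^esub> e \<noteq> \<zero>\<^bsub>k\<^esub>" for e :: nat using zeta zeta_unit by (induction e) (simp_all add: K.integral_iff)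
  then have zU: "?z \<in> Units k" by (simp add: K.field_Units)
  have VV: "V l \<otimes> V i \<in> carrier C" "V i \<otimes> V l \<in> carrier C" using V_closed[OF l] V_closed[OF i] by auto
  have canc: "inv\<^bsub>k\<^esub> ?z \<odot> (?z \<odot> y) = y" if "y \<in> carrier C" for y
    using that zU K.Units_inv_closed[OF zU] by (simp add: C.M.smult_assoc1[symmetric])
  show ?thesis using arg_cong[OF eq, of "\<lambda>y. inv\<^bsub>k\<^esub> ?z \<odot> y"] by (simp only: canc[OF VV(1)] canc[OF VV(2)])
qed

lemma V_V: "l \<in> {1..m} \<Longrightarrow> i \<in> {1..m} \<Longrightarrow> V l \<otimes> V i = V i \<otimes> V l"
  using V_V_commute[of l i] V_V_commute[of i l] by (cases i l rule: linorder_cases) auto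

interpretation BR: comm_monoid BR
  by (rule brauer_comm_monoid[OF K.field_axioms])

lemma symbol_ab: "l \<in> {1..m} \<Longrightarrow> smb (a l) (b l) \<in> carrier BR"
  by (rule symbol_closed) (simp_all add: a b_closed)

text \<open>The induction over the factors quantifies over algebras of one fixed type, while a
  tensor product has elements of another type. Only the class of the source and the image in
  \<open>C\<close> matter, and both survive the change of source.\<close>

lemma transport_hom:
  fixes T :: "('a, 't, 'ts) module_scheme"
  assumes csa: "central_simple_algebra k T" and H: "H \<in> alg_hom k T C"
  obtains B :: "('a, nat \<Rightarrow> 'a) module" and h where "central_simple_algebra k B" "h \<in> alg_hom k B C"
    "h ` carrier B = H ` carrier T" "brauer_class k B = brauer_class k T"
proof -
  note T = csa_alg[OF K.field_axioms csa]
  obtain B :: "('a, nat \<Rightarrow> 'a) module" where B: "central_simple_algebra k B" "alg_isomorphic k T B"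
    by (rule csa_transport[OF K.field_axioms csa])
  note kB = csa_alg[OF K.field_axioms B(1)]
  obtain p where p: "p \<in> alg_hom k B T" "inj_on p (carrier B)" "p ` carrier B = carrier T"
    using alg_isomorphic_sym[OF T B(2)] by (rule alg_isomorphicE)
  show thesis
  proof (rule that[OF B(1) alg_hom_comp[OF p(1) H]])
    show "(H \<circ> p) ` carrier B = H ` carrier T" unfolding image_comp[symmetric] p(3) ..
    show "brauer_class k B = brauer_class k T"
      by (rule brauer_class_iso[OF K.field_axioms csa kB B(2), symmetric])
  qed
qed

text \<open>The last clause expresses through commutation that the image is generated by the
  \<open>A i\<close> and \<open>V i\<close> met so far: whatever commutes with these commutes with
  all of it. Applied to the next cyclic factor, it gives the commutation that a homomorphism from
  the tensor product demands.\<close>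

lemma partial_tensor:
  assumes "n \<le> m"
  shows "\<exists>(B :: ('a, nat \<Rightarrow> 'a) module) h. central_simple_algebra k B \<and> h \<in> alg_hom k B C \<and>
    brauer_class k B = (\<Otimes>\<^bsub>BR\<^esub>i\<in>{1..n}. smb (a i) (b i)) \<and>
    A ` {1..n} \<union> V ` {1..n} \<subseteq> h ` carrier B \<and>
    (\<forall>v\<in>carrier C. (\<forall>i\<in>{1..n}. A i \<otimes> v = v \<otimes> A i \<and> V i \<otimes> v = v \<otimes> V i) \<longrightarrow>
       (\<forall>z\<in>h ` carrier B. z \<otimes> v = v \<otimes> z))"
  using assms
proof (induction n)
  case 0
  have H: "(\<lambda>r. r \<odot> \<one>) \<in> alg_hom k B0 C"
    by (rule alg_homI) (simp_all add: C.M.smult_l_distr C.M.smult_assoc1 C.smult_mult_smult)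
  obtain B :: "('a, nat \<Rightarrow> 'a) module" and h where B: "central_simple_algebra k B" "h \<in> alg_hom k B C"
    "h ` carrier B = (\<lambda>r. r \<odot> \<one>) ` carrier B0" "brauer_class k B = brauer_class k B0"
    by (rule transport_hom[OF base_algebra_csa[OF K.field_axioms] H])
  have "\<forall>v\<in>carrier C. \<forall>z\<in>h ` carrier B. z \<otimes> v = v \<otimes> z"
    unfolding B(3) by (auto simp: C.smult_mult_l C.smult_mult_r)
  then show ?case using B(1,2,4) by (intro exI[of _ B] exI[of _ h]) (simp add: brauer_one[OF K.field_axioms])
next
  case (Suc n)
  have "n \<le> m" using Suc.prems by simp
  from Suc.IH[OF this] obtain B :: "('a, nat \<Rightarrow> 'a) module" and h where B: "central_simple_algebra k B" "h \<in> alg_hom k B C"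
    "brauer_class k B = (\<Otimes>\<^bsub>BR\<^esub>i\<in>{1..n}. smb (a i) (b i))"
    "A ` {1..n} \<union> V ` {1..n} \<subseteq> h ` carrier B"
    and comm_B: "\<forall>v\<in>carrier C. (\<forall>i\<in>{1..n}. A i \<otimes> v = v \<otimes> A i \<and> V i \<otimes> v = v \<otimes> V i) \<longrightarrow>
       (\<forall>z\<in>h ` carrier B. z \<otimes> v = v \<otimes> z)"
    by (elim exE conjE)
  have Bc: "z \<otimes> v = v \<otimes> z"
    if "v \<in> carrier C" "\<And>i. i \<in> {1..n} \<Longrightarrow> A i \<otimes> v = v \<otimes> A i"
      "\<And>i. i \<in> {1..n} \<Longrightarrow> V i \<otimes> v = v \<otimes> V i" "z \<in> h ` carrier B" for v z
    using comm_B[rule_format, OF that(1) _ that(4)] that(2,3) by blast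
  let ?l = "Suc n"
  have l: "?l \<in> {1..m}" using Suc.prems by simp
  let ?Z = "cyclic_algebra k q \<zeta> (a ?l) (b ?l)"
  note ab = a(1)[OF l] a(2)[OF l] b_closed(1)[OF l] b_closed(2)[OF l]
  note Z = cyc_csa[OF ab]
  interpret T: alg_pair k B ?Z
    by (rule alg_pairI[OF csa_alg[OF K.field_axioms B(1)] csa_alg[OF K.field_axioms Z]])
  obtain g where g: "g \<in> alg_hom k ?Z C" "g (cyc_gen k q \<zeta> (a ?l) (b ?l) 1) = V ?l"
    "g (cyc_gen k q \<zeta> (a ?l) (b ?l) 2) = A ?l"
    by (rule cyc_lift[OF ab(1,3) C.k_alg_axioms V_A_pair[OF l]])
  have gc: "g u \<otimes> v = v \<otimes> g u"
    if "v \<in> carrier C" "A ?l \<otimes> v = v \<otimes> A ?l" "V ?l \<otimes> v = v \<otimes> V ?l" "u \<in> carrier ?Z" for v u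
    by (rule cyc_commute[OF ab(1,3) C.k_alg_axioms g(1) that(1) _ _ that(4)]) (simp_all only: g that)
  have comm: "h x \<otimes> g y = g y \<otimes> h x" if x: "x \<in> carrier B" and y: "y \<in> carrier ?Z" for x y
  proof (rule Bc[OF alg_homD(1)[OF g(1) y]])
    fix i assume "i \<in> {1..n}"
    then have i: "i \<in> {1..m}" "i \<noteq> ?l" using Suc.prems by auto
    show "A i \<otimes> g y = g y \<otimes> A i"
      by (rule gc[OF A[OF i(1)] A_comm[OF l i(1)] V_A_commute[OF l i(1,2)] y, symmetric])
    show "V i \<otimes> g y = g y \<otimes> V i"
      by (rule gc[OF V_closed[OF i(1)] V_A_commute[OF i(1) l i(2)[symmetric], symmetric] V_V[OF l i(1)] y, symmetric])
  qed (use x in blast)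
  obtain H where H: "H \<in> alg_hom k T.AB C"
    "\<And>x y. x \<in> carrier B \<Longrightarrow> y \<in> carrier ?Z \<Longrightarrow> H (T.t x y) = h x \<otimes> g y"
  proof (rule T.tensor_hom[OF C.k_alg_axioms B(2) g(1) comm])
    fix H assume H: "H \<in> alg_hom k T.AB C"
      "\<And>x y. x \<in> carrier B \<Longrightarrow> y \<in> carrier ?Z \<Longrightarrow> H (T.t x y) = h x \<otimes> g y"
    show thesis by (rule that[OF H])
  qed
  obtain B' :: "('a, nat \<Rightarrow> 'a) module" and h' where B': "central_simple_algebra k B'" "h' \<in> alg_hom k B' C"
    "h' ` carrier B' = H ` carrier T.AB" "brauer_class k B' = brauer_class k T.AB"
    by (rule transport_hom[OF T.tensor_csa[OF B(1) Z] H(1)])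
  note hD = alg_homD[OF B(2)] and gD = alg_homD[OF g(1)]
  have Hl: "H (T.t x \<one>\<^bsub>?Z\<^esub>) = h x" if "x \<in> carrier B" for x
    using that by (simp add: H(2) gD(5) hD(1))
  have Hr: "H (T.t \<one>\<^bsub>B\<^esub> y) = g y" if "y \<in> carrier ?Z" for y
    using that by (simp add: H(2) hD(5) gD(1))
  have img_l: "h ` carrier B \<subseteq> H ` carrier T.AB"
  proof
    fix u assume "u \<in> h ` carrier B"
    then obtain x where "x \<in> carrier B" "u = h x" by blast
    then show "u \<in> H ` carrier T.AB" using Hl[of x] T.t_closed[of x "\<one>\<^bsub>?Z\<^esub>"] by (metis T.B.one_closed imageI)
  qed
  have img_r: "g ` carrier ?Z \<subseteq> H ` carrier T.AB"
  proof
    fix u assume "u \<in> g ` carrier ?Z"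
    then obtain y where "y \<in> carrier ?Z" "u = g y" by blast
    then show "u \<in> H ` carrier T.AB" using Hr[of y] T.t_closed[of "\<one>\<^bsub>B\<^esub>" y] by (metis T.A.one_closed imageI)
  qed
  have gens: "cyc_gen k q \<zeta> (a ?l) (b ?l) 1 \<in> carrier ?Z" "cyc_gen k q \<zeta> (a ?l) (b ?l) 2 \<in> carrier ?Z"
    using cyc_gens[OF ab(1,3)] unfolding cyc_pair_def by blast+
  have AV: "A ?l \<in> g ` carrier ?Z" "V ?l \<in> g ` carrier ?Z"
    using imageI[OF gens(1), of g] imageI[OF gens(2), of g] by (simp_all only: g)
  have range: "{1..?l} = insert ?l {1..n}" by auto
  have 1: "A ` {1..?l} \<union> V ` {1..?l} \<subseteq> h' ` carrier B'"
    unfolding B'(3) range using B(4) img_l img_r AV by blast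
  have 2: "brauer_class k B' = (\<Otimes>\<^bsub>BR\<^esub>i\<in>{1..?l}. smb (a i) (b i))"
  proof -
    have cl: "(\<lambda>i. smb (a i) (b i)) \<in> {1..n} \<rightarrow> carrier BR" using symbol_ab Suc.prems by auto
    have "brauer_class k B' = brauer_class k B \<otimes>\<^bsub>BR\<^esub> smb (a ?l) (b ?l)"
      unfolding B'(4) brauer_symbol_def by (rule brauer_mult[OF K.field_axioms B(1) Z, symmetric])
    also have "\<dots> = smb (a ?l) (b ?l) \<otimes>\<^bsub>BR\<^esub> (\<Otimes>\<^bsub>BR\<^esub>i\<in>{1..n}. smb (a i) (b i))"
      unfolding B(3) by (rule BR.m_comm[OF BR.finprod_closed[OF cl] symbol_ab[OF l]])
    also have "\<dots> = (\<Otimes>\<^bsub>BR\<^esub>i\<in>{1..?l}. smb (a i) (b i))"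
      unfolding range by (rule BR.finprod_insert[symmetric]) (use cl symbol_ab[OF l] in auto)
    finally show ?thesis .
  qed
  have 3: "z \<otimes> v = v \<otimes> z" if v: "v \<in> carrier C"
    and c: "\<And>i. i \<in> {1..?l} \<Longrightarrow> A i \<otimes> v = v \<otimes> A i \<and> V i \<otimes> v = v \<otimes> V i"
    and z: "z \<in> h' ` carrier B'" for v z
  proof -
    obtain u where u: "u \<in> carrier T.AB" "z = H u" using z unfolding B'(3) by blast
    have cB: "h x \<otimes> v = v \<otimes> h x" if x: "x \<in> carrier B" for x
      by (rule Bc[OF v _ _ imageI[OF x]]) (use c in auto)
    have cZ: "g y \<otimes> v = v \<otimes> g y" if y: "y \<in> carrier ?Z" for y
      by (rule gc[OF v _ _ y]) (use c[of ?l] in auto)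
    have "carrier T.AB \<subseteq> {u \<in> carrier T.AB. H u \<in> {w \<in> carrier C. w \<otimes> v = v \<otimes> w}}"
      by (rule T.tensor_generated[OF subring_vimage[OF T.AB.k_alg_axioms C.k_alg_axioms H(1) C.centralizer_subring[OF v]]])
        (use cB cZ in \<open>auto simp: Hl Hr hD(1) gD(1) T.t_closed\<close>)
    then show ?thesis using u by blast
  qed
  show ?case using B'(1,2) 1 2 3 by (intro exI[of _ B'] exI[of _ h']) blast
qed

text \<open>The homomorphism from the full tensor product is injective by simplicity. Its image
  contains all \<open>A i\<close> and \<open>V i\<close>, and \<open>U l\<close> is
  \<open>V l\<close> times the inverse of the correction, so it is onto; in particular
  \<open>C\<close> inherits central simplicity.\<close>

theorem class_prod_b:
  "central_simple_algebra k C \<and> brauer_class k C = (\<Otimes>\<^bsub>BR\<^esub>i\<in>{1..m}. smb (a i) (b i))"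
proof -
  obtain B :: "('a, nat \<Rightarrow> 'a) module" and h where B: "central_simple_algebra k B" "h \<in> alg_hom k B C"
    "brauer_class k B = (\<Otimes>\<^bsub>BR\<^esub>i\<in>{1..m}. smb (a i) (b i))"
    "A ` {1..m} \<union> V ` {1..m} \<subseteq> h ` carrier B"
    using partial_tensor[OF order_refl] by blast
  note kB = csa_alg[OF K.field_axioms B(1)]
  have "alg_isomorphic k B C"
  proof (rule csa_surj_iso[OF B(1) C.k_alg_axioms B(2) C1])
    fix S assume S: "subring S C" and hS: "h ` carrier B \<subseteq> S"
    note scal = alg_hom_image_scalar[OF kB B(2) hS]
    have AS: "A i \<in> S" and VS: "V i \<in> S" if "i \<in> {1..m}" for i using B(4) hS that by blast+
    note Sm = subringE(6)[OF S]
    have pw: "z [^] (n::nat) \<in> S" if "z \<in> S" for z n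
      by (induction n) (use that subringE(3,6)[OF S] in auto)
    have WS: "W l n \<in> S" if "n \<le> m" for l n
      using that
    proof (induction n)
      case (Suc n)
      then show ?case unfolding W.simps by (intro Sm pw AS) auto
    qed (simp add: subringE(3)[OF S])
    have US: "U l \<in> S" if l: "l \<in> {1..m}" for l
    proof -
      have n: "l - 1 \<le> m" using l by auto
      let ?W = "W l (l - 1)" and ?w = "w l (l - 1)"
      note cl = U[OF l] W_closed[OF n, of l]
      have wU: "?w \<in> Units k" using w_closed[OF n, of l] by (simp add: K.field_Units)
      \<comment> \<open>Shows that the power with exponent \<open>q - 1\<close>, divided by the
        nonzero scalar \<open>?w\<close>, is the inverse of the correction, so the inverse stays
        inside the subring.\<close>
      have "?W \<otimes> ?W [^] (q - 1) = ?w \<odot> \<one>"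
        using C.nat_pow_Suc2[OF cl(2), of "q - 1"] q_pos W_pow[OF n, of l] by simp
      then have "V l \<otimes> ?W [^] (q - 1) = ?w \<odot> U l"
        unfolding V_def using cl w_closed[OF n, of l] by (simp add: C.m_assoc C.smult_mult_r del: One_nat_def)
      then have "(inv\<^bsub>k\<^esub> ?w \<odot> \<one>) \<otimes> (V l \<otimes> ?W [^] (q - 1)) = U l"
        using cl wU w_closed[OF n, of l] K.Units_inv_closed[OF wU]
        by (simp add: C.smult_mult_smult)
      then show ?thesis
        using Sm[OF scal[OF K.Units_inv_closed[OF wU]] Sm[OF VS[OF l] pw[OF WS[OF n], of l "q - 1"]]] by (simp only:)
    qed
    show "carrier C \<subseteq> S" by (rule gen[OF S scal]) (use AS US in auto)
  qed
  then show ?thesis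
    using csa_iso[OF B(1) C.k_alg_axioms] brauer_class_iso[OF K.field_axioms B(1) C.k_alg_axioms] B(3) by simp
qed

text \<open>Multiplicativity in the second argument splits off one power of \<open>a i\<close> after
  another; the splitting of the symbol with second argument 1 covers exponent 0.\<close>

lemma symbol_w:
  assumes l: "l \<in> {1..m}" and z: "z \<in> carrier k" "z \<noteq> \<zero>\<^bsub>k\<^esub>" and n: "n \<le> m"
  shows "smb (a l) (z \<otimes>\<^bsub>k\<^esub> w l n) = smb (a l) z \<otimes>\<^bsub>BR\<^esub> (\<Otimes>\<^bsub>BR\<^esub>i\<in>{1..n}. smb (a l) (a i) [^]\<^bsub>BR\<^esub> d i l)"
  using n
proof (induction n)
  case 0
  then show ?case using z symbol_closed[OF a(1)[OF l] a(2)[OF l] z] by simp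
next
  case (Suc n)
  let ?i = "Suc n"
  have i: "?i \<in> {1..m}" using Suc.prems by simp
  note al = a(1)[OF l] a(2)[OF l] and ai = a(1)[OF i] a(2)[OF i]
  have ne: "a ?i [^]\<^bsub>k\<^esub> e \<in> carrier k" "a ?i [^]\<^bsub>k\<^esub> e \<noteq> \<zero>\<^bsub>k\<^esub>" for e :: nat
    using ai by simp (use ai in \<open>induction e; simp add: K.integral_iff\<close>)
  have pw: "smb (a l) (a ?i [^]\<^bsub>k\<^esub> e) = smb (a l) (a ?i) [^]\<^bsub>BR\<^esub> e" for e :: nat
  proof (induction e)
    case (Suc e)
    then show ?case using symbol_mult_right[OF al ne[of e] ai] by simp
  qed (simp add: symbol_one_right[OF al])
  have cl: "(\<lambda>i. smb (a l) (a i) [^]\<^bsub>BR\<^esub> d i l) \<in> {1..n} \<rightarrow> carrier BR"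
    using symbol_closed[OF al] a Suc.prems by auto
  have wn: "w l n \<in> carrier k" "w l n \<noteq> \<zero>\<^bsub>k\<^esub>" using w_closed[of n l] Suc.prems by auto
  then have zw: "z \<otimes>\<^bsub>k\<^esub> w l n \<in> carrier k" "z \<otimes>\<^bsub>k\<^esub> w l n \<noteq> \<zero>\<^bsub>k\<^esub>" using z by (simp_all add: K.integral_iff)
  have range: "{1..?i} = insert ?i {1..n}" by auto
  have sc: "smb (a l) z \<in> carrier BR" "smb (a l) (a ?i) [^]\<^bsub>BR\<^esub> d ?i l \<in> carrier BR"
    using symbol_closed[OF al z] symbol_closed[OF al ai] by simp_all
  have "smb (a l) (z \<otimes>\<^bsub>k\<^esub> w l ?i) = smb (a l) ((z \<otimes>\<^bsub>k\<^esub> w l n) \<otimes>\<^bsub>k\<^esub> a ?i [^]\<^bsub>k\<^esub> d ?i l)"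
    using z wn ne by (simp add: K.m_assoc)
  also have "\<dots> = smb (a l) (z \<otimes>\<^bsub>k\<^esub> w l n) \<otimes>\<^bsub>BR\<^esub> smb (a l) (a ?i) [^]\<^bsub>BR\<^esub> d ?i l"
    unfolding symbol_mult_right[OF al zw ne] pw ..
  also have "\<dots> = smb (a l) z \<otimes>\<^bsub>BR\<^esub> (smb (a l) (a ?i) [^]\<^bsub>BR\<^esub> d ?i l \<otimes>\<^bsub>BR\<^esub> (\<Otimes>\<^bsub>BR\<^esub>i\<in>{1..n}. smb (a l) (a i) [^]\<^bsub>BR\<^esub> d i l))"
    using Suc sc BR.finprod_closed[OF cl] by (simp add: BR.m_ac)
  also have "smb (a l) (a ?i) [^]\<^bsub>BR\<^esub> d ?i l \<otimes>\<^bsub>BR\<^esub> (\<Otimes>\<^bsub>BR\<^esub>i\<in>{1..n}. smb (a l) (a i) [^]\<^bsub>BR\<^esub> d i l) =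
      (\<Otimes>\<^bsub>BR\<^esub>i\<in>{1..?i}. smb (a l) (a i) [^]\<^bsub>BR\<^esub> d i l)"
    unfolding range by (rule BR.finprod_insert[symmetric]) (use cl sc in auto)
  finally show ?case .
qed

text \<open>Collects the products belonging to the single \<open>l\<close> into one product over
  pairs. Passing from \<open>n\<close> to \<open>Suc n\<close> adds exactly the pairs whose second
  entry is \<open>Suc n\<close>.\<close>

lemma finprod_pairs:
  assumes g: "\<And>i l. i \<in> {1..m} \<Longrightarrow> l \<in> {1..m} \<Longrightarrow> g i l \<in> carrier BR" and n: "n \<le> m"
  shows "(\<Otimes>\<^bsub>BR\<^esub>l\<in>{1..n}. \<Otimes>\<^bsub>BR\<^esub>i\<in>{1..l - 1}. g i l) =
    (\<Otimes>\<^bsub>BR\<^esub>w\<in>{w \<in> {1..n} \<times> {1..n}. fst w < snd w}. g (fst w) (snd w))"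
  using n
proof (induction n)
  case 0
  then show ?case by simp
next
  case (Suc n)
  let ?l = "Suc n"
  let ?S = "{w \<in> {1..n} \<times> {1..n}. fst w < snd w}" and ?T = "(\<lambda>i. (i, ?l)) ` {1..n}"
  have set: "{w \<in> {1..?l} \<times> {1..?l}. fst w < snd w} = ?T \<union> ?S"
    by auto
  have fin: "finite ?S" by (rule finite_subset[of _ "{1..n} \<times> {1..n}"]) auto
  have gS: "(\<lambda>w. g (fst w) (snd w)) \<in> ?S \<rightarrow> carrier BR" "(\<lambda>w. g (fst w) (snd w)) \<in> ?T \<rightarrow> carrier BR"
    using g Suc.prems by auto
  have inner: "(\<Otimes>\<^bsub>BR\<^esub>i\<in>{1..l - 1}. g i l) \<in> carrier BR" if "l \<in> {1..m}" for l
    by (rule BR.finprod_closed) (use g that in auto)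
  have range: "{1..?l} = insert ?l {1..n}" by auto
  have "(\<Otimes>\<^bsub>BR\<^esub>l\<in>{1..?l}. \<Otimes>\<^bsub>BR\<^esub>i\<in>{1..l - 1}. g i l) =
      (\<Otimes>\<^bsub>BR\<^esub>i\<in>{1..n}. g i ?l) \<otimes>\<^bsub>BR\<^esub> (\<Otimes>\<^bsub>BR\<^esub>l\<in>{1..n}. \<Otimes>\<^bsub>BR\<^esub>i\<in>{1..l - 1}. g i l)"
    unfolding range by (subst BR.finprod_insert) (use inner[of ?l] inner Suc.prems in auto)
  also have "(\<Otimes>\<^bsub>BR\<^esub>i\<in>{1..n}. g i ?l) = (\<Otimes>\<^bsub>BR\<^esub>w\<in>?T. g (fst w) (snd w))"
    by (subst BR.finprod_reindex) (use gS in \<open>auto simp: inj_on_def\<close>)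
  also have "(\<Otimes>\<^bsub>BR\<^esub>l\<in>{1..n}. \<Otimes>\<^bsub>BR\<^esub>i\<in>{1..l - 1}. g i l) = (\<Otimes>\<^bsub>BR\<^esub>w\<in>?S. g (fst w) (snd w))"
    using Suc by simp
  also have "(\<Otimes>\<^bsub>BR\<^esub>w\<in>?T. g (fst w) (snd w)) \<otimes>\<^bsub>BR\<^esub> (\<Otimes>\<^bsub>BR\<^esub>w\<in>?S. g (fst w) (snd w)) =
      (\<Otimes>\<^bsub>BR\<^esub>w\<in>?T \<union> ?S. g (fst w) (snd w))"
    by (rule BR.finprod_Un_disjoint[symmetric]) (use fin gS in auto)
  finally show ?case unfolding set .
qed

theorem class_formula:
  "brauer_class k C \<in> carrier BR \<and>
   brauer_class k C = (\<Otimes>\<^bsub>BR\<^esub>i\<in>{1..m}. smb (a i) (\<zeta> [^]\<^bsub>k\<^esub> j i)) \<otimes>\<^bsub>BR\<^esub>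
     (\<Otimes>\<^bsub>BR\<^esub>w\<in>{w \<in> {1..m} \<times> {1..m}. fst w < snd w}. smb (a (snd w)) (a (fst w)) [^]\<^bsub>BR\<^esub> d (fst w) (snd w))"
proof -
  have zn: "\<zeta> [^]\<^bsub>k\<^esub> e \<noteq> \<zero>\<^bsub>k\<^esub>" for e :: nat using zeta zeta_unit by (induction e) (simp_all add: K.integral_iff)
  have s1: "smb (a l) (\<zeta> [^]\<^bsub>k\<^esub> j l) \<in> carrier BR" if "l \<in> {1..m}" for l
    by (rule symbol_closed[OF a(1)[OF that] a(2)[OF that] _ zn]) simp
  have s2: "smb (a l) (a i) [^]\<^bsub>BR\<^esub> d i l \<in> carrier BR" if "i \<in> {1..m}" "l \<in> {1..m}" for i l
    by (intro BR.nat_pow_closed symbol_closed a that)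
  have inner: "(\<Otimes>\<^bsub>BR\<^esub>i\<in>{1..l - 1}. smb (a l) (a i) [^]\<^bsub>BR\<^esub> d i l) \<in> carrier BR" if "l \<in> {1..m}" for l
    by (rule BR.finprod_closed) (use s2 that in auto)
  have "brauer_class k C = (\<Otimes>\<^bsub>BR\<^esub>l\<in>{1..m}. smb (a l) (b l))" using class_prod_b by blast
  also have "\<dots> = (\<Otimes>\<^bsub>BR\<^esub>l\<in>{1..m}. smb (a l) (\<zeta> [^]\<^bsub>k\<^esub> j l) \<otimes>\<^bsub>BR\<^esub> (\<Otimes>\<^bsub>BR\<^esub>i\<in>{1..l - 1}. smb (a l) (a i) [^]\<^bsub>BR\<^esub> d i l))"
  proof (rule BR.finprod_cong'[OF refl])
    fix l assume l: "l \<in> {1..m}"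
    then have n: "l - 1 \<le> m" by auto
    show "smb (a l) (b l) = smb (a l) (\<zeta> [^]\<^bsub>k\<^esub> j l) \<otimes>\<^bsub>BR\<^esub> (\<Otimes>\<^bsub>BR\<^esub>i\<in>{1..l - 1}. smb (a l) (a i) [^]\<^bsub>BR\<^esub> d i l)"
      unfolding b_def by (rule symbol_w[OF l zeta_pow_closed zn n])
  qed (use s1 inner in auto)
  also have "\<dots> = (\<Otimes>\<^bsub>BR\<^esub>l\<in>{1..m}. smb (a l) (\<zeta> [^]\<^bsub>k\<^esub> j l)) \<otimes>\<^bsub>BR\<^esub>
      (\<Otimes>\<^bsub>BR\<^esub>l\<in>{1..m}. \<Otimes>\<^bsub>BR\<^esub>i\<in>{1..l - 1}. smb (a l) (a i) [^]\<^bsub>BR\<^esub> d i l)"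
    by (rule BR.finprod_multf) (use s1 inner in auto)
  also note finprod_pairs[of "\<lambda>i l. smb (a l) (a i) [^]\<^bsub>BR\<^esub> d i l", OF s2 order_refl]
  finally show ?thesis
    using brauer_class_closed[OF K.field_axioms] class_prod_b by blast
qed

end

section \<open>Crossed products\<close>

text \<open>The group laws of the Galois group form an assumption here; in the theorem they come
  with the central extension that has this group as its quotient.\<close>

locale galois_action = L: field L for L :: "('a, 'r) ring_scheme" (structure) +
  fixes K :: "'a set"
  assumes K: "subfield K L" and F_group: "group (galois_group L K)"
begin

abbreviation "k \<equiv> L\<lparr>carrier := K\<rparr>"
abbreviation "F \<equiv> galois_group L K"
text \<open>\<open>L\<close> as a module over the subfield \<open>k\<close>, from which the
  components of crossed product elements are taken.\<close>

abbreviation "LB \<equiv> base_algebra L"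

sublocale F: group F by (rule F_group)

lemma k_field: "field k" by (rule L.subfield_iff(2)[OF K])

lemma K_L: "x \<in> K \<Longrightarrow> x \<in> carrier L" using subfieldE(3)[OF K] by blast

lemma F_hom: "\<sigma> \<in> carrier F \<Longrightarrow> \<sigma> \<in> ring_hom L L"
  and F_Bij: "\<sigma> \<in> carrier F \<Longrightarrow> \<sigma> \<in> Bij (carrier L)"
  and F_fix: "\<sigma> \<in> carrier F \<Longrightarrow> x \<in> K \<Longrightarrow> \<sigma> x = x"
  by (simp_all add: galois_group_def)

lemma F_mult:
  assumes \<sigma>: "\<sigma> \<in> carrier F" and \<tau>: "\<tau> \<in> carrier F" and x: "x \<in> carrier L"
  shows "(\<sigma> \<otimes>\<^bsub>F\<^esub> \<tau>) x = \<sigma> (\<tau> x)"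
proof -
  have "\<sigma> \<otimes>\<^bsub>F\<^esub> \<tau> = compose (carrier L) \<sigma> \<tau>"
    unfolding galois_group_def BijGroup_def by (simp add: F_Bij[OF \<sigma>] F_Bij[OF \<tau>])
  then show ?thesis using x by (simp add: compose_eq)
qed

lemma F_one: "x \<in> carrier L \<Longrightarrow> \<one>\<^bsub>F\<^esub> x = x"
  by (simp add: galois_group_def BijGroup_def)

lemma act:
  assumes \<sigma>: "\<sigma> \<in> carrier F"
  shows "x \<in> carrier L \<Longrightarrow> \<sigma> x \<in> carrier L"
    and "x \<in> carrier L \<Longrightarrow> y \<in> carrier L \<Longrightarrow> \<sigma> (x \<oplus> y) = \<sigma> x \<oplus> \<sigma> y"
    and "x \<in> carrier L \<Longrightarrow> y \<in> carrier L \<Longrightarrow> \<sigma> (x \<otimes> y) = \<sigma> x \<otimes> \<sigma> y"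
  by (fact ring_hom_closed[OF F_hom[OF \<sigma>]] ring_hom_add[OF F_hom[OF \<sigma>]] ring_hom_mult[OF F_hom[OF \<sigma>]])+

lemma act_zero_one:
  assumes \<sigma>: "\<sigma> \<in> carrier F" shows "\<sigma> \<zero> = \<zero>" "\<sigma> \<one> = \<one>"
  using F_fix[OF \<sigma>] subringE(2,3)[OF subfieldE(1)[OF K]] by auto

lemma act_nonzero:
  assumes \<sigma>: "\<sigma> \<in> carrier F" and x: "x \<in> carrier L" "x \<noteq> \<zero>" shows "\<sigma> x \<noteq> \<zero>"
  using inj_onD[of \<sigma> "carrier L" x "\<zero>"] F_Bij[OF \<sigma>] act_zero_one[OF \<sigma>] x by (auto simp: Bij_def bij_betw_def)

lemma unit: "x \<in> carrier L \<Longrightarrow> x \<noteq> \<zero> \<Longrightarrow> inv x \<in> carrier L"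
  "x \<in> carrier L \<Longrightarrow> x \<noteq> \<zero> \<Longrightarrow> inv x \<otimes> x = \<one>"
  "x \<in> carrier L \<Longrightarrow> x \<noteq> \<zero> \<Longrightarrow> x \<otimes> inv x = \<one>"
  "x \<in> carrier L \<Longrightarrow> x \<noteq> \<zero> \<Longrightarrow> inv x \<noteq> \<zero>"
proof -
  have "x \<in> Units L" if "x \<in> carrier L" "x \<noteq> \<zero>" using that by (simp add: L.field_Units)
  note u = L.Units_inv_closed[OF this] L.Units_l_inv[OF this] L.Units_r_inv[OF this]
  show 1: "x \<in> carrier L \<Longrightarrow> x \<noteq> \<zero> \<Longrightarrow> inv x \<in> carrier L"
    and "x \<in> carrier L \<Longrightarrow> x \<noteq> \<zero> \<Longrightarrow> inv x \<otimes> x = \<one>"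
    and 2: "x \<in> carrier L \<Longrightarrow> x \<noteq> \<zero> \<Longrightarrow> x \<otimes> inv x = \<one>" by (fact u)+
  show "x \<in> carrier L \<Longrightarrow> x \<noteq> \<zero> \<Longrightarrow> inv x \<noteq> \<zero>" using 2 by (metis L.r_null L.one_not_zero)
qed

lemma LB_simps [simp]: "carrier LB = carrier L" "x \<otimes>\<^bsub>LB\<^esub> y = x \<otimes> y" "\<one>\<^bsub>LB\<^esub> = \<one>" "x \<oplus>\<^bsub>LB\<^esub> y = x \<oplus> y"
  "\<zero>\<^bsub>LB\<^esub> = \<zero>" "x \<odot>\<^bsub>LB\<^esub> y = x \<otimes> y"
  by (simp_all add: base_algebra_def)

lemma LB_module: "module k LB"
proof (rule module.intro)
  show "cring k" using k_field by (simp add: field_def domain_def)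
  show "abelian_group LB"
  proof (rule abelian_groupI)
    fix x assume "x \<in> carrier LB"
    then show "\<exists>y\<in>carrier LB. y \<oplus>\<^bsub>LB\<^esub> x = \<zero>\<^bsub>LB\<^esub>" by (intro bexI[of _ "\<ominus> x"]) (simp_all add: L.l_neg)
  qed (simp_all add: L.a_ac)
  show "module_axioms k LB"
    by unfold_locales (simp_all add: K_L L.l_distr L.r_distr L.m_assoc)
qed

end

locale crossed = galois_action L K for L :: "('a, 'r) ring_scheme" (structure) and K +
  fixes f :: "('a \<Rightarrow> 'a) \<times> ('a \<Rightarrow> 'a) \<Rightarrow> 'a"
  assumes F_finite: "finite (carrier F)"
    and f: "\<And>\<sigma> \<tau>. \<sigma> \<in> carrier F \<Longrightarrow> \<tau> \<in> carrier F \<Longrightarrow> f (\<sigma>, \<tau>) \<in> carrier L"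
    and f_nonzero: "\<And>\<sigma> \<tau>. \<sigma> \<in> carrier F \<Longrightarrow> \<tau> \<in> carrier F \<Longrightarrow> f (\<sigma>, \<tau>) \<noteq> \<zero>"
    and cocycle: "\<And>\<sigma> \<tau> \<rho>. \<sigma> \<in> carrier F \<Longrightarrow> \<tau> \<in> carrier F \<Longrightarrow> \<rho> \<in> carrier F \<Longrightarrow>
      f (\<sigma>, \<tau>) \<otimes> f (\<sigma> \<otimes>\<^bsub>F\<^esub> \<tau>, \<rho>) = \<sigma> (f (\<tau>, \<rho>)) \<otimes> f (\<sigma>, \<tau> \<otimes>\<^bsub>F\<^esub> \<rho>)"
begin

abbreviation "CP \<equiv> crossed_product L K f"
abbreviation "u \<equiv> delta LB (carrier F)"
abbreviation "f1 \<equiv> f (\<one>\<^bsub>F\<^esub>, \<one>\<^bsub>F\<^esub>)"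
abbreviation "pairs \<rho> \<equiv> {w \<in> carrier F \<times> carrier F. fst w \<otimes>\<^bsub>F\<^esub> snd w = \<rho>}"

sublocale V: fun_module k LB "carrier F" CP
  using LB_module unfolding fun_module_def fun_module_axioms_def by (simp add: crossed_product_def Let_def)

sublocale V': module k CP by (rule V.V_module)

lemma finite_pairs: "finite (pairs \<rho>)"
  by (rule finite_subset[of _ "carrier F \<times> carrier F"]) (auto simp: F_finite)

lemma mult_at:
  assumes "\<rho> \<in> carrier F"
  shows "(x \<otimes>\<^bsub>CP\<^esub> y) \<rho> = (\<Oplus>w\<in>pairs \<rho>. x (fst w) \<otimes> (fst w) (y (snd w)) \<otimes> f w)"
  using assms by (simp add: crossed_product_def Let_def)

lemma term_closed:
  assumes x: "x \<in> carrier CP" and y: "y \<in> carrier CP" and w: "w \<in> pairs \<rho>"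
  shows "x (fst w) \<otimes> (fst w) (y (snd w)) \<otimes> f w \<in> carrier L"
  using V.mem[OF x, of "fst w"] V.mem[OF y, of "snd w"] w f[of "fst w" "snd w"] act(1)[of "fst w"] by auto

lemma pairs_F: "w \<in> pairs \<rho> \<Longrightarrow> fst w \<in> carrier F" "w \<in> pairs \<rho> \<Longrightarrow> snd w \<in> carrier F"
  "w \<in> pairs \<rho> \<Longrightarrow> f w \<in> carrier L"
  using f[of "fst w" "snd w"] by auto

lemma finsum_terms:
  assumes "x \<in> carrier CP" "y \<in> carrier CP" "x' \<in> carrier CP" "y' \<in> carrier CP"
  shows "(\<Oplus>w\<in>pairs \<rho>. x (fst w) \<otimes> fst w (y (snd w)) \<otimes> f w) \<oplus> (\<Oplus>w\<in>pairs \<rho>. x' (fst w) \<otimes> fst w (y' (snd w)) \<otimes> f w) =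
    (\<Oplus>w\<in>pairs \<rho>. x (fst w) \<otimes> fst w (y (snd w)) \<otimes> f w \<oplus> x' (fst w) \<otimes> fst w (y' (snd w)) \<otimes> f w)"
  by (rule L.finsum_addf[symmetric]; rule Pi_I; rule term_closed[OF assms(1,2)] term_closed[OF assms(3,4)]; assumption)

lemma finsum_scaled:
  assumes "r \<in> carrier L" "x \<in> carrier CP" "y \<in> carrier CP"
  shows "r \<otimes> (\<Oplus>w\<in>pairs \<rho>. x (fst w) \<otimes> fst w (y (snd w)) \<otimes> f w) = (\<Oplus>w\<in>pairs \<rho>. r \<otimes> (x (fst w) \<otimes> fst w (y (snd w)) \<otimes> f w))"
  by (rule L.finsum_rdistr[OF finite_pairs assms(1)], rule Pi_I, rule term_closed[OF assms(2,3)])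

lemma mult_closed: "x \<in> carrier CP \<Longrightarrow> y \<in> carrier CP \<Longrightarrow> x \<otimes>\<^bsub>CP\<^esub> y \<in> carrier CP"
proof -
  assume x: "x \<in> carrier CP" and y: "y \<in> carrier CP"
  have "(x \<otimes>\<^bsub>CP\<^esub> y) \<in> extensional (carrier F)" by (simp add: crossed_product_def Let_def)
  moreover have "(x \<otimes>\<^bsub>CP\<^esub> y) \<rho> \<in> carrier L" if "\<rho> \<in> carrier F" for \<rho>
    unfolding mult_at[OF that] by (rule L.finsum_closed, rule Pi_I, rule term_closed[OF x y])
  ultimately show ?thesis unfolding V.carrier by (auto simp: PiE_def)
qed

lemma u_closed: "\<sigma> \<in> carrier F \<Longrightarrow> x \<in> carrier L \<Longrightarrow> u \<sigma> x \<in> carrier CP"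
  by (rule V.delta_closed) simp_all

text \<open>In the convolution sum only the pair \<open>(\<sigma>, \<tau>)\<close> has two nonzero
  components.\<close>

lemma u_mult:
  assumes \<sigma>: "\<sigma> \<in> carrier F" and \<tau>: "\<tau> \<in> carrier F" and x: "x \<in> carrier L" and y: "y \<in> carrier L"
  shows "u \<sigma> x \<otimes>\<^bsub>CP\<^esub> u \<tau> y = u (\<sigma> \<otimes>\<^bsub>F\<^esub> \<tau>) (x \<otimes> \<sigma> y \<otimes> f (\<sigma>, \<tau>))"
proof (rule V.eqI[OF mult_closed[OF u_closed[OF \<sigma> x] u_closed[OF \<tau> y]] u_closed])
  note cl = act(1)[OF \<sigma> y] f[OF \<sigma> \<tau>]
  show "\<sigma> \<otimes>\<^bsub>F\<^esub> \<tau> \<in> carrier F" using \<sigma> \<tau> by simp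
  show z: "x \<otimes> \<sigma> y \<otimes> f (\<sigma>, \<tau>) \<in> carrier L" using x cl by simp
  fix \<rho> assume \<rho>: "\<rho> \<in> carrier F"
  let ?z = "x \<otimes> \<sigma> y \<otimes> f (\<sigma>, \<tau>)"
  have "(u \<sigma> x \<otimes>\<^bsub>CP\<^esub> u \<tau> y) \<rho> = (\<Oplus>w\<in>pairs \<rho>. if (\<sigma>, \<tau>) = w then ?z else \<zero>)"
    unfolding mult_at[OF \<rho>]
  proof (rule L.finsum_cong'[OF refl])
    fix w assume w: "w \<in> pairs \<rho>"
    then have wF: "fst w \<in> carrier F" "snd w \<in> carrier F" by auto
    show "u \<sigma> x (fst w) \<otimes> fst w (u \<tau> y (snd w)) \<otimes> f w = (if (\<sigma>, \<tau>) = w then ?z else \<zero>)"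
    proof (cases "(\<sigma>, \<tau>) = w")
      case True
      show ?thesis unfolding True[symmetric] by (simp add: delta_def \<sigma> \<tau>)
    next
      case False
      then have "fst w \<noteq> \<sigma> \<or> snd w \<noteq> \<tau>" by (metis prod.collapse)
      then have "u \<sigma> x (fst w) = \<zero> \<or> fst w (u \<tau> y (snd w)) = \<zero>"
        using wF act_zero_one(1)[OF wF(1)] by (elim disjE) (simp_all add: delta_def)
      moreover have "u \<sigma> x (fst w) \<in> carrier L" "fst w (u \<tau> y (snd w)) \<in> carrier L"
        using V.mem[OF u_closed[OF \<sigma> x] wF(1)] V.mem[OF u_closed[OF \<tau> y] wF(2)] act(1)[OF wF(1)] by simp_all
      ultimately show ?thesis using False pairs_F(3)[OF w] by (elim disjE) simp_all
    qed
  qed (use z in auto)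
  also have "\<dots> = (if \<rho> = \<sigma> \<otimes>\<^bsub>F\<^esub> \<tau> then ?z else \<zero>)"
  proof (cases "\<rho> = \<sigma> \<otimes>\<^bsub>F\<^esub> \<tau>")
    case True
    have "(\<Oplus>w\<in>pairs \<rho>. if (\<sigma>, \<tau>) = w then ?z else \<zero>) = ?z"
      by (rule L.add.finprod_singleton[of "(\<sigma>, \<tau>)" "pairs \<rho>" "\<lambda>_. ?z"]) (use \<sigma> \<tau> z True finite_pairs in auto)
    with True show ?thesis by simp
  next
    case False
    have "(\<Oplus>w\<in>pairs \<rho>. if (\<sigma>, \<tau>) = w then ?z else \<zero>) = \<zero>"
      by (rule L.add.finprod_one_eqI) (use False in auto)
    with False show ?thesis by simp
  qed
  finally show "(u \<sigma> x \<otimes>\<^bsub>CP\<^esub> u \<tau> y) \<rho> = u (\<sigma> \<otimes>\<^bsub>F\<^esub> \<tau>) ?z \<rho>" using \<rho> by (simp add: delta_def)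
qed

lemma one_eq: "\<one>\<^bsub>CP\<^esub> = u \<one>\<^bsub>F\<^esub> (inv f1)"
  unfolding crossed_product_def Let_def delta_def LB_simps by simp

lemma f1: "f1 \<in> carrier L" "f1 \<noteq> \<zero>" "inv f1 \<in> carrier L" "inv f1 \<otimes> f1 = \<one>" "inv f1 \<noteq> \<zero>"
  using f[of "\<one>\<^bsub>F\<^esub>" "\<one>\<^bsub>F\<^esub>"] f_nonzero[of "\<one>\<^bsub>F\<^esub>" "\<one>\<^bsub>F\<^esub>"] unit by auto

text \<open>The cocycle identity at the triple 1, 1, \<open>\<sigma>\<close>. Together with its
  counterpart on the right it replaces a normalisation of \<open>f\<close>.\<close>

lemma f_one_left: "\<sigma> \<in> carrier F \<Longrightarrow> f (\<one>\<^bsub>F\<^esub>, \<sigma>) = f1"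
  using cocycle[of "\<one>\<^bsub>F\<^esub>" "\<one>\<^bsub>F\<^esub>" \<sigma>] f[of "\<one>\<^bsub>F\<^esub>" \<sigma>] f_nonzero[of "\<one>\<^bsub>F\<^esub>" \<sigma>] f1
  by (simp add: F_one L.m_rcancel)

lemma f_one_right: "\<sigma> \<in> carrier F \<Longrightarrow> f (\<sigma>, \<one>\<^bsub>F\<^esub>) = \<sigma> f1"
  using cocycle[of \<sigma> "\<one>\<^bsub>F\<^esub>" "\<one>\<^bsub>F\<^esub>"] f[of \<sigma> "\<one>\<^bsub>F\<^esub>"] f_nonzero[of \<sigma> "\<one>\<^bsub>F\<^esub>"] f1 act(1)[of \<sigma> f1]
  by (simp add: L.m_rcancel)

lemma u_add: "\<sigma> \<in> carrier F \<Longrightarrow> x \<in> carrier L \<Longrightarrow> y \<in> carrier L \<Longrightarrow> u \<sigma> (x \<oplus> y) = u \<sigma> x \<oplus>\<^bsub>CP\<^esub> u \<sigma> y"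
  by (rule V.eqI) (auto simp: u_closed V.at)

lemma u_smult: "\<sigma> \<in> carrier F \<Longrightarrow> r \<in> K \<Longrightarrow> x \<in> carrier L \<Longrightarrow> u \<sigma> (r \<otimes> x) = r \<odot>\<^bsub>CP\<^esub> u \<sigma> x"
  by (rule V.eqI) (auto simp: u_closed V.at K_L)

text \<open>The embedding of \<open>L\<close>, that is \<open>x\<close> times the unit; the factor
  \<open>inv f1\<close> belongs to the unit of an unnormalised crossed product.\<close>

definition e :: "'a \<Rightarrow> ('a \<Rightarrow> 'a) \<Rightarrow> 'a" where "e x = u \<one>\<^bsub>F\<^esub> (x \<otimes> inv f1)"

lemma e_closed: "x \<in> carrier L \<Longrightarrow> e x \<in> carrier CP"
  unfolding e_def by (rule u_closed) (simp_all add: f1)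

lemma e_mult_u: "\<sigma> \<in> carrier F \<Longrightarrow> x \<in> carrier L \<Longrightarrow> y \<in> carrier L \<Longrightarrow> e x \<otimes>\<^bsub>CP\<^esub> u \<sigma> y = u \<sigma> (x \<otimes> y)"
proof -
  assume a: "\<sigma> \<in> carrier F" "x \<in> carrier L" "y \<in> carrier L"
  have "x \<otimes> inv f1 \<otimes> y \<otimes> f1 = x \<otimes> y \<otimes> (inv f1 \<otimes> f1)"
    using a f1(1,3) by (simp add: L.m_ac)
  then show ?thesis using a f1 by (simp add: e_def u_mult F_one f_one_left[OF a(1)])
qed

lemma u_mult_e:
  assumes \<sigma>: "\<sigma> \<in> carrier F" and x: "x \<in> carrier L" and y: "y \<in> carrier L"
  shows "u \<sigma> y \<otimes>\<^bsub>CP\<^esub> e x = e (\<sigma> x) \<otimes>\<^bsub>CP\<^esub> u \<sigma> y"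
proof -
  have "\<sigma> (inv f1) \<otimes> \<sigma> f1 = \<one>" using act(3)[OF \<sigma> f1(3,1)] f1(4) act_zero_one[OF \<sigma>] by simp
  moreover have "y \<otimes> (\<sigma> x \<otimes> \<sigma> (inv f1)) \<otimes> \<sigma> f1 = \<sigma> x \<otimes> y \<otimes> (\<sigma> (inv f1) \<otimes> \<sigma> f1)"
    using x y act(1)[OF \<sigma>] f1 by (simp add: L.m_ac)
  ultimately show ?thesis
    using \<sigma> x y f1 act[OF \<sigma>] by (simp add: e_mult_u) (simp add: e_def u_mult f_one_right[OF \<sigma>])
qed

text \<open>The elements \<open>u \<sigma> x\<close> span, and on them associativity is the cocycle
  identity.\<close>

lemma CP_alg: "k_alg k CP"
proof (rule k_algI_span[OF k_field V.V_module])
  show "\<one>\<^bsub>CP\<^esub> \<in> carrier CP" unfolding one_eq by (rule u_closed) (simp_all add: f1)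
  let ?S = "{u \<sigma> x | \<sigma> x. \<sigma> \<in> carrier F \<and> x \<in> carrier LB}"
  show "?S \<subseteq> carrier CP" using u_closed by auto
  show "carrier CP \<subseteq> lin_span k CP ?S" by (rule V.V_span[OF F_finite])
  fix x y assume x: "x \<in> carrier CP" and y: "y \<in> carrier CP"
  show xy: "x \<otimes>\<^bsub>CP\<^esub> y \<in> carrier CP" by (rule mult_closed[OF x y])
  show "(x \<oplus>\<^bsub>CP\<^esub> y) \<otimes>\<^bsub>CP\<^esub> z = x \<otimes>\<^bsub>CP\<^esub> z \<oplus>\<^bsub>CP\<^esub> y \<otimes>\<^bsub>CP\<^esub> z" if z: "z \<in> carrier CP" for z
  proof (rule V.eqI)
    fix \<rho> assume \<rho>: "\<rho> \<in> carrier F"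
    show "((x \<oplus>\<^bsub>CP\<^esub> y) \<otimes>\<^bsub>CP\<^esub> z) \<rho> = (x \<otimes>\<^bsub>CP\<^esub> z \<oplus>\<^bsub>CP\<^esub> y \<otimes>\<^bsub>CP\<^esub> z) \<rho>"
      unfolding V.at(1)[OF \<rho>] mult_at[OF \<rho>] LB_simps finsum_terms[OF x z y z]
    proof (rule L.finsum_cong'[OF refl])
      fix w assume w: "w \<in> pairs \<rho>"
      note wF = pairs_F(1)[OF w] pairs_F(2)[OF w]
      note cl = V.mem[OF _ wF(1), unfolded LB_simps] V.mem[OF _ wF(2), unfolded LB_simps] pairs_F(3)[OF w]
      note wact = act[OF wF(1)]
      show "(x \<oplus>\<^bsub>CP\<^esub> y) (fst w) \<otimes> fst w (z (snd w)) \<otimes> f w = x (fst w) \<otimes> fst w (z (snd w)) \<otimes> f w \<oplus> y (fst w) \<otimes> fst w (z (snd w)) \<otimes> f w"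
        using cl(1)[OF x] cl(1)[OF y] cl(2)[OF z] cl(3) wact(1) by (simp add: V.at(1)[OF wF(1)] L.l_distr)
    qed (intro Pi_I L.a_closed term_closed x y z; assumption)
  qed (use x y z in \<open>auto intro: mult_closed\<close>)
  show "z \<otimes>\<^bsub>CP\<^esub> (x \<oplus>\<^bsub>CP\<^esub> y) = z \<otimes>\<^bsub>CP\<^esub> x \<oplus>\<^bsub>CP\<^esub> z \<otimes>\<^bsub>CP\<^esub> y" if z: "z \<in> carrier CP" for z
  proof (rule V.eqI)
    fix \<rho> assume \<rho>: "\<rho> \<in> carrier F"
    show "(z \<otimes>\<^bsub>CP\<^esub> (x \<oplus>\<^bsub>CP\<^esub> y)) \<rho> = (z \<otimes>\<^bsub>CP\<^esub> x \<oplus>\<^bsub>CP\<^esub> z \<otimes>\<^bsub>CP\<^esub> y) \<rho>"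
      unfolding V.at(1)[OF \<rho>] mult_at[OF \<rho>] LB_simps finsum_terms[OF z x z y]
    proof (rule L.finsum_cong'[OF refl])
      fix w assume w: "w \<in> pairs \<rho>"
      note wF = pairs_F(1)[OF w] pairs_F(2)[OF w]
      note cl = V.mem[OF _ wF(1), unfolded LB_simps] V.mem[OF _ wF(2), unfolded LB_simps] pairs_F(3)[OF w]
      note wact = act[OF wF(1)]
      show "z (fst w) \<otimes> fst w ((x \<oplus>\<^bsub>CP\<^esub> y) (snd w)) \<otimes> f w = z (fst w) \<otimes> fst w (x (snd w)) \<otimes> f w \<oplus> z (fst w) \<otimes> fst w (y (snd w)) \<otimes> f w"
        using cl(2)[OF x] cl(2)[OF y] cl(1)[OF z] cl(3) wact by (simp add: V.at(1)[OF wF(2)] L.l_distr L.r_distr)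
    qed (intro Pi_I L.a_closed term_closed x y z; assumption)
  qed (use x y z in \<open>auto intro: mult_closed\<close>)
  fix r assume r: "r \<in> carrier k"
  then have rL: "r \<in> carrier L" and rK: "r \<in> K" by (simp_all add: K_L)
  show "(r \<odot>\<^bsub>CP\<^esub> x) \<otimes>\<^bsub>CP\<^esub> y = r \<odot>\<^bsub>CP\<^esub> (x \<otimes>\<^bsub>CP\<^esub> y)"
  proof (rule V.eqI)
    fix \<rho> assume \<rho>: "\<rho> \<in> carrier F"
    show "((r \<odot>\<^bsub>CP\<^esub> x) \<otimes>\<^bsub>CP\<^esub> y) \<rho> = (r \<odot>\<^bsub>CP\<^esub> (x \<otimes>\<^bsub>CP\<^esub> y)) \<rho>"
      unfolding V.at(3)[OF \<rho>] mult_at[OF \<rho>] LB_simps finsum_scaled[OF rL x y]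
    proof (rule L.finsum_cong'[OF refl])
      fix w assume w: "w \<in> pairs \<rho>"
      note wF = pairs_F(1)[OF w] pairs_F(2)[OF w]
      note cl = V.mem[OF _ wF(1), unfolded LB_simps] V.mem[OF _ wF(2), unfolded LB_simps] pairs_F(3)[OF w]
      note wact = act[OF wF(1)]
      show "(r \<odot>\<^bsub>CP\<^esub> x) (fst w) \<otimes> fst w (y (snd w)) \<otimes> f w = r \<otimes> (x (fst w) \<otimes> fst w (y (snd w)) \<otimes> f w)"
        using cl(1)[OF x] cl(2)[OF y] cl(3) rL wact(1) by (simp add: V.at(3)[OF wF(1)] L.m_assoc)
    qed (intro Pi_I L.m_closed rL term_closed x y; assumption)
  qed (use x y r in \<open>auto intro: mult_closed\<close>)
  show "x \<otimes>\<^bsub>CP\<^esub> (r \<odot>\<^bsub>CP\<^esub> y) = r \<odot>\<^bsub>CP\<^esub> (x \<otimes>\<^bsub>CP\<^esub> y)"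
  proof (rule V.eqI)
    fix \<rho> assume \<rho>: "\<rho> \<in> carrier F"
    show "(x \<otimes>\<^bsub>CP\<^esub> (r \<odot>\<^bsub>CP\<^esub> y)) \<rho> = (r \<odot>\<^bsub>CP\<^esub> (x \<otimes>\<^bsub>CP\<^esub> y)) \<rho>"
      unfolding V.at(3)[OF \<rho>] mult_at[OF \<rho>] LB_simps finsum_scaled[OF rL x y]
    proof (rule L.finsum_cong'[OF refl])
      fix w assume w: "w \<in> pairs \<rho>"
      note wF = pairs_F(1)[OF w] pairs_F(2)[OF w]
      note cl = V.mem[OF _ wF(1), unfolded LB_simps] V.mem[OF _ wF(2), unfolded LB_simps] pairs_F(3)[OF w]
      note wact = act[OF wF(1)]
      show "x (fst w) \<otimes> fst w ((r \<odot>\<^bsub>CP\<^esub> y) (snd w)) \<otimes> f w = r \<otimes> (x (fst w) \<otimes> fst w (y (snd w)) \<otimes> f w)"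
        using cl(1)[OF x] cl(2)[OF y] cl(3) rL wact F_fix[OF wF(1) rK] by (simp add: V.at(3)[OF wF(2)] L.m_ac)
    qed (intro Pi_I L.m_closed rL term_closed x y; assumption)
  qed (use x y r in \<open>auto intro: mult_closed\<close>)
next
  let ?S = "{u \<sigma> x | \<sigma> x. \<sigma> \<in> carrier F \<and> x \<in> carrier LB}"
  have one_e: "\<one>\<^bsub>CP\<^esub> = e \<one>" using f1 by (simp add: one_eq e_def)
  show "\<one>\<^bsub>CP\<^esub> \<otimes>\<^bsub>CP\<^esub> x = x" "x \<otimes>\<^bsub>CP\<^esub> \<one>\<^bsub>CP\<^esub> = x" if "x \<in> ?S" for x
    using that by (auto simp: one_e e_mult_u u_mult_e act_zero_one)
  fix x y z assume "x \<in> ?S" "y \<in> ?S" "z \<in> ?S"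
  then obtain \<sigma> \<tau> \<rho> x' y' z' where eq: "x = u \<sigma> x'" "y = u \<tau> y'" "z = u \<rho> z'"
    and F: "\<sigma> \<in> carrier F" "\<tau> \<in> carrier F" "\<rho> \<in> carrier F"
    and cl: "x' \<in> carrier L" "y' \<in> carrier L" "z' \<in> carrier L" by auto
  note c = cl f[OF F(1,2)] f[OF F(2,3)] f[OF F.m_closed[OF F(1,2)] F(3)] f[OF F(1) F.m_closed[OF F(2,3)]]
    act(1)[OF F(1)] act(1)[OF F(2)]
  have "x' \<otimes> \<sigma> y' \<otimes> f (\<sigma>, \<tau>) \<otimes> \<sigma> (\<tau> z') \<otimes> f (\<sigma> \<otimes>\<^bsub>F\<^esub> \<tau>, \<rho>) =
      x' \<otimes> \<sigma> y' \<otimes> \<sigma> (\<tau> z') \<otimes> (f (\<sigma>, \<tau>) \<otimes> f (\<sigma> \<otimes>\<^bsub>F\<^esub> \<tau>, \<rho>))"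
    using c by (simp add: L.m_ac)
  also have "\<dots> = x' \<otimes> (\<sigma> y' \<otimes> \<sigma> (\<tau> z') \<otimes> \<sigma> (f (\<tau>, \<rho>))) \<otimes> f (\<sigma>, \<tau> \<otimes>\<^bsub>F\<^esub> \<rho>)"
    unfolding cocycle[OF F] using c by (simp add: L.m_assoc)
  finally show "x \<otimes>\<^bsub>CP\<^esub> y \<otimes>\<^bsub>CP\<^esub> z = x \<otimes>\<^bsub>CP\<^esub> (y \<otimes>\<^bsub>CP\<^esub> z)"
    unfolding eq using F c by (simp add: u_mult F_mult act(3)[OF F(1)] F.m_assoc)
qed

sublocale C: k_alg k CP by (rule CP_alg)

lemma e_hom: "e \<in> alg_hom k LB CP"
proof (rule alg_homI)
  fix x y assume x: "x \<in> carrier LB" and y: "y \<in> carrier LB"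
  show "e x \<in> carrier CP" using x e_closed by simp
  show "e (x \<oplus>\<^bsub>LB\<^esub> y) = e x \<oplus>\<^bsub>CP\<^esub> e y" using x y f1 by (simp add: e_def u_add L.l_distr)
  show "e (x \<otimes>\<^bsub>LB\<^esub> y) = e x \<otimes>\<^bsub>CP\<^esub> e y"
    using x y f1 e_mult_u[of "\<one>\<^bsub>F\<^esub>" x "y \<otimes> inv f1"] by (simp add: e_def L.m_assoc)
  show "e (r \<odot>\<^bsub>LB\<^esub> x) = r \<odot>\<^bsub>CP\<^esub> e x" if "r \<in> carrier k" for r
    using that x f1 by (simp add: e_def K_L L.m_assoc u_smult)
qed (use f1 in \<open>simp add: e_def one_eq\<close>)

lemma e_scalar: "r \<in> K \<Longrightarrow> e r = r \<odot>\<^bsub>CP\<^esub> \<one>\<^bsub>CP\<^esub>"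
  using f1 by (simp add: e_def one_eq u_smult)

lemma one_not_zero: "\<one>\<^bsub>CP\<^esub> \<noteq> \<zero>\<^bsub>CP\<^esub>"
proof
  assume "\<one>\<^bsub>CP\<^esub> = \<zero>\<^bsub>CP\<^esub>"
  then have "\<one>\<^bsub>CP\<^esub> \<one>\<^bsub>F\<^esub> = \<zero>\<^bsub>CP\<^esub> \<one>\<^bsub>F\<^esub>" by simp
  then show False using f1(5) by (simp add: one_eq V.at)
qed

text \<open>The \<open>\<rho>\<close> for which \<open>S\<close> contains some
  \<open>u \<rho> y\<close> with \<open>y\<close> nonzero are closed under the group operations, so
  they exhaust the Galois group once they contain generators. One nonzero coefficient gives all
  others, because \<open>S\<close> contains the image of \<open>L\<close>.\<close>

lemma generated:
  assumes S: "subring S CP" and eS: "\<And>x. x \<in> carrier L \<Longrightarrow> e x \<in> S"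
    and T: "T \<subseteq> carrier F" "generate F T = carrier F"
    and uT: "\<And>\<tau>. \<tau> \<in> T \<Longrightarrow> \<exists>y\<in>carrier L. y \<noteq> \<zero> \<and> u \<tau> y \<in> S"
  shows "carrier CP \<subseteq> S"
proof -
  define P where "P \<rho> \<longleftrightarrow> (\<exists>y\<in>carrier L. y \<noteq> \<zero> \<and> u \<rho> y \<in> S)" for \<rho>
  have P1: "P \<one>\<^bsub>F\<^esub>"
    unfolding P_def using eS[of "\<one>"] f1 by (intro bexI[of _ "inv f1"]) (simp_all add: e_def)
  have Pm: "P (\<sigma> \<otimes>\<^bsub>F\<^esub> \<tau>)" if \<sigma>: "\<sigma> \<in> carrier F" "P \<sigma>" and \<tau>: "\<tau> \<in> carrier F" "P \<tau>" for \<sigma> \<tau>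
  proof -
    obtain x y where x: "x \<in> carrier L" "x \<noteq> \<zero>" "u \<sigma> x \<in> S" and y: "y \<in> carrier L" "y \<noteq> \<zero>" "u \<tau> y \<in> S"
      using \<sigma>(2) \<tau>(2) unfolding P_def by blast
    have "u (\<sigma> \<otimes>\<^bsub>F\<^esub> \<tau>) (x \<otimes> \<sigma> y \<otimes> f (\<sigma>, \<tau>)) \<in> S"
      unfolding u_mult[OF \<sigma>(1) \<tau>(1) x(1) y(1), symmetric] by (rule subringE(6)[OF S x(3) y(3)])
    then show ?thesis unfolding P_def
      using x y act(1)[OF \<sigma>(1) y(1)] act_nonzero[OF \<sigma>(1) y(1,2)] f[OF \<sigma>(1) \<tau>(1)] f_nonzero[OF \<sigma>(1) \<tau>(1)]
      by (intro bexI[of _ "x \<otimes> \<sigma> y \<otimes> f (\<sigma>, \<tau>)"]) (simp_all add: L.integral_iff)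
  qed
  \<comment> \<open>A subring offers products but no inverses; in a finite group the inverse is a
    power.\<close>
  have Pinv: "P (inv\<^bsub>F\<^esub> \<sigma>)" if \<sigma>: "\<sigma> \<in> carrier F" "P \<sigma>" for \<sigma>
  proof -
    have Pn: "P (\<sigma> [^]\<^bsub>F\<^esub> n)" for n :: nat using \<sigma> by (induction n) (auto intro: P1 Pm)
    have "order F > 0" using F_finite by (simp add: F.order_gt_0_iff_finite)
    then have "\<sigma> [^]\<^bsub>F\<^esub> (order F - 1) \<otimes>\<^bsub>F\<^esub> \<sigma> = \<one>\<^bsub>F\<^esub>"
      using F.pow_order_eq_1[OF \<sigma>(1)] F.nat_pow_Suc[of \<sigma> "order F - 1"] by simp
    then have "inv\<^bsub>F\<^esub> \<sigma> = \<sigma> [^]\<^bsub>F\<^esub> (order F - 1)" by (rule F.inv_equality) (use \<sigma> in auto)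
    then show ?thesis using Pn by simp
  qed
  have PF: "P \<rho>" if "\<rho> \<in> generate F T" for \<rho>
    using that
  proof induction
    case (eng g h)
    then show ?case using Pm F.generate_in_carrier[OF T(1)] by blast
  qed (use T(1) P1 uT Pinv in \<open>auto simp: P_def\<close>)
  have uS: "u \<rho> z \<in> S" if \<rho>: "\<rho> \<in> carrier F" and z: "z \<in> carrier L" for \<rho> z
  proof -
    obtain y where y: "y \<in> carrier L" "y \<noteq> \<zero>" "u \<rho> y \<in> S"
      using PF[of \<rho>] \<rho> T(2) unfolding P_def by auto
    have "e (z \<otimes> inv y) \<otimes>\<^bsub>CP\<^esub> u \<rho> y \<in> S"
      by (rule subringE(6)[OF S eS y(3)]) (use z y unit in auto)
    moreover have "z \<otimes> inv y \<otimes> y = z" using z y unit by (simp add: L.m_assoc)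
    ultimately show ?thesis using \<rho> z y unit by (simp add: e_mult_u)
  qed
  let ?D = "{u \<sigma> x | \<sigma> x. \<sigma> \<in> carrier F \<and> x \<in> carrier LB}"
  have D: "?D \<subseteq> carrier CP" using u_closed by auto
  show ?thesis
  proof
    fix x assume "x \<in> carrier CP"
    then have "x \<in> lin_span k CP ?D" using V.V_span[OF F_finite] by blast
    then show "x \<in> S"
      using D
    proof (induction rule: V'.lin_span_induct)
      case (smult r x)
      have "e r \<otimes>\<^bsub>CP\<^esub> x \<in> S" by (rule subringE(6)[OF S eS smult(3)]) (use smult K_L in auto)
      then show ?case using smult e_scalar[of r] by (simp add: C.smult_mult_l)
    qed (use subringE(2,7)[OF S] uS in auto)
  qed
qed

end

section \<open>Factor sets of central extensions\<close>

text \<open>\<open>M\<close> consists of nonzero elements of the base field, so the Galois group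
  fixes it pointwise. This trivial action matches the centrality of the extension.\<close>

locale central_ext = galois_action L K for L :: "('a, 'r) ring_scheme" (structure) and K +
  fixes M :: "'a monoid" and G :: "'g monoid" and \<iota> :: "'a \<Rightarrow> 'g" and \<pi> :: "'g \<Rightarrow> 'a \<Rightarrow> 'a"
  assumes ext: "central_extension M G F \<iota> \<pi>"
    and M_K: "carrier M \<subseteq> K - {\<zero>}"
    and M_ops: "monoid.mult M = monoid.mult L" "\<one>\<^bsub>M\<^esub> = \<one>"
begin

sublocale G: group G using ext by (simp add: central_extension_def)
sublocale M: group M using ext by (simp add: central_extension_def)
sublocale \<iota>: group_hom M G \<iota>
  using ext by unfold_locales (simp add: central_extension_def mon_def)
sublocale \<pi>: group_hom G F \<pi>
  using ext by unfold_locales (simp add: central_extension_def epi_def)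

lemma \<iota>_inj: "inj_on \<iota> (carrier M)"
  and \<pi>_surj: "\<pi> ` carrier G = carrier F"
  and \<pi>_kernel: "kernel G F \<pi> = \<iota> ` carrier M"
  and \<iota>_central: "z \<in> carrier M \<Longrightarrow> x \<in> carrier G \<Longrightarrow> \<iota> z \<otimes>\<^bsub>G\<^esub> x = x \<otimes>\<^bsub>G\<^esub> \<iota> z"
  using ext by (simp_all add: central_extension_def mon_def epi_def)

lemma \<pi>_\<iota>: "z \<in> carrier M \<Longrightarrow> \<pi> (\<iota> z) = \<one>\<^bsub>F\<^esub>"
  using \<pi>_kernel by (auto simp: kernel_def)

lemma M_mem: "z \<in> carrier M \<Longrightarrow> z \<in> K" "z \<in> carrier M \<Longrightarrow> z \<in> carrier L" "z \<in> carrier M \<Longrightarrow> z \<noteq> \<zero>"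
  using M_K K_L by auto

lemma M_closed: "z \<in> carrier M \<Longrightarrow> z' \<in> carrier M \<Longrightarrow> z \<otimes> z' \<in> carrier M"
  "z \<in> carrier M \<Longrightarrow> z' \<in> carrier M \<Longrightarrow> \<iota> (z \<otimes> z') = \<iota> z \<otimes>\<^bsub>G\<^esub> \<iota> z'"
  using M.m_closed[of z z'] \<iota>.hom_mult[of z z'] by (simp_all add: M_ops)

lemma \<iota>_cancel:
  assumes "z \<in> carrier M" "z' \<in> carrier M" "x \<in> carrier G" "\<iota> z \<otimes>\<^bsub>G\<^esub> x = \<iota> z' \<otimes>\<^bsub>G\<^esub> x"
  shows "z = z'"
  using assms inj_onD[OF \<iota>_inj, of z z'] by (simp add: G.r_cancel)

lemma inv_\<iota>:
  assumes x: "x \<in> carrier G" and y: "y \<in> carrier G" and xy: "\<pi> x = \<pi> y"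
  shows "inv_into (carrier M) \<iota> (x \<otimes>\<^bsub>G\<^esub> inv\<^bsub>G\<^esub> y) \<in> carrier M"
    and "\<iota> (inv_into (carrier M) \<iota> (x \<otimes>\<^bsub>G\<^esub> inv\<^bsub>G\<^esub> y)) \<otimes>\<^bsub>G\<^esub> y = x"
proof -
  have "\<pi> (x \<otimes>\<^bsub>G\<^esub> inv\<^bsub>G\<^esub> y) = \<one>\<^bsub>F\<^esub>" using x y xy by simp
  then have *: "x \<otimes>\<^bsub>G\<^esub> inv\<^bsub>G\<^esub> y \<in> \<iota> ` carrier M"
    unfolding \<pi>_kernel[symmetric] kernel_def using x y by simp
  show "inv_into (carrier M) \<iota> (x \<otimes>\<^bsub>G\<^esub> inv\<^bsub>G\<^esub> y) \<in> carrier M" by (rule inv_into_into[OF *])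
  show "\<iota> (inv_into (carrier M) \<iota> (x \<otimes>\<^bsub>G\<^esub> inv\<^bsub>G\<^esub> y)) \<otimes>\<^bsub>G\<^esub> y = x"
    unfolding f_inv_into_f[OF *] using x y by (simp add: G.m_assoc)
qed

text \<open>With \<open>h\<close> the inverse of the cochain \<open>g\<close> defining the
  coboundary, the relation takes a form without inverses: it is the rule by which the cocycle
  changes when each basis element is rescaled by \<open>h\<close>. The coefficients \<open>N\<close>
  are left open because the relation is used both for the roots of unity and for the nonzero
  elements of \<open>L\<close>.\<close>

lemma H2_classE:
  assumes N: "group N" "\<And>x. x \<in> carrier N \<Longrightarrow> x \<in> carrier L"
      "monoid.mult N = monoid.mult L" "\<one>\<^bsub>N\<^esub> = \<one>"
    and stable: "\<And>\<sigma> x. \<sigma> \<in> carrier F \<Longrightarrow> x \<in> carrier N \<Longrightarrow> \<sigma> x \<in> carrier N"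
    and c: "\<And>\<sigma> \<tau>. \<sigma> \<in> carrier F \<Longrightarrow> \<tau> \<in> carrier F \<Longrightarrow> c (\<sigma>, \<tau>) \<in> carrier N"
    and f: "f \<in> H2_class F N c"
  obtains h where "\<And>\<sigma>. \<sigma> \<in> carrier F \<Longrightarrow> h \<sigma> \<in> carrier N"
    "\<And>\<sigma> \<tau>. \<sigma> \<in> carrier F \<Longrightarrow> \<tau> \<in> carrier F \<Longrightarrow> f (\<sigma>, \<tau>) \<in> carrier N"
    "\<And>\<sigma> \<tau>. \<sigma> \<in> carrier F \<Longrightarrow> \<tau> \<in> carrier F \<Longrightarrow>
       f (\<sigma>, \<tau>) \<otimes> (h \<sigma> \<otimes> \<sigma> (h \<tau>)) = c (\<sigma>, \<tau>) \<otimes> h (\<sigma> \<otimes>\<^bsub>F\<^esub> \<tau>)"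
proof -
  interpret N: group N by fact
  obtain g where g: "g \<in> carrier F \<rightarrow> carrier N" and feq: "f = restrict (\<lambda>(\<sigma>, \<tau>).
      \<sigma> (g \<tau>) \<otimes>\<^bsub>N\<^esub> inv\<^bsub>N\<^esub> (g (\<sigma> \<otimes>\<^bsub>F\<^esub> \<tau>)) \<otimes>\<^bsub>N\<^esub> g \<sigma>) (carrier F \<times> carrier F) \<otimes>\<^bsub>two_cochains F N\<^esub> c"
    using f unfolding H2_class_def two_coboundaries_def r_coset_def by blast
  have gN: "g \<sigma> \<in> carrier N" if "\<sigma> \<in> carrier F" for \<sigma> using g that by blast
  define h where "h \<sigma> = inv\<^bsub>N\<^esub> (g \<sigma>)" for \<sigma>
  have hN: "h \<sigma> \<in> carrier N" and gh: "g \<sigma> \<otimes> h \<sigma> = \<one>" if "\<sigma> \<in> carrier F" for \<sigma>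
    using N.inv_closed[OF gN[OF that]] N.r_inv[OF gN[OF that]] unfolding h_def N(3,4) by auto
  have f_eq: "f (\<sigma>, \<tau>) = \<sigma> (g \<tau>) \<otimes> h (\<sigma> \<otimes>\<^bsub>F\<^esub> \<tau>) \<otimes> g \<sigma> \<otimes> c (\<sigma>, \<tau>)"
    if "\<sigma> \<in> carrier F" "\<tau> \<in> carrier F" for \<sigma> \<tau>
    unfolding feq two_cochains_def product_group_def using that by (simp add: h_def N(3))
  show thesis
  proof (rule that[of h])
    fix \<sigma> \<tau> assume F: "\<sigma> \<in> carrier F" "\<tau> \<in> carrier F"
    note \<sigma>\<tau> = F.m_closed[OF F]
    have "\<sigma> (g \<tau>) \<otimes>\<^bsub>N\<^esub> h (\<sigma> \<otimes>\<^bsub>F\<^esub> \<tau>) \<otimes>\<^bsub>N\<^esub> g \<sigma> \<otimes>\<^bsub>N\<^esub> c (\<sigma>, \<tau>) \<in> carrier N"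
      by (intro N.m_closed stable[OF F(1) gN[OF F(2)]] hN[OF \<sigma>\<tau>] gN[OF F(1)] c[OF F])
    then show "f (\<sigma>, \<tau>) \<in> carrier N" unfolding f_eq[OF F] N(3) .
    note cl = N(2)[OF gN[OF F(1)]] N(2)[OF gN[OF F(2)]] N(2)[OF hN[OF F(1)]] N(2)[OF hN[OF F(2)]]
      N(2)[OF hN[OF \<sigma>\<tau>]] N(2)[OF c[OF F]]
    have "\<sigma> (g \<tau>) \<otimes> \<sigma> (h \<tau>) = \<one>"
      unfolding act(3)[OF F(1) cl(2,4), symmetric] gh[OF F(2)] by (rule act_zero_one(2)[OF F(1)])
    moreover have "f (\<sigma>, \<tau>) \<otimes> (h \<sigma> \<otimes> \<sigma> (h \<tau>)) =
        c (\<sigma>, \<tau>) \<otimes> h (\<sigma> \<otimes>\<^bsub>F\<^esub> \<tau>) \<otimes> (g \<sigma> \<otimes> h \<sigma>) \<otimes> (\<sigma> (g \<tau>) \<otimes> \<sigma> (h \<tau>))"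
      unfolding f_eq[OF F] using cl act(1)[OF F(1) cl(2)] act(1)[OF F(1) cl(4)] by (simp add: L.m_ac)
    ultimately show "f (\<sigma>, \<tau>) \<otimes> (h \<sigma> \<otimes> \<sigma> (h \<tau>)) = c (\<sigma>, \<tau>) \<otimes> h (\<sigma> \<otimes>\<^bsub>F\<^esub> \<tau>)"
      using cl by (simp add: gh[OF F(1)])
  qed (rule hN)
qed

lemma H2_class_nonempty: "group N \<Longrightarrow> H2_class F N c \<noteq> {}"
  unfolding H2_class_def two_coboundaries_def r_coset_def
  using monoid.one_closed[OF group.is_monoid] by fastforce

end

locale factor_system = central_ext L K M G \<iota> \<pi>
  for L :: "('a, 'r) ring_scheme" (structure) and K M and G :: "'g monoid" and \<iota> \<pi> +
  fixes t :: "('a \<Rightarrow> 'a) \<Rightarrow> 'g"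
  assumes t: "t \<in> sections G F \<pi>"
begin

abbreviation "c \<equiv> factor_set M G F \<iota> t"

lemma t_closed: "\<sigma> \<in> carrier F \<Longrightarrow> t \<sigma> \<in> carrier G" and \<pi>_t: "\<sigma> \<in> carrier F \<Longrightarrow> \<pi> (t \<sigma>) = \<sigma>"
  using t by (auto simp: sections_def)

lemma c:
  assumes F: "\<sigma> \<in> carrier F" "\<tau> \<in> carrier F"
  shows "c (\<sigma>, \<tau>) \<in> carrier M" "\<iota> (c (\<sigma>, \<tau>)) \<otimes>\<^bsub>G\<^esub> t (\<sigma> \<otimes>\<^bsub>F\<^esub> \<tau>) = t \<sigma> \<otimes>\<^bsub>G\<^esub> t \<tau>"
  using inv_\<iota>[of "t \<sigma> \<otimes>\<^bsub>G\<^esub> t \<tau>" "t (\<sigma> \<otimes>\<^bsub>F\<^esub> \<tau>)"] F by (simp_all add: t_closed \<pi>_t factor_set_def)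

text \<open>Associativity in \<open>G\<close> of a product of three values of the section;
  centrality moves \<open>\<iota> (c (\<tau>, \<rho>))\<close> past
  \<open>t \<sigma>\<close>.\<close>

lemma c_cocycle:
  assumes F: "\<sigma> \<in> carrier F" "\<tau> \<in> carrier F" "\<rho> \<in> carrier F"
  shows "c (\<sigma>, \<tau>) \<otimes> c (\<sigma> \<otimes>\<^bsub>F\<^esub> \<tau>, \<rho>) = c (\<tau>, \<rho>) \<otimes> c (\<sigma>, \<tau> \<otimes>\<^bsub>F\<^esub> \<rho>)"
proof (rule \<iota>_cancel)
  note F' = F.m_closed[OF F(1,2)] F.m_closed[OF F(2,3)]
  note cM = c(1)[OF F(1,2)] c(1)[OF F'(1) F(3)] c(1)[OF F(2,3)] c(1)[OF F(1) F'(2)]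
  note cl = cM[THEN \<iota>.hom_closed] t_closed[OF F(1)] t_closed[OF F(2)] t_closed[OF F(3)]
    t_closed[OF F'(1)] t_closed[OF F'(2)]
  show "c (\<sigma>, \<tau>) \<otimes> c (\<sigma> \<otimes>\<^bsub>F\<^esub> \<tau>, \<rho>) \<in> carrier M" "c (\<tau>, \<rho>) \<otimes> c (\<sigma>, \<tau> \<otimes>\<^bsub>F\<^esub> \<rho>) \<in> carrier M"
    using cM by (auto intro: M_closed)
  show T: "t (\<sigma> \<otimes>\<^bsub>F\<^esub> \<tau> \<otimes>\<^bsub>F\<^esub> \<rho>) \<in> carrier G" by (intro t_closed F.m_closed F)
  have "\<iota> (c (\<sigma>, \<tau>) \<otimes> c (\<sigma> \<otimes>\<^bsub>F\<^esub> \<tau>, \<rho>)) \<otimes>\<^bsub>G\<^esub> t (\<sigma> \<otimes>\<^bsub>F\<^esub> \<tau> \<otimes>\<^bsub>F\<^esub> \<rho>) =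
      \<iota> (c (\<sigma>, \<tau>)) \<otimes>\<^bsub>G\<^esub> (t (\<sigma> \<otimes>\<^bsub>F\<^esub> \<tau>) \<otimes>\<^bsub>G\<^esub> t \<rho>)"
    unfolding M_closed(2)[OF cM(1,2)] c(2)[OF F'(1) F(3), symmetric] using cl T by (simp add: G.m_assoc)
  also have "\<dots> = t \<sigma> \<otimes>\<^bsub>G\<^esub> (t \<tau> \<otimes>\<^bsub>G\<^esub> t \<rho>)"
    using cl c(2)[OF F(1,2)] by (simp add: G.m_assoc[symmetric])
  also have "\<dots> = (t \<sigma> \<otimes>\<^bsub>G\<^esub> \<iota> (c (\<tau>, \<rho>))) \<otimes>\<^bsub>G\<^esub> t (\<tau> \<otimes>\<^bsub>F\<^esub> \<rho>)"
    unfolding c(2)[OF F(2,3), symmetric] using cl by (simp add: G.m_assoc)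
  also have "\<dots> = \<iota> (c (\<tau>, \<rho>)) \<otimes>\<^bsub>G\<^esub> (t \<sigma> \<otimes>\<^bsub>G\<^esub> t (\<tau> \<otimes>\<^bsub>F\<^esub> \<rho>))"
    unfolding \<iota>_central[OF cM(3) cl(5), symmetric] using cl by (simp add: G.m_assoc)
  also have "\<dots> = \<iota> (c (\<tau>, \<rho>) \<otimes> c (\<sigma>, \<tau> \<otimes>\<^bsub>F\<^esub> \<rho>)) \<otimes>\<^bsub>G\<^esub> t (\<sigma> \<otimes>\<^bsub>F\<^esub> \<tau> \<otimes>\<^bsub>F\<^esub> \<rho>)"
    unfolding M_closed(2)[OF cM(3,4)] c(2)[OF F(1) F'(2), symmetric]
    using cl T F.m_assoc[OF F] by (simp add: G.m_assoc)
  finally show "\<iota> (c (\<sigma>, \<tau>) \<otimes> c (\<sigma> \<otimes>\<^bsub>F\<^esub> \<tau>, \<rho>)) \<otimes>\<^bsub>G\<^esub> t (\<sigma> \<otimes>\<^bsub>F\<^esub> \<tau> \<otimes>\<^bsub>F\<^esub> \<rho>) =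
      \<iota> (c (\<tau>, \<rho>) \<otimes> c (\<sigma>, \<tau> \<otimes>\<^bsub>F\<^esub> \<rho>)) \<otimes>\<^bsub>G\<^esub> t (\<sigma> \<otimes>\<^bsub>F\<^esub> \<tau> \<otimes>\<^bsub>F\<^esub> \<rho>)" .
qed

end

text \<open>\<open>f\<close> is an arbitrary representative of the image of the extension class with
  coefficients in the nonzero elements of \<open>L\<close>, and \<open>h\<close> witnesses that it
  is cohomologous to the factor set of the section \<open>t\<close>.\<close>

locale cohomologous = factor_system L K M G \<iota> \<pi> t
  for L :: "('a, 'r) ring_scheme" (structure) and K M and G :: "'g monoid" and \<iota> \<pi> t +
  fixes f :: "('a \<Rightarrow> 'a) \<times> ('a \<Rightarrow> 'a) \<Rightarrow> 'a" and h :: "('a \<Rightarrow> 'a) \<Rightarrow> 'a"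
  assumes fin: "finite (carrier F)"
    and h: "\<And>\<sigma>. \<sigma> \<in> carrier F \<Longrightarrow> h \<sigma> \<in> carrier L" "\<And>\<sigma>. \<sigma> \<in> carrier F \<Longrightarrow> h \<sigma> \<noteq> \<zero>"
    and fc: "\<And>\<sigma> \<tau>. \<sigma> \<in> carrier F \<Longrightarrow> \<tau> \<in> carrier F \<Longrightarrow> f (\<sigma>, \<tau>) \<in> carrier L"
      "\<And>\<sigma> \<tau>. \<sigma> \<in> carrier F \<Longrightarrow> \<tau> \<in> carrier F \<Longrightarrow> f (\<sigma>, \<tau>) \<noteq> \<zero>"
    and fh: "\<And>\<sigma> \<tau>. \<sigma> \<in> carrier F \<Longrightarrow> \<tau> \<in> carrier F \<Longrightarrow>
       f (\<sigma>, \<tau>) \<otimes> (h \<sigma> \<otimes> \<sigma> (h \<tau>)) = c (\<sigma>, \<tau>) \<otimes> h (\<sigma> \<otimes>\<^bsub>F\<^esub> \<tau>)"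
begin

text \<open>After multiplication by the nonzero element \<open>?H\<close> both sides can be
  rewritten with \<open>fh\<close> until every \<open>f\<close> has become a value of the factor
  set, whose cocycle identity is known.\<close>

lemma f_cocycle:
  assumes F: "\<sigma> \<in> carrier F" "\<tau> \<in> carrier F" "\<rho> \<in> carrier F"
  shows "f (\<sigma>, \<tau>) \<otimes> f (\<sigma> \<otimes>\<^bsub>F\<^esub> \<tau>, \<rho>) = \<sigma> (f (\<tau>, \<rho>)) \<otimes> f (\<sigma>, \<tau> \<otimes>\<^bsub>F\<^esub> \<rho>)"
proof -
  note F' = F.m_closed[OF F(1,2)] F.m_closed[OF F(2,3)]
  note cK = c(1)[OF F(1,2), THEN M_mem(2)] c(1)[OF F'(1) F(3), THEN M_mem(2)]
    c(1)[OF F(2,3), THEN M_mem(2)] c(1)[OF F(1) F'(2), THEN M_mem(2)]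
  note fL = fc(1)[OF F(1,2)] fc(1)[OF F'(1) F(3)] fc(1)[OF F(2,3)] fc(1)[OF F(1) F'(2)]
  note hL = h(1)[OF F(1)] h(1)[OF F(2)] h(1)[OF F(3)] h(1)[OF F'(1)] h(1)[OF F'(2)] h(1)[OF F.m_closed[OF F'(1) F(3)]]
  note a = act(1)[OF F(1)] act(1)[OF F(2)]
  let ?x = "h \<sigma>" and ?y = "\<sigma> (h \<tau>)" and ?z = "\<sigma> (\<tau> (h \<rho>))"
  let ?H = "?x \<otimes> ?y \<otimes> ?z"
  have "(f (\<sigma>, \<tau>) \<otimes> f (\<sigma> \<otimes>\<^bsub>F\<^esub> \<tau>, \<rho>)) \<otimes> ?H =
      (f (\<sigma>, \<tau>) \<otimes> (?x \<otimes> ?y)) \<otimes> (f (\<sigma> \<otimes>\<^bsub>F\<^esub> \<tau>, \<rho>) \<otimes> ?z)"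
    using fL hL a by (simp add: L.m_ac)
  also have "\<dots> = c (\<sigma>, \<tau>) \<otimes> (f (\<sigma> \<otimes>\<^bsub>F\<^esub> \<tau>, \<rho>) \<otimes> (h (\<sigma> \<otimes>\<^bsub>F\<^esub> \<tau>) \<otimes> (\<sigma> \<otimes>\<^bsub>F\<^esub> \<tau>) (h \<rho>)))"
    unfolding fh[OF F(1,2)] F_mult[OF F(1,2) hL(3)] using cK fL hL a by (simp add: L.m_ac)
  also have "\<dots> = (c (\<sigma>, \<tau>) \<otimes> c (\<sigma> \<otimes>\<^bsub>F\<^esub> \<tau>, \<rho>)) \<otimes> h (\<sigma> \<otimes>\<^bsub>F\<^esub> \<tau> \<otimes>\<^bsub>F\<^esub> \<rho>)"
    unfolding fh[OF F'(1) F(3)] using cK hL by (simp add: L.m_assoc)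
  also have "\<dots> = c (\<tau>, \<rho>) \<otimes> (f (\<sigma>, \<tau> \<otimes>\<^bsub>F\<^esub> \<rho>) \<otimes> (?x \<otimes> \<sigma> (h (\<tau> \<otimes>\<^bsub>F\<^esub> \<rho>))))"
    unfolding c_cocycle[OF F] fh[OF F(1) F'(2)] F.m_assoc[OF F] using cK hL(6) F.m_assoc[OF F] by (simp add: L.m_assoc)
  also have "\<dots> = \<sigma> (c (\<tau>, \<rho>) \<otimes> h (\<tau> \<otimes>\<^bsub>F\<^esub> \<rho>)) \<otimes> (f (\<sigma>, \<tau> \<otimes>\<^bsub>F\<^esub> \<rho>) \<otimes> ?x)"
    unfolding act(3)[OF F(1) cK(3) hL(5)] F_fix[OF F(1) M_mem(1)[OF c(1)[OF F(2,3)]]]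
    using cK fL hL a by (simp add: L.m_ac)
  also have "\<dots> = (\<sigma> (f (\<tau>, \<rho>)) \<otimes> f (\<sigma>, \<tau> \<otimes>\<^bsub>F\<^esub> \<rho>)) \<otimes> ?H"
    unfolding fh[OF F(2,3), symmetric] using fL hL a by (simp add: act(3)[OF F(1)] L.m_ac)
  finally have eq: "(f (\<sigma>, \<tau>) \<otimes> f (\<sigma> \<otimes>\<^bsub>F\<^esub> \<tau>, \<rho>)) \<otimes> ?H = (\<sigma> (f (\<tau>, \<rho>)) \<otimes> f (\<sigma>, \<tau> \<otimes>\<^bsub>F\<^esub> \<rho>)) \<otimes> ?H" .
  have "?H \<noteq> \<zero>" "?H \<in> carrier L"
    using hL a h(2)[OF F(1)] act_nonzero[OF F(1) hL(2) h(2)[OF F(2)]]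
      act_nonzero[OF F(1) a(2)[OF hL(3)] act_nonzero[OF F(2) hL(3) h(2)[OF F(3)]]]
    by (simp_all add: L.integral_iff)
  then show ?thesis using eq fL a by (subst (asm) L.m_rcancel) simp_all
qed

sublocale crossed L K f
  by unfold_locales (fact fin fc f_cocycle)+

text \<open>The central part of \<open>x\<close> relative to the section: \<open>x\<close> is
  \<open>\<iota> (z x)\<close> times \<open>t (\<pi> x)\<close>.\<close>

definition z :: "'g \<Rightarrow> 'a" where "z x = inv_into (carrier M) \<iota> (x \<otimes>\<^bsub>G\<^esub> inv\<^bsub>G\<^esub> (t (\<pi> x)))"

lemma z: assumes "x \<in> carrier G" shows "z x \<in> carrier M" "\<iota> (z x) \<otimes>\<^bsub>G\<^esub> t (\<pi> x) = x"
  unfolding z_def using inv_\<iota>[OF assms t_closed[OF \<pi>.hom_closed[OF assms]]] assms by (simp_all add: \<pi>_t)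

lemma z_unique:
  assumes "x \<in> carrier G" "y \<in> carrier M" "\<iota> y \<otimes>\<^bsub>G\<^esub> t (\<pi> x) = x" shows "z x = y"
  by (rule \<iota>_cancel[of _ _ "t (\<pi> x)"]) (use assms z[OF assms(1)] t_closed in auto)

text \<open>Rescaling the basis element of \<open>\<sigma>\<close> by \<open>h \<sigma>\<close>
  turns the cocycle \<open>f\<close> into the factor set of the section. In this way
  \<open>G\<close> maps multiplicatively to the crossed product, with \<open>\<iota> w\<close>
  acting as the scalar \<open>w\<close>.\<close>

definition \<Phi> :: "'g \<Rightarrow> ('a \<Rightarrow> 'a) \<Rightarrow> 'a" where "\<Phi> x = u (\<pi> x) (z x \<otimes> h (\<pi> x))"

lemma \<Phi>_coeff:
  assumes x: "x \<in> carrier G"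
  shows "z x \<otimes> h (\<pi> x) \<in> carrier L" "z x \<otimes> h (\<pi> x) \<noteq> \<zero>"
  using M_mem(2,3)[OF z(1)[OF x]] h[OF \<pi>.hom_closed[OF x]] by (simp_all add: L.integral_iff)

lemma \<Phi>_closed: "x \<in> carrier G \<Longrightarrow> \<Phi> x \<in> carrier CP"
  unfolding \<Phi>_def by (rule u_closed[OF \<pi>.hom_closed \<Phi>_coeff(1)])

text \<open>Moving the central part of \<open>y\<close> past the section value belonging to
  \<open>x\<close> shows that the central part of the product acquires the factor
  \<open>c (\<pi> x, \<pi> y)\<close>; on the side of the crossed product \<open>fh\<close> yields
  the same factor.\<close>

lemma \<Phi>_mult:
  assumes x: "x \<in> carrier G" and y: "y \<in> carrier G"
  shows "\<Phi> (x \<otimes>\<^bsub>G\<^esub> y) = \<Phi> x \<otimes>\<^bsub>CP\<^esub> \<Phi> y"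
proof -
  let ?s = "\<pi> x" and ?t = "\<pi> y"
  note F = \<pi>.hom_closed[OF x] \<pi>.hom_closed[OF y]
  note zM = z(1)[OF x] z(1)[OF y] c(1)[OF F]
  note cl = zM[THEN M_mem(2)] h(1)[OF F(1)] h(1)[OF F(2)] h(1)[OF F.m_closed[OF F]] fc(1)[OF F]
  note tG = t_closed[OF F(1)] t_closed[OF F(2)] t_closed[OF F.m_closed[OF F]]
  note \<iota>G = zM[THEN \<iota>.hom_closed]
  have "z (x \<otimes>\<^bsub>G\<^esub> y) = z x \<otimes> z y \<otimes> c (?s, ?t)"
  proof (rule z_unique)
    have "\<iota> (z x \<otimes> z y \<otimes> c (?s, ?t)) \<otimes>\<^bsub>G\<^esub> t (\<pi> (x \<otimes>\<^bsub>G\<^esub> y)) = \<iota> (z x) \<otimes>\<^bsub>G\<^esub> \<iota> (z y) \<otimes>\<^bsub>G\<^esub> (t ?s \<otimes>\<^bsub>G\<^esub> t ?t)"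
      unfolding c(2)[OF F, symmetric] using zM \<iota>G tG x y by (simp add: M_closed G.m_assoc)
    also have "\<dots> = \<iota> (z x) \<otimes>\<^bsub>G\<^esub> (\<iota> (z y) \<otimes>\<^bsub>G\<^esub> t ?s) \<otimes>\<^bsub>G\<^esub> t ?t" using \<iota>G tG by (simp add: G.m_assoc)
    also have "\<dots> = (\<iota> (z x) \<otimes>\<^bsub>G\<^esub> t ?s) \<otimes>\<^bsub>G\<^esub> (\<iota> (z y) \<otimes>\<^bsub>G\<^esub> t ?t)"
      unfolding \<iota>_central[OF zM(2) tG(1)] using \<iota>G tG by (simp add: G.m_assoc)
    also have "\<dots> = x \<otimes>\<^bsub>G\<^esub> y" unfolding z(2)[OF x] z(2)[OF y] ..
    finally show "\<iota> (z x \<otimes> z y \<otimes> c (?s, ?t)) \<otimes>\<^bsub>G\<^esub> t (\<pi> (x \<otimes>\<^bsub>G\<^esub> y)) = x \<otimes>\<^bsub>G\<^esub> y" .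
  qed (use x y zM M_closed in auto)
  moreover have "z x \<otimes> h ?s \<otimes> ?s (z y \<otimes> h ?t) \<otimes> f (?s, ?t) =
      z x \<otimes> z y \<otimes> (f (?s, ?t) \<otimes> (h ?s \<otimes> ?s (h ?t)))"
    unfolding act(3)[OF F(1) cl(2,5)] F_fix[OF F(1) M_mem(1)[OF zM(2)]]
    using cl act(1)[OF F(1) cl(5)] by (simp add: L.m_ac)
  ultimately show ?thesis
    unfolding \<Phi>_def u_mult[OF F \<Phi>_coeff(1)[OF x] \<Phi>_coeff(1)[OF y]]
    using x y cl by (simp add: fh[OF F] L.m_assoc)
qed

lemma \<Phi>_\<iota>:
  assumes w: "w \<in> carrier M" and x: "x \<in> carrier G"
  shows "\<Phi> (\<iota> w \<otimes>\<^bsub>G\<^esub> x) = w \<odot>\<^bsub>CP\<^esub> \<Phi> x"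
proof -
  note F = \<pi>.hom_closed[OF x]
  note zx = z[OF x]
  have \<pi>: "\<pi> (\<iota> w \<otimes>\<^bsub>G\<^esub> x) = \<pi> x" using w x F by (simp add: \<pi>_\<iota>)
  have "\<iota> (w \<otimes> z x) \<otimes>\<^bsub>G\<^esub> t (\<pi> x) = \<iota> w \<otimes>\<^bsub>G\<^esub> (\<iota> (z x) \<otimes>\<^bsub>G\<^esub> t (\<pi> x))"
    using w zx(1) t_closed[OF F] by (simp add: M_closed G.m_assoc)
  then have "\<iota> (w \<otimes> z x) \<otimes>\<^bsub>G\<^esub> t (\<pi> (\<iota> w \<otimes>\<^bsub>G\<^esub> x)) = \<iota> w \<otimes>\<^bsub>G\<^esub> x" unfolding zx(2) \<pi> .
  then have "z (\<iota> w \<otimes>\<^bsub>G\<^esub> x) = w \<otimes> z x" by (intro z_unique) (use w x zx(1) M_closed in auto)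
  then have "\<Phi> (\<iota> w \<otimes>\<^bsub>G\<^esub> x) = u (\<pi> x) (w \<otimes> (z x \<otimes> h (\<pi> x)))"
    unfolding \<Phi>_def \<pi> using M_mem(2)[OF w] M_mem(2)[OF zx(1)] h(1)[OF F] by (simp add: L.m_assoc)
  also have "\<dots> = w \<odot>\<^bsub>CP\<^esub> \<Phi> x" unfolding \<Phi>_def by (rule u_smult[OF F M_mem(1)[OF w] \<Phi>_coeff(1)[OF x]])
  finally show ?thesis .
qed

lemma \<Phi>_one: "\<Phi> \<one>\<^bsub>G\<^esub> = \<one>\<^bsub>CP\<^esub>"
proof -
  have F1: "\<one>\<^bsub>F\<^esub> \<in> carrier F" by simp
  let ?c = "c (\<one>\<^bsub>F\<^esub>, \<one>\<^bsub>F\<^esub>)" and ?h = "h \<one>\<^bsub>F\<^esub>" and ?z = "z \<one>\<^bsub>G\<^esub>"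
  note cM = c(1)[OF F1 F1] and zM = z(1)[OF G.one_closed]
  note L = M_mem(2)[OF cM] M_mem(2)[OF zM] h(1)[OF F1] f1(1)
  have "\<iota> ?c \<otimes>\<^bsub>G\<^esub> t \<one>\<^bsub>F\<^esub> = t \<one>\<^bsub>F\<^esub> \<otimes>\<^bsub>G\<^esub> t \<one>\<^bsub>F\<^esub>" using c(2)[OF F1 F1] by simp
  then have "\<iota> ?c = t \<one>\<^bsub>F\<^esub>" using cM t_closed[OF F1] by (simp add: G.r_cancel)
  then have "\<iota> (?z \<otimes> ?c) = \<iota> \<one>"
    using z(2)[OF G.one_closed] M_closed(2)[OF zM cM] \<iota>.hom_one by (simp add: M_ops)
  then have zc: "?z \<otimes> ?c = \<one>"
    using inj_onD[OF \<iota>_inj] M_closed(1)[OF zM cM] M.one_closed by (simp add: M_ops)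
  have "f1 \<otimes> ?h \<otimes> ?h = ?c \<otimes> ?h" using fh[OF F1 F1] L by (simp add: F_one L.m_assoc)
  then have "f1 \<otimes> ?h = ?c" using L h(2)[OF F1] by (simp add: L.m_rcancel)
  then have "f1 \<otimes> (?z \<otimes> ?h) = \<one>" using zc L by (metis L.m_lcomm)
  then have "inv f1 = ?z \<otimes> ?h" using L by (intro L.comm_inv_char) auto
  then show ?thesis unfolding one_eq \<Phi>_def by simp
qed

lemma \<Phi>_pow: "x \<in> carrier G \<Longrightarrow> \<Phi> x [^]\<^bsub>CP\<^esub> (n::nat) = \<Phi> (x [^]\<^bsub>G\<^esub> n)"
  by (induction n) (simp_all add: \<Phi>_one \<Phi>_mult)

lemma \<Phi>_e: "x \<in> carrier G \<Longrightarrow> y \<in> carrier L \<Longrightarrow> \<Phi> x \<otimes>\<^bsub>CP\<^esub> e y = e (\<pi> x y) \<otimes>\<^bsub>CP\<^esub> \<Phi> x"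
  unfolding \<Phi>_def by (rule u_mult_e[OF \<pi>.hom_closed _ \<Phi>_coeff(1)])

end

section \<open>The obstruction\<close>

lemma nat_pow_ops:
  fixes A (structure)
  assumes "monoid.mult A = monoid.mult B" "\<one> = \<one>\<^bsub>B\<^esub>"
  shows "x [^] (n::nat) = x [^]\<^bsub>B\<^esub> n"
  by (simp add: nat_pow_def assms)

text \<open>The elements of \<open>L\<close> whose image lies in \<open>S\<close> form a subring,
  not evidently a field. Since \<open>L\<close> is finite over \<open>K\<close>, the roots are
  algebraic, so adjoining them to \<open>K\<close> as a ring already gives the field they
  generate.\<close>

lemma (in crossed) generated_by_roots:
  assumes fd: "ring.finite_dimension L K (carrier L)" and \<alpha>: "\<alpha> ` I \<subseteq> carrier L" "finite I"
    and L_gen: "generate_field L (K \<union> \<alpha> ` I) = carrier L"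
    and S: "subring S CP" and scalars: "\<And>r. r \<in> K \<Longrightarrow> r \<odot>\<^bsub>CP\<^esub> \<one>\<^bsub>CP\<^esub> \<in> S" and eS: "e ` \<alpha> ` I \<subseteq> S"
    and x: "x \<in> carrier L"
  shows "e x \<in> S"
proof -
  note eD = alg_homD[OF e_hom, unfolded LB_simps]
  let ?T = "{x \<in> carrier L. e x \<in> S}"
  have K_T: "K \<subseteq> ?T" using scalars by (auto simp: e_scalar K_L)
  have "subring ?T L"
  proof (rule L.subringI)
    show "\<one> \<in> ?T" using subringE(3)[OF S] unfolding eD(5)[symmetric] by blast
    fix x y assume x: "x \<in> ?T" and y: "y \<in> ?T"
    show xy: "x \<otimes> y \<in> ?T" if "x \<in> ?T" "y \<in> ?T" for x y
      using that eD(3)[of x y] subringE(6)[OF S, of "e x" "e y"] by simp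
    show "x \<oplus> y \<in> ?T" using x y eD(2)[of x y] subringE(7)[OF S, of "e x" "e y"] by simp
    have "\<ominus> \<one> \<in> ?T" using K_T subringE(3,5)[OF subfieldE(1)[OF K]] by blast
    then show "\<ominus> x \<in> ?T" using xy[of "\<ominus> \<one>" x] x by (simp add: L.l_minus)
  qed auto
  note T = this
  obtain xs where xs: "set xs = \<alpha> ` I" using finite_list[OF finite_imageI[OF \<alpha>(2)]] ..
  have "e (\<alpha> i) \<in> S" "\<alpha> i \<in> carrier L" if "i \<in> I" for i
    using subsetD[OF eS imageI[OF imageI[OF that]]] subsetD[OF \<alpha>(1) imageI[OF that]] .
  then have "set xs \<subseteq> ?T" unfolding xs by (intro image_subsetI CollectI conjI)
  then have incl: "L.finite_extension K xs \<subseteq> ?T" by (rule L.finite_extension_subring_incl[OF T K_T])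
  have xsL: "set xs \<subseteq> carrier L" using xs \<alpha>(1) by simp
  have "subfield (L.finite_extension K xs) L"
    by (rule L.finite_extension_is_subfield[OF K xsL])
      (use xsL L.finite_dimension_imp_algebraic[OF K L.carrier_is_subring fd] in blast)
  moreover have "K \<union> \<alpha> ` I \<subseteq> L.finite_extension K xs"
    using L.finite_extension_incl[OF subfieldE(3)[OF K] xsL] L.finite_extension_mem[OF subfieldE(1)[OF K] xsL] xs by simp
  ultimately have "carrier L \<subseteq> L.finite_extension K xs"
    unfolding L_gen[symmetric] using \<alpha>(1) subfieldE(3)[OF K]
    by (intro L.generate_field_min_subfield1) auto
  then show ?thesis using incl x by blast
qed

text \<open>The relations among the \<open>s i\<close> are carried over by the multiplicative map
  \<open>\<Phi>\<close>, with central elements becoming scalars; the action on the roots becomes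
  conjugation through \<open>\<Phi>_e\<close>. Generation is reduced to the roots in
  \<open>L\<close> and the \<open>\<sigma> i\<close> in the Galois group.\<close>

lemma (in cohomologous) crossed_product_gens:
  fixes a \<alpha> :: "nat \<Rightarrow> 'a" and \<sigma> :: "nat \<Rightarrow> 'a \<Rightarrow> 'a" and s :: "nat \<Rightarrow> 'g"
  assumes kum: "kummer k q \<zeta>" and \<zeta>: "\<And>i::nat. \<zeta> [^] i \<in> carrier M"
    and fd: "ring.finite_dimension L K (carrier L)"
    and a: "\<And>i. i \<in> {1..m} \<Longrightarrow> a i \<in> K - {\<zero>}"
    and \<alpha>: "\<And>i. i \<in> {1..m} \<Longrightarrow> \<alpha> i \<in> carrier L \<and> \<alpha> i [^] q = a i"
    and L_gen: "generate_field L (K \<union> \<alpha> ` {1..m}) = carrier L"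
    and \<sigma>: "\<And>i. i \<in> {1..m} \<Longrightarrow> \<sigma> i \<in> carrier F"
    and \<sigma>_gen: "generate F (\<sigma> ` {1..m}) = carrier F"
    and \<sigma>_\<alpha>: "\<And>i l. i \<in> {1..m} \<Longrightarrow> l \<in> {1..m} \<Longrightarrow> \<sigma> l (\<alpha> i) = (if i = l then \<zeta> \<otimes> \<alpha> i else \<alpha> i)"
    and s: "\<And>i. i \<in> {1..m} \<Longrightarrow> s i \<in> carrier G \<and> \<pi> (s i) = \<sigma> i"
    and j: "\<And>i. i \<in> {1..m} \<Longrightarrow> s i [^]\<^bsub>G\<^esub> q = \<iota> (\<zeta> [^] j i)"
    and d: "\<And>i l. i \<in> {1..m} \<Longrightarrow> l \<in> {1..m} \<Longrightarrow> i < l \<Longrightarrow>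
      s l \<otimes>\<^bsub>G\<^esub> s i = \<iota> (\<zeta> [^] d i l) \<otimes>\<^bsub>G\<^esub> (s i \<otimes>\<^bsub>G\<^esub> s l)"
  shows "kummer_gens k q \<zeta> CP m a (\<lambda>i. e (\<alpha> i)) (\<lambda>i. \<Phi> (s i)) j d"
proof (rule kummer_gens.intro[OF kum CP_alg kummer_gens_axioms.intro])
  note eD = alg_homD[OF e_hom]
  have pow_k: "x [^]\<^bsub>k\<^esub> (n::nat) = x [^] n" for x n by (rule nat_pow_ops) simp_all
  have \<zeta>K: "\<zeta> \<in> K" and \<zeta>L: "\<zeta> \<in> carrier L"
    using kum K_L by (auto simp: kummer_def kummer_axioms_def primitive_root_of_unity_def)
  fix i assume i: "i \<in> {1..m}"
  have si: "s i \<in> carrier G" "\<pi> (s i) = \<sigma> i" using s[OF i] by auto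
  have \<alpha>i: "\<alpha> i \<in> carrier L" "\<alpha> i [^] q = a i" using \<alpha>[OF i] by auto
  show "a i \<in> carrier k" "a i \<noteq> \<zero>\<^bsub>k\<^esub>" using a[OF i] by auto
  show "e (\<alpha> i) \<in> carrier CP" by (rule e_closed[OF \<alpha>i(1)])
  show "\<Phi> (s i) \<in> carrier CP" by (rule \<Phi>_closed[OF si(1)])
  have "e x [^]\<^bsub>CP\<^esub> (n::nat) = e (x [^] n)" if "x \<in> carrier L" for x n
    using that eD(3,5) by (induction n) simp_all
  from this[OF \<alpha>i(1), of q] show "e (\<alpha> i) [^]\<^bsub>CP\<^esub> q = a i \<odot>\<^bsub>CP\<^esub> \<one>\<^bsub>CP\<^esub>"
    using e_scalar[of "a i"] a[OF i] \<alpha>i(2) by simp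
  have "\<Phi> (s i) [^]\<^bsub>CP\<^esub> q = \<Phi> (\<iota> (\<zeta> [^] j i) \<otimes>\<^bsub>G\<^esub> \<one>\<^bsub>G\<^esub>)"
    unfolding \<Phi>_pow[OF si(1)] j[OF i] using \<zeta>[of "j i"] by simp
  then show "\<Phi> (s i) [^]\<^bsub>CP\<^esub> q = \<zeta> [^]\<^bsub>k\<^esub> j i \<odot>\<^bsub>CP\<^esub> \<one>\<^bsub>CP\<^esub>"
    unfolding pow_k \<Phi>_\<iota>[OF \<zeta> G.one_closed] \<Phi>_one .
  have "e (\<zeta> \<otimes> \<alpha> i) = \<zeta> \<odot>\<^bsub>CP\<^esub> e (\<alpha> i)" using eD(4)[of \<zeta> "\<alpha> i"] \<zeta>K \<alpha>i(1) by simp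
  then show "\<Phi> (s i) \<otimes>\<^bsub>CP\<^esub> e (\<alpha> i) = \<zeta> \<odot>\<^bsub>CP\<^esub> (e (\<alpha> i) \<otimes>\<^bsub>CP\<^esub> \<Phi> (s i))"
    unfolding \<Phi>_e[OF si(1) \<alpha>i(1)] si(2) \<sigma>_\<alpha>[OF i i] using \<zeta>K e_closed[OF \<alpha>i(1)] \<Phi>_closed[OF si(1)]
    by (simp add: C.smult_mult_l)
  fix l assume l: "l \<in> {1..m}"
  have sl: "s l \<in> carrier G" "\<pi> (s l) = \<sigma> l" using s[OF l] by auto
  have \<alpha>l: "\<alpha> l \<in> carrier L" using \<alpha>[OF l] by auto
  show "e (\<alpha> i) \<otimes>\<^bsub>CP\<^esub> e (\<alpha> l) = e (\<alpha> l) \<otimes>\<^bsub>CP\<^esub> e (\<alpha> i)"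
    using eD(3)[of "\<alpha> i" "\<alpha> l"] eD(3)[of "\<alpha> l" "\<alpha> i"] \<alpha>i(1) \<alpha>l by (simp add: L.m_comm)
  show "\<Phi> (s l) \<otimes>\<^bsub>CP\<^esub> e (\<alpha> i) = e (\<alpha> i) \<otimes>\<^bsub>CP\<^esub> \<Phi> (s l)" if "i \<noteq> l"
    unfolding \<Phi>_e[OF sl(1) \<alpha>i(1)] sl(2) \<sigma>_\<alpha>[OF i l] using that by simp
  show "\<Phi> (s l) \<otimes>\<^bsub>CP\<^esub> \<Phi> (s i) = \<zeta> [^]\<^bsub>k\<^esub> d i l \<odot>\<^bsub>CP\<^esub> (\<Phi> (s i) \<otimes>\<^bsub>CP\<^esub> \<Phi> (s l))" if "i < l"
    unfolding pow_k \<Phi>_mult[OF sl(1) si(1), symmetric] d[OF i l that] \<Phi>_mult[OF si(1) sl(1), symmetric]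
    by (rule \<Phi>_\<iota>[OF \<zeta> G.m_closed[OF si(1) sl(1)]])
next
  show "\<one>\<^bsub>CP\<^esub> \<noteq> \<zero>\<^bsub>CP\<^esub>" by (rule one_not_zero)
  fix S assume S: "subring S CP" and scalars: "\<And>r. r \<in> carrier k \<Longrightarrow> r \<odot>\<^bsub>CP\<^esub> \<one>\<^bsub>CP\<^esub> \<in> S"
    and AS: "(\<lambda>i. e (\<alpha> i)) ` {1..m} \<subseteq> S" and US: "(\<lambda>i. \<Phi> (s i)) ` {1..m} \<subseteq> S"
  show "carrier CP \<subseteq> S"
  proof (rule generated[OF S _ _ \<sigma>_gen])
    show "e x \<in> S" if "x \<in> carrier L" for x
      by (rule generated_by_roots[OF fd _ _ L_gen S scalars _ that]) (use \<alpha> AS in auto)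
    show "\<sigma> ` {1..m} \<subseteq> carrier F" using \<sigma> by auto
    fix \<tau> assume "\<tau> \<in> \<sigma> ` {1..m}"
    then obtain i where i: "i \<in> {1..m}" "\<tau> = \<sigma> i" by blast
    have si: "s i \<in> carrier G" "\<pi> (s i) = \<sigma> i" using s[OF i(1)] by auto
    have "\<Phi> (s i) \<in> S" using US i(1) by blast
    then show "\<exists>y\<in>carrier L. y \<noteq> \<zero> \<and> u \<tau> y \<in> S"
      using \<Phi>_coeff[OF si(1)] unfolding \<Phi>_def si(2) i(2) by blast
  qed
qed

lemma mult_of_group: "field R \<Longrightarrow> group (mult_of R)"
proof -
  assume "field R"
  then interpret field R .
  show ?thesis
  proof (rule groupI)
    fix x assume x: "x \<in> carrier (mult_of R)"
    then have U: "x \<in> Units R" by (simp add: field_Units)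
    have "inv\<^bsub>R\<^esub> x \<noteq> \<zero>\<^bsub>R\<^esub>" using Units_l_inv[OF U] x by (metis DiffD1 carrier_mult_of l_null one_not_zero)
    then show "\<exists>y\<in>carrier (mult_of R). y \<otimes>\<^bsub>mult_of R\<^esub> x = \<one>\<^bsub>mult_of R\<^esub>"
      using U by (intro bexI[of _ "inv\<^bsub>R\<^esub> x"]) (simp_all add: Units_inv_closed)
  qed (auto simp: m_assoc integral_iff)
qed

text \<open>The image of \<open>p ^ n\<close> in a field is the \<open>n\<close>-th power of the
  image of \<open>p\<close>.\<close>

lemma (in field) add_pow_power_nonzero:
  fixes p n :: nat
  assumes "add_pow R p \<one> \<noteq> \<zero>" shows "add_pow R (p ^ n) \<one> \<noteq> \<zero>"
proof (induction n)
  case (Suc n)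
  have "add_pow R (p ^ Suc n) \<one> = add_pow R p \<one> \<otimes> add_pow R (p ^ n) \<one>"
    by (simp add: add_pow_ldistr add.nat_pow_pow mult.commute)
  then show ?case using Suc assms by (simp add: integral_iff)
qed simp

theorem theorem2p8:
  fixes p m n :: nat
    and L :: "'a ring" and K :: "'a set" and \<zeta> :: 'a and a \<alpha> :: "nat \<Rightarrow> 'a"
    and G :: "'g monoid" and \<iota> :: "'a \<Rightarrow> 'g" and \<pi> :: "'g \<Rightarrow> 'a \<Rightarrow> 'a"
    and \<sigma> :: "nat \<Rightarrow> 'a \<Rightarrow> 'a" and s :: "nat \<Rightarrow> 'g"
    and j :: "nat \<Rightarrow> nat" and d :: "nat \<Rightarrow> nat \<Rightarrow> nat"
    and q :: nat and k :: "'a ring" and F :: "('a \<Rightarrow> 'a) monoid" and \<mu> :: "'a monoid"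
  assumes q_def: "q = p ^ n"
    and k_def: "k = L\<lparr>carrier := K\<rparr>"
    and F_def: "F = galois_group L K"
    and mu_def: "\<mu> = subgroup_generated (mult_of k) {\<zeta>}"
    and "Factorial_Ring.prime p" and "odd p"
    and "field L" and "subfield K L"
    and char: "[p] \<cdot>\<^bsub>k\<^esub> \<one>\<^bsub>k\<^esub> \<noteq> \<zero>\<^bsub>k\<^esub>"
    and zeta: "primitive_root_of_unity k q \<zeta>"
    and a: "\<And>i. i \<in> {1..m} \<Longrightarrow> a i \<in> K - {\<zero>\<^bsub>k\<^esub>}"
    and roots: "\<And>i. i \<in> {1..m} \<Longrightarrow> \<alpha> i \<in> carrier L \<and> \<alpha> i [^]\<^bsub>L\<^esub> q = a i"
    and L_gen: "generate_field L (K \<union> \<alpha> ` {1..m}) = carrier L"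
    and galois: "galois_extension L K"
    and gal_iso: "F \<cong> product_group {1..m} (\<lambda>i. integer_mod_group q)"
    and extension: "central_extension \<mu> G F \<iota> \<pi>"
    and nonsplit: "\<not> split_extension G F \<pi>"
    and sigma: "\<And>i. i \<in> {1..m} \<Longrightarrow> \<sigma> i \<in> carrier F"
    and sigma_gen: "generate F (\<sigma> ` {1..m}) = carrier F"
    and sigma_root: "\<And>i l. i \<in> {1..m} \<Longrightarrow> l \<in> {1..m} \<Longrightarrow>
          \<sigma> l (\<alpha> i) = (if i = l then \<zeta> \<otimes>\<^bsub>L\<^esub> \<alpha> i else \<alpha> i)"
    and s: "\<And>i. i \<in> {1..m} \<Longrightarrow> s i \<in> carrier G \<and> \<pi> (s i) = \<sigma> i"
    and j: "\<And>i. i \<in> {1..m} \<Longrightarrow> j i \<in> {0..q - 1} \<and> s i [^]\<^bsub>G\<^esub> q = \<iota> (\<zeta> [^]\<^bsub>L\<^esub> j i)"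
    and d: "\<And>i l. i \<in> {1..m} \<Longrightarrow> l \<in> {1..m} \<Longrightarrow> i < l \<Longrightarrow> d i l \<in> {0..q - 1} \<and>
          s l \<otimes>\<^bsub>G\<^esub> s i = \<iota> (\<zeta> [^]\<^bsub>L\<^esub> d i l) \<otimes>\<^bsub>G\<^esub> (s i \<otimes>\<^bsub>G\<^esub> s l)"
  shows "obstruction L K \<mu> G \<iota> \<pi> \<in> carrier (brauer_group k) \<and>
    obstruction L K \<mu> G \<iota> \<pi> =
      (\<Otimes>\<^bsub>brauer_group k\<^esub>i\<in>{1..m}. brauer_symbol k q \<zeta> (a i) (\<zeta> [^]\<^bsub>k\<^esub> j i)) \<otimes>\<^bsub>brauer_group k\<^esub>
      (\<Otimes>\<^bsub>brauer_group k\<^esub>w\<in>{w \<in> {1..m} \<times> {1..m}. fst w < snd w}.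
         brauer_symbol k q \<zeta> (a (snd w)) (a (fst w)) [^]\<^bsub>brauer_group k\<^esub> d (fst w) (snd w))"
proof -
  let ?k = "L\<lparr>carrier := K\<rparr>" and ?F = "galois_group L K"
  interpret galois_action L K
    using \<open>field L\<close> \<open>subfield K L\<close> extension
    by (simp add: galois_action_def galois_action_axioms_def central_extension_def F_def)
  have ext: "central_extension \<mu> G ?F \<iota> \<pi>" using extension unfolding F_def .
  have \<mu>: "carrier \<mu> \<subseteq> K - {\<zero>\<^bsub>L\<^esub>}" "monoid.mult \<mu> = monoid.mult L" "\<one>\<^bsub>\<mu>\<^esub> = \<one>\<^bsub>L\<^esub>"
    using group.carrier_subgroup_generated_subset[OF mult_of_group[OF k_field], of "{\<zeta>}"]
    by (simp_all add: mu_def k_def subgroup_generated_def)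
  interpret central_ext L K \<mu> G \<iota> \<pi>
    by unfold_locales (fact ext \<mu>)+
  have q: "q > 0" using \<open>Factorial_Ring.prime p\<close> by (simp add: q_def prime_gt_0_nat)
  have pow_k: "x [^]\<^bsub>?k\<^esub> (e::nat) = x [^]\<^bsub>L\<^esub> e" for x e by (rule nat_pow_ops) simp_all
  have "add_pow ?k q \<one>\<^bsub>?k\<^esub> \<noteq> \<zero>\<^bsub>?k\<^esub>"
    using char unfolding q_def k_def by (rule field.add_pow_power_nonzero[OF k_field])
  then have kum: "kummer ?k q \<zeta>"
    using k_field zeta q by (simp add: kummer_def kummer_axioms_def k_def)
  interpret kum: kummer ?k q \<zeta> by (rule kum)
  have \<zeta>0: "\<zeta> \<noteq> \<zero>\<^bsub>L\<^esub>" using kum.zeta_unit by simp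
  have "\<zeta> \<in> carrier \<mu>"
    using kum.zeta(1) \<zeta>0 by (simp add: mu_def k_def subgroup_generated_def generate.incl)
  then have \<zeta>_\<mu>: "\<zeta> [^]\<^bsub>L\<^esub> (e::nat) \<in> carrier \<mu>" for e
    using M.nat_pow_closed[of \<zeta> e] nat_pow_ops[OF \<mu>(2,3), of \<zeta> e] by simp
  \<comment> \<open>Sums over the Galois group are finite because it is isomorphic to a finite
    product of cyclic groups, which are finite as \<open>q\<close> is positive.\<close>
  have fin: "finite (carrier ?F)"
  proof -
    obtain i where "i \<in> iso ?F (product_group {1..m} (\<lambda>i. integer_mod_group q))"
      using gal_iso unfolding is_iso_def F_def by blast
    then have "bij_betw i (carrier ?F) (carrier (product_group {1..m} (\<lambda>i. integer_mod_group q)))"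
      by (simp add: iso_def)
    moreover have "finite (carrier (product_group {1..m} (\<lambda>i. integer_mod_group q)))"
      using q by (auto simp: product_group_def carrier_integer_mod_group intro!: finite_PiE)
    ultimately show ?thesis by (simp add: bij_betw_finite)
  qed
  have L_mult: "group (mult_of L)" "monoid.mult (mult_of L) = monoid.mult L" "\<one>\<^bsub>mult_of L\<^esub> = \<one>\<^bsub>L\<^esub>"
    using mult_of_group[OF L.field_axioms] by simp_all
  let ?c = "\<Union>f\<in>extension_class \<mu> G ?F \<iota> \<pi>. H2_class ?F (mult_of L) f"
  let ?X = "(\<Otimes>\<^bsub>brauer_group ?k\<^esub>i\<in>{1..m}. brauer_symbol ?k q \<zeta> (a i) (\<zeta> [^]\<^bsub>?k\<^esub> j i)) \<otimes>\<^bsub>brauer_group ?k\<^esub>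
      (\<Otimes>\<^bsub>brauer_group ?k\<^esub>w\<in>{w \<in> {1..m} \<times> {1..m}. fst w < snd w}.
         brauer_symbol ?k q \<zeta> (a (snd w)) (a (fst w)) [^]\<^bsub>brauer_group ?k\<^esub> d (fst w) (snd w))"
  \<comment> \<open>\<open>obstruction\<close> takes unions over representatives; the formula is
    shown for each crossed product that can occur, whatever section and cochains lead to it.\<close>
  have main: "brauer_class ?k (crossed_product L K f) \<in> carrier (brauer_group ?k) \<and>
      brauer_class ?k (crossed_product L K f) = ?X" if f: "f \<in> ?c" for f
  proof -
    obtain t f0 where t: "t \<in> sections G ?F \<pi>" and f0: "f0 \<in> H2_class ?F \<mu> (factor_set \<mu> G ?F \<iota> t)"
      and f: "f \<in> H2_class ?F (mult_of L) f0"
      using f unfolding extension_class_def by blast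
    interpret factor_system L K \<mu> G \<iota> \<pi> t by unfold_locales (fact t)
    obtain h1 where h1: "\<And>\<sigma>. \<sigma> \<in> carrier ?F \<Longrightarrow> h1 \<sigma> \<in> carrier \<mu>"
      "\<And>\<sigma> \<tau>. \<sigma> \<in> carrier ?F \<Longrightarrow> \<tau> \<in> carrier ?F \<Longrightarrow> f0 (\<sigma>, \<tau>) \<in> carrier \<mu>"
      "\<And>\<sigma> \<tau>. \<sigma> \<in> carrier ?F \<Longrightarrow> \<tau> \<in> carrier ?F \<Longrightarrow>
         f0 (\<sigma>, \<tau>) \<otimes>\<^bsub>L\<^esub> (h1 \<sigma> \<otimes>\<^bsub>L\<^esub> \<sigma> (h1 \<tau>)) = c (\<sigma>, \<tau>) \<otimes>\<^bsub>L\<^esub> h1 (\<sigma> \<otimes>\<^bsub>?F\<^esub> \<tau>)"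
    proof (rule H2_classE[OF M.group_axioms M_mem(2) \<mu>(2,3) _ c(1) f0])
      show "\<sigma> x \<in> carrier \<mu>" if "\<sigma> \<in> carrier ?F" "x \<in> carrier \<mu>" for \<sigma> x
        using that F_fix[OF that(1) M_mem(1)[OF that(2)]] by simp
    qed (assumption | rule that; assumption)+
    have f0L: "f0 (\<sigma>, \<tau>) \<in> carrier (mult_of L)" if "\<sigma> \<in> carrier ?F" "\<tau> \<in> carrier ?F" for \<sigma> \<tau>
      using M_mem(2,3)[OF h1(2)[OF that]] by simp
    obtain h2 where h2: "\<And>\<sigma>. \<sigma> \<in> carrier ?F \<Longrightarrow> h2 \<sigma> \<in> carrier (mult_of L)"
      "\<And>\<sigma> \<tau>. \<sigma> \<in> carrier ?F \<Longrightarrow> \<tau> \<in> carrier ?F \<Longrightarrow> f (\<sigma>, \<tau>) \<in> carrier (mult_of L)"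
      "\<And>\<sigma> \<tau>. \<sigma> \<in> carrier ?F \<Longrightarrow> \<tau> \<in> carrier ?F \<Longrightarrow>
         f (\<sigma>, \<tau>) \<otimes>\<^bsub>L\<^esub> (h2 \<sigma> \<otimes>\<^bsub>L\<^esub> \<sigma> (h2 \<tau>)) = f0 (\<sigma>, \<tau>) \<otimes>\<^bsub>L\<^esub> h2 (\<sigma> \<otimes>\<^bsub>?F\<^esub> \<tau>)"
    proof (rule H2_classE[OF L_mult(1) _ L_mult(2,3) _ f0L f])
      show "\<sigma> x \<in> carrier (mult_of L)" if "\<sigma> \<in> carrier ?F" "x \<in> carrier (mult_of L)" for \<sigma> x
        using that act(1)[OF that(1), of x] act_nonzero[OF that(1), of x] by simp
      show "x \<in> carrier L" if "x \<in> carrier (mult_of L)" for x using that by simp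
    qed (assumption | rule that; assumption)+
    note h2 = h2(1,2)[unfolded carrier_mult_of, THEN DiffD1] h2(1,2)[unfolded carrier_mult_of, THEN DiffD2] h2(3)
    \<comment> \<open>\<open>h1\<close> relates the factor set to \<open>f0\<close> with values in
      the roots of unity, \<open>h2\<close> relates \<open>f0\<close> to \<open>f\<close> with
      values in the nonzero elements of \<open>L\<close>; their product relates the factor set to
      \<open>f\<close> directly.\<close>
    have cohom: "cohomologous L K \<mu> G \<iota> \<pi> t f (\<lambda>\<sigma>. h2 \<sigma> \<otimes>\<^bsub>L\<^esub> h1 \<sigma>)"
    proof unfold_locales
      fix \<sigma> assume \<sigma>: "\<sigma> \<in> carrier ?F"
      note h\<sigma> = M_mem(2,3)[OF h1(1)[OF \<sigma>]] h2(1)[OF \<sigma>] h2(3)[OF \<sigma>]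
      show "h2 \<sigma> \<otimes>\<^bsub>L\<^esub> h1 \<sigma> \<in> carrier L" "h2 \<sigma> \<otimes>\<^bsub>L\<^esub> h1 \<sigma> \<noteq> \<zero>\<^bsub>L\<^esub>"
        using h\<sigma> by (auto simp: L.integral_iff)
      fix \<tau> assume \<tau>: "\<tau> \<in> carrier ?F"
      show fL: "f (\<sigma>, \<tau>) \<in> carrier L" and "f (\<sigma>, \<tau>) \<noteq> \<zero>\<^bsub>L\<^esub>"
        using h2(2)[OF \<sigma> \<tau>] h2(4)[OF \<sigma> \<tau>] by auto
      note h\<tau> = M_mem(2)[OF h1(1)[OF \<tau>]] h2(1)[OF \<tau>]
      note h\<sigma>\<tau> = M_mem(2)[OF h1(1)[OF F.m_closed[OF \<sigma> \<tau>]]] h2(1)[OF F.m_closed[OF \<sigma> \<tau>]]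
      note cl = h\<sigma>(1,3) h\<tau> h\<sigma>\<tau> fL M_mem(2)[OF h1(2)[OF \<sigma> \<tau>]] M_mem(2)[OF c(1)[OF \<sigma> \<tau>]]
        act(1)[OF \<sigma> h\<tau>(1)] act(1)[OF \<sigma> h\<tau>(2)]
      have "f (\<sigma>, \<tau>) \<otimes>\<^bsub>L\<^esub> (h2 \<sigma> \<otimes>\<^bsub>L\<^esub> h1 \<sigma> \<otimes>\<^bsub>L\<^esub> \<sigma> (h2 \<tau> \<otimes>\<^bsub>L\<^esub> h1 \<tau>)) =
          (f (\<sigma>, \<tau>) \<otimes>\<^bsub>L\<^esub> (h2 \<sigma> \<otimes>\<^bsub>L\<^esub> \<sigma> (h2 \<tau>))) \<otimes>\<^bsub>L\<^esub> (h1 \<sigma> \<otimes>\<^bsub>L\<^esub> \<sigma> (h1 \<tau>))"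
        unfolding act(3)[OF \<sigma> h\<tau>(2,1)] using cl by (simp add: L.m_ac)
      also have "\<dots> = (f0 (\<sigma>, \<tau>) \<otimes>\<^bsub>L\<^esub> (h1 \<sigma> \<otimes>\<^bsub>L\<^esub> \<sigma> (h1 \<tau>))) \<otimes>\<^bsub>L\<^esub> h2 (\<sigma> \<otimes>\<^bsub>?F\<^esub> \<tau>)"
        unfolding h2(5)[OF \<sigma> \<tau>] using cl by (simp add: L.m_ac)
      also have "\<dots> = c (\<sigma>, \<tau>) \<otimes>\<^bsub>L\<^esub> (h2 (\<sigma> \<otimes>\<^bsub>?F\<^esub> \<tau>) \<otimes>\<^bsub>L\<^esub> h1 (\<sigma> \<otimes>\<^bsub>?F\<^esub> \<tau>))"
        unfolding h1(3)[OF \<sigma> \<tau>] using cl by (simp add: L.m_ac)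
      finally show "f (\<sigma>, \<tau>) \<otimes>\<^bsub>L\<^esub> (h2 \<sigma> \<otimes>\<^bsub>L\<^esub> h1 \<sigma> \<otimes>\<^bsub>L\<^esub> \<sigma> (h2 \<tau> \<otimes>\<^bsub>L\<^esub> h1 \<tau>)) =
          c (\<sigma>, \<tau>) \<otimes>\<^bsub>L\<^esub> (h2 (\<sigma> \<otimes>\<^bsub>?F\<^esub> \<tau>) \<otimes>\<^bsub>L\<^esub> h1 (\<sigma> \<otimes>\<^bsub>?F\<^esub> \<tau>))" .
    qed (rule fin)
    show ?thesis
    proof (rule kummer_gens.class_formula[OF cohomologous.crossed_product_gens[OF cohom kum \<zeta>_\<mu> _ _ _ L_gen]])
      show "ring.finite_dimension L K (carrier L)" using galois by (simp add: galois_extension_def)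
      show "generate ?F (\<sigma> ` {1..m}) = carrier ?F" using sigma_gen unfolding F_def .
      fix i assume i: "i \<in> {1..m}"
      show "a i \<in> K - {\<zero>\<^bsub>L\<^esub>}" using a[OF i] unfolding k_def by simp
      show "\<alpha> i \<in> carrier L \<and> \<alpha> i [^]\<^bsub>L\<^esub> q = a i" by (rule roots[OF i])
      show "\<sigma> i \<in> carrier ?F" using sigma[OF i] unfolding F_def .
      show "s i \<in> carrier G \<and> \<pi> (s i) = \<sigma> i" by (rule s[OF i])
      show "s i [^]\<^bsub>G\<^esub> q = \<iota> (\<zeta> [^]\<^bsub>L\<^esub> j i)" using j[OF i] ..
      fix l assume l: "l \<in> {1..m}"
      show "\<sigma> l (\<alpha> i) = (if i = l then \<zeta> \<otimes>\<^bsub>L\<^esub> \<alpha> i else \<alpha> i)" by (rule sigma_root[OF i l])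
      show "s l \<otimes>\<^bsub>G\<^esub> s i = \<iota> (\<zeta> [^]\<^bsub>L\<^esub> d i l) \<otimes>\<^bsub>G\<^esub> (s i \<otimes>\<^bsub>G\<^esub> s l)" if "i < l"
        using d[OF i l that] ..
    qed
  qed
  \<comment> \<open>A union of equal sets has their common value only over a nonempty index set. A
    section exists because \<open>\<pi>\<close> is surjective.\<close>
  have "?c \<noteq> {}"
  proof -
    have "restrict (inv_into (carrier G) \<pi>) (carrier ?F) \<in> sections G ?F \<pi>"
      unfolding sections_def using \<pi>_surj by (auto intro: inv_into_into f_inv_into_f)
    then show ?thesis
      unfolding extension_class_def
      using H2_class_nonempty[OF M.group_axioms] H2_class_nonempty[OF L_mult(1)] by blast
  qed
  then have X: "(\<Union>f\<in>?c. brauer_class ?k (crossed_product L K f)) = ?X"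
    by (rule SUP_eq_const) (rule conjunct2[OF main])
  obtain f where f: "f \<in> ?c" using \<open>?c \<noteq> {}\<close> by (elim ex_in_conv[THEN iffD2, THEN exE])
  have "?X \<in> carrier (brauer_group ?k)"
    by (rule subst[of _ _ "\<lambda>x. x \<in> carrier (brauer_group ?k)", OF conjunct2[OF main[OF f]] conjunct1[OF main[OF f]]])
  with X show ?thesis unfolding obstruction_def Let_def k_def F_def by (simp only: simp_thms)
qed

end
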